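(* Let $\mathcal M\subset\mathbb C^N$ be a closed complex submanifold that is invariant under complex conjugation ($\xi\in\mathcal M\Rightarrow\bar\xi\in\mathcal M$), and suppose that $M:=\mathcal M\cap\mathbb R^N$ is a smooth compact manifold. Let $\mathfrak g$ be a graded real Lie algebra as in the context, with basis $\omega_1,\dots,\omega_n$ of $\mathfrak g^{[1]}$, and let $\mathfrak g$ act on $\mathcal M$ by holomorphic vector fields; let $\Omega_j$ be the vector field corresponding to $\omega_j$, and assume that the $\Omega_j$ are real on $M$. Let $\mathcal A(\mathcal M)$ be the algebra of holomorphic functions on $\mathcal M$. Then there is $a_0>0$ such that for every $a$ with $0<a\le a_0$ the following hold. (a) For every $z\in U^!_a(\mathfrak g)$ and every $F\in\mathcal A(\mathcal M)$ the series $\rho(z)F=\sum_p\rho(z^{[p]})F$ converges uniformly in a neighborhood of $M$ in $\mathcal M$. (b) For every $z\in\overline{\mathbf G}(\mathbb R)\cap U^!_a(\mathfrak g)$ there is an analytic diffeomorphism $\mathcal Q_z$ of $M$ such that $(\rho(z)F)(m)=F(\mathcal Q_z(m))$ for all $F\in\mathcal A(\mathcal M)$ and $m\in M$. (c) For $z\in\mathbf G^!_a(\mathbb R)$ write $z=z_1z_2\cdots z_k$ with $z_j\in\overline{\mathbf G}(\mathbb R)\cap U^!_a(\mathfrak g)$ and put $\mathcal Q_z:=\mathcal Q_{z_k}\circ\cdots\circ\mathcal Q_{z_1}$. Then $\mathcal Q_z$ does not depend on the choice of the decomposition, and $z\mapsto\mathcal Q_z$ is a homomorphism from $\mathbf G^!_a(\mathbb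 R)$ to the group of analytic diffeomorphisms of $M$ with multiplication $P\cdot Q:=Q\circ P$ (that is, $\mathcal Q_{zw}=\mathcal Q_w\circ\mathcal Q_z$). (d) Let $\mu:[0,T]\to\mathfrak g^{[1]}$ be continuously differentiable, and let $\mathcal E(t)\in\overline{U}(\mathfrak g)$ be the solution of $\mathcal E'(t)=\mathcal E(t)\mu(t)$, $\mathcal E(0)=1$. Suppose $\mathcal E(T)=1$. Let $\mathcal R(t)$, $t\in[0,T]$, be the family of diffeomorphisms of $M$ such that $\mathcal R(0)=\mathrm{id}$ and $\mathcal R(t)^{-1}\frac{d}{dt}\mathcal R(t)=\rho(\mu(t))$, understood as an identity of operators on functions where $\mathcal R(t)$ acts by $F\mapsto F\circ\mathcal R(t)$; that is, $\frac{d}{dt}\bigl(F\circ\mathcal R(t)\bigr)=\bigl(\rho(\mu(t))F\bigr)\circ\mathcal R(t)$ for all smooth $F$ on $M$. Then $\mathcal R(T)=\mathrm{id}$.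
   Context: $\mathfrak g=\bigoplus_{k>0}\mathfrak g^{[k]}$ is a graded real Lie algebra, $[\mathfrak g^{[k]},\mathfrak g^{[m]}]\subset\mathfrak g^{[k+m]}$, $\dim\mathfrak g^{[k]}<\infty$, generated by $\mathfrak g^{[1]}$; $\omega_1,\dots,\omega_n$ is a fixed basis of $\mathfrak g^{[1]}$. The universal enveloping algebra $U(\mathfrak g)=\bigoplus_{p\ge0}U(\mathfrak g)^{[p]}$ has the induced grading; $\overline U(\mathfrak g)=\prod_{p\ge 0}U(\mathfrak g)^{[p]}$ is the algebra of formal series $z=\sum_p z^{[p]}$, with the product topology; $\overline{\mathfrak g}=\prod_{k\ge1}\mathfrak g^{[k]}\subset\overline U(\mathfrak g)$. The group $\overline{\mathbf G}=\overline{\mathbf G}(\mathbb R)$ is $\{\exp(x):x\in\overline{\mathfrak g}\}\subset\overline U(\mathfrak g)$ under multiplication. For $z\in U(\mathfrak g)^{[p]}$ the norm is $\|z\|=\inf\sum_w|c_w|$, the infimum over all representations $z=\sum_w c_w w$ as a finite linear combination of words $w=\omega_{j_1}\cdots\omega_{j_p}$. For $a>0$, $U^!_a(\mathfrak g)$ is the set of $z\in\overline U(\mathfrak g)$ with $\sup_p\|z^{[p]}\|\,p!\,a^{-p}<\infty$, and $U^!(\mathfrak g)=\bigcup_{a>0}U^!_a(\mathfrak g)$. The group $\mathbf G^!(\mathbb R)$ is $\overline{\mathbf G}(\mathbb R)\cap U^!(\mathfrak g)$, and $\mathbf G^!_a(\mathbb R)$ is the subgroup of $\mathbf G^!(\mathbb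 R)$ generated by $\overline{\mathbf G}(\mathbb R)\cap U^!_a(\mathfrak g)$. An action of $\mathfrak g$ by holomorphic vector fields is a Lie algebra homomorphism to holomorphic vector fields, viewed as derivations with the commutator bracket. It induces an action $\rho$ of $U(\mathfrak g)$ by differential operators on $\mathcal M$, $\rho(\omega_{i_1}\cdots\omega_{i_k})=\Omega_{i_1}\cdots\Omega_{i_k}$; for $z=\sum z^{[p]}\in\overline U(\mathfrak g)$, $\rho(z)$ denotes the formal series $\sum_p\rho(z^{[p]})$. "Real on $M$" means that $\Omega_j$ is tangent to $M$ and restricts to a real vector field on $M$. *)

theory Defs
  imports
    "HOL-Analysis.Analysis"
    "HOL-Analysis.Finite_Function_Topology"
    "HOL-Computational_Algebra.Formal_Power_Series"
    "HOL-Algebra.Generated_Groups"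
begin

class lie_algebra = real_vector +
  fixes lie_bracket :: "'a \<Rightarrow> 'a \<Rightarrow> 'a"
  assumes lie_bracket_add_left: "lie_bracket (x + y) z = lie_bracket x z + lie_bracket y z"
    and lie_bracket_add_right: "lie_bracket x (y + z) = lie_bracket x y + lie_bracket x z"
    and lie_bracket_scaleR_left: "lie_bracket (c *\<^sub>R x) y = c *\<^sub>R lie_bracket x y"
    and lie_bracket_scaleR_right: "lie_bracket x (c *\<^sub>R y) = c *\<^sub>R lie_bracket x y"
    and lie_bracket_self: "lie_bracket x x = 0"
    and lie_jacobi: "lie_bracket x (lie_bracket y z) + lie_bracket y (lie_bracket z x)
      + lie_bracket z (lie_bracket x y) = 0"

datatype 'a free_monoid = Word (letters: "'a list")

instantiation free_monoid :: (type) monoid_add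
begin

definition "0 = Word []"
definition "v + w = Word (letters v @ letters w)"

instance
  by standard (auto simp: zero_free_monoid_def plus_free_monoid_def)

end

text \<open>Finitely supported functions on words form the free associative unital algebra.
  The enveloping algebra is its quotient by the two-sided ideal which makes
  the generators depend linearly on the Lie algebra element (giving the tensor algebra)
  and identifies commutators with brackets.\<close>

type_synonym 'g free_algebra = "'g free_monoid \<Rightarrow>\<^sub>0 real"

definition free_gen :: "'g \<Rightarrow> 'g free_algebra" where
  "free_gen x = Poly_Mapping.single (Word [x]) 1"

inductive_set uea_ideal :: "'g::lie_algebra free_algebra set" where
  zero: "0 \<in> uea_ideal"
| add: "p \<in> uea_ideal \<Longrightarrow> q \<in> uea_ideal \<Longrightarrow> p + q \<in> uea_ideal"
| mult_left: "p \<in> uea_ideal \<Longrightarrow> q * p \<in> uea_ideal"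
| mult_right: "p \<in> uea_ideal \<Longrightarrow> p * q \<in> uea_ideal"
| gen_add: "free_gen (x + y) - free_gen x - free_gen y \<in> uea_ideal"
| gen_scaleR: "free_gen (c *\<^sub>R x) - c *\<^sub>R free_gen x \<in> uea_ideal"
| gen_bracket: "free_gen x * free_gen y - free_gen y * free_gen x
    - free_gen (lie_bracket x y) \<in> uea_ideal"

lemma uea_ideal_uminus: "p \<in> uea_ideal \<Longrightarrow> - p \<in> uea_ideal"
  using uea_ideal.mult_left [of p "- 1"] by simp

lemma uea_ideal_diff: "p \<in> uea_ideal \<Longrightarrow> q \<in> uea_ideal \<Longrightarrow> p - q \<in> uea_ideal"
  using uea_ideal.add [of p "- q"] uea_ideal_uminus [of q] by simp

lemma free_lookup_scaleR: "Poly_Mapping.lookup (c *\<^sub>R p) k = c * Poly_Mapping.lookup p k"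
  for p :: "'g free_algebra"
proof -
  have "finite {k. c * Poly_Mapping.lookup p k \<noteq> 0}"
    by (rule finite_subset [OF _ finite_lookup [of p]]) auto
  then show ?thesis
    by (simp add: scaleR_poly_mapping_def)
qed

lemma free_scaleR_eq: "c *\<^sub>R p = Poly_Mapping.single 0 c * p"
  for p :: "'g free_algebra"
proof (rule poly_mapping_eqI)
  fix k
  have "Poly_Mapping.lookup (Poly_Mapping.single 0 c * p) k
      = Sum_any (\<lambda>l. c * Sum_any (\<lambda>q. Poly_Mapping.lookup p q when k = l + q) when l = 0)"
    unfolding lookup_mult
    by (rule Sum_any.cong) (auto simp: lookup_single when_def)
  then show "Poly_Mapping.lookup (c *\<^sub>R p) k = Poly_Mapping.lookup (Poly_Mapping.single 0 c * p) k"
    by (simp add: free_lookup_scaleR)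
qed

lemma free_mult_scaleR_right: "p * (c *\<^sub>R q) = c *\<^sub>R (p * q)"
  for p q :: "'g free_algebra"
proof (rule poly_mapping_eqI)
  fix k
  have fin: "finite {r. (Poly_Mapping.lookup q r when k = l + r) \<noteq> 0}" for l
    by (rule finite_subset [OF _ finite_lookup [of q]]) auto
  have fin': "finite {l. Poly_Mapping.lookup p l
      * Sum_any (\<lambda>r. Poly_Mapping.lookup q r when k = l + r) \<noteq> 0}"
    by (rule finite_subset [OF _ finite_lookup [of p]]) auto
  have inner: "Sum_any (\<lambda>r. Poly_Mapping.lookup (c *\<^sub>R q) r when k = l + r)
      = c * Sum_any (\<lambda>r. Poly_Mapping.lookup q r when k = l + r)" for l
    by (simp add: free_lookup_scaleR Sum_any_right_distrib [OF fin] mult_when)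
  have "Poly_Mapping.lookup (p * (c *\<^sub>R q)) k
      = Sum_any (\<lambda>l. c * (Poly_Mapping.lookup p l
          * Sum_any (\<lambda>r. Poly_Mapping.lookup q r when k = l + r)))"
    unfolding lookup_mult inner by (simp add: mult.left_commute)
  also have "\<dots> = Poly_Mapping.lookup (c *\<^sub>R (p * q)) k"
    by (simp add: free_lookup_scaleR lookup_mult Sum_any_right_distrib [OF fin'])
  finally show "Poly_Mapping.lookup (p * (c *\<^sub>R q)) k = Poly_Mapping.lookup (c *\<^sub>R (p * q)) k" .
qed

lemma free_mult_scaleR_left: "(c *\<^sub>R p) * q = c *\<^sub>R (p * q)"
  for p q :: "'g free_algebra"
  by (simp add: free_scaleR_eq mult.assoc)

lemma lookup_mult_zero: "Poly_Mapping.lookup (p * q) 0 = Poly_Mapping.lookup p 0 * Poly_Mapping.lookup q 0"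
  for p q :: "'g free_algebra"
proof -
  have zero_iff: "0 = v + w \<longleftrightarrow> v = 0 \<and> w = 0" for v w :: "'g free_monoid"
    by (cases v; cases w) (auto simp: zero_free_monoid_def plus_free_monoid_def)
  have "Poly_Mapping.lookup (p * q) 0
      = Sum_any (\<lambda>l :: 'g free_monoid. Poly_Mapping.lookup p 0 * Poly_Mapping.lookup q 0 when l = 0)"
    unfolding lookup_mult
    by (rule Sum_any.cong) (auto simp: zero_iff when_def)
  then show ?thesis
    by simp
qed

lemma free_gen_ne: "Word [x] \<noteq> 0"
  by (simp add: zero_free_monoid_def)

lemma uea_ideal_lookup_zero: "p \<in> uea_ideal \<Longrightarrow> Poly_Mapping.lookup p 0 = 0"
  by (induction rule: uea_ideal.induct)
    (simp_all add: lookup_mult_zero lookup_add lookup_minus free_lookup_scaleR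
      free_gen_def lookup_single free_gen_ne)

quotient_type (overloaded) 'g uea = "'g::lie_algebra free_algebra" / "\<lambda>p q. p - q \<in> uea_ideal"
proof (rule equivpI)
  show "reflp (\<lambda>p q :: 'g free_algebra. p - q \<in> uea_ideal)"
    by (rule reflpI) (simp add: uea_ideal.zero)
  show "symp (\<lambda>p q :: 'g free_algebra. p - q \<in> uea_ideal)"
    by (rule sympI, drule uea_ideal_uminus) simp
  show "transp (\<lambda>p q :: 'g free_algebra. p - q \<in> uea_ideal)"
    by (rule transpI, drule (1) uea_ideal.add) simp
qed

instantiation uea :: (lie_algebra) real_algebra_1
begin

lift_definition zero_uea :: "'a uea" is 0 .
lift_definition one_uea :: "'a uea" is 1 .
lift_definition plus_uea :: "'a uea \<Rightarrow> 'a uea \<Rightarrow> 'a uea" is "(+)"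
  by (metis add_diff_add uea_ideal.add)
lift_definition minus_uea :: "'a uea \<Rightarrow> 'a uea \<Rightarrow> 'a uea" is "(-)"
  by (metis (no_types, lifting) diff_diff_eq2 diff_add_eq diff_diff_add add.commute uea_ideal_diff)
lift_definition uminus_uea :: "'a uea \<Rightarrow> 'a uea" is uminus
  by (metis minus_diff_minus uea_ideal_uminus)
lift_definition times_uea :: "'a uea \<Rightarrow> 'a uea \<Rightarrow> 'a uea" is "(*)"
  by (metis mult_diff_mult uea_ideal.add uea_ideal.mult_left uea_ideal.mult_right)
lift_definition scaleR_uea :: "real \<Rightarrow> 'a uea \<Rightarrow> 'a uea" is scaleR
  by (metis free_scaleR_eq scaleR_right_diff_distrib uea_ideal.mult_left)

instance
proof
  fix a b c :: "'a uea" and r s :: real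
  show "a + b + c = a + (b + c)" "a + b = b + a" "0 + a = a" "- a + a = 0" "a - b = a + - b"
    "a * b * c = a * (b * c)" "(a + b) * c = a * c + b * c" "a * (b + c) = a * b + a * c"
    "1 * a = a" "a * 1 = a" "r *\<^sub>R (a + b) = r *\<^sub>R a + r *\<^sub>R b"
    "(r + s) *\<^sub>R a = r *\<^sub>R a + s *\<^sub>R a" "r *\<^sub>R s *\<^sub>R a = (r * s) *\<^sub>R a" "1 *\<^sub>R a = a"
    "r *\<^sub>R a * b = r *\<^sub>R (a * b)" "a * r *\<^sub>R b = r *\<^sub>R (a * b)"
    by (transfer; simp add: algebra_simps scaleR_add_left scaleR_add_right uea_ideal.zero
        free_mult_scaleR_left free_mult_scaleR_right)+
  show "(0 :: 'a uea) \<noteq> 1"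
  proof (transfer, rule notI)
    assume "0 - (1 :: 'a free_algebra) \<in> uea_ideal"
    from uea_ideal_lookup_zero [OF this] show False
      by (simp add: lookup_minus)
  qed
qed

end

lift_definition uea_gen :: "'g::lie_algebra \<Rightarrow> 'g uea" is free_gen .

definition lie_subalgebra :: "'g::lie_algebra set \<Rightarrow> bool" where
  "lie_subalgebra A \<longleftrightarrow> subspace A \<and> (\<forall>x\<in>A. \<forall>y\<in>A. lie_bracket x y \<in> A)"

locale graded_lie_algebra =
  fixes gr :: "nat \<Rightarrow> 'g::lie_algebra set"
  assumes subspace_gr: "subspace (gr k)"
    and gr_0: "gr 0 = {0}"
    and gr_direct_sum: "\<exists>!c. (\<forall>k. c k \<in> gr k) \<and> finite {k. c k \<noteq> 0} \<and> x = (\<Sum>k | c k \<noteq> 0. c k)"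
    and lie_bracket_gr: "x \<in> gr k \<Longrightarrow> y \<in> gr m \<Longrightarrow> lie_bracket x y \<in> gr (k + m)"
    and finite_dim_gr: "\<exists>B. finite B \<and> span B = gr k"
    and gr_1_generates: "lie_subalgebra A \<Longrightarrow> gr 1 \<subseteq> A \<Longrightarrow> A = UNIV"

definition indexed_basis :: "nat \<Rightarrow> (nat \<Rightarrow> 'a::real_vector) \<Rightarrow> 'a set \<Rightarrow> bool" where
  "indexed_basis n \<omega> V \<longleftrightarrow>
    inj_on \<omega> {..<n} \<and> independent (\<omega> ` {..<n}) \<and> span (\<omega> ` {..<n}) = V"

definition uea_grade :: "(nat \<Rightarrow> 'g::lie_algebra set) \<Rightarrow> nat \<Rightarrow> 'g uea set" where
  "uea_grade gr p = span {prod_list (map uea_gen xs) | xs ks.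
    list_all2 (\<lambda>x k. x \<in> gr k) xs ks \<and> sum_list ks = p}"

text \<open>A formal series \<open>z\<close> of homogeneous elements is encoded as the formal power series
  whose coefficient at degree \<open>p\<close> is the component of degree \<open>p\<close> of \<open>z\<close>; the product
  of the completed algebra is then the (Cauchy) product of power series.\<close>

definition uea_completion :: "(nat \<Rightarrow> 'g::lie_algebra set) \<Rightarrow> 'g uea fps set" where
  "uea_completion gr = {z. \<forall>p. fps_nth z p \<in> uea_grade gr p}"

definition lie_completion :: "(nat \<Rightarrow> 'g::lie_algebra set) \<Rightarrow> 'g uea fps set" where
  "lie_completion gr = {x. \<forall>k. fps_nth x k \<in> uea_gen ` gr k}"

text \<open>The constant term of an element \<open>x\<close> of the completed Lie algebra vanishes, so
  \<open>x ^ k\<close> contributes to the exponential series only in degrees \<open>p \<ge> k\<close>.\<close>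

definition series_exp :: "'g::lie_algebra uea fps \<Rightarrow> 'g uea fps" where
  "series_exp x = Abs_fps (\<lambda>p. \<Sum>k\<le>p. fps_nth (x ^ k) p /\<^sub>R fact k)"

definition G_bar :: "(nat \<Rightarrow> 'g::lie_algebra set) \<Rightarrow> 'g uea fps set" where
  "G_bar gr = series_exp ` lie_completion gr"

definition index_words :: "nat \<Rightarrow> nat \<Rightarrow> nat list set" where
  "index_words n p = {w. length w = p \<and> set w \<subseteq> {..<n}}"

definition uea_word :: "(nat \<Rightarrow> 'g::lie_algebra) \<Rightarrow> nat list \<Rightarrow> 'g uea" where
  "uea_word \<omega> w = prod_list (map (\<lambda>j. uea_gen (\<omega> j)) w)"

definition uea_norm :: "nat \<Rightarrow> (nat \<Rightarrow> 'g::lie_algebra) \<Rightarrow> nat \<Rightarrow> 'g uea \<Rightarrow> real" where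
  "uea_norm n \<omega> p z = Inf {(\<Sum>w\<in>index_words n p. \<bar>c w\<bar>) | c.
    z = (\<Sum>w\<in>index_words n p. c w *\<^sub>R uea_word \<omega> w)}"

definition U_fact_a ::
  "(nat \<Rightarrow> 'g::lie_algebra set) \<Rightarrow> nat \<Rightarrow> (nat \<Rightarrow> 'g) \<Rightarrow> real \<Rightarrow> 'g uea fps set" where
  "U_fact_a gr n \<omega> a = {z \<in> uea_completion gr.
    bdd_above (range (\<lambda>p. uea_norm n \<omega> p (fps_nth z p) * fact p / a ^ p))}"

definition U_fact ::
  "(nat \<Rightarrow> 'g::lie_algebra set) \<Rightarrow> nat \<Rightarrow> (nat \<Rightarrow> 'g) \<Rightarrow> 'g uea fps set" where
  "U_fact gr n \<omega> = (\<Union>a\<in>{0<..}. U_fact_a gr n \<omega> a)"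

definition G_fact ::
  "(nat \<Rightarrow> 'g::lie_algebra set) \<Rightarrow> nat \<Rightarrow> (nat \<Rightarrow> 'g) \<Rightarrow> 'g uea fps monoid" where
  "G_fact gr n \<omega> = \<lparr>carrier = G_bar gr \<inter> U_fact gr n \<omega>, mult = (*), one = 1\<rparr>"

definition G_fact_a ::
  "(nat \<Rightarrow> 'g::lie_algebra set) \<Rightarrow> nat \<Rightarrow> (nat \<Rightarrow> 'g) \<Rightarrow> real \<Rightarrow> 'g uea fps monoid" where
  "G_fact_a gr n \<omega> a = subgroup_generated (G_fact gr n \<omega>) (G_bar gr \<inter> U_fact_a gr n \<omega> a)"

text \<open>Differentiability of a curve in the completed algebra, for the product topology:
  each component is a curve in a finite-dimensional space, whose topology
  is the one of the norm \<open>uea_norm\<close>.\<close>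

definition has_series_derivative ::
  "nat \<Rightarrow> (nat \<Rightarrow> 'g::lie_algebra) \<Rightarrow> (real \<Rightarrow> 'g uea fps) \<Rightarrow> 'g uea fps \<Rightarrow> real \<Rightarrow> real set \<Rightarrow> bool"
  where
  "has_series_derivative n \<omega> E E' t S \<longleftrightarrow> (\<forall>p.
    ((\<lambda>s. uea_norm n \<omega> p ((fps_nth (E s) p - fps_nth (E t) p) /\<^sub>R (s - t) - fps_nth E' p))
      \<longlongrightarrow> 0) (at t within S))"

definition C1_curve :: "nat \<Rightarrow> (nat \<Rightarrow> 'a::real_vector) \<Rightarrow> real set \<Rightarrow> (real \<Rightarrow> 'a) \<Rightarrow> bool" where
  "C1_curve n \<omega> S \<mu> \<longleftrightarrow> (\<exists>c c'.
    (\<forall>t\<in>S. \<mu> t = (\<Sum>j<n. c j t *\<^sub>R \<omega> j)) \<and>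
    (\<forall>j<n. (\<forall>t\<in>S. (c j has_real_derivative c' j t) (at t within S)) \<and> continuous_on S (c' j)))"

definition holomorphic_fun_on :: "(complex ^ 'n) set \<Rightarrow> (complex ^ 'n \<Rightarrow> complex) \<Rightarrow> bool" where
  "holomorphic_fun_on U f \<longleftrightarrow>
    (\<forall>x\<in>U. \<exists>D. (f has_derivative D) (at x) \<and> (\<forall>c v. D (c *s v) = c * D v))"

definition holomorphic_map_on ::
  "(complex ^ 'n) set \<Rightarrow> (complex ^ 'n \<Rightarrow> complex ^ 'm) \<Rightarrow> bool" where
  "holomorphic_map_on U f \<longleftrightarrow> (\<forall>i. holomorphic_fun_on U (\<lambda>x. f x $ i))"

definition complex_submanifold :: "(complex ^ 'n) set \<Rightarrow> bool" where
  "complex_submanifold S \<longleftrightarrow> (\<forall>p\<in>S. \<exists>U V \<phi> \<psi> L.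
    open U \<and> open V \<and> p \<in> U \<and> homeomorphism U V \<phi> \<psi> \<and>
    holomorphic_map_on U (\<phi> :: complex ^ 'n \<Rightarrow> complex ^ 'n) \<and> holomorphic_map_on V \<psi> \<and>
    vec.subspace L \<and> \<phi> ` (S \<inter> U) = V \<inter> L)"

primrec Ck_on ::
  "nat \<Rightarrow> 'a::euclidean_space set \<Rightarrow> ('a \<Rightarrow> 'b::euclidean_space) \<Rightarrow> bool" where
  "Ck_on 0 U f \<longleftrightarrow> continuous_on U f"
| "Ck_on (Suc k) U f \<longleftrightarrow> (\<forall>x\<in>U. f differentiable at x) \<and>
    (\<forall>v. Ck_on k U (\<lambda>x. frechet_derivative f (at x) v))"

definition smooth_on :: "'a::euclidean_space set \<Rightarrow> ('a \<Rightarrow> 'b::euclidean_space) \<Rightarrow> bool" where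
  "smooth_on U f \<longleftrightarrow> (\<forall>k. Ck_on k U f)"

definition smooth_submanifold :: "'a::euclidean_space set \<Rightarrow> bool" where
  "smooth_submanifold S \<longleftrightarrow> (\<forall>p\<in>S. \<exists>U V \<phi> \<psi> L.
    open U \<and> open V \<and> p \<in> U \<and> homeomorphism U V \<phi> \<psi> \<and>
    smooth_on U \<phi> \<and> smooth_on V (\<psi> :: 'a \<Rightarrow> 'a) \<and>
    subspace L \<and> \<phi> ` (S \<inter> U) = V \<inter> L)"

definition real_analytic_fun_on :: "(real ^ 'n) set \<Rightarrow> (real ^ 'n \<Rightarrow> real) \<Rightarrow> bool" where
  "real_analytic_fun_on U f \<longleftrightarrow> (\<forall>x0\<in>U. \<exists>r>0. \<exists>b :: ('n \<Rightarrow> nat) \<Rightarrow> real. \<forall>x\<in>ball x0 r.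
    ((\<lambda>\<alpha>. b \<alpha> * (\<Prod>i\<in>UNIV. (x $ i - x0 $ i) ^ \<alpha> i)) has_sum f x) UNIV)"

definition real_analytic_map_on ::
  "(real ^ 'n) set \<Rightarrow> (real ^ 'n \<Rightarrow> real ^ 'm) \<Rightarrow> bool" where
  "real_analytic_map_on U f \<longleftrightarrow> (\<forall>i. real_analytic_fun_on U (\<lambda>x. f x $ i))"

text \<open>Functions and maps on a submanifold \<open>S\<close> are functions on the ambient space whose values
  off \<open>S\<close> are irrelevant; they are regular if they locally extend to regular ones.\<close>

definition extends_locally ::
  "(('a::topological_space) set \<Rightarrow> ('a \<Rightarrow> 'b) \<Rightarrow> bool) \<Rightarrow> 'a set \<Rightarrow> ('a \<Rightarrow> 'b) \<Rightarrow> bool" where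
  "extends_locally R S f \<longleftrightarrow>
    (\<forall>p\<in>S. \<exists>U g. open U \<and> p \<in> U \<and> R U g \<and> (\<forall>x\<in>S \<inter> U. g x = f x))"

definition holomorphic_functions :: "(complex ^ 'n) set \<Rightarrow> (complex ^ 'n \<Rightarrow> complex) set" where
  "holomorphic_functions S = {F. extends_locally holomorphic_fun_on S F}"

definition smooth_diffeo :: "'a::euclidean_space set \<Rightarrow> ('a \<Rightarrow> 'a) \<Rightarrow> bool" where
  "smooth_diffeo M f \<longleftrightarrow> bij_betw f M M \<and>
    extends_locally smooth_on M f \<and> extends_locally smooth_on M (inv_into M f)"

definition analytic_diffeo :: "(real ^ 'n) set \<Rightarrow> (real ^ 'n \<Rightarrow> real ^ 'n) \<Rightarrow> bool" where
  "analytic_diffeo M f \<longleftrightarrow> bij_betw f M M \<and>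
    extends_locally real_analytic_map_on M f \<and> extends_locally real_analytic_map_on M (inv_into M f)"

text \<open>The product of \<open>P\<close> and \<open>Q\<close> is \<open>Q \<circ> P\<close>. Extensionality makes
  a diffeomorphism of \<open>M\<close> a unique element of the carrier.\<close>

definition analytic_diffeo_group :: "(real ^ 'n) set \<Rightarrow> (real ^ 'n \<Rightarrow> real ^ 'n) monoid" where
  "analytic_diffeo_group M =
    \<lparr>carrier = {f \<in> extensional M. analytic_diffeo M f},
     mult = (\<lambda>P Q. compose M Q P), one = restrict id M\<rparr>"

definition complexify :: "real ^ 'n \<Rightarrow> complex ^ 'n" where
  "complexify x = (\<chi> i. complex_of_real (x $ i))"

definition real_points :: "(complex ^ 'n) set \<Rightarrow> (real ^ 'n) set" where
  "real_points S = {x. complexify x \<in> S}"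

definition tangent_space :: "'a::real_normed_vector set \<Rightarrow> 'a \<Rightarrow> 'a set" where
  "tangent_space S p = {v. \<exists>\<gamma> :: real \<Rightarrow> 'a.
    \<gamma> 0 = p \<and> (\<forall>t. \<gamma> t \<in> S) \<and> (\<gamma> has_vector_derivative v) (at 0)}"

text \<open>The derivative of \<open>F\<close> within \<open>S\<close> is not unique as a linear map on the ambient space,
  but its value on vectors tangent to \<open>S\<close> is, and vector fields on \<open>S\<close> are tangent to \<open>S\<close>.\<close>

definition vf_apply ::
  "'a::real_normed_vector set \<Rightarrow> ('a \<Rightarrow> 'a) \<Rightarrow> ('a \<Rightarrow> 'b::real_normed_vector) \<Rightarrow> 'a \<Rightarrow> 'b" where
  "vf_apply S X F p = frechet_derivative F (at p within S) (X p)"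

definition holomorphic_vector_field ::
  "(complex ^ 'n) set \<Rightarrow> (complex ^ 'n \<Rightarrow> complex ^ 'n) \<Rightarrow> bool" where
  "holomorphic_vector_field S X \<longleftrightarrow>
    (\<forall>\<xi>\<in>S. X \<xi> \<in> tangent_space S \<xi>) \<and> extends_locally holomorphic_map_on S X"

definition real_on :: "(real ^ 'n) set \<Rightarrow> (complex ^ 'n \<Rightarrow> complex ^ 'n) \<Rightarrow> bool" where
  "real_on M X \<longleftrightarrow> (\<forall>m\<in>M. X (complexify m) \<in> complexify ` tangent_space M m)"

definition real_restriction :: "(complex ^ 'n \<Rightarrow> complex ^ 'n) \<Rightarrow> real ^ 'n \<Rightarrow> real ^ 'n" where
  "real_restriction X m = (\<chi> i. Re (X (complexify m) $ i))"

definition lie_action ::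
  "(complex ^ 'n) set \<Rightarrow> ('g::lie_algebra \<Rightarrow> complex ^ 'n \<Rightarrow> complex ^ 'n) \<Rightarrow> bool" where
  "lie_action S X \<longleftrightarrow>
    (\<forall>x. holomorphic_vector_field S (X x)) \<and>
    (\<forall>x y. \<forall>\<xi>\<in>S. X (x + y) \<xi> = X x \<xi> + X y \<xi>) \<and>
    (\<forall>c x. \<forall>\<xi>\<in>S. X (c *\<^sub>R x) \<xi> = c *\<^sub>R X x \<xi>) \<and>
    (\<forall>x y. \<forall>F\<in>holomorphic_functions S. \<forall>\<xi>\<in>S.
      vf_apply S (X (lie_bracket x y)) F \<xi> =
        vf_apply S (X x) (vf_apply S (X y) F) \<xi> - vf_apply S (X y) (vf_apply S (X x) F) \<xi>)"

text \<open>For a Lie algebra action the result does not depend on the chosen representative in the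
  free algebra, since the operators on holomorphic functions respect the defining relations.\<close>

definition uea_act ::
  "(complex ^ 'n) set \<Rightarrow> ('g::lie_algebra \<Rightarrow> complex ^ 'n \<Rightarrow> complex ^ 'n) \<Rightarrow> 'g uea \<Rightarrow>
    (complex ^ 'n \<Rightarrow> complex) \<Rightarrow> complex ^ 'n \<Rightarrow> complex" where
  "uea_act S X u F \<xi> = (\<Sum>w\<in>Poly_Mapping.keys (rep_uea u).
    Poly_Mapping.lookup (rep_uea u) w *\<^sub>R foldr (\<lambda>x. vf_apply S (X x)) (letters w) F \<xi>)"

definition series_act ::
  "(complex ^ 'n) set \<Rightarrow> ('g::lie_algebra \<Rightarrow> complex ^ 'n \<Rightarrow> complex ^ 'n) \<Rightarrow> 'g uea fps \<Rightarrow>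
    (complex ^ 'n \<Rightarrow> complex) \<Rightarrow> complex ^ 'n \<Rightarrow> complex" where
  "series_act S X z F \<xi> = suminf (\<lambda>p. uea_act S X (fps_nth z p) F \<xi>)"

end

theory Submission
  imports Defs "HOL-Complex_Analysis.Complex_Analysis"
begin

no_notation fps_nth (infixl "$" 75)

text \<open>Represent a series \<open>z\<close> by words with \<open>\<ell>\<^sup>1\<close>-norms at most \<open>C a\<^sup>p / p!\<close> in degree \<open>p\<close>. Cauchy's estimate on
  \<open>p\<close> nested balls bounds \<open>p\<close>-fold derivatives along the fields by \<open>p!\<close> times a geometric factor, so the
  series \<open>\<rho>(z)F\<close> converges near \<open>M\<close> for small \<open>a\<close>. Exponentials act by algebra homomorphisms, hence for
  \<open>z\<close> in the group \<open>F \<mapsto> (\<rho>(z)F)(m)\<close> is a character. Applying it to powers shows that its values on the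
  coordinate functions are close to those at \<open>m\<close>, and approximation by polynomials then shows that it is
  the evaluation at a point of \<open>M\<close>, which is \<open>\<Q>\<^sub>z(m)\<close>.

  If two products of such series agree, so do their dilations by \<open>t\<close> (degree \<open>p\<close> scaled by \<open>t\<^sup>p\<close>). For small
  \<open>t\<close> a single convergent series describes the composed maps, which therefore agree; both sides are analytic
  in \<open>t\<close>, so they agree at \<open>t = 1\<close>.

  On a short interval the iterated integrals of \<open>\<mu>\<close> form a small group-like series whose map is the
  transition of \<open>\<R>\<close>, because the remainder of its Taylor expansion tends to zero. The product of these
  series over a subdivision of \<open>[0, T]\<close> is \<open>\<E>(T) = 1\<close>, and uniqueness applies.\<close>

section \<open>Holomorphic functions of several variables\<close>

text \<open>Coefficients on words, rather than elements of the enveloping algebra, carry the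
  analysis. Words satisfy linear relations, so a family of coefficients is chosen once and
  afterwards only its action on functions matters. Group-likeness is also expressed through that
  action, by compatibility with products of functions; exponentials and iterated integrals can then
  be treated alike. The obstacle is that smallness is lost under products: the radii
  \<open>a\<close> of the factors add up, so a product of many small series may leave the range
  where its action converges although the composed maps exist. Equal products can therefore not be
  compared by summing their common series, which is why dilations enter. The rate 1/4 built into
  \<open>a0\<close> has two uses: composing two series costs binomial coefficients up to
  \<open>2 ^ (k + q)\<close>, and a complex dilation parameter may have modulus up to 2. Either way
  1/2 remains. The character only gives a point of the ambient space near \<open>m\<close>. A local
  retraction forces it onto the complex submanifold, and reality of the fields on \<open>M\<close>
  makes it a real point.\<close>

lemma norm_scalar_mult_cvec: "norm (c *s v) = norm c * norm v" for v :: "complex ^ 'n"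
  by (simp add: norm_vec_def L2_set_right_distrib norm_mult)

lemma scaleR_cvec: "r *\<^sub>R v = complex_of_real r *s v" for v :: "complex ^ 'n"
  unfolding vec_eq_iff vector_scalar_mult_def vector_scaleR_component vec_lambda_beta by (simp add: scaleR_conv_of_real)

lemma holomorphic_fun_on_has_derivative:
  assumes "holomorphic_fun_on U f" "x \<in> U"
  shows "(f has_derivative frechet_derivative f (at x)) (at x)"
  using assms unfolding holomorphic_fun_on_def
  by (metis frechet_derivative_at)

lemma frechet_derivative_scalar_mult:
  assumes "holomorphic_fun_on U f" "x \<in> U"
  shows "frechet_derivative f (at x) (c *s v) = c * frechet_derivative f (at x) v"
  using assms unfolding holomorphic_fun_on_def
  by (metis frechet_derivative_at)

lemma holomorphic_fun_on_subset: "holomorphic_fun_on U f \<Longrightarrow> V \<subseteq> U \<Longrightarrow> holomorphic_fun_on V f"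
  unfolding holomorphic_fun_on_def by blast

lemma holomorphic_map_on_subset: "holomorphic_map_on U f \<Longrightarrow> V \<subseteq> U \<Longrightarrow> holomorphic_map_on V f"
  unfolding holomorphic_map_on_def using holomorphic_fun_on_subset by blast

lemma holomorphic_fun_on_continuous:
  assumes "holomorphic_fun_on U f"
  shows "continuous_on U f"
  using assms by (meson holomorphic_fun_on_has_derivative has_derivative_continuous
      continuous_at_imp_continuous_on)

lemma holomorphic_fun_on_cong:
  assumes "open U" "\<And>x. x \<in> U \<Longrightarrow> f x = g x" "holomorphic_fun_on U f"
  shows "holomorphic_fun_on U g"
  unfolding holomorphic_fun_on_def
proof
  fix x assume x: "x \<in> U"
  obtain D where D: "(f has_derivative D) (at x)" "\<forall>c v. D (c *s v) = c * D v"
    using assms x by (auto simp: holomorphic_fun_on_def)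
  have "(g has_derivative D) (at x)"
    by (rule has_derivative_transform_within_open[OF D(1) assms(1) x]) (rule assms(2))
  with D show "\<exists>D. (g has_derivative D) (at x) \<and> (\<forall>c v. D (c *s v) = c * D v)" by blast
qed

lemma holomorphic_fun_on_const: "holomorphic_fun_on U (\<lambda>x. c)"
  unfolding holomorphic_fun_on_def by (intro ballI exI[of _ "\<lambda>_. 0"]) simp

lemma holomorphic_fun_on_component: "holomorphic_fun_on U (\<lambda>x. x $ i)"
  unfolding holomorphic_fun_on_def
  by (intro ballI exI[of _ "\<lambda>v. v $ i"])
    (auto intro!: bounded_linear_imp_has_derivative bounded_linear_vec_nth)

lemma holomorphic_fun_on_add:
  assumes "holomorphic_fun_on U f" "holomorphic_fun_on U g"
  shows "holomorphic_fun_on U (\<lambda>x. f x + g x)"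
  unfolding holomorphic_fun_on_def
proof
  fix x assume "x \<in> U"
  with assms show "\<exists>D. ((\<lambda>x. f x + g x) has_derivative D) (at x) \<and> (\<forall>c v. D (c *s v) = c * D v)"
    by (intro exI[of _ "\<lambda>v. frechet_derivative f (at x) v + frechet_derivative g (at x) v"])
      (auto intro!: has_derivative_add holomorphic_fun_on_has_derivative
        simp: frechet_derivative_scalar_mult algebra_simps)
qed

lemma holomorphic_fun_on_mult:
  assumes "holomorphic_fun_on U f" "holomorphic_fun_on U g"
  shows "holomorphic_fun_on U (\<lambda>x. f x * g x)"
  unfolding holomorphic_fun_on_def
proof
  fix x assume "x \<in> U"
  with assms show "\<exists>D. ((\<lambda>x. f x * g x) has_derivative D) (at x) \<and> (\<forall>c v. D (c *s v) = c * D v)"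
    by (intro exI[of _ "\<lambda>v. f x * frechet_derivative g (at x) v + frechet_derivative f (at x) v * g x"]
          conjI has_derivative_mult holomorphic_fun_on_has_derivative)
      (auto simp: frechet_derivative_scalar_mult algebra_simps)
qed

lemma holomorphic_fun_on_scaleR:
  "holomorphic_fun_on U f \<Longrightarrow> holomorphic_fun_on U (\<lambda>x. r *\<^sub>R f x)"
  unfolding scaleR_conv_of_real by (intro holomorphic_fun_on_mult holomorphic_fun_on_const)

lemma holomorphic_fun_on_diff:
  assumes "holomorphic_fun_on U f" "holomorphic_fun_on U g"
  shows "holomorphic_fun_on U (\<lambda>x. f x - g x)"
  using holomorphic_fun_on_add[OF assms(1) holomorphic_fun_on_scaleR[OF assms(2), of "-1"]] by simp

lemma holomorphic_fun_on_sum: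
  "(\<And>i. i \<in> I \<Longrightarrow> holomorphic_fun_on U (f i)) \<Longrightarrow> holomorphic_fun_on U (\<lambda>x. \<Sum>i\<in>I. f i x)"
  by (induction I rule: infinite_finite_induct)
    (simp_all add: holomorphic_fun_on_const holomorphic_fun_on_add)

lemma holomorphic_fun_on_power:
  "holomorphic_fun_on U f \<Longrightarrow> holomorphic_fun_on U (\<lambda>x. f x ^ k)"
  by (induction k) (simp_all add: holomorphic_fun_on_const holomorphic_fun_on_mult)

lemma holomorphic_fun_on_prod:
  "(\<And>i. i \<in> I \<Longrightarrow> holomorphic_fun_on U (f i)) \<Longrightarrow> holomorphic_fun_on U (\<lambda>x. \<Prod>i\<in>I. f i x)"
  by (induction I rule: infinite_finite_induct)
    (simp_all add: holomorphic_fun_on_const holomorphic_fun_on_mult)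

lemmas holomorphic_fun_intros = holomorphic_fun_on_const holomorphic_fun_on_component
  holomorphic_fun_on_add holomorphic_fun_on_mult holomorphic_fun_on_scaleR holomorphic_fun_on_diff
  holomorphic_fun_on_sum holomorphic_fun_on_power holomorphic_fun_on_prod

lemma vec_eq_sum_axis: "x = (\<Sum>i\<in>UNIV. axis i (x $ i))" for x :: "'a::comm_monoid_add ^ 'n"
  by (simp add: vec_eq_iff axis_def sum.delta')

lemma bounded_linear_axis: "bounded_linear (\<lambda>c. axis i c :: complex ^ 'n)"
  by (rule linear_conv_bounded_linear[THEN iffD1], rule linearI) (auto simp: axis_def vec_eq_iff)

lemma has_derivative_cvec:
  fixes f :: "'a::real_normed_vector \<Rightarrow> complex ^ 'm"
  assumes "\<And>i. ((\<lambda>x. f x $ i) has_derivative D i) F"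
  shows "(f has_derivative (\<lambda>v. \<chi> i. D i v)) F"
proof -
  have "((\<lambda>x. \<Sum>i\<in>UNIV. axis i (f x $ i)) has_derivative (\<lambda>v. \<Sum>i\<in>UNIV. axis i (D i v))) F"
    by (intro has_derivative_sum bounded_linear.has_derivative[OF bounded_linear_axis] assms)
  moreover have "(\<Sum>i\<in>UNIV. axis i (D i v)) = (\<chi> i. D i v)" for v
    using vec_eq_sum_axis[of "\<chi> i. D i v"] by simp
  ultimately show ?thesis by (simp flip: vec_eq_sum_axis)
qed

lemma holomorphic_map_on_has_derivative:
  assumes "holomorphic_map_on U f" "x \<in> U"
  obtains D where "(f has_derivative D) (at x)" "\<And>c v. D (c *s v) = c *s D v"
proof
  show "(f has_derivative (\<lambda>v. \<chi> i. frechet_derivative (\<lambda>x. f x $ i) (at x) v)) (at x)"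
    using assms by (intro has_derivative_cvec holomorphic_fun_on_has_derivative)
      (auto simp: holomorphic_map_on_def)
  show "(\<chi> i. frechet_derivative (\<lambda>x. f x $ i) (at x) (c *s v))
     = c *s (\<chi> i. frechet_derivative (\<lambda>x. f x $ i) (at x) v)" for c v
    using assms by (auto simp: vec_eq_iff holomorphic_map_on_def
        intro!: frechet_derivative_scalar_mult)
qed

lemma holomorphic_map_on_continuous:
  assumes "holomorphic_map_on U f"
  shows "continuous_on U f"
  using assms by (meson holomorphic_map_on_has_derivative has_derivative_continuous
      continuous_at_imp_continuous_on)

lemma holomorphic_fun_on_compose:
  assumes "holomorphic_map_on U f" "holomorphic_fun_on V g" "f ` U \<subseteq> V"
  shows "holomorphic_fun_on U (\<lambda>x. g (f x))"
  unfolding holomorphic_fun_on_def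
proof
  fix x assume x: "x \<in> U"
  obtain D where D: "(f has_derivative D) (at x)" "\<And>c v. D (c *s v) = c *s D v"
    using holomorphic_map_on_has_derivative[OF assms(1) x] by blast
  have fx: "f x \<in> V" using x assms(3) by blast
  have "((\<lambda>x. g (f x)) has_derivative (\<lambda>v. frechet_derivative g (at (f x)) (D v))) (at x)"
    using diff_chain_at[OF D(1) holomorphic_fun_on_has_derivative[OF assms(2) fx]]
    by (simp add: o_def)
  then show "\<exists>D. ((\<lambda>x. g (f x)) has_derivative D) (at x) \<and> (\<forall>c v. D (c *s v) = c * D v)"
    using D(2) frechet_derivative_scalar_mult[OF assms(2) fx] by (intro exI conjI) auto
qed

lemma holomorphic_map_on_compose:
  assumes "holomorphic_map_on U f" "holomorphic_map_on V g" "f ` U \<subseteq> V"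
  shows "holomorphic_map_on U (\<lambda>x. g (f x))"
  unfolding holomorphic_map_on_def
  using assms(2) by (auto intro!: holomorphic_fun_on_compose[OF assms(1) _ assms(3)]
      simp: holomorphic_map_on_def)

text \<open>Complex homogeneity of the derivative turns the real chain rule into multiplication by a
  single complex number. All reductions to one complex variable pass through this.\<close>

lemma holomorphic_fun_on_compose_curve:
  assumes "holomorphic_fun_on U G" "\<gamma> \<zeta> \<in> U"
    and "\<And>i. ((\<lambda>\<zeta>. \<gamma> \<zeta> $ i) has_field_derivative d i) (at \<zeta>)"
  shows "((\<lambda>\<zeta>. G (\<gamma> \<zeta>)) has_field_derivative frechet_derivative G (at (\<gamma> \<zeta>)) (\<chi> i. d i)) (at \<zeta>)"
proof -
  have 1: "(\<gamma> has_derivative (\<lambda>v. \<chi> i. d i * v)) (at \<zeta>)"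
    by (rule has_derivative_cvec) (use assms(3) has_field_derivative_imp_has_derivative in blast)
  have "((\<lambda>x. G (\<gamma> x)) has_derivative (\<lambda>v. frechet_derivative G (at (\<gamma> \<zeta>)) (\<chi> i. d i * v))) (at \<zeta>)"
    using diff_chain_at[OF 1 holomorphic_fun_on_has_derivative[OF assms(1,2)]] by (simp add: o_def)
  moreover have "(\<chi> i. d i * v) = v *s (\<chi> i. d i)" for v
    by (simp add: vec_eq_iff mult.commute)
  ultimately show ?thesis
    using frechet_derivative_scalar_mult[OF assms(1,2)]
    by (intro has_derivative_imp_has_field_derivative) auto
qed

lemma holomorphic_fun_on_compose_curve_on:
  assumes "holomorphic_fun_on U G" "open S" "\<And>\<zeta>. \<zeta> \<in> S \<Longrightarrow> \<gamma> \<zeta> \<in> U"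
    and "\<And>i. (\<lambda>\<zeta>. \<gamma> \<zeta> $ i) holomorphic_on S"
  shows "(\<lambda>\<zeta>. G (\<gamma> \<zeta>)) holomorphic_on S"
  unfolding holomorphic_on_open[OF assms(2)]
proof
  fix \<zeta> assume "\<zeta> \<in> S"
  from holomorphic_fun_on_compose_curve[where \<gamma> = \<gamma>, OF assms(1) assms(3)[OF this]
      holomorphic_derivI[OF assms(4,2) this]]
  show "\<exists>f'. ((\<lambda>\<zeta>. G (\<gamma> \<zeta>)) has_field_derivative f') (at \<zeta>)" by blast
qed

lemma has_field_derivative_along_line:
  assumes "holomorphic_fun_on U G" "x + \<zeta> *s v \<in> U"
  shows "((\<lambda>\<zeta>. G (x + \<zeta> *s v)) has_field_derivative frechet_derivative G (at (x + \<zeta> *s v)) v) (at \<zeta>)"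
proof -
  have "((\<lambda>\<zeta>. (x + \<zeta> *s v) $ i) has_field_derivative v $ i) (at \<zeta>)" for i
    by (auto intro!: derivative_eq_intros)
  from holomorphic_fun_on_compose_curve[OF assms this] show ?thesis by simp
qed

section \<open>Cauchy estimates, locally uniform limits, and holomorphy of derivatives\<close>

lemma Cauchy_directional:
  assumes hol: "holomorphic_fun_on (ball m (s + h)) G"
    and bd: "\<And>y. y \<in> ball m (s + h) \<Longrightarrow> norm (G y) \<le> S"
    and x: "x \<in> ball m s" and h: "h > 0"
  shows "norm (frechet_derivative G (at x) v) \<le> S * norm v / h"
proof (cases "v = 0")
  case True
  have xU: "x \<in> ball m (s + h)" using x h by auto
  have "frechet_derivative G (at x) 0 = 0"
    using frechet_derivative_scalar_mult[OF hol xU, of 0 0] by simp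
  with True show ?thesis by simp
next
  case False
  then have v: "norm v > 0" by simp
  have inU: "x + \<zeta> *s v \<in> ball m (s + h)" if "\<zeta> \<in> cball 0 (h / norm v)" for \<zeta>
  proof -
    have "norm (\<zeta> *s v) \<le> h" using that v by (simp add: norm_scalar_mult_cvec field_simps)
    then have "dist x (x + \<zeta> *s v) \<le> h" by (simp add: dist_norm norm_minus_commute)
    then show ?thesis using x dist_triangle[of m "x + \<zeta> *s v" x] by (simp add: dist_commute)
  qed
  let ?g = "\<lambda>\<zeta>. G (x + \<zeta> *s v)"
  have der: "(?g has_field_derivative frechet_derivative G (at (x + \<zeta> *s v)) v) (at \<zeta>)"
    if "\<zeta> \<in> cball 0 (h / norm v)" for \<zeta>
    by (rule has_field_derivative_along_line[OF hol inU[OF that]])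
  have "norm ((deriv ^^ 1) ?g 0) \<le> fact 1 * S / (h / norm v) ^ 1"
  proof (rule Cauchy_inequality)
    show "?g holomorphic_on ball 0 (h / norm v)"
      by (rule holomorphic_onI, rule field_differentiable_at_within)
        (use der in \<open>force simp: field_differentiable_def\<close>)
    show "continuous_on (cball 0 (h / norm v)) ?g"
      by (rule continuous_at_imp_continuous_on) (use der DERIV_isCont in blast)
    show "0 < h / norm v" using v h by simp
    show "norm (?g \<zeta>) \<le> S" if "norm (0 - \<zeta>) = h / norm v" for \<zeta>
      using that by (intro bd inU) simp
  qed
  moreover have "deriv ?g 0 = frechet_derivative G (at x) v"
    using DERIV_imp_deriv[OF der[of 0]] v h by simp
  ultimately show ?thesis using v h by (simp add: field_simps)
qed

lemma frechet_derivative_diff_fun: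
  assumes "holomorphic_fun_on U f" "holomorphic_fun_on U g" "x \<in> U"
  shows "frechet_derivative (\<lambda>x. f x - g x) (at x) v
    = frechet_derivative f (at x) v - frechet_derivative g (at x) v"
proof -
  note D = assms(1,2)[THEN holomorphic_fun_on_has_derivative, OF assms(3)]
  from fun_cong[OF frechet_derivative_at[OF has_derivative_diff[OF D]], of v]
  show ?thesis by simp
qed

text \<open>Weierstrass' theorem. Cauchy's estimate on half the radius makes the derivatives
  uniformly Cauchy, relative to the norm of the direction, so the limit may be differentiated term
  by term; homogeneity passes to the limit.\<close>

lemma holomorphic_fun_on_uniform_limit:
  fixes f :: "nat \<Rightarrow> complex ^ 'n \<Rightarrow> complex"
  assumes hol: "\<And>k. holomorphic_fun_on U (f k)"
    and lim: "\<And>x. x \<in> U \<Longrightarrow> \<exists>d>0. ball x d \<subseteq> U \<and> uniform_limit (ball x d) f g sequentially"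
  shows "holomorphic_fun_on U g"
  unfolding holomorphic_fun_on_def
proof
  fix x assume x: "x \<in> U"
  obtain d where d: "d > 0" "ball x d \<subseteq> U" "uniform_limit (ball x d) f g sequentially"
    using lim[OF x] by blast
  define D where "D k y v = frechet_derivative (f k) (at y) v" for k y v
  let ?S = "ball x (d / 2)"
  have SU: "y \<in> U" if "y \<in> ?S" for y using that d by (auto simp: subset_iff)
  have Cau: "\<exists>N. \<forall>k\<ge>N. \<forall>l\<ge>N. \<forall>y\<in>?S. \<forall>v. norm (D k y v - D l y v) \<le> e * norm v" if e: "e > 0" for e
  proof -
    \<comment> \<open>Two such errors add up to \<open>e * d / 2\<close>, and Cauchy's estimate with
      margin \<open>d / 2\<close> turns this into \<open>e\<close>.\<close>
    obtain N where N: "\<forall>k\<ge>N. \<forall>y\<in>ball x d. dist (f k y) (g y) < e * d / 4"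
      using uniform_limitD[OF d(3), of "e * d / 4"] e d(1) by (auto simp: eventually_sequentially)
    show ?thesis
    proof (intro exI[of _ N] allI impI ballI)
      fix k l y v assume k: "N \<le> k" "N \<le> l" and y: "y \<in> ?S"
      have hd: "holomorphic_fun_on (ball x (d/2 + d/2)) (\<lambda>x. f k x - f l x)"
        using d(2) by (auto intro!: holomorphic_fun_on_diff holomorphic_fun_on_subset[OF hol])
      have "norm (f k z - f l z) \<le> e * d / 2" if "z \<in> ball x (d/2 + d/2)" for z
      proof -
        have "dist (f k z) (f l z) \<le> dist (f k z) (g z) + dist (f l z) (g z)"
          by (metis dist_commute dist_triangle)
        also have "\<dots> \<le> e * d / 4 + e * d / 4"
          using N k that by (intro add_mono less_imp_le) auto
        finally show ?thesis by (simp add: dist_norm mult.commute)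
      qed
      from Cauchy_directional[OF hd this y, of v]
      have "norm (frechet_derivative (\<lambda>x. f k x - f l x) (at y) v) \<le> e * norm v"
        using d(1) by (simp add: field_simps)
      then show "norm (D k y v - D l y v) \<le> e * norm v"
        using frechet_derivative_diff_fun[OF hol hol SU[OF y]] by (simp add: D_def)
    qed
  qed
  define D' where "D' y v = lim (\<lambda>k. D k y v)" for y v
  have lim': "(\<lambda>k. D k y v) \<longlonglongrightarrow> D' y v" if y: "y \<in> ?S" for y v
  proof -
    have "Cauchy (\<lambda>k. D k y v)"
    proof (rule CauchyI)
      fix e :: real assume e: "e > 0"
      then have "e / (norm v + 1) > 0" by (simp add: add_nonneg_pos)
      from Cau[OF this] obtain N where N: "\<forall>k\<ge>N. \<forall>l\<ge>N. norm (D k y v - D l y v) \<le> e / (norm v + 1) * norm v"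
        using y by blast
      have "e / (norm v + 1) * norm v < e"
        using e by (simp add: pos_divide_less_eq add_nonneg_pos add.commute[of 1])
      with N show "\<exists>M. \<forall>m\<ge>M. \<forall>n\<ge>M. norm (D m y v - D n y v) < e" by (meson order_le_less_trans)
    qed
    then show ?thesis unfolding D'_def by (simp add: Cauchy_convergent_iff convergent_LIMSEQ_iff)
  qed
  have ev: "\<forall>\<^sub>F k in sequentially. \<forall>y\<in>?S. \<forall>v. norm (D k y v - D' y v) \<le> e * norm v" if e: "e > 0" for e
  proof -
    obtain N where N: "\<forall>k\<ge>N. \<forall>l\<ge>N. \<forall>y\<in>?S. \<forall>v. norm (D k y v - D l y v) \<le> e * norm v"
      using Cau[OF e] by blast
    have "norm (D k y v - D' y v) \<le> e * norm v" if k: "k \<ge> N" and y: "y \<in> ?S" for k y v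
    proof (rule Lim_bounded)
      show "(\<lambda>l. norm (D k y v - D l y v)) \<longlonglongrightarrow> norm (D k y v - D' y v)"
        by (intro tendsto_intros lim'[OF y])
      show "\<forall>n\<ge>N. norm (D k y v - D n y v) \<le> e * norm v" using N k y by blast
    qed
    then show ?thesis unfolding eventually_sequentially by blast
  qed
  have gl: "(\<lambda>n. f n y) \<longlonglongrightarrow> g y" if "y \<in> ball x d" for y
    using tendsto_uniform_limitI[OF d(3) that] .
  have xS: "x \<in> ?S" using d by simp
  have "\<exists>g. \<forall>y\<in>?S. (\<lambda>n. f n y) \<longlonglongrightarrow> g y \<and> (g has_derivative D' y) (at y within ?S)"
  proof (rule has_derivative_sequence[where f' = D and ?x0.0 = x and l = "g x"])
    show "(f n has_derivative D n y) (at y within ?S)" if "y \<in> ?S" for n y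
      unfolding D_def[abs_def]
      by (rule has_derivative_at_withinI, rule holomorphic_fun_on_has_derivative[OF hol SU[OF that]])
  qed (use ev xS d gl[of x] in auto)
  then obtain g' where g': "\<And>y. y \<in> ?S \<Longrightarrow> (\<lambda>n. f n y) \<longlonglongrightarrow> g' y"
    "\<And>y. y \<in> ?S \<Longrightarrow> (g' has_derivative D' y) (at y within ?S)" by blast
  have gg: "g' y = g y" if "y \<in> ?S" for y
    using LIMSEQ_unique[OF g'(1)[OF that] gl] that d(1) by auto
  have "(g' has_derivative D' x) (at x)"
    using g'(2)[OF xS] unfolding at_within_open[OF xS open_ball] .
  then have "(g has_derivative D' x) (at x)"
    by (rule has_derivative_transform_within_open[OF _ open_ball xS gg])
  moreover have "D' x (c *s v) = c * D' x v" for c v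
  proof -
    have "(\<lambda>k. D k x (c *s v)) \<longlonglongrightarrow> c * D' x v"
      unfolding D_def frechet_derivative_scalar_mult[OF hol x]
      using tendsto_mult_left[OF lim'[OF xS, of v], of c] by (simp add: D_def)
    with lim'[OF xS] show ?thesis using LIMSEQ_unique by blast
  qed
  ultimately show "\<exists>D. (g has_derivative D) (at x) \<and> (\<forall>c v. D (c *s v) = c * D v)" by blast
qed

lemma holomorphic_fun_on_locally:
  assumes "\<And>x. x \<in> U \<Longrightarrow> \<exists>d>0. holomorphic_fun_on (ball x d) f"
  shows "holomorphic_fun_on U f"
  using assms unfolding holomorphic_fun_on_def by (meson centre_in_ball)

text \<open>Taylor's formula of order one, with the second derivative on the disc of radius
  \<open>R / 2\<close> bounded by Cauchy on discs of radius \<open>R / 4\<close>: this gives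
  \<open>2 * S / (R / 4)^2\<close>, hence the constant 32.\<close>

lemma quadratic_remainder:
  assumes hol: "g holomorphic_on ball 0 R" and bd: "\<And>\<zeta>. \<zeta> \<in> ball 0 R \<Longrightarrow> norm (g \<zeta>) \<le> S"
    and R: "R > 0" and z: "norm z \<le> R / 4"
  shows "norm (g z - g 0 - deriv g 0 * z) \<le> 32 * S / R\<^sup>2 * (norm z)\<^sup>2"
proof -

  define f where "f i = (deriv ^^ i) g" for i
  have "norm (f 0 z - (\<Sum>i\<le>1. f i 0 * (z - 0) ^ i / fact i)) \<le> 32 * S / R\<^sup>2 * norm (z - 0) ^ (Suc 1) / fact 1"
  proof (rule complex_Taylor[where S = "ball 0 (R/2)"])
    fix i :: nat and x assume x: "x \<in> ball (0::complex) (R/2)"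
    have "(deriv ^^ i) g holomorphic_on ball 0 R"
      by (rule holomorphic_higher_deriv[OF hol]) simp
    then have "(f i has_field_derivative deriv (f i) x) (at x)"
      unfolding f_def using x R by (intro holomorphic_derivI[OF _ open_ball]) auto
    then show "(f i has_field_derivative f (Suc i) x) (at x within ball 0 (R/2))"
      by (simp add: f_def has_field_derivative_at_within)
    have sub: "cball x (R/4) \<subseteq> ball 0 R"
    proof
      fix y assume "y \<in> cball x (R/4)"
      then have "norm (y - x) \<le> R/4" by (simp add: dist_norm norm_minus_commute)
      then show "y \<in> ball 0 R" using x R norm_triangle_sub[of y x] by simp
    qed
    have "norm ((deriv ^^ 2) g x) \<le> fact 2 * S / (R/4) ^ 2"
    proof (rule Cauchy_inequality)
      show "g holomorphic_on ball x (R/4)"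
        using sub by (intro holomorphic_on_subset[OF hol]) auto
      show "continuous_on (cball x (R/4)) g"
        by (rule continuous_on_subset[OF holomorphic_on_imp_continuous_on[OF hol] sub])
      show "0 < R / 4" using R by simp
      show "norm (g y) \<le> S" if "norm (x - y) = R/4" for y
        using that sub by (intro bd) (auto simp: subset_iff dist_norm)
    qed
    then show "norm (f (Suc 1) x) \<le> 32 * S / R\<^sup>2"
      by (simp add: f_def numeral_2_eq_2 power_divide)
  qed (use R z in auto)
  then show ?thesis by (simp add: f_def power2_eq_square algebra_simps)
qed

text \<open>The definition of holomorphy asks for one complex derivative only. The difference
  quotients in direction \<open>v\<close> are holomorphic and, by
  \<open>quadratic_remainder\<close>, converge locally uniformly, so their limit is
  holomorphic.\<close>

lemma holomorphic_fun_on_directional_derivative: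
  fixes G :: "complex ^ 'n \<Rightarrow> complex"
  assumes U: "open U" and hol: "holomorphic_fun_on U G"
  shows "holomorphic_fun_on U (\<lambda>x. frechet_derivative G (at x) v)"
proof (rule holomorphic_fun_on_locally)
  fix x assume x: "x \<in> U"
  have "isCont G x"
    using holomorphic_fun_on_continuous[OF hol] U x by (simp add: continuous_on_eq_continuous_at)
  then obtain d1 where d1: "d1 > 0" "\<And>y. dist y x < d1 \<Longrightarrow> dist (G y) (G x) < 1"
    unfolding continuous_at_eps_delta by (meson zero_less_one)
  obtain d2 where d2: "d2 > 0" "ball x d2 \<subseteq> U" using U x open_contains_ball by blast
  define d where "d = min d1 d2 / 2"
  have d: "d > 0" using d1 d2 by (simp add: d_def)
  define S where "S = norm (G x) + 1"
  have bU: "y \<in> U" "norm (G y) \<le> S" if "y \<in> ball x (2*d)" for y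
  proof -
    show "y \<in> U" using that d2 by (auto simp: d_def)
    have "dist (G y) (G x) < 1" using that by (intro d1) (auto simp: d_def dist_commute)
    then show "norm (G y) \<le> S" unfolding S_def dist_norm
      using norm_triangle_sub[of "G y" "G x"] by linarith
  qed
  \<comment> \<open>A step \<open>\<zeta>\<close> in the disc of radius \<open>R\<close> moves a
    point by at most \<open>d\<close>, so lines starting in the ball of radius \<open>d\<close> stay
    in the ball of radius \<open>2 * d\<close>. The summand 1 covers \<open>v = 0\<close>.\<close>
  define R where "R = d / (norm v + 1)"
  have nv: "norm v + 1 > 0" by (simp add: add_nonneg_pos)
  have R: "R > 0" using d nv by (simp add: R_def)
  have line: "y + \<zeta> *s v \<in> ball x (2*d)" if "y \<in> ball x d" "\<zeta> \<in> ball 0 R" for y \<zeta>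
  proof -
    have "norm \<zeta> * norm v \<le> R * (norm v + 1)"
      using that R by (intro mult_mono) auto
    also have "\<dots> = d" using nv by (simp add: R_def)
    finally have "dist y (y + \<zeta> *s v) \<le> d" by (simp add: dist_norm norm_scalar_mult_cvec)
    then show ?thesis using that dist_triangle[of x "y + \<zeta> *s v" y] by (simp add: dist_commute)
  qed
  define \<epsilon> where "\<epsilon> k = complex_of_real (R / (4 * (real k + 1)))" for k
  have eR: "norm (\<epsilon> k) \<le> R / 4" "\<epsilon> k \<noteq> 0" "\<epsilon> k \<in> ball 0 R" for k
  proof -
    have *: "norm (\<epsilon> k) = R / (4 * (real k + 1))"
      unfolding \<epsilon>_def norm_of_real using R by simp
    show "norm (\<epsilon> k) \<le> R / 4" unfolding * using R by (intro divide_left_mono) auto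
    then show "\<epsilon> k \<in> ball 0 R" using R by simp
    have "norm (\<epsilon> k) > 0" unfolding * using R by simp
    then show "\<epsilon> k \<noteq> 0" by simp
  qed
  define f where "f k y = (G (y + \<epsilon> k *s v) - G y) / \<epsilon> k" for k y
  have est: "norm (f k y - frechet_derivative G (at y) v) \<le> 32 * S / R\<^sup>2 * norm (\<epsilon> k)"
    if y: "y \<in> ball x d" for k y
  proof -
    let ?g = "\<lambda>\<zeta>. G (y + \<zeta> *s v)"
    have der: "(?g has_field_derivative frechet_derivative G (at (y + \<zeta> *s v)) v) (at \<zeta>)"
      if "\<zeta> \<in> ball 0 R" for \<zeta>
      by (rule has_field_derivative_along_line[OF hol bU(1)[OF line[OF y that]]])
    have d0: "deriv ?g 0 = frechet_derivative G (at y) v"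
      using DERIV_imp_deriv[OF der[of 0]] R by simp
    have "norm (?g (\<epsilon> k) - ?g 0 - deriv ?g 0 * \<epsilon> k) \<le> 32 * S / R\<^sup>2 * (norm (\<epsilon> k))\<^sup>2"
    proof (rule quadratic_remainder)
      show "?g holomorphic_on ball 0 R"
        by (rule holomorphic_onI, rule field_differentiable_at_within)
          (use der in \<open>force simp: field_differentiable_def\<close>)
    qed (use bU(2) line y eR R in auto)
    moreover have "f k y - deriv ?g 0 = (?g (\<epsilon> k) - ?g 0 - deriv ?g 0 * \<epsilon> k) / \<epsilon> k"
      using eR(2)[of k] by (simp add: f_def diff_divide_distrib)
    ultimately have "norm (f k y - deriv ?g 0) \<le> 32 * S / R\<^sup>2 * (norm (\<epsilon> k))\<^sup>2 / norm (\<epsilon> k)"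
      by (simp only: norm_divide) (rule divide_right_mono, simp_all)
    also have "\<dots> = 32 * S / R\<^sup>2 * norm (\<epsilon> k)" by (simp add: power2_eq_square)
    finally show ?thesis by (simp add: d0)
  qed
  have "holomorphic_fun_on (ball x d) (\<lambda>y. frechet_derivative G (at y) v)"
  proof (rule holomorphic_fun_on_uniform_limit)
    fix k
    have "holomorphic_map_on (ball x d) (\<lambda>y. y + \<epsilon> k *s v)"
      unfolding holomorphic_map_on_def by (auto intro!: holomorphic_fun_intros)
    then have 1: "holomorphic_fun_on (ball x d) (\<lambda>y. G (y + \<epsilon> k *s v))"
      by (rule holomorphic_fun_on_compose[OF _ hol]) (use line eR bU in blast)
    have "holomorphic_fun_on (ball x d) (\<lambda>y. (G (y + \<epsilon> k *s v) - G y) * inverse (\<epsilon> k))"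
      by (intro holomorphic_fun_on_mult holomorphic_fun_on_diff 1 holomorphic_fun_on_const
          holomorphic_fun_on_subset[OF hol]) (use bU d in auto)
    then show "holomorphic_fun_on (ball x d) (f k)"
      by (simp add: f_def[abs_def] divide_inverse)
  next
    have "(\<lambda>k. 32 * S / R\<^sup>2 * norm (\<epsilon> k)) \<longlonglongrightarrow> 32 * S / R\<^sup>2 * 0"
    proof (rule tendsto_mult_left)
      have "(\<lambda>k. \<epsilon> k) \<longlonglongrightarrow> 0" unfolding \<epsilon>_def
        by (rule tendsto_eq_rhs[of _ "complex_of_real 0"], rule tendsto_of_real) (real_asymp, simp)
      then show "(\<lambda>k. norm (\<epsilon> k)) \<longlonglongrightarrow> 0" by (simp add: tendsto_norm_zero)
    qed
    then have ev: "\<forall>\<^sub>F k in sequentially. 32 * S / R\<^sup>2 * norm (\<epsilon> k) < e" if "e > 0" for e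
      using order_tendstoD(2)[OF _ that] by simp
    have ul: "uniform_limit (ball x d) f (\<lambda>y. frechet_derivative G (at y) v) sequentially"
      unfolding uniform_limit_iff dist_norm
    proof (intro allI impI)
      fix e :: real assume "e > 0"
      from ev[OF this] show "\<forall>\<^sub>F k in sequentially. \<forall>y\<in>ball x d. norm (f k y - frechet_derivative G (at y) v) < e"
        by eventually_elim (use est in \<open>blast intro: order_le_less_trans\<close>)
    qed
    show "\<exists>e>0. ball y e \<subseteq> ball x d \<and>
        uniform_limit (ball y e) f (\<lambda>y. frechet_derivative G (at y) v) sequentially"
      if y: "y \<in> ball x d" for y
    proof -
      obtain e where e: "e > 0" "ball y e \<subseteq> ball x d" using openE[OF open_ball y] .
      with ul show ?thesis using uniform_limit_on_subset[OF ul e(2)] by blast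
    qed
  qed
  then show "\<exists>d>0. holomorphic_fun_on (ball x d) (\<lambda>y. frechet_derivative G (at y) v)"
    using d by blast
qed

lemma frechet_derivative_axis_expansion:
  assumes "holomorphic_fun_on U G" "x \<in> U"
  shows "frechet_derivative G (at x) v = (\<Sum>i\<in>UNIV. v $ i * frechet_derivative G (at x) (axis i 1))"
proof -
  interpret linear "frechet_derivative G (at x)"
    using holomorphic_fun_on_has_derivative[OF assms] has_derivative_linear by blast
  have "axis i (v $ i) = v $ i *s axis i (1::complex)" for i
    by (simp add: axis_def vec_eq_iff)
  then have "v = (\<Sum>i\<in>UNIV. v $ i *s axis i 1)"
    using vec_eq_sum_axis[of v] by simp
  then have "frechet_derivative G (at x) v = frechet_derivative G (at x) (\<Sum>i\<in>UNIV. v $ i *s axis i 1)"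
    by simp
  then show ?thesis by (simp add: sum frechet_derivative_scalar_mult[OF assms])
qed

text \<open>The direction varies with the point, so the derivative is split into the fixed
  coordinate directions, with the holomorphic components of \<open>Y\<close> as factors.\<close>

lemma holomorphic_fun_on_vector_field_derivative:
  assumes "open U" "holomorphic_fun_on U G" "holomorphic_map_on U Y"
  shows "holomorphic_fun_on U (\<lambda>x. frechet_derivative G (at x) (Y x))"
proof (rule holomorphic_fun_on_cong[OF assms(1)])
  show "holomorphic_fun_on U (\<lambda>x. \<Sum>i\<in>UNIV. Y x $ i * frechet_derivative G (at x) (axis i 1))"
    using assms(3) by (intro holomorphic_fun_on_sum holomorphic_fun_on_mult
        holomorphic_fun_on_directional_derivative assms) (auto simp: holomorphic_map_on_def)
qed (simp add: frechet_derivative_axis_expansion[OF assms(2)])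

subsection \<open>Power series expansion\<close>

definition polydisc :: "complex ^ 'n \<Rightarrow> real \<Rightarrow> (complex ^ 'n) set" where
  "polydisc m \<rho> = {\<xi>. \<forall>i. norm (\<xi> $ i - m $ i) < \<rho>}"

definition vec_upd :: "'a ^ 'n \<Rightarrow> 'n \<Rightarrow> 'a \<Rightarrow> 'a ^ 'n" where
  "vec_upd \<xi> i \<zeta> = (\<chi> j. if j = i then \<zeta> else \<xi> $ j)"

lemma vec_upd_nth: "vec_upd \<xi> i \<zeta> $ j = (if j = i then \<zeta> else \<xi> $ j)"
  by (simp add: vec_upd_def)

lemma vec_upd_same: "vec_upd \<xi> i (\<xi> $ i) = \<xi>"
  by (simp add: vec_eq_iff vec_upd_nth)

lemma open_polydisc: "open (polydisc m \<rho>)"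
proof -
  have "polydisc m \<rho> = (\<Inter>i. (\<lambda>\<xi>. norm (\<xi> $ i - m $ i)) -` {..<\<rho>})"
    by (auto simp: polydisc_def)
  also have "open \<dots>"
    by (intro open_INT ballI open_vimage continuous_intros finite open_lessThan)
  finally show ?thesis .
qed

lemma polydisc_subset_ball:
  fixes m :: "complex ^ 'n" and \<rho> \<epsilon> :: real
  assumes "\<rho> * real CARD('n) \<le> \<epsilon>"
  shows "polydisc m \<rho> \<subseteq> ball m \<epsilon>"
proof
  fix \<xi> assume "\<xi> \<in> polydisc m \<rho>"
  then have *: "norm ((\<xi> - m) $ i) < \<rho>" for i by (simp add: polydisc_def)
  have "norm (\<xi> - m) \<le> (\<Sum>i\<in>UNIV. norm ((\<xi> - m) $ i))"
    unfolding norm_vec_def by (rule L2_set_le_sum) simp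
  also have "\<dots> < sum (\<lambda>i::'n. \<rho>) UNIV"
    by (rule sum_strict_mono) (use * in auto)
  also have "\<dots> \<le> \<epsilon>" using assms by (simp add: mult.commute)
  finally show "\<xi> \<in> ball m \<epsilon>" by (simp add: dist_norm norm_minus_commute)
qed

text \<open>Cauchy's inequality wants continuity up to the circle, so it is applied for radii
  \<open>r < \<rho>\<close> and \<open>r\<close> then tends to \<open>\<rho>\<close>.\<close>

lemma Taylor_coefficient_bound:
  assumes hol: "g holomorphic_on ball c \<rho>" and \<rho>: "\<rho> > 0"
    and bd: "\<And>\<zeta>. \<zeta> \<in> ball c \<rho> \<Longrightarrow> norm (g \<zeta>) \<le> S"
  shows "norm ((deriv ^^ k) g c / fact k) \<le> S / \<rho> ^ k"
proof -
  let ?a = "norm ((deriv ^^ k) g c / fact k)"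
  have "?a * r ^ k \<le> S" if r: "0 < r" "r < \<rho>" for r
  proof -
    have sub: "cball c r \<subseteq> ball c \<rho>" using r by auto
    have "norm ((deriv ^^ k) g c) \<le> fact k * S / r ^ k"
      using sub r
      by (intro Cauchy_inequality holomorphic_on_subset[OF hol]
          continuous_on_subset[OF holomorphic_on_imp_continuous_on[OF hol]] bd)
        (auto simp: dist_norm)
    then show ?thesis using r by (simp add: norm_divide field_simps)
  qed
  then have "\<forall>\<^sub>F r in at_left \<rho>. ?a * r ^ k \<le> S"
    using eventually_at_left_real[OF \<rho>] by (auto elim!: eventually_mono)
  moreover have "((\<lambda>r. ?a * r ^ k) \<longlongrightarrow> ?a * \<rho> ^ k) (at_left \<rho>)"
    by (intro tendsto_intros)
  ultimately have "?a * \<rho> ^ k \<le> S" using tendsto_upperbound trivial_limit_at_left_real by blast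
  then show ?thesis using \<rho> by (simp add: field_simps)
qed

text \<open>A multi-index supported in \<open>insert i I\<close> is an exponent of \<open>i\<close>
  together with a multi-index supported in \<open>I\<close>. Both inductions on the set of
  coordinates reindex along this bijection.\<close>

lemma bij_betw_index_insert:
  assumes "i \<notin> I"
  shows "bij_betw (\<lambda>(k, \<alpha>). \<alpha>(i := k)) (UNIV \<times> {\<alpha>. \<forall>j. j \<notin> I \<longrightarrow> \<alpha> j = (0::nat)})
    {\<alpha>. \<forall>j. j \<notin> insert i I \<longrightarrow> \<alpha> j = 0}"
  by (rule bij_betwI[where g = "\<lambda>\<alpha>. (\<alpha> i, \<alpha>(i := 0))"]) (use assms in \<open>auto simp: fun_eq_iff\<close>)

lemma summable_on_multi_geometric:
  fixes t :: "'n \<Rightarrow> real"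
  assumes "finite I" "\<And>i. i \<in> I \<Longrightarrow> 0 \<le> t i \<and> t i < 1"
  shows "(\<lambda>\<alpha>. \<Prod>i\<in>I. t i ^ \<alpha> i) summable_on {\<alpha>. \<forall>j. j \<notin> I \<longrightarrow> \<alpha> j = (0::nat)}"
  using assms
proof (induction I rule: finite_induct)
  case empty
  have "{\<alpha>. \<forall>j. \<alpha> j = (0::nat)} = {\<lambda>_::'n. 0}" by auto
  then show ?case by simp
next
  case (insert i I)
  let ?A = "{\<alpha>. \<forall>j. j \<notin> I \<longrightarrow> \<alpha> j = (0::nat)}"
  let ?f = "\<lambda>\<alpha>. \<Prod>i\<in>I. t i ^ \<alpha> i"
  have IH: "?f summable_on ?A" using insert by auto
  have "(\<lambda>(k, \<alpha>). t i ^ k * ?f \<alpha>) summable_on (UNIV \<times> ?A)"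
  proof (rule summable_on_SigmaI)
    show "((\<lambda>\<alpha>. case (k, \<alpha>) of (k, \<alpha>) \<Rightarrow> t i ^ k * ?f \<alpha>) has_sum t i ^ k * infsum ?f ?A) ?A" for k
      using has_sum_cmult_right[OF has_sum_infsum[OF IH], of "t i ^ k"] by simp
    have "summable (\<lambda>k. norm (t i ^ k))" using insert.prems[of i] by (simp add: summable_geometric)
    then have "(\<lambda>k. t i ^ k) summable_on UNIV" by (rule norm_summable_imp_summable_on)
    then show "(\<lambda>k. t i ^ k * infsum ?f ?A) summable_on UNIV"
      by (rule summable_on_cmult_left)
    show "0 \<le> (case (k, \<alpha>) of (k, \<alpha>) \<Rightarrow> t i ^ k * ?f \<alpha>)" for k \<alpha>
      using insert.prems by (auto intro!: mult_nonneg_nonneg prod_nonneg)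
  qed
  moreover have "(\<lambda>(k, \<alpha>). t i ^ k * ?f \<alpha>)
      = (\<lambda>p. (\<lambda>\<alpha>. \<Prod>j\<in>insert i I. t j ^ \<alpha> j) ((\<lambda>(k, \<alpha>). \<alpha>(i := k)) p))"
  proof (rule ext)
    fix p :: "nat \<times> ('n \<Rightarrow> nat)"
    obtain k \<alpha> where p: "p = (k, \<alpha>)" by (cases p)
    have "(\<Prod>j\<in>I. t j ^ (\<alpha>(i := k)) j) = ?f \<alpha>" using insert.hyps by (intro prod.cong) auto
    then show "(\<lambda>(k, \<alpha>). t i ^ k * ?f \<alpha>) p
      = (\<lambda>\<alpha>. \<Prod>j\<in>insert i I. t j ^ \<alpha> j) ((\<lambda>(k, \<alpha>). \<alpha>(i := k)) p)"
      using insert.hyps p by simp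
  qed
  ultimately have "(\<lambda>p. (\<lambda>\<alpha>. \<Prod>j\<in>insert i I. t j ^ \<alpha> j) ((\<lambda>(k, \<alpha>). \<alpha>(i := k)) p)) summable_on (UNIV \<times> ?A)"
    by (simp only:)
  then show ?case
    using summable_on_reindex_bij_betw[OF bij_betw_index_insert[OF insert.hyps(2)],
      of "\<lambda>\<alpha>. \<Prod>j\<in>insert i I. t j ^ \<alpha> j"] by blast
qed

definition partial_derivs :: "'n \<Rightarrow> nat \<Rightarrow> (complex ^ 'n \<Rightarrow> complex) \<Rightarrow> complex ^ 'n \<Rightarrow> complex" where
  "partial_derivs i k H = ((\<lambda>G \<xi>. frechet_derivative G (at \<xi>) (axis i 1)) ^^ k) H"

lemma holomorphic_partial_derivs:
  "open U \<Longrightarrow> holomorphic_fun_on U H \<Longrightarrow> holomorphic_fun_on U (partial_derivs i k H)"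
  by (induction k) (simp_all add: partial_derivs_def holomorphic_fun_on_directional_derivative)

text \<open>Exhibits the Taylor coefficients of a slice in coordinate \<open>i\<close> as
  holomorphic functions of all coordinates, so that they can be expanded further.\<close>

lemma deriv_slice:
  assumes hol: "holomorphic_fun_on (polydisc m \<rho>) H" and \<xi>: "\<xi> \<in> polydisc m \<rho>"
    and \<zeta>: "\<zeta> \<in> ball (m $ i) \<rho>"
  shows "(deriv ^^ k) (\<lambda>\<zeta>. H (vec_upd \<xi> i \<zeta>)) \<zeta> = partial_derivs i k H (vec_upd \<xi> i \<zeta>)"
  using \<zeta>
proof (induction k arbitrary: \<zeta>)
  case 0
  then show ?case by (simp add: partial_derivs_def)
next
  case (Suc k)
  have inP: "vec_upd \<xi> i \<zeta> \<in> polydisc m \<rho>"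
    using Suc.prems \<xi> by (simp add: polydisc_def vec_upd_nth dist_norm norm_minus_commute)
  have "((\<lambda>\<zeta>. vec_upd \<xi> i \<zeta> $ j) has_field_derivative (if j = i then 1 else 0)) (at \<zeta>)" for j
    by (auto simp: vec_upd_nth)
  from holomorphic_fun_on_compose_curve[OF holomorphic_partial_derivs[OF open_polydisc hol] inP this]
  have "((\<lambda>\<zeta>. partial_derivs i k H (vec_upd \<xi> i \<zeta>)) has_field_derivative
      partial_derivs i (Suc k) H (vec_upd \<xi> i \<zeta>)) (at \<zeta>)"
    by (simp add: partial_derivs_def axis_def)
  then have "((deriv ^^ k) (\<lambda>\<zeta>. H (vec_upd \<xi> i \<zeta>)) has_field_derivative
      partial_derivs i (Suc k) H (vec_upd \<xi> i \<zeta>)) (at \<zeta>)"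
    by (rule has_field_derivative_transform_within_open[OF _ open_ball Suc.prems])
      (simp add: Suc.IH)
  then show ?case by (simp add: DERIV_imp_deriv)
qed

lemma holomorphic_slice:
  assumes hol: "holomorphic_fun_on (polydisc m \<rho>) H" and \<xi>: "\<xi> \<in> polydisc m \<rho>"
  shows "(\<lambda>\<zeta>. H (vec_upd \<xi> i \<zeta>)) holomorphic_on ball (m $ i) \<rho>"
proof (rule holomorphic_fun_on_compose_curve_on[OF hol open_ball])
  show "vec_upd \<xi> i \<zeta> \<in> polydisc m \<rho>" if "\<zeta> \<in> ball (m $ i) \<rho>" for \<zeta>
    using that \<xi> by (simp add: polydisc_def vec_upd_nth dist_norm norm_minus_commute)
  show "(\<lambda>\<zeta>. vec_upd \<xi> i \<zeta> $ j) holomorphic_on ball (m $ i) \<rho>" for j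
    by (cases "j = i") (simp_all add: vec_upd_nth)
qed

text \<open>Induction on the set \<open>I\<close> of coordinates that are expanded, the others being
  held at the centre. The one-variable Taylor coefficients \<open>Hk k\<close> in a new coordinate
  are holomorphic on the same polydisc and bounded by \<open>S / \<rho> ^ k\<close>, so the
  induction hypothesis expands them in turn. The resulting bounds are dominated by a multiple
  geometric series, which justifies rearranging the double sum.\<close>

lemma power_series_expansion_coordinates:
  fixes m :: "complex ^ 'n"
  assumes "finite I" and \<rho>: "\<rho> > 0"
    and "holomorphic_fun_on (polydisc m \<rho>) H" "\<And>\<xi>. \<xi> \<in> polydisc m \<rho> \<Longrightarrow> norm (H \<xi>) \<le> S"
  shows "\<exists>b. (\<forall>\<alpha>. norm (b \<alpha>) \<le> S / \<rho> ^ (\<Sum>i\<in>I. \<alpha> i)) \<and>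
    (\<forall>\<xi>\<in>polydisc m \<rho>. (\<forall>j. j \<notin> I \<longrightarrow> \<xi> $ j = m $ j) \<longrightarrow>
      ((\<lambda>\<alpha>. b \<alpha> * (\<Prod>i\<in>I. (\<xi> $ i - m $ i) ^ \<alpha> i)) has_sum H \<xi>) {\<alpha>. \<forall>j. j \<notin> I \<longrightarrow> \<alpha> j = (0::nat)})"
  using assms(1,3,4)
proof (induction I arbitrary: H S rule: finite_induct)
  case empty
  have "m \<in> polydisc m \<rho>" using \<rho> by (simp add: polydisc_def)
  then have "norm (H m) \<le> S" using empty by blast
  moreover have "((\<lambda>\<alpha>. H m * (\<Prod>i\<in>{}. (\<xi> $ i - m $ i) ^ \<alpha> i)) has_sum H \<xi>)
      {\<alpha>. \<forall>j. j \<notin> {} \<longrightarrow> \<alpha> j = (0::nat)}" if "\<forall>j. j \<notin> {} \<longrightarrow> \<xi> $ j = m $ j" for \<xi>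
  proof -
    have "H \<xi> = H m" using that by (simp flip: vec_eq_iff)
    moreover have "{\<alpha>. \<forall>j. j \<notin> {} \<longrightarrow> \<alpha> j = (0::nat)} = {\<lambda>_::'n. 0}" by auto
    ultimately show ?thesis using has_sum_finite[of "{\<lambda>_::'n. 0::nat}" "\<lambda>_. H m"] by simp
  qed
  ultimately show ?case by (intro exI[of _ "\<lambda>_. H m"]) simp
next
  case (insert i I)
  let ?P = "polydisc m \<rho>" and ?A = "{\<alpha>. \<forall>j. j \<notin> I \<longrightarrow> \<alpha> j = (0::nat)}"
  \<comment> \<open>Freezing coordinate \<open>i\<close> at the centre gives coefficient functions
    on the whole polydisc that no longer depend on it.\<close>
  define c where "c \<xi> = vec_upd \<xi> i (m $ i)" for \<xi>
  have cP: "c \<xi> \<in> ?P" if "\<xi> \<in> ?P" for \<xi>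
    using that \<rho> by (simp add: c_def polydisc_def vec_upd_nth)
  define Hk where "Hk k \<xi> = partial_derivs i k H (c \<xi>) / fact k" for k \<xi>
  have Hk_deriv: "Hk k \<xi> = (deriv ^^ k) (\<lambda>\<zeta>. H (vec_upd \<xi> i \<zeta>)) (m $ i) / fact k" if "\<xi> \<in> ?P" for k \<xi>
    using deriv_slice[OF insert.prems(1) that, of "m $ i"] \<rho> by (simp add: Hk_def c_def)
  have slice_bd: "norm (H (vec_upd \<xi> i \<zeta>)) \<le> S" if "\<xi> \<in> ?P" "\<zeta> \<in> ball (m $ i) \<rho>" for \<xi> \<zeta>
    using that by (intro insert.prems(2)) (simp add: polydisc_def vec_upd_nth dist_norm norm_minus_commute)
  have hol: "holomorphic_fun_on ?P (Hk k)" for k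
  proof -
    have "holomorphic_fun_on ?P (\<lambda>\<xi>. c \<xi> $ j)" for j
      by (cases "j = i") (simp_all add: c_def vec_upd_nth holomorphic_fun_intros)
    then have "holomorphic_map_on ?P c" by (simp add: holomorphic_map_on_def)
    then have "holomorphic_fun_on ?P (\<lambda>\<xi>. partial_derivs i k H (c \<xi>))"
      by (rule holomorphic_fun_on_compose[OF _ holomorphic_partial_derivs[OF open_polydisc insert.prems(1)]])
        (use cP in blast)
    then have "holomorphic_fun_on ?P (\<lambda>\<xi>. partial_derivs i k H (c \<xi>) * (1 / fact k))"
      by (intro holomorphic_fun_intros)
    then show ?thesis by (simp add: Hk_def[abs_def])
  qed
  have bd: "norm (Hk k \<xi>) \<le> S / \<rho> ^ k" if "\<xi> \<in> ?P" for k \<xi>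
    unfolding Hk_deriv[OF that]
    by (rule Taylor_coefficient_bound[OF holomorphic_slice[OF insert.prems(1) that] \<rho> slice_bd[OF that]])
  define good where "good k b \<longleftrightarrow> (\<forall>\<alpha>. norm (b \<alpha>) \<le> S / \<rho> ^ k / \<rho> ^ (\<Sum>i\<in>I. \<alpha> i)) \<and>
    (\<forall>\<xi>\<in>?P. (\<forall>j. j \<notin> I \<longrightarrow> \<xi> $ j = m $ j) \<longrightarrow>
      ((\<lambda>\<alpha>. b \<alpha> * (\<Prod>i\<in>I. (\<xi> $ i - m $ i) ^ \<alpha> i)) has_sum Hk k \<xi>) ?A)" for k b
  have "\<exists>b. good k b" for k unfolding good_def by (rule insert.IH[OF hol bd])
  then obtain b where b': "\<And>k. good k (b k)" by metis
  have b_bd: "norm (b k \<alpha>) \<le> S / \<rho> ^ k / \<rho> ^ (\<Sum>i\<in>I. \<alpha> i)" for k \<alpha>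
    by (rule b'[unfolded good_def, THEN conjunct1, THEN spec])
  have b_sum: "((\<lambda>\<alpha>. b k \<alpha> * (\<Prod>i\<in>I. (\<xi> $ i - m $ i) ^ \<alpha> i)) has_sum Hk k \<xi>) ?A"
    if "\<xi> \<in> ?P" "\<forall>j. j \<notin> I \<longrightarrow> \<xi> $ j = m $ j" for k \<xi>
    by (rule b'[unfolded good_def, THEN conjunct2, THEN bspec, THEN mp, OF that])
  define b' where "b' \<alpha> = b (\<alpha> i) (\<alpha>(i := 0))" for \<alpha>
  have "m \<in> ?P" using \<rho> by (simp add: polydisc_def)
  from order_trans[OF norm_ge_zero insert.prems(2)[OF this]] have S0: "S \<ge> 0" .
  have b'_bd: "norm (b' \<alpha>) \<le> S / \<rho> ^ (\<Sum>i\<in>insert i I. \<alpha> i)" for \<alpha>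
  proof -
    have "(\<Sum>j\<in>I. (\<alpha>(i := 0)) j) = (\<Sum>j\<in>I. \<alpha> j)" using insert.hyps by (intro sum.cong) auto
    then show ?thesis using b_bd[of "\<alpha> i" "\<alpha>(i := 0)"] insert.hyps
      by (simp add: b'_def power_add)
  qed
  moreover have "((\<lambda>\<alpha>. b' \<alpha> * (\<Prod>i\<in>insert i I. (\<xi> $ i - m $ i) ^ \<alpha> i)) has_sum H \<xi>)
      {\<alpha>. \<forall>j. j \<notin> insert i I \<longrightarrow> \<alpha> j = (0::nat)}"
    if \<xi>: "\<xi> \<in> ?P" and off: "\<forall>j. j \<notin> insert i I \<longrightarrow> \<xi> $ j = m $ j" for \<xi>
  proof -
    let ?g = "\<lambda>\<alpha>. b' \<alpha> * (\<Prod>i\<in>insert i I. (\<xi> $ i - m $ i) ^ \<alpha> i)"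
    let ?e = "\<lambda>(k, \<alpha>). \<alpha>(i := k)"
    let ?f = "\<lambda>(k, \<alpha>). b k \<alpha> * (\<Prod>i\<in>I. (\<xi> $ i - m $ i) ^ \<alpha> i) * (\<xi> $ i - m $ i) ^ k"
    have fg: "?f p = ?g (?e p)" if "p \<in> UNIV \<times> ?A" for p
    proof (cases p)
      case (Pair k \<alpha>)
      have "\<alpha> i = 0" using that Pair insert.hyps by auto
      then have "\<alpha>(i := 0) = \<alpha>" by auto
      moreover have "(\<Prod>j\<in>I. (\<xi> $ j - m $ j) ^ (\<alpha>(i := k)) j) = (\<Prod>j\<in>I. (\<xi> $ j - m $ j) ^ \<alpha> j)"
        using insert.hyps by (intro prod.cong) auto
      ultimately show ?thesis using insert.hyps Pair by (simp add: b'_def)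
    qed
    define t where "t j = norm (\<xi> $ j - m $ j) / \<rho>" for j
    have t: "0 \<le> t j" "t j < 1" for j using \<xi> \<rho> by (auto simp: t_def polydisc_def)
    have g_bd: "norm (?g \<alpha>) \<le> S * (\<Prod>j\<in>insert i I. t j ^ \<alpha> j)" for \<alpha>
    proof -
      have "norm (?g \<alpha>) \<le> S / \<rho> ^ (\<Sum>i\<in>insert i I. \<alpha> i) * (\<Prod>j\<in>insert i I. norm (\<xi> $ j - m $ j) ^ \<alpha> j)"
        unfolding norm_mult prod_norm[symmetric] norm_power
        by (intro mult_right_mono b'_bd) (simp add: prod_nonneg)
      also have "\<dots> = S * (\<Prod>j\<in>insert i I. t j ^ \<alpha> j)"
        by (simp add: t_def power_divide prod_dividef power_sum)
      finally show ?thesis .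
    qed
    have "(\<lambda>\<alpha>. S * (\<Prod>j\<in>insert i I. t j ^ \<alpha> j)) summable_on {\<alpha>. \<forall>j. j \<notin> insert i I \<longrightarrow> \<alpha> j = (0::nat)}"
      using t insert.hyps by (intro summable_on_cmult_right summable_on_multi_geometric) auto
    then have "(\<lambda>\<alpha>. norm (?g \<alpha>)) summable_on {\<alpha>. \<forall>j. j \<notin> insert i I \<longrightarrow> \<alpha> j = (0::nat)}"
      by (rule Infinite_Sum.abs_summable_on_comparison_test') (rule g_bd)
    then have "?g summable_on {\<alpha>. \<forall>j. j \<notin> insert i I \<longrightarrow> \<alpha> j = (0::nat)}"
      by (rule Infinite_Sum.abs_summable_summable)
    then have "(\<lambda>p. ?g (?e p)) summable_on (UNIV \<times> ?A)"
      using summable_on_reindex_bij_betw[OF bij_betw_index_insert[OF insert.hyps(2)], of ?g] by blast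
    then have summ: "?f summable_on (UNIV \<times> ?A)"
      using summable_on_cong[of "UNIV \<times> ?A" ?f "\<lambda>p. ?g (?e p)", OF fg] by blast
    \<comment> \<open>Since the family is summable over pairs, it may be summed by rows: row
      \<open>k\<close> gives the coefficient function \<open>Hk k\<close>, and the row sums form the
      Taylor series in coordinate \<open>i\<close>.\<close>
    have "(?f has_sum H \<xi>) (UNIV \<times> ?A)"
    proof (rule has_sum_SigmaI[OF _ _ summ])
      fix k :: nat
      have "\<forall>j. j \<notin> I \<longrightarrow> c \<xi> $ j = m $ j" using off by (auto simp: c_def vec_upd_nth)
      from b_sum[OF cP[OF \<xi>] this]
      have "((\<lambda>\<alpha>. b k \<alpha> * (\<Prod>i\<in>I. (c \<xi> $ i - m $ i) ^ \<alpha> i)) has_sum Hk k (c \<xi>)) ?A" .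
      moreover have "(\<Prod>j\<in>I. (c \<xi> $ j - m $ j) ^ \<alpha> j) = (\<Prod>j\<in>I. (\<xi> $ j - m $ j) ^ \<alpha> j)" for \<alpha>
        using insert.hyps by (intro prod.cong) (auto simp: c_def vec_upd_nth)
      moreover have "Hk k (c \<xi>) = Hk k \<xi>" by (simp add: Hk_def c_def vec_upd_def cong: if_cong)
      ultimately have "((\<lambda>\<alpha>. b k \<alpha> * (\<Prod>i\<in>I. (\<xi> $ i - m $ i) ^ \<alpha> i)) has_sum Hk k \<xi>) ?A" by simp
      from has_sum_cmult_left[OF this, of "(\<xi> $ i - m $ i) ^ k"]
      show "((\<lambda>\<alpha>. ?f (k, \<alpha>)) has_sum Hk k \<xi> * (\<xi> $ i - m $ i) ^ k) ?A" by simp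
    next
      have "\<xi> $ i \<in> ball (m $ i) \<rho>"
        using \<xi> by (simp add: polydisc_def dist_norm norm_minus_commute)
      from holomorphic_power_series[OF holomorphic_slice[OF insert.prems(1) \<xi>] this]
      have sums: "(\<lambda>k. Hk k \<xi> * (\<xi> $ i - m $ i) ^ k) sums H \<xi>"
        by (simp add: Hk_deriv[OF \<xi>] vec_upd_same)
      have "summable (\<lambda>k. norm (Hk k \<xi> * (\<xi> $ i - m $ i) ^ k))"
      proof (rule summable_comparison_test')
        show "summable (\<lambda>k. S * t i ^ k)" using t[of i] by (intro summable_mult summable_geometric) auto
        show "norm (norm (Hk k \<xi> * (\<xi> $ i - m $ i) ^ k)) \<le> S * t i ^ k" if "k \<ge> 0" for k
        proof -
          have "norm (Hk k \<xi>) * norm (\<xi> $ i - m $ i) ^ k \<le> S / \<rho> ^ k * norm (\<xi> $ i - m $ i) ^ k"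
            by (intro mult_right_mono bd[OF \<xi>]) simp
          then show ?thesis by (simp add: norm_mult norm_power t_def power_divide)
        qed
      qed
      from norm_summable_imp_has_sum[OF this sums]
      show "((\<lambda>k. Hk k \<xi> * (\<xi> $ i - m $ i) ^ k) has_sum H \<xi>) UNIV" .
    qed
    then have "((\<lambda>p. ?g (?e p)) has_sum H \<xi>) (UNIV \<times> ?A)"
      using has_sum_cong[of "UNIV \<times> ?A" ?f "\<lambda>p. ?g (?e p)", OF fg] by blast
    then show ?thesis
      using has_sum_reindex_bij_betw[OF bij_betw_index_insert[OF insert.hyps(2)], of ?g] by blast
  qed
  ultimately show ?case by blast
qed

lemma power_series_expansion:
  fixes m :: "complex ^ 'n"
  assumes "\<rho> > 0" "holomorphic_fun_on (polydisc m \<rho>) H" "\<forall>\<xi>\<in>polydisc m \<rho>. norm (H \<xi>) \<le> S"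
  shows "\<exists>b. (\<forall>\<alpha>. norm (b \<alpha>) \<le> S / \<rho> ^ (\<Sum>i\<in>UNIV. \<alpha> i)) \<and>
    (\<forall>\<xi>\<in>polydisc m \<rho>. ((\<lambda>\<alpha>. b \<alpha> * (\<Prod>i\<in>UNIV. (\<xi> $ i - m $ i) ^ \<alpha> i)) has_sum H \<xi>) UNIV)"
  using power_series_expansion_coordinates[of UNIV, OF finite assms(1,2)] assms(3) by simp

section \<open>Restriction of holomorphic functions to real points: analyticity and
  smoothness\<close>

lemma locally_bounded:
  assumes "open U" "holomorphic_fun_on U H" "x \<in> U"
  obtains \<epsilon> where "\<epsilon> > 0" "ball x \<epsilon> \<subseteq> U" "\<And>y. y \<in> ball x \<epsilon> \<Longrightarrow> norm (H y) \<le> norm (H x) + 1"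
proof -
  have "isCont H x"
    using holomorphic_fun_on_continuous[OF assms(2)] assms(1,3) by (simp add: continuous_on_eq_continuous_at)
  then obtain d1 where d1: "d1 > 0" "\<And>y. dist y x < d1 \<Longrightarrow> dist (H y) (H x) < 1"
    unfolding continuous_at_eps_delta by (meson zero_less_one)
  obtain d2 where d2: "d2 > 0" "ball x d2 \<subseteq> U" using assms open_contains_ball by blast
  show ?thesis
  proof
    show "min d1 d2 > 0" using d1 d2 by simp
    show "ball x (min d1 d2) \<subseteq> U" using d2 by auto
    show "norm (H y) \<le> norm (H x) + 1" if "y \<in> ball x (min d1 d2)" for y
    proof -
      have "dist (H y) (H x) < 1" using that by (intro d1) (auto simp: dist_commute)
      then show ?thesis using norm_triangle_sub[of "H y" "H x"] by (simp add: dist_norm)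
    qed
  qed
qed

lemma norm_complexify: "norm (complexify x) = norm x"
  by (simp add: norm_vec_def complexify_def)

lemma complexify_diff: "complexify (x - y) = complexify x - complexify y"
  by (simp add: complexify_def vec_eq_iff)

lemma dist_complexify: "dist (complexify x) (complexify y) = dist x y"
  by (simp add: dist_norm norm_complexify flip: complexify_diff)

lemma bounded_linear_complexify: "bounded_linear complexify"
  by (rule linear_conv_bounded_linear[THEN iffD1], rule linearI)
    (auto simp: complexify_def vec_eq_iff scaleR_conv_of_real[symmetric] scaleR_complex.simps complex_eq_iff)

lemma continuous_on_complexify: "continuous_on S complexify"
  using bounded_linear_complexify linear_continuous_on by blast

text \<open>At real points, with a real centre, the monomials are real, so the real parts of the
  complex coefficients are the coefficients of a real power series.\<close>

lemma real_analytic_Re_holomorphic: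
  assumes "open W" "holomorphic_fun_on W H" "complexify ` U \<subseteq> W"
  shows "real_analytic_fun_on U (\<lambda>x. Re (H (complexify x)))"
  unfolding real_analytic_fun_on_def
proof
  fix x0 :: "real ^ 'a" assume "x0 \<in> U"
  then have "complexify x0 \<in> W" using assms by blast
  from locally_bounded[OF assms(1,2) this] obtain \<epsilon> where \<epsilon>: "\<epsilon> > 0" "ball (complexify x0) \<epsilon> \<subseteq> W"
    "\<And>y. y \<in> ball (complexify x0) \<epsilon> \<Longrightarrow> norm (H y) \<le> norm (H (complexify x0)) + 1" by blast
  define \<rho> where "\<rho> = \<epsilon> / CARD('a)"
  have \<rho>: "\<rho> > 0" using \<epsilon> by (simp add: \<rho>_def)
  have sub: "polydisc (complexify x0) \<rho> \<subseteq> ball (complexify x0) \<epsilon>"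
    by (intro polydisc_subset_ball) (simp add: \<rho>_def)
  have hol: "holomorphic_fun_on (polydisc (complexify x0) \<rho>) H"
    using holomorphic_fun_on_subset[OF assms(2)] sub \<epsilon>(2) by blast
  have bd: "\<forall>y\<in>polydisc (complexify x0) \<rho>. norm (H y) \<le> norm (H (complexify x0)) + 1"
    using \<epsilon>(3) sub by blast
  from power_series_expansion[OF \<rho> hol bd] obtain b where b: "\<forall>\<xi>\<in>polydisc (complexify x0) \<rho>.
      ((\<lambda>\<alpha>. b \<alpha> * (\<Prod>i\<in>UNIV. (\<xi> $ i - complexify x0 $ i) ^ \<alpha> i)) has_sum H \<xi>) UNIV"
    by (elim exE conjE)
  show "\<exists>r>0. \<exists>b. \<forall>x\<in>ball x0 r. ((\<lambda>\<alpha>. b \<alpha> * (\<Prod>i\<in>UNIV. (x $ i - x0 $ i) ^ \<alpha> i)) has_sum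
      Re (H (complexify x))) UNIV"
  proof (intro exI conjI ballI)
    fix x assume x: "x \<in> ball x0 \<rho>"
    have "complexify x \<in> polydisc (complexify x0) \<rho>"
      unfolding polydisc_def
    proof (clarify)
      fix i
      have "norm (complexify x $ i - complexify x0 $ i) \<le> norm (complexify x - complexify x0)"
        using Finite_Cartesian_Product.norm_nth_le[of "complexify x - complexify x0" i] by simp
      also have "\<dots> < \<rho>" using x by (simp add: dist_norm norm_minus_commute norm_complexify flip: complexify_diff)
      finally show "norm (complexify x $ i - complexify x0 $ i) < \<rho>" .
    qed
    from has_sum_Re[OF bspec[OF b this]]
    have "((\<lambda>\<alpha>. Re (b \<alpha> * (\<Prod>i\<in>UNIV. (complexify x $ i - complexify x0 $ i) ^ \<alpha> i))) has_sum Re (H (complexify x))) UNIV" .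
    moreover have "Re (b \<alpha> * (\<Prod>i\<in>UNIV. (complexify x $ i - complexify x0 $ i) ^ \<alpha> i))
        = Re (b \<alpha>) * (\<Prod>i\<in>UNIV. (x $ i - x0 $ i) ^ \<alpha> i)" for \<alpha>
    proof -
      have "(\<Prod>i\<in>UNIV. (complexify x $ i - complexify x0 $ i) ^ \<alpha> i) = complex_of_real (\<Prod>i\<in>UNIV. (x $ i - x0 $ i) ^ \<alpha> i)"
        by (simp add: complexify_def)
      then show ?thesis by (simp del: of_real_prod)
    qed
    ultimately show "((\<lambda>\<alpha>. Re (b \<alpha>) * (\<Prod>i\<in>UNIV. (x $ i - x0 $ i) ^ \<alpha> i)) has_sum Re (H (complexify x))) UNIV"
      by simp
  qed (rule \<rho>)
qed

lemma Ck_on_cong: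
  assumes "open U" "\<And>x. x \<in> U \<Longrightarrow> f x = g x" "Ck_on k U f"
  shows "Ck_on k U g"
  using assms(2,3)
proof (induction k arbitrary: f g)
  case 0
  then show ?case using continuous_on_cong by fastforce
next
  case (Suc k)
  have d: "(g has_derivative frechet_derivative f (at x)) (at x)" if x: "x \<in> U" for x
  proof (rule has_derivative_transform_within_open[OF _ assms(1) x Suc.prems(1)])
    show "(f has_derivative frechet_derivative f (at x)) (at x)"
      using Suc.prems(2) x frechet_derivative_works by auto
  qed
  show ?case unfolding Ck_on.simps
  proof (intro conjI ballI allI)
    show "g differentiable at x" if "x \<in> U" for x using d[OF that] differentiableI by blast
    show "Ck_on k U (\<lambda>x. frechet_derivative g (at x) v)" for v
    proof (rule Suc.IH)
      show "Ck_on k U (\<lambda>x. frechet_derivative f (at x) v)" using Suc.prems(2) by simp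
      show "frechet_derivative f (at x) v = frechet_derivative g (at x) v" if "x \<in> U" for x
        using frechet_derivative_at[OF d[OF that]] by simp
    qed
  qed
qed

lemma has_derivative_Re_complexify:
  assumes "holomorphic_fun_on W H" "complexify x \<in> W"
  shows "((\<lambda>x. Re (H (complexify x))) has_derivative
    (\<lambda>v. Re (frechet_derivative H (at (complexify x)) (complexify v)))) (at x)"
proof -
  have "(complexify has_derivative complexify) (at x)"
    using bounded_linear_imp_has_derivative[OF bounded_linear_complexify] .
  from diff_chain_at[OF this holomorphic_fun_on_has_derivative[OF assms]]
  have "((\<lambda>x. H (complexify x)) has_derivative (\<lambda>v. frechet_derivative H (at (complexify x)) (complexify v))) (at x)"
    by (simp add: o_def)
  from bounded_linear.has_derivative[OF bounded_linear_Re this] show ?thesis .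
qed

text \<open>A directional derivative is again the real part of a holomorphic function, so the
  induction on the order reproduces its own hypothesis.\<close>

lemma smooth_on_Re_holomorphic:
  assumes "open W" "holomorphic_fun_on W H" "open U" "complexify ` U \<subseteq> W"
  shows "smooth_on U (\<lambda>x. Re (H (complexify x)))"
  unfolding smooth_on_def
proof
  fix k
  show "Ck_on k U (\<lambda>x. Re (H (complexify x)))"
    using assms(2)
  proof (induction k arbitrary: H)
    case 0
    have "continuous_on U (\<lambda>x. H (complexify x))"
      by (rule continuous_on_compose2[OF holomorphic_fun_on_continuous[OF 0] continuous_on_complexify assms(4)])
    then show ?case by (auto intro: continuous_intros)
  next
    case (Suc k)
    have d: "((\<lambda>x. Re (H (complexify x))) has_derivative
      (\<lambda>v. Re (frechet_derivative H (at (complexify x)) (complexify v)))) (at x)" if "x \<in> U" for x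
      using that assms(4) by (intro has_derivative_Re_complexify[OF Suc.prems]) auto
    show ?case unfolding Ck_on.simps
    proof (intro conjI ballI allI)
      show "(\<lambda>x. Re (H (complexify x))) differentiable at x" if "x \<in> U" for x
        using d[OF that] differentiableI by blast
      fix v
      have "Ck_on k U (\<lambda>x. Re (frechet_derivative H (at (complexify x)) (complexify v)))"
        by (rule Suc.IH[OF holomorphic_fun_on_directional_derivative[OF assms(1) Suc.prems]])
      then show "Ck_on k U (\<lambda>x. frechet_derivative (\<lambda>x. Re (H (complexify x))) (at x) v)"
        by (rule Ck_on_cong[OF assms(3), rotated])
          (simp flip: frechet_derivative_at[OF d])
    qed
  qed
qed

subsection \<open>Iterated derivatives along vector fields\<close>

definition iter_deriv ::
  "(nat \<Rightarrow> complex ^ 'n \<Rightarrow> complex ^ 'n) \<Rightarrow> nat list \<Rightarrow> (complex ^ 'n \<Rightarrow> complex) \<Rightarrow> complex ^ 'n \<Rightarrow> complex" where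
  "iter_deriv Y = foldr (\<lambda>j F \<xi>. frechet_derivative F (at \<xi>) (Y j \<xi>))"

lemma iter_deriv_simps:
  "iter_deriv Y [] F = F"
  "iter_deriv Y (j # w) F \<xi> = frechet_derivative (iter_deriv Y w F) (at \<xi>) (Y j \<xi>)"
  by (simp_all add: iter_deriv_def)

lemma iter_deriv_append: "iter_deriv Y (u @ v) F = iter_deriv Y u (iter_deriv Y v F)"
  by (simp add: iter_deriv_def)

lemma holomorphic_iter_deriv:
  assumes "open U" "\<And>j. j \<in> set w \<Longrightarrow> holomorphic_map_on U (Y j)" "holomorphic_fun_on U F"
  shows "holomorphic_fun_on U (iter_deriv Y w F)"
  using assms(2)
proof (induction w)
  case Nil
  then show ?case by (simp add: iter_deriv_simps assms)
next
  case (Cons j w)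
  have "iter_deriv Y (j # w) F = (\<lambda>\<xi>. frechet_derivative (iter_deriv Y w F) (at \<xi>) (Y j \<xi>))"
    by (simp add: iter_deriv_simps fun_eq_iff)
  then show ?case using Cons holomorphic_fun_on_vector_field_derivative[OF assms(1)] by simp
qed

text \<open>One term of the exponential series of \<open>p\<close>, all terms being
  nonnegative.\<close>

lemma power_self_le_exp_fact: "real p ^ p \<le> exp 1 ^ p * fact p"
proof -
  have "(\<Sum>n\<in>{p}. real p ^ n / fact n) \<le> exp (real p)"
    unfolding exp_def using summable_exp_generic[of "real p"]
    using sum_le_suminf[of "\<lambda>n. real p ^ n /\<^sub>R fact n" "{p}"]
    by (simp add: divide_inverse mult.commute)
  then show ?thesis by (simp add: field_simps flip: exp_of_nat_mult)
qed

text \<open>The margin \<open>h\<close> is first shrunk to \<open>r < h\<close>, which places the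
  closed ball inside a slightly larger open one; then \<open>r\<close> tends to \<open>h\<close>.
  The nested balls of the next estimate would otherwise lose a little in every step.\<close>

lemma Cauchy_directional_cball:
  assumes hol: "holomorphic_fun_on (ball m (s + h)) G"
    and bd: "\<And>y. y \<in> ball m (s + h) \<Longrightarrow> norm (G y) \<le> S"
    and x: "x \<in> cball m s" and h: "h > 0"
  shows "norm (frechet_derivative G (at x) v) \<le> S * norm v / h"
proof -
  let ?a = "norm (frechet_derivative G (at x) v)"
  have "?a * r \<le> S * norm v" if r: "0 < r" "r < h" for r
  proof -
    have "?a \<le> S * norm v / r"
    proof (rule Cauchy_directional[where s = "s + h - r"])
      show "x \<in> ball m (s + h - r)" using x r by auto
    qed (use hol bd r in auto)
    then show ?thesis using r by (simp add: field_simps)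
  qed
  then have "\<forall>\<^sub>F r in at_left h. ?a * r \<le> S * norm v"
    using eventually_at_left_real[OF h] by (auto elim!: eventually_mono)
  moreover have "((\<lambda>r. ?a * r) \<longlongrightarrow> ?a * h) (at_left h)"
    by (intro tendsto_intros)
  ultimately have "?a * h \<le> S * norm v" using tendsto_upperbound trivial_limit_at_left_real by blast
  then show ?thesis using h by (simp add: field_simps)
qed

text \<open>Cauchy's estimate on \<open>length w\<close> nested balls whose radii differ by \<open>h / length w\<close>.\<close>

lemma iter_deriv_bound:
  assumes Y: "\<And>j. j \<in> set w \<Longrightarrow> holomorphic_map_on (ball m (s + h)) (Y j)"
    "\<And>j y. j \<in> set w \<Longrightarrow> y \<in> ball m (s + h) \<Longrightarrow> norm (Y j y) \<le> B"
    and F: "holomorphic_fun_on (ball m (s + h)) F" "\<And>y. y \<in> ball m (s + h) \<Longrightarrow> norm (F y) \<le> S"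
    and h: "h > 0" and B: "B \<ge> 0" and S: "S \<ge> 0" and \<xi>: "\<xi> \<in> cball m s"
  shows "norm (iter_deriv Y w F \<xi>) \<le> S * (exp 1 * B / h) ^ length w * fact (length w)"
proof (cases "w = []")
  case True
  then show ?thesis using F \<xi> h by (simp add: iter_deriv_simps)
next
  case False
  define p where "p = length w"
  have p: "p > 0" using False by (simp add: p_def)
  define \<eta> where "\<eta> = h / real p"
  have \<eta>: "\<eta> > 0" using h p by (simp add: \<eta>_def)
  \<comment> \<open>Each derivative costs \<open>\<eta>\<close> of the radius. The separate
    condition \<open>y \<in> ball m (s + h)\<close> is for empty \<open>v\<close>, where the closed
    ball is larger than the domain of the bound on \<open>F\<close>.\<close>
  have nested: "norm (iter_deriv Y v F y) \<le> S * (B / \<eta>) ^ length v"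
    if "set v \<subseteq> set w" "y \<in> cball m (s + h - length v * \<eta>)" "y \<in> ball m (s + h)" for v y
    using that
  proof (induction v arbitrary: y)
    case Nil
    then show ?case using F by (simp add: iter_deriv_simps)
  next
    case (Cons j v)
    let ?r = "s + h - real (length (j # v)) * \<eta>"
    have r: "?r + \<eta> = s + h - real (length v) * \<eta>" by (simp add: algebra_simps)
    have sub: "ball m (?r + \<eta>) \<subseteq> ball m (s + h)" unfolding r using \<eta> by (intro subset_ball) simp
    have "norm (frechet_derivative (iter_deriv Y v F) (at y) (Y j y)) \<le> S * (B / \<eta>) ^ length v * norm (Y j y) / \<eta>"
    proof (rule Cauchy_directional_cball)
      show "holomorphic_fun_on (ball m (?r + \<eta>)) (iter_deriv Y v F)"
        using Cons.prems(1) by (intro holomorphic_iter_deriv open_ball holomorphic_fun_on_subset[OF F(1) sub]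
            holomorphic_map_on_subset[OF Y(1) sub]) auto
      show "norm (iter_deriv Y v F y') \<le> S * (B / \<eta>) ^ length v" if "y' \<in> ball m (?r + \<eta>)" for y'
        using that sub Cons.prems(1) unfolding r by (intro Cons.IH) auto
    qed (use Cons.prems \<eta> in auto)
    also have "\<dots> \<le> S * (B / \<eta>) ^ length v * B / \<eta>"
      using Y(2)[of j y] Cons.prems \<eta> B S by (intro divide_right_mono mult_left_mono) auto
    finally show ?case by (simp add: iter_deriv_simps mult_ac)
  qed
  have "s + h - length w * \<eta> = s" using p by (simp add: \<eta>_def p_def)
  with nested[of w \<xi>] \<xi> h have "norm (iter_deriv Y w F \<xi>) \<le> S * (B / \<eta>) ^ p"
    by (simp add: p_def)
  \<comment> \<open>The margins \<open>h / p\<close> produce the factor \<open>p ^ p\<close>, which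
    is then traded for \<open>exp 1 ^ p * fact p\<close>.\<close>
  also have "(B / \<eta>) ^ p = (B / h) ^ p * real p ^ p"
    using p h by (simp add: \<eta>_def power_divide power_mult_distrib)
  also have "S * ((B / h) ^ p * real p ^ p) \<le> S * ((B / h) ^ p * (exp 1 ^ p * fact p))"
    using S B h by (intro mult_left_mono power_self_le_exp_fact) auto
  finally show ?thesis by (simp add: p_def power_mult_distrib power_divide mult_ac)
qed

section \<open>Functions and vector fields on a submanifold\<close>

text \<open>A tangent vector is the velocity of a curve in \<open>S\<close>, and the chain rule
  along this curve determines either derivative on it. This makes the value of
  \<open>vf_apply\<close> independent of the derivative picked by
  \<open>frechet_derivative\<close>.\<close>

lemma tangent_derivative_unique:
  assumes D: "(F has_derivative D1) (at p within S)" "(F has_derivative D2) (at p within S)"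
    and v: "v \<in> tangent_space S p"
  shows "D1 v = D2 v"
proof -
  obtain \<gamma> where \<gamma>: "\<gamma> 0 = p" "\<And>t. \<gamma> t \<in> S" "(\<gamma> has_vector_derivative v) (at 0)"
    using v unfolding tangent_space_def by blast
  have "((F \<circ> \<gamma>) has_derivative D \<circ> (\<lambda>t. t *\<^sub>R v)) (at 0)"
    if "(F has_derivative D) (at p within S)" for D
  proof (rule diff_chain_within)
    show "(\<gamma> has_derivative (\<lambda>t. t *\<^sub>R v)) (at 0)"
      using \<gamma>(3) by (simp add: has_vector_derivative_def)
    show "(F has_derivative D) (at (\<gamma> 0) within range \<gamma>)"
      unfolding \<gamma>(1) by (rule has_derivative_subset[OF that]) (use \<gamma>(2) in blast)
  qed
  from has_derivative_unique[OF this[OF D(1)] this[OF D(2)]]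
  have "D1 (1 *\<^sub>R v) = D2 (1 *\<^sub>R v)" by (metis comp_apply)
  then show ?thesis by simp
qed

lemma vf_apply_eq:
  assumes "(F has_derivative D) (at p within S)" "X p \<in> tangent_space S p"
  shows "vf_apply S X F p = D (X p)"
proof -
  have "F differentiable (at p within S)" using assms(1) by (rule differentiableI)
  then show ?thesis unfolding vf_apply_def
    using tangent_derivative_unique[OF _ assms] frechet_derivative_works by blast
qed

lemma has_derivative_within_local_extension:
  assumes G: "(G has_derivative D) (at p)" and U: "open U" "p \<in> U" "p \<in> S"
    and eq: "\<And>x. x \<in> S \<inter> U \<Longrightarrow> G x = F x"
  shows "(F has_derivative D) (at p within S)"
proof -
  obtain d where "d > 0" "ball p d \<subseteq> U" using U openE by blast
  then show ?thesis
    by (intro has_derivative_transform_within[OF has_derivative_at_withinI[OF G] _ U(3)] eq)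
      (auto simp: dist_commute)
qed

text \<open>The bridge from calculus within \<open>S\<close> to calculus on open sets: any local
  holomorphic extension computes the derivative along a tangent field.\<close>

lemma vf_apply_local_extension:
  assumes hol: "holomorphic_fun_on U G" and U: "open U" "p \<in> U" "p \<in> S"
    and eq: "\<And>x. x \<in> S \<inter> U \<Longrightarrow> G x = F x" and v: "X p \<in> tangent_space S p"
  shows "vf_apply S X F p = frechet_derivative G (at p) (X p)"
  by (rule vf_apply_eq[where X = X, OF has_derivative_within_local_extension[OF holomorphic_fun_on_has_derivative[OF hol]] v])
    (use U eq in auto)

lemma holomorphic_functionsE:
  assumes "F \<in> holomorphic_functions S" "p \<in> S"
  obtains U G where "open U" "p \<in> U" "holomorphic_fun_on U G" "\<And>x. x \<in> S \<inter> U \<Longrightarrow> G x = F x"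
  using assms unfolding holomorphic_functions_def extends_locally_def by blast

lemma holomorphic_functionsI:
  assumes "\<And>p. p \<in> S \<Longrightarrow> \<exists>U G. open U \<and> p \<in> U \<and> holomorphic_fun_on U G \<and> (\<forall>x\<in>S \<inter> U. G x = F x)"
  shows "F \<in> holomorphic_functions S"
  using assms unfolding holomorphic_functions_def extends_locally_def by blast

lemma holomorphic_functions_entire:
  "holomorphic_fun_on UNIV F \<Longrightarrow> F \<in> holomorphic_functions S"
  by (rule holomorphic_functionsI) blast

lemma holomorphic_functions_binary:
  assumes F: "F1 \<in> holomorphic_functions S" "F2 \<in> holomorphic_functions S" and p: "p \<in> S"
  obtains U G1 G2 where "open U" "p \<in> U" "holomorphic_fun_on U G1" "holomorphic_fun_on U G2"
    "\<And>x. x \<in> S \<inter> U \<Longrightarrow> G1 x = F1 x" "\<And>x. x \<in> S \<inter> U \<Longrightarrow> G2 x = F2 x"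
proof -
  obtain U1 G1 where 1: "open U1" "p \<in> U1" "holomorphic_fun_on U1 G1" "\<And>x. x \<in> S \<inter> U1 \<Longrightarrow> G1 x = F1 x"
    using holomorphic_functionsE[OF F(1) p] by blast
  obtain U2 G2 where 2: "open U2" "p \<in> U2" "holomorphic_fun_on U2 G2" "\<And>x. x \<in> S \<inter> U2 \<Longrightarrow> G2 x = F2 x"
    using holomorphic_functionsE[OF F(2) p] by blast
  show ?thesis
  proof (rule that)
    show "open (U1 \<inter> U2)" "p \<in> U1 \<inter> U2" using 1 2 by auto
    show "holomorphic_fun_on (U1 \<inter> U2) G1" "holomorphic_fun_on (U1 \<inter> U2) G2"
      using 1 2 holomorphic_fun_on_subset by blast+
  qed (use 1 2 in auto)
qed

lemma holomorphic_functions_add: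
  assumes "F \<in> holomorphic_functions S" "G \<in> holomorphic_functions S"
  shows "(\<lambda>x. F x + G x) \<in> holomorphic_functions S"
proof (rule holomorphic_functionsI)
  fix p assume "p \<in> S"
  then obtain U f g where "open U" "p \<in> U" "holomorphic_fun_on U f" "holomorphic_fun_on U g"
    "\<And>x. x \<in> S \<inter> U \<Longrightarrow> f x = F x" "\<And>x. x \<in> S \<inter> U \<Longrightarrow> g x = G x"
    using holomorphic_functions_binary[OF assms] by metis
  then show "\<exists>U H. open U \<and> p \<in> U \<and> holomorphic_fun_on U H \<and> (\<forall>x\<in>S \<inter> U. H x = F x + G x)"
    by (intro exI[of _ U] exI[of _ "\<lambda>x. f x + g x"]) (auto intro: holomorphic_fun_on_add)
qed

lemma holomorphic_functions_mult:
  assumes "F \<in> holomorphic_functions S" "G \<in> holomorphic_functions S"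
  shows "(\<lambda>x. F x * G x) \<in> holomorphic_functions S"
proof (rule holomorphic_functionsI)
  fix p assume "p \<in> S"
  then obtain U f g where "open U" "p \<in> U" "holomorphic_fun_on U f" "holomorphic_fun_on U g"
    "\<And>x. x \<in> S \<inter> U \<Longrightarrow> f x = F x" "\<And>x. x \<in> S \<inter> U \<Longrightarrow> g x = G x"
    using holomorphic_functions_binary[OF assms] by metis
  then show "\<exists>U H. open U \<and> p \<in> U \<and> holomorphic_fun_on U H \<and> (\<forall>x\<in>S \<inter> U. H x = F x * G x)"
    by (intro exI[of _ U] exI[of _ "\<lambda>x. f x * g x"]) (auto intro: holomorphic_fun_on_mult)
qed

lemma holomorphic_functions_const: "(\<lambda>x. c) \<in> holomorphic_functions S"
  by (intro holomorphic_functions_entire holomorphic_fun_intros)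

lemma holomorphic_functions_coord: "(\<lambda>x. x $ i) \<in> holomorphic_functions S"
  by (intro holomorphic_functions_entire holomorphic_fun_intros)

lemma holomorphic_functions_scaleR:
  "F \<in> holomorphic_functions S \<Longrightarrow> (\<lambda>x. r *\<^sub>R F x) \<in> holomorphic_functions S"
  unfolding scaleR_conv_of_real by (intro holomorphic_functions_mult holomorphic_functions_const)

lemma holomorphic_functions_sum:
  "(\<And>i. i \<in> I \<Longrightarrow> F i \<in> holomorphic_functions S) \<Longrightarrow> (\<lambda>x. \<Sum>i\<in>I. F i x) \<in> holomorphic_functions S"
  by (induction I rule: infinite_finite_induct)
    (simp_all add: holomorphic_functions_const holomorphic_functions_add)

lemma vf_apply_cong:
  assumes "F \<in> holomorphic_functions S" "\<And>x. x \<in> S \<Longrightarrow> F x = G x" "p \<in> S" "X p \<in> tangent_space S p"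
  shows "vf_apply S X F p = vf_apply S X G p"
proof -
  obtain U f where U: "open U" "p \<in> U" "holomorphic_fun_on U f" "\<And>x. x \<in> S \<inter> U \<Longrightarrow> f x = F x"
    using holomorphic_functionsE[OF assms(1,3)] by metis
  have "vf_apply S X F p = frechet_derivative f (at p) (X p)"
    by (rule vf_apply_local_extension[where X = X, OF U(3,1,2) assms(3) U(4) assms(4)])
  moreover have "vf_apply S X G p = frechet_derivative f (at p) (X p)"
    by (rule vf_apply_local_extension[where X = X, OF U(3,1,2) assms(3) _ assms(4)]) (use U(4) assms(2) in auto)
  ultimately show ?thesis by simp
qed

lemma vf_apply_holomorphic:
  assumes F: "F \<in> holomorphic_functions S" and X: "holomorphic_vector_field S X"
  shows "vf_apply S X F \<in> holomorphic_functions S"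
proof (rule holomorphic_functionsI)
  fix p assume p: "p \<in> S"
  obtain U f where U: "open U" "p \<in> U" "holomorphic_fun_on U f" "\<And>x. x \<in> S \<inter> U \<Longrightarrow> f x = F x"
    using holomorphic_functionsE[OF F p] by metis
  obtain V Y where V: "open V" "p \<in> V" "holomorphic_map_on V Y" "\<And>x. x \<in> S \<inter> V \<Longrightarrow> Y x = X x"
    using X p unfolding holomorphic_vector_field_def extends_locally_def by metis
  show "\<exists>U H. open U \<and> p \<in> U \<and> holomorphic_fun_on U H \<and> (\<forall>x\<in>S \<inter> U. H x = vf_apply S X F x)"
  proof (intro exI conjI ballI)
    show "open (U \<inter> V)" "p \<in> U \<inter> V" using U V by auto
    show "holomorphic_fun_on (U \<inter> V) (\<lambda>x. frechet_derivative f (at x) (Y x))"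
      by (rule holomorphic_fun_on_vector_field_derivative)
        (use U V holomorphic_fun_on_subset holomorphic_map_on_subset in blast)+
    fix x assume x: "x \<in> S \<inter> (U \<inter> V)"
    have "vf_apply S X F x = frechet_derivative f (at x) (X x)"
    proof (rule vf_apply_local_extension[where X = X, OF U(3,1)])
      show "X x \<in> tangent_space S x" using X x unfolding holomorphic_vector_field_def by blast
    qed (use x U(4) in auto)
    then show "frechet_derivative f (at x) (Y x) = vf_apply S X F x" using V(4)[of x] x by auto
  qed
qed

lemma vf_apply_binary:
  assumes F: "F1 \<in> holomorphic_functions S" "F2 \<in> holomorphic_functions S" and p: "p \<in> S"
    and X: "X p \<in> tangent_space S p"
  shows vf_apply_add: "vf_apply S X (\<lambda>x. F1 x + F2 x) p = vf_apply S X F1 p + vf_apply S X F2 p"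
    and vf_apply_mult: "vf_apply S X (\<lambda>x. F1 x * F2 x) p
      = vf_apply S X F1 p * F2 p + F1 p * vf_apply S X F2 p"
proof -
  obtain U G1 G2 where U: "open U" "p \<in> U" "holomorphic_fun_on U G1" "holomorphic_fun_on U G2"
    and eq: "\<And>x. x \<in> S \<inter> U \<Longrightarrow> G1 x = F1 x" "\<And>x. x \<in> S \<inter> U \<Longrightarrow> G2 x = F2 x"
    using holomorphic_functions_binary[OF F p] by metis
  note D = U(3,4)[THEN holomorphic_fun_on_has_derivative, OF U(2)]
  have 1: "vf_apply S X F1 p = frechet_derivative G1 (at p) (X p)"
    "vf_apply S X F2 p = frechet_derivative G2 (at p) (X p)"
    by (rule vf_apply_local_extension[where X = X, OF U(3,1,2) p eq(1) X],
        assumption, rule vf_apply_local_extension[where X = X, OF U(4,1,2) p eq(2) X], assumption)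
  have "((\<lambda>x. F1 x + F2 x) has_derivative
      (\<lambda>v. frechet_derivative G1 (at p) v + frechet_derivative G2 (at p) v)) (at p within S)"
    by (rule has_derivative_within_local_extension[OF has_derivative_add[OF D] U(1,2) p]) (simp add: eq)
  from vf_apply_eq[where X = X, OF this X]
  show "vf_apply S X (\<lambda>x. F1 x + F2 x) p = vf_apply S X F1 p + vf_apply S X F2 p" by (simp add: 1)
  have "((\<lambda>x. F1 x * F2 x) has_derivative
      (\<lambda>v. G1 p * frechet_derivative G2 (at p) v + frechet_derivative G1 (at p) v * G2 p)) (at p within S)"
    by (rule has_derivative_within_local_extension[OF has_derivative_mult[OF D] U(1,2) p]) (simp add: eq)
  from vf_apply_eq[where X = X, OF this X]
  show "vf_apply S X (\<lambda>x. F1 x * F2 x) p = vf_apply S X F1 p * F2 p + F1 p * vf_apply S X F2 p"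
    using eq[of p] U(2) p by (simp add: 1 add.commute)
qed

lemma vf_apply_const:
  assumes "p \<in> S" "X p \<in> tangent_space S p"
  shows "vf_apply S X (\<lambda>x. c) p = 0"
proof -
  have "((\<lambda>x. c) has_derivative (\<lambda>v. 0)) (at p within S)" by simp
  from vf_apply_eq[where X = X, OF this assms(2)] show ?thesis .
qed

lemma vf_apply_cmult:
  assumes "F \<in> holomorphic_functions S" "p \<in> S" "X p \<in> tangent_space S p"
  shows "vf_apply S X (\<lambda>x. a * F x) p = a * vf_apply S X F p"
  using vf_apply_mult[where X = X, OF holomorphic_functions_const[of a] assms]
    vf_apply_const[where X = X and c = a and p = p and S = S] assms(2,3)
  by simp

lemma vf_apply_sum:
  assumes "\<And>i. i \<in> I \<Longrightarrow> F i \<in> holomorphic_functions S" "p \<in> S" "X p \<in> tangent_space S p"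
  shows "vf_apply S X (\<lambda>x. \<Sum>i\<in>I. F i x) p = (\<Sum>i\<in>I. vf_apply S X (F i) p)"
  using assms(1)
proof (induction I rule: infinite_finite_induct)
  case (insert i I)
  have "vf_apply S X (\<lambda>x. F i x + (\<Sum>i\<in>I. F i x)) p = vf_apply S X (F i) p + vf_apply S X (\<lambda>x. \<Sum>i\<in>I. F i x) p"
    using insert.prems
    by (intro vf_apply_add[where X = X, OF _ holomorphic_functions_sum assms(2,3)]) auto
  with insert show ?case by simp
qed (simp_all add: vf_apply_const[where X = X, OF assms(2,3)])

lemma vf_apply_field_add:
  assumes "F \<in> holomorphic_functions S" "p \<in> S"
    "X p \<in> tangent_space S p" "Y p \<in> tangent_space S p" "Z p \<in> tangent_space S p" "Z p = X p + Y p"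
  shows "vf_apply S Z F p = vf_apply S X F p + vf_apply S Y F p"
proof -
  obtain U f where U: "open U" "p \<in> U" "holomorphic_fun_on U f" "\<And>x. x \<in> S \<inter> U \<Longrightarrow> f x = F x"
    using holomorphic_functionsE[OF assms(1,2)] by metis
  note E = vf_apply_local_extension[OF U(3,1,2) assms(2) U(4)]
  interpret linear "frechet_derivative f (at p)"
    using holomorphic_fun_on_has_derivative[OF U(3,2)] has_derivative_linear by blast
  show ?thesis using E[of Z] E[of X] E[of Y] assms by (simp add: add)
qed

lemma vf_apply_field_scaleR:
  assumes "F \<in> holomorphic_functions S" "p \<in> S"
    "X p \<in> tangent_space S p" "Z p \<in> tangent_space S p" "Z p = c *\<^sub>R X p"
  shows "vf_apply S Z F p = c *\<^sub>R vf_apply S X F p"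
proof -
  obtain U f where U: "open U" "p \<in> U" "holomorphic_fun_on U f" "\<And>x. x \<in> S \<inter> U \<Longrightarrow> f x = F x"
    using holomorphic_functionsE[OF assms(1,2)] by metis
  note E = vf_apply_local_extension[OF U(3,1,2) assms(2) U(4)]
  interpret linear "frechet_derivative f (at p)"
    using holomorphic_fun_on_has_derivative[OF U(3,2)] has_derivative_linear by blast
  show ?thesis using E[of Z] E[of X] assms by (simp add: scaleR)
qed

lemma foldr_vf_apply_holomorphic:
  assumes "F \<in> holomorphic_functions S" "\<And>j. j \<in> set w \<Longrightarrow> holomorphic_vector_field S (X j)"
  shows "foldr (\<lambda>j. vf_apply S (X j)) w F \<in> holomorphic_functions S"
  using assms(2) by (induction w) (auto simp: assms(1) intro: vf_apply_holomorphic)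

lemma foldr_vf_apply_lincomb:
  assumes F: "\<And>k. k \<in> I \<Longrightarrow> F k \<in> holomorphic_functions S"
    and X: "\<And>j. j \<in> set w \<Longrightarrow> holomorphic_vector_field S (X j)" and \<xi>: "\<xi> \<in> S"
  shows "foldr (\<lambda>j. vf_apply S (X j)) w (\<lambda>x. \<Sum>k\<in>I. b k * F k x) \<xi>
    = (\<Sum>k\<in>I. b k * foldr (\<lambda>j. vf_apply S (X j)) w (F k) \<xi>)"
  using X \<xi>
proof (induction w arbitrary: \<xi>)
  case Nil
  then show ?case by simp
next
  case (Cons j w)
  let ?D = "foldr (\<lambda>j. vf_apply S (X j)) w"
  have j: "X j \<xi> \<in> tangent_space S \<xi>"
    using Cons.prems unfolding holomorphic_vector_field_def by simp
  have A: "?D (F k) \<in> holomorphic_functions S" if "k \<in> I" for k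
    using Cons.prems by (intro foldr_vf_apply_holomorphic F that) auto
  have A1: "(\<lambda>x. b k * ?D (F k) x) \<in> holomorphic_functions S" if "k \<in> I" for k
    by (intro holomorphic_functions_mult holomorphic_functions_const A that)
  have A2: "?D (\<lambda>x. \<Sum>k\<in>I. b k * F k x) \<in> holomorphic_functions S"
    using Cons.prems by (intro foldr_vf_apply_holomorphic holomorphic_functions_sum holomorphic_functions_mult
        holomorphic_functions_const F) auto
  have "vf_apply S (X j) (?D (\<lambda>x. \<Sum>k\<in>I. b k * F k x)) \<xi> = vf_apply S (X j) (\<lambda>x. \<Sum>k\<in>I. b k * ?D (F k) x) \<xi>"
    by (rule vf_apply_cong[where X = "X j", OF A2 _ Cons.prems(2) j]) (use Cons in auto)
  also have "\<dots> = (\<Sum>k\<in>I. vf_apply S (X j) (\<lambda>x. b k * ?D (F k) x) \<xi>)"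
    by (rule vf_apply_sum[where X = "X j", OF A1 Cons.prems(2) j])
  also have "\<dots> = (\<Sum>k\<in>I. b k * vf_apply S (X j) (?D (F k)) \<xi>)"
  proof (rule sum.cong[OF refl])
    fix k assume k: "k \<in> I"
    show "vf_apply S (X j) (\<lambda>x. b k * ?D (F k) x) \<xi> = b k * vf_apply S (X j) (?D (F k)) \<xi>"
      by (rule vf_apply_cmult[where X = "X j", OF A[OF k] Cons.prems(2) j])
  qed
  finally show ?case by simp
qed

lemma foldr_vf_apply_cong:
  assumes F: "F \<in> holomorphic_functions S" "\<And>x. x \<in> S \<Longrightarrow> F x = G x"
    and X: "\<And>j. j \<in> set w \<Longrightarrow> holomorphic_vector_field S (X j)" and \<xi>: "\<xi> \<in> S"
  shows "foldr (\<lambda>j. vf_apply S (X j)) w F \<xi> = foldr (\<lambda>j. vf_apply S (X j)) w G \<xi>"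
  using X \<xi>
proof (induction w arbitrary: \<xi>)
  case Nil
  then show ?case using F by simp
next
  case (Cons j w)
  have "X j \<xi> \<in> tangent_space S \<xi>"
    using Cons.prems unfolding holomorphic_vector_field_def by simp
  then show ?case using Cons
    by (auto intro!: vf_apply_cong[where X = "X j"] foldr_vf_apply_holomorphic F(1))
qed

subsection \<open>Local charts\<close>

lemma holomorphic_map_on_complex_linear:
  fixes g :: "complex ^ 'n \<Rightarrow> complex ^ 'm"
  assumes "Vector_Spaces.linear (*s) (*s) g"
  shows "holomorphic_map_on U g"
  unfolding holomorphic_map_on_def holomorphic_fun_on_def
proof (intro allI ballI exI conjI)
  interpret Vector_Spaces.linear "(*s)" "(*s)" g by (rule assms)
  fix i x
  have "linear (\<lambda>x. g x $ i)"
    by (rule linearI) (simp_all add: add scaleR_cvec scale scaleR_conv_of_real)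
  then show "((\<lambda>x. g x $ i) has_derivative (\<lambda>x. g x $ i)) (at x)"
    using linear_conv_bounded_linear bounded_linear_imp_has_derivative by blast
  show "g (c *s v) $ i = c * g v $ i" for c v by (simp add: scale)
qed

text \<open>In a flattening chart, project linearly onto the complex subspace \<open>L\<close> and
  map back. The neighbourhood is cut down to the points whose projection stays in the range of the
  chart; such projections lie in \<open>V \<inter> L\<close>, which corresponds to points of
  \<open>S\<close>.\<close>

lemma holomorphic_retraction:
  fixes S :: "(complex ^ 'n) set"
  assumes "complex_submanifold S" "p \<in> S"
  obtains U r where "open U" "p \<in> U" "holomorphic_map_on U r" "r ` U \<subseteq> S" "\<And>x. x \<in> S \<inter> U \<Longrightarrow> r x = x"
proof -
  obtain U V L and \<phi> \<psi> :: "complex ^ 'n \<Rightarrow> complex ^ 'n" where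
    U: "open U" "open V" "p \<in> U" "homeomorphism U V \<phi> \<psi>"
    "holomorphic_map_on U \<phi>" "holomorphic_map_on V \<psi>" "vec.subspace L" "\<phi> ` (S \<inter> U) = V \<inter> L"
    using assms unfolding complex_submanifold_def by metis
  obtain \<pi> where \<pi>: "range \<pi> \<subseteq> L" "Vector_Spaces.linear (*s) (*s) \<pi>" "\<And>v. v \<in> L \<Longrightarrow> \<pi> v = v"
    using vec.linear_exists_left_inverse_on[OF vec.linear_ident U(7)] by auto
  have inv: "\<psi> (\<phi> x) = x" if "x \<in> U" for x using U(4) that by (simp add: homeomorphism_def)
  have \<phi>L: "\<phi> x \<in> V \<inter> L" if "x \<in> S \<inter> U" for x using U(8) that by blast
  define W where "W = U \<inter> (\<lambda>x. \<pi> (\<phi> x)) -` V"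
  have hol: "holomorphic_map_on U (\<lambda>x. \<pi> (\<phi> x))"
    by (rule holomorphic_map_on_compose[OF U(5) holomorphic_map_on_complex_linear[OF \<pi>(2), of UNIV]]) simp
  have W: "open W"
    unfolding W_def by (rule continuous_open_preimage[OF holomorphic_map_on_continuous[OF hol] U(1,2)])
  show ?thesis
  proof (rule that[OF W])
    show "p \<in> W" using U(3) assms(2) \<phi>L[of p] \<pi>(3)[of "\<phi> p"] by (simp add: W_def)
    show "holomorphic_map_on W (\<lambda>x. \<psi> (\<pi> (\<phi> x)))"
      by (rule holomorphic_map_on_compose[OF holomorphic_map_on_subset[OF hol] U(6)]) (auto simp: W_def)
    show "(\<lambda>x. \<psi> (\<pi> (\<phi> x))) ` W \<subseteq> S"
    proof (rule image_subsetI)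
      fix x assume x: "x \<in> W"
      have "\<pi> (\<phi> x) \<in> V \<inter> L" using x \<pi>(1) by (auto simp: W_def)
      then obtain y where "y \<in> S \<inter> U" "\<phi> y = \<pi> (\<phi> x)" using U(8) by (metis imageE)
      then show "\<psi> (\<pi> (\<phi> x)) \<in> S" using inv[of y] by auto
    qed
    show "\<psi> (\<pi> (\<phi> x)) = x" if "x \<in> S \<inter> W" for x
      using that \<phi>L[of x] \<pi>(3)[of "\<phi> x"] inv[of x] by (auto simp: W_def)
  qed
qed

section \<open>Finitely many tangent holomorphic fields and uniform charts along the compact set
  \<open>M\<close>\<close>

locale analytic_vector_fields =
  fixes S :: "(complex ^ 'N) set" and M :: "(real ^ 'N) set"
    and n :: nat and X :: "nat \<Rightarrow> complex ^ 'N \<Rightarrow> complex ^ 'N"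
  assumes submanifold: "complex_submanifold S"
    and M_eq: "M = real_points S"
    and compact_M: "compact M"
    and X_field: "\<And>j. j < n \<Longrightarrow> holomorphic_vector_field S (X j)"
    and X_real: "\<And>j. j < n \<Longrightarrow> real_on M (X j)"
begin

lemma M_S: "m \<in> M \<Longrightarrow> complexify m \<in> S"
  by (simp add: M_eq real_points_def)

lemma X_tangent: "j < n \<Longrightarrow> p \<in> S \<Longrightarrow> X j p \<in> tangent_space S p"
  using X_field unfolding holomorphic_vector_field_def by blast

text \<open>The retraction \<open>r\<close> extends functions off \<open>S\<close> by composition,
  and \<open>Y\<close> extends the fields. Both live on a full ball of the ambient space, where
  Cauchy's estimates apply.\<close>

definition chart :: "real \<Rightarrow> real \<Rightarrow> complex ^ 'N \<Rightarrow> (complex ^ 'N \<Rightarrow> complex ^ 'N) \<Rightarrow>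
    (nat \<Rightarrow> complex ^ 'N \<Rightarrow> complex ^ 'N) \<Rightarrow> bool" where
  "chart \<delta> B p r Y \<longleftrightarrow>
    holomorphic_map_on (ball p \<delta>) r \<and> r ` ball p \<delta> \<subseteq> S \<and> (\<forall>x\<in>S \<inter> ball p \<delta>. r x = x) \<and>
    (\<forall>j<n. holomorphic_map_on (ball p \<delta>) (Y j) \<and>
      (\<forall>x\<in>ball p \<delta>. norm (Y j x) \<le> B) \<and> (\<forall>x\<in>S \<inter> ball p \<delta>. Y j x = X j x))"

lemma chart_mono:
  assumes "chart \<delta> B p r Y" "ball q \<delta>' \<subseteq> ball p \<delta>" "B \<le> B'"
  shows "chart \<delta>' B' q r Y"
proof -
  have "norm (Y j x) \<le> B'" if "j < n" "x \<in> ball q \<delta>'" for j x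
    using assms that unfolding chart_def by (meson order_trans subsetD)
  moreover have "holomorphic_map_on (ball q \<delta>') (Y j)" if "j < n" for j
    using assms that unfolding chart_def by (meson holomorphic_map_on_subset)
  moreover have "holomorphic_map_on (ball q \<delta>') r"
    using assms unfolding chart_def by (meson holomorphic_map_on_subset)
  ultimately show ?thesis using assms(1,2) unfolding chart_def by blast
qed

lemma vector_field_local_extension:
  assumes p: "p \<in> S" and j: "j < n"
  obtains d Y where "d > 0" "holomorphic_map_on (ball p d) Y" "\<And>x. x \<in> S \<inter> ball p d \<Longrightarrow> Y x = X j x"
    "\<And>x. x \<in> ball p d \<Longrightarrow> norm (Y x) \<le> norm (X j p) + 1"
proof -
  obtain U Y where Y: "open U" "p \<in> U" "holomorphic_map_on U Y" "\<And>x. x \<in> S \<inter> U \<Longrightarrow> Y x = X j x"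
    using X_field[OF j] p unfolding holomorphic_vector_field_def extends_locally_def by metis
  have "isCont Y p"
    using holomorphic_map_on_continuous[OF Y(3)] Y(1,2) by (simp add: continuous_on_eq_continuous_at)
  then obtain d1 where d1: "d1 > 0" "\<And>y. dist y p < d1 \<Longrightarrow> dist (Y y) (Y p) < 1"
    unfolding continuous_at_eps_delta by (meson zero_less_one)
  obtain d2 where d2: "d2 > 0" "ball p d2 \<subseteq> U" using Y(1,2) openE by blast
  show ?thesis
  proof (rule that[of "min d1 d2" Y])
    show "min d1 d2 > 0" using d1 d2 by simp
    show "holomorphic_map_on (ball p (min d1 d2)) Y"
      by (rule holomorphic_map_on_subset[OF Y(3)]) (use d2 in auto)
    show "Y x = X j x" if "x \<in> S \<inter> ball p (min d1 d2)" for x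
      using that d2 by (intro Y(4)) auto
    show "norm (Y x) \<le> norm (X j p) + 1" if "x \<in> ball p (min d1 d2)" for x
    proof -
      have "dist (Y x) (Y p) < 1" using that by (intro d1) (auto simp: dist_commute)
      moreover have "Y p = X j p" using p Y(2) by (intro Y(4)) auto
      ultimately show ?thesis using norm_triangle_sub[of "Y x" "Y p"] by (simp add: dist_norm)
    qed
  qed
qed

lemma local_chart:
  assumes p: "p \<in> S"
  obtains \<delta> B r Y where "\<delta> > 0" "chart \<delta> B p r Y"
proof -
  obtain U r where r: "open U" "p \<in> U" "holomorphic_map_on U r" "r ` U \<subseteq> S" "\<And>x. x \<in> S \<inter> U \<Longrightarrow> r x = x"
    using holomorphic_retraction[OF submanifold p] by metis
  obtain d0 where d0: "d0 > 0" "ball p d0 \<subseteq> U" using r(1,2) openE by blast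
  have "\<exists>dY. fst dY > 0 \<and> holomorphic_map_on (ball p (fst dY)) (snd dY) \<and>
      (\<forall>x\<in>S \<inter> ball p (fst dY). snd dY x = X j x) \<and>
      (\<forall>x\<in>ball p (fst dY). norm (snd dY x) \<le> norm (X j p) + 1)" if "j < n" for j
  proof -
    obtain d Y where "d > 0" "holomorphic_map_on (ball p d) Y" "\<And>x. x \<in> S \<inter> ball p d \<Longrightarrow> Y x = X j x"
      "\<And>x. x \<in> ball p d \<Longrightarrow> norm (Y x) \<le> norm (X j p) + 1"
      using vector_field_local_extension[OF p \<open>j < n\<close>] by metis
    then show ?thesis by (intro exI[of _ "(d, Y)"]) simp
  qed
  then obtain dY where dY: "\<And>j. j < n \<Longrightarrow> fst (dY j) > 0"
    "\<And>j. j < n \<Longrightarrow> holomorphic_map_on (ball p (fst (dY j))) (snd (dY j))"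
    "\<And>j x. j < n \<Longrightarrow> x \<in> S \<inter> ball p (fst (dY j)) \<Longrightarrow> snd (dY j) x = X j x"
    "\<And>j x. j < n \<Longrightarrow> x \<in> ball p (fst (dY j)) \<Longrightarrow> norm (snd (dY j) x) \<le> norm (X j p) + 1"
    by metis
  define \<delta> where "\<delta> = Min (insert d0 ((\<lambda>j. fst (dY j)) ` {..<n}))"
  have \<delta>: "\<delta> > 0" using d0 dY(1) by (simp add: \<delta>_def)
  have \<delta>0: "ball p \<delta> \<subseteq> ball p d0" by (intro subset_ball) (simp add: \<delta>_def)
  have \<delta>j: "ball p \<delta> \<subseteq> ball p (fst (dY j))" if "j < n" for j
    using that by (intro subset_ball) (simp add: \<delta>_def)
  define B where "B = (\<Sum>j<n. norm (X j p)) + 1"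
  have B: "norm (X j p) + 1 \<le> B" if "j < n" for j
    unfolding B_def using member_le_sum[of j "{..<n}" "\<lambda>j. norm (X j p)"] that by simp
  have "chart \<delta> B p r (\<lambda>j. snd (dY j))"
    unfolding chart_def
  proof (intro conjI allI impI ballI)
    show "holomorphic_map_on (ball p \<delta>) r"
      using holomorphic_map_on_subset[OF r(3)] \<delta>0 d0 by blast
    show "r ` ball p \<delta> \<subseteq> S" using r(4) \<delta>0 d0 by blast
    show "r x = x" if "x \<in> S \<inter> ball p \<delta>" for x using r(5)[of x] \<delta>0 d0 that by blast
    fix j assume j: "j < n"
    show "holomorphic_map_on (ball p \<delta>) (snd (dY j))"
      by (rule holomorphic_map_on_subset[OF dY(2)[OF j] \<delta>j[OF j]])
    show "norm (snd (dY j) x) \<le> B" if "x \<in> ball p \<delta>" for x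
      using dY(4)[OF j, of x] \<delta>j[OF j] that B[OF j] by (meson order_trans subsetD)
    show "snd (dY j) x = X j x" if "x \<in> S \<inter> ball p \<delta>" for x
      using dY(3)[OF j, of x] \<delta>j[OF j] that by blast
  qed
  with \<delta> that show ?thesis by blast
qed

text \<open>Compactness of \<open>M\<close>: in a finite subcover by balls of half the chart radius,
  the chart of a centre also serves all points near it, and minimum and maximum over the centres
  give one radius and one bound.\<close>

lemma uniform_charts:
  "\<exists>\<delta>>0. \<exists>B>0. \<forall>m\<in>M. \<exists>r Y. chart \<delta> B (complexify m) r Y"
proof -
  have "\<exists>dB. fst dB > 0 \<and> (\<exists>r Y. chart (fst dB) (snd dB) (complexify m) r Y)" if m: "m \<in> M" for m
  proof -
    obtain \<delta> B r Y where "\<delta> > 0" "chart \<delta> B (complexify m) r Y"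
      by (rule local_chart[OF M_S[OF m]])
    then show ?thesis by (intro exI[of _ "(\<delta>, B)"]) auto
  qed
  then obtain dB where dB: "\<And>m. m \<in> M \<Longrightarrow> fst (dB m) > 0"
    "\<And>m. m \<in> M \<Longrightarrow> \<exists>r Y. chart (fst (dB m)) (snd (dB m)) (complexify m) r Y" by metis
  have "M \<subseteq> (\<Union>m\<in>M. ball m (fst (dB m) / 2))" using dB(1) by force
  then obtain C where C: "C \<subseteq> M" "finite C" "M \<subseteq> (\<Union>m\<in>C. ball m (fst (dB m) / 2))"
    using compactE_image[OF compact_M, of M "\<lambda>m. ball m (fst (dB m) / 2)"] by auto
  define \<delta> where "\<delta> = Min (insert 1 ((\<lambda>m. fst (dB m) / 2) ` C))"
  define B where "B = Max (insert 1 ((\<lambda>m. snd (dB m)) ` C))"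
  have \<delta>: "\<delta> > 0" using dB(1) C by (auto simp: \<delta>_def)
  have "B \<ge> 1" using C(2) by (simp add: B_def)
  moreover have "\<exists>r Y. chart \<delta> B (complexify m) r Y" if m: "m \<in> M" for m
  proof -
    obtain c where c: "c \<in> C" "m \<in> ball c (fst (dB c) / 2)" using C(3) m by blast
    obtain r Y where rY: "chart (fst (dB c)) (snd (dB c)) (complexify c) r Y" using dB(2) c(1) C(1) by blast
    have le: "\<delta> \<le> fst (dB c) / 2" unfolding \<delta>_def by (rule Min_le) (use c(1) C(2) in auto)
    have le': "snd (dB c) \<le> B" unfolding B_def by (rule Max_ge) (use c(1) C(2) in auto)
    have "ball (complexify m) \<delta> \<subseteq> ball (complexify c) (fst (dB c))"
    proof
      fix x assume "x \<in> ball (complexify m) \<delta>"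
      then show "x \<in> ball (complexify c) (fst (dB c))"
        using c(2) le dist_triangle[of "complexify c" x "complexify m"] by (simp add: dist_complexify)
    qed
    from chart_mono[OF rY this le'] show ?thesis by blast
  qed
  ultimately show ?thesis using \<delta> by (intro exI[of _ \<delta>] conjI exI[of _ B]) auto
qed

definition iter_field :: "nat list \<Rightarrow> (complex ^ 'N \<Rightarrow> complex) \<Rightarrow> complex ^ 'N \<Rightarrow> complex" where
  "iter_field = foldr (\<lambda>j. vf_apply S (X j))"

lemma iter_field_simps:
  "iter_field [] F = F" "iter_field (j # w) F = vf_apply S (X j) (iter_field w F)"
  by (simp_all add: iter_field_def)

lemma iter_field_append: "iter_field (u @ v) F = iter_field u (iter_field v F)"
  by (simp add: iter_field_def)

lemma iter_field_holomorphic: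
  "F \<in> holomorphic_functions S \<Longrightarrow> set w \<subseteq> {..<n} \<Longrightarrow> iter_field w F \<in> holomorphic_functions S"
  unfolding iter_field_def by (rule foldr_vf_apply_holomorphic) (auto intro: X_field)

lemma iter_field_lincomb:
  assumes F: "\<And>k. k \<in> I \<Longrightarrow> F k \<in> holomorphic_functions S" and w: "set w \<subseteq> {..<n}" and \<xi>: "\<xi> \<in> S"
  shows "iter_field w (\<lambda>x. \<Sum>k\<in>I. b k * F k x) \<xi> = (\<Sum>k\<in>I. b k * iter_field w (F k) \<xi>)"
  unfolding iter_field_def by (rule foldr_vf_apply_lincomb[OF F _ \<xi>]) (use w X_field in auto)

text \<open>On \<open>S\<close> the extended fields agree with the given ones and are tangent, so
  differentiating an ambient extension along them gives an ambient extension of the derived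
  function. This allows the induction on the word.\<close>

lemma iter_field_eq_iter_deriv:
  assumes ch: "chart \<delta> B p r Y" and \<epsilon>: "\<epsilon> \<le> \<delta>" and hol: "holomorphic_fun_on (ball p \<epsilon>) G"
    and eq: "\<And>x. x \<in> S \<inter> ball p \<epsilon> \<Longrightarrow> G x = F x" and w: "set w \<subseteq> {..<n}" and x: "x \<in> S \<inter> ball p \<epsilon>"
  shows "iter_field w F x = iter_deriv Y w G x"
  using w x
proof (induction w arbitrary: x)
  case Nil
  then show ?case by (simp add: iter_field_simps iter_deriv_simps eq)
next
  case (Cons j w)
  have sub: "ball p \<epsilon> \<subseteq> ball p \<delta>" using \<epsilon> by (rule subset_ball)
  have j: "j < n" using Cons.prems by simp
  have "vf_apply S (X j) (iter_field w F) x = frechet_derivative (iter_deriv Y w G) (at x) (X j x)"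
  proof (rule vf_apply_local_extension[where U = "ball p \<epsilon>"])
    show "holomorphic_fun_on (ball p \<epsilon>) (iter_deriv Y w G)"
      using ch Cons.prems(1) by (intro holomorphic_iter_deriv hol open_ball holomorphic_map_on_subset[OF _ sub])
        (auto simp: chart_def)
    show "X j x \<in> tangent_space S x" using X_tangent[OF j] Cons.prems by blast
  qed (use Cons in auto)
  moreover have "Y j x = X j x" using ch j Cons.prems sub unfolding chart_def by blast
  ultimately show ?case by (simp add: iter_field_simps iter_deriv_simps)
qed

text \<open>The local extensions supplied by the definition of a holomorphic function live on
  neighbourhoods that depend on \<open>F\<close>. Composition with \<open>r\<close> extends every
  \<open>F\<close> to the same ball of radius \<open>\<delta>\<close>, which is what makes
  \<open>a0\<close> independent of \<open>F\<close>.\<close>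

lemma chart_extension:
  assumes "chart \<delta> B p r Y" "F \<in> holomorphic_functions S"
  shows "holomorphic_fun_on (ball p \<delta>) (\<lambda>x. F (r x))"
proof (rule holomorphic_fun_on_locally)
  fix x assume x: "x \<in> ball p \<delta>"
  have rx: "r x \<in> S" using assms(1) x unfolding chart_def by blast
  have rhol: "holomorphic_map_on (ball p \<delta>) r" using assms(1) unfolding chart_def by blast
  obtain U G where U: "open U" "r x \<in> U" "holomorphic_fun_on U G" "\<And>x. x \<in> S \<inter> U \<Longrightarrow> G x = F x"
    using holomorphic_functionsE[OF assms(2) rx] by metis
  have "open (ball p \<delta> \<inter> r -` U)"
    by (rule continuous_open_preimage[OF holomorphic_map_on_continuous[OF rhol] open_ball U(1)])
  then obtain d where d: "d > 0" "ball x d \<subseteq> ball p \<delta> \<inter> r -` U"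
    using x U(2) openE[of "ball p \<delta> \<inter> r -` U" x] by blast
  have "holomorphic_fun_on (ball x d) (\<lambda>x. G (r x))"
    by (rule holomorphic_fun_on_compose[OF holomorphic_map_on_subset[OF rhol] U(3)]) (use d in auto)
  then have "holomorphic_fun_on (ball x d) (\<lambda>x. F (r x))"
  proof (rule holomorphic_fun_on_cong[OF open_ball, rotated])
    show "G (r y) = F (r y)" if "y \<in> ball x d" for y
    proof (rule U(4))
      have "y \<in> ball p \<delta>" "r y \<in> U" using that d(2) by auto
      then show "r y \<in> S \<inter> U" using assms(1) unfolding chart_def by blast
    qed
  qed
  then show "\<exists>d>0. holomorphic_fun_on (ball x d) (\<lambda>x. F (r x))" using d(1) by blast
qed

text \<open>Tangent spaces of \<open>M\<close> are not used as vector spaces: linearity comes from an arbitrary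
  Frechet derivative within \<open>M\<close>, whose values on the tangent vectors of the fields are known.\<close>

lemma vf_apply_real_restriction:
  assumes F: "F \<in> holomorphic_functions S" and m: "m \<in> M"
    and V: "V (complexify m) = (\<Sum>j<n. k j *\<^sub>R X j (complexify m))"
  shows "vf_apply M (real_restriction V) (\<lambda>x. Re (F (complexify x))) m
    = Re (\<Sum>j<n. of_real (k j) * vf_apply S (X j) F (complexify m))"
proof -
  let ?f = "\<lambda>x. Re (F (complexify x))"
  obtain U G where U: "open U" "complexify m \<in> U" "holomorphic_fun_on U G" "\<And>x. x \<in> S \<inter> U \<Longrightarrow> G x = F x"
    using holomorphic_functionsE[OF F M_S[OF m]] by metis
  let ?D = "\<lambda>v. Re (frechet_derivative G (at (complexify m)) (complexify v))"
  have D: "(?f has_derivative ?D) (at m within M)"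
    by (rule has_derivative_within_local_extension[OF has_derivative_Re_complexify[OF U(3,2)]
          open_vimage[OF U(1) continuous_on_complexify] _ m]) (use U M_S in auto)
  have "?f differentiable (at m within M)" by (rule differentiableI[OF D])
  then have D': "(?f has_derivative frechet_derivative ?f (at m within M)) (at m within M)"
    by (simp add: frechet_derivative_works)
  interpret L: linear "frechet_derivative ?f (at m within M)" by (rule has_derivative_linear[OF D'])
  have "\<forall>j\<in>{..<n}. \<exists>v. v \<in> tangent_space M m \<and> X j (complexify m) = complexify v"
    using X_real m unfolding real_on_def by blast
  then obtain v where v: "\<And>j. j < n \<Longrightarrow> v j \<in> tangent_space M m" "\<And>j. j < n \<Longrightarrow> X j (complexify m) = complexify (v j)"
    by (metis lessThan_iff)
  have Vv: "V (complexify m) = complexify (\<Sum>j<n. k j *\<^sub>R v j)"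
    unfolding V linear_sum[OF bounded_linear.linear[OF bounded_linear_complexify]]
    by (intro sum.cong refl) (simp add: v(2) linear_scale[OF bounded_linear.linear[OF bounded_linear_complexify]])
  then have "real_restriction V m = (\<Sum>j<n. k j *\<^sub>R v j)"
    unfolding real_restriction_def Vv by (simp add: complexify_def vec_eq_iff)
  then have "vf_apply M (real_restriction V) ?f m = (\<Sum>j<n. k j * frechet_derivative ?f (at m within M) (v j))"
    by (simp add: vf_apply_def L.sum L.scale)
  also have "\<dots> = (\<Sum>j<n. k j * Re (vf_apply S (X j) F (complexify m)))"
  proof (intro sum.cong refl arg_cong2[of _ _ _ _ "(*)"])
    fix j assume "j \<in> {..<n}"
    then have j: "j < n" by simp
    have "frechet_derivative ?f (at m within M) (v j) = ?D (v j)"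
      by (rule tangent_derivative_unique[OF D' D v(1)[OF j]])
    also have "\<dots> = Re (vf_apply S (X j) F (complexify m))"
      using vf_apply_local_extension[where X = "X j", OF U(3,1,2) M_S[OF m] U(4) X_tangent[OF j M_S[OF m]]]
      by (simp add: v(2)[OF j])
    finally show "frechet_derivative ?f (at m within M) (v j) = Re (vf_apply S (X j) F (complexify m))" .
  qed
  finally show ?thesis by simp
qed

text \<open>The formula for real parts is applied to \<open>- \<i> * F\<close>, whose real part is
  the imaginary part of \<open>F\<close> and hence vanishes on \<open>M\<close>.\<close>

lemma vf_apply_real:
  assumes F: "F \<in> holomorphic_functions S" and real: "\<And>m. m \<in> M \<Longrightarrow> F (complexify m) \<in> \<real>"
    and j: "j < n" and m: "m \<in> M"
  shows "vf_apply S (X j) F (complexify m) \<in> \<real>"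
proof -
  have G: "(\<lambda>x. - \<i> * F x) \<in> holomorphic_functions S"
    by (intro holomorphic_functions_mult holomorphic_functions_const F)
  obtain v where v: "v \<in> tangent_space M m" "X j (complexify m) = complexify v"
    using X_real[OF j] m unfolding real_on_def by blast
  have restr: "real_restriction (X j) m = v" unfolding real_restriction_def v(2) by (simp add: complexify_def vec_eq_iff)
  have "((\<lambda>x. Re (- \<i> * F (complexify x))) has_derivative (\<lambda>_. 0)) (at m within M)"
    by (rule has_derivative_transform[OF m _ has_derivative_const]) (use real in \<open>auto simp: complex_is_Real_iff\<close>)
  from vf_apply_eq[where X = "real_restriction (X j)", OF this]
  have "0 = vf_apply M (real_restriction (X j)) (\<lambda>x. Re (- \<i> * F (complexify x))) m"
    using v(1) restr by simp
  also have "\<dots> = Re (\<Sum>i<n. of_real (if i = j then 1 else 0) * vf_apply S (X i) (\<lambda>x. - \<i> * F x) (complexify m))"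
    by (rule vf_apply_real_restriction[OF G m]) (simp add: j if_distrib[of "\<lambda>r. r *\<^sub>R _"] cong: if_cong)
  also have "\<dots> = Re (vf_apply S (X j) (\<lambda>x. - \<i> * F x) (complexify m))"
    by (simp add: j if_distrib[of of_real] if_distrib[of "\<lambda>r. r * _"] cong: if_cong)
  also have "\<dots> = Im (vf_apply S (X j) F (complexify m))"
    unfolding vf_apply_cmult[where X = "X j", OF F M_S[OF m] X_tangent[OF j M_S[OF m]]] by simp
  finally show ?thesis by (simp add: complex_is_Real_iff)
qed

lemma iter_field_real:
  assumes "F \<in> holomorphic_functions S" "\<And>m. m \<in> M \<Longrightarrow> F (complexify m) \<in> \<real>"
    and "set w \<subseteq> {..<n}" "m \<in> M"
  shows "iter_field w F (complexify m) \<in> \<real>"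
  using assms(3,4)
proof (induction w arbitrary: m)
  case (Cons j w)
  then show ?case
    using iter_field_holomorphic[OF assms(1)] by (auto simp: iter_field_simps intro!: vf_apply_real)
qed (simp add: iter_field_simps assms)

end

section \<open>Convergence of the action of a formal series\<close>

lemma frechet_derivative_eq_on_open:
  assumes "holomorphic_fun_on U G" "open U" "x \<in> U" "\<And>y. y \<in> U \<Longrightarrow> G y = F y"
  shows "frechet_derivative F (at x) = frechet_derivative G (at x)"
proof -
  have "(F has_derivative frechet_derivative G (at x)) (at x)"
    by (rule has_derivative_transform_within_open[OF holomorphic_fun_on_has_derivative[OF assms(1,3)] assms(2,3,4)])
  then show ?thesis by (rule frechet_derivative_at[symmetric])
qed

lemma frechet_derivative_lincomb:
  assumes "\<And>k. k \<in> I \<Longrightarrow> holomorphic_fun_on U (G k)" "x \<in> U"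
  shows "frechet_derivative (\<lambda>x. \<Sum>k\<in>I. a k * G k x) (at x) v = (\<Sum>k\<in>I. a k * frechet_derivative (G k) (at x) v)"
proof -
  have "((\<lambda>x. \<Sum>k\<in>I. a k * G k x) has_derivative (\<lambda>v. \<Sum>k\<in>I. a k * frechet_derivative (G k) (at x) v)) (at x)"
    using assms by (intro has_derivative_sum has_derivative_mult_right holomorphic_fun_on_has_derivative)
  from fun_cong[OF frechet_derivative_at[OF this], of v] show ?thesis by simp
qed

lemma iter_deriv_lincomb:
  assumes "open U" "\<And>j. j \<in> set w \<Longrightarrow> holomorphic_map_on U (Y j)"
    and G: "\<And>k. k \<in> I \<Longrightarrow> holomorphic_fun_on U (G k)" and "x \<in> U"
  shows "iter_deriv Y w (\<lambda>x. \<Sum>k\<in>I. a k * G k x) x = (\<Sum>k\<in>I. a k * iter_deriv Y w (G k) x)"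
  using assms(2,4)
proof (induction w arbitrary: x)
  case Nil
  then show ?case by (simp add: iter_deriv_simps)
next
  case (Cons j w)
  have hol: "holomorphic_fun_on U (iter_deriv Y w (G k))" if "k \<in> I" for k
    using Cons.prems(1) by (intro holomorphic_iter_deriv assms(1) G that) auto
  have "frechet_derivative (iter_deriv Y w (\<lambda>x. \<Sum>k\<in>I. a k * G k x)) (at x)
      = frechet_derivative (\<lambda>x. \<Sum>k\<in>I. a k * iter_deriv Y w (G k) x) (at x)"
  proof (rule frechet_derivative_eq_on_open[OF _ assms(1) Cons.prems(2)])
    show "holomorphic_fun_on U (\<lambda>x. \<Sum>k\<in>I. a k * iter_deriv Y w (G k) x)"
      by (intro holomorphic_fun_on_sum holomorphic_fun_on_mult holomorphic_fun_on_const hol)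
    show "(\<Sum>k\<in>I. a k * iter_deriv Y w (G k) y) = iter_deriv Y w (\<lambda>x. \<Sum>k\<in>I. a k * G k x) y"
      if "y \<in> U" for y
      using Cons.IH[OF Cons.prems(1) that] by simp
  qed
  then show ?case
    by (simp add: iter_deriv_simps frechet_derivative_lincomb[OF hol Cons.prems(2)])
qed

lemma iter_deriv_const: "iter_deriv Y w (\<lambda>_. c) = (\<lambda>_. if w = [] then c else 0)"
proof (induction w)
  case (Cons j w)
  then obtain d where "iter_deriv Y w (\<lambda>_. c) = (\<lambda>_. d)" by blast
  then have "iter_deriv Y (j # w) (\<lambda>_. c) = (\<lambda>\<xi>. frechet_derivative (\<lambda>_. d) (at \<xi>) (Y j \<xi>))"
    by (intro ext) (simp only: iter_deriv_simps)
  then show ?case by (simp add: frechet_derivative_const)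
qed (simp add: iter_deriv_simps)

text \<open>The partial sums of the power series are the approximating polynomials.\<close>

lemma polynomial_approximation:
  fixes p :: "complex ^ 'n"
  assumes \<rho>: "0 < h" "h < \<rho>" and hol: "holomorphic_fun_on (polydisc p \<rho>) H"
    and bd: "\<forall>\<xi>\<in>polydisc p \<rho>. norm (H \<xi>) \<le> S0" and e: "e > 0"
  shows "\<exists>A b. finite A \<and> (\<forall>\<xi>. (\<forall>i. norm (\<xi> $ i - p $ i) \<le> h) \<longrightarrow>
      norm (H \<xi> - (\<Sum>\<alpha>\<in>A. b \<alpha> * (\<Prod>i\<in>UNIV. (\<xi> $ i - p $ i) ^ \<alpha> i))) \<le> e)"
proof -
  have "0 < \<rho>" using \<rho> by simp
  from power_series_expansion[OF this hol bd] obtain b where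
    b: "\<forall>\<alpha>. norm (b \<alpha>) \<le> S0 / \<rho> ^ (\<Sum>i\<in>UNIV. \<alpha> i)"
    and sum: "\<forall>\<xi>\<in>polydisc p \<rho>. ((\<lambda>\<alpha>. b \<alpha> * (\<Prod>i\<in>UNIV. (\<xi> $ i - p $ i) ^ \<alpha> i)) has_sum H \<xi>) UNIV"
    by (elim exE conjE)
  define g where "g \<alpha> = norm (b \<alpha>) * h ^ (\<Sum>i\<in>UNIV. \<alpha> i)" for \<alpha> :: "'n \<Rightarrow> nat"
  have "p \<in> polydisc p \<rho>" using \<open>0 < \<rho>\<close> by (simp add: polydisc_def)
  have "(\<lambda>\<alpha>. S0 * (\<Prod>i\<in>UNIV. (h / \<rho>) ^ \<alpha> i)) summable_on {\<alpha>. \<forall>j::'n. j \<notin> UNIV \<longrightarrow> \<alpha> j = (0::nat)}"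
    using \<rho> by (intro summable_on_cmult_right summable_on_multi_geometric) auto
  then have "(\<lambda>\<alpha>. S0 * (\<Prod>i\<in>UNIV. (h / \<rho>) ^ \<alpha> i)) summable_on (UNIV :: ('n \<Rightarrow> nat) set)" by simp
  then have "g summable_on UNIV"
  proof (rule summable_on_comparison_test)
    show "g \<alpha> \<le> S0 * (\<Prod>i\<in>UNIV. (h / \<rho>) ^ \<alpha> i)" for \<alpha>
    proof -
      have "g \<alpha> \<le> S0 / \<rho> ^ (\<Sum>i\<in>UNIV. \<alpha> i) * h ^ (\<Sum>i\<in>UNIV. \<alpha> i)"
        unfolding g_def using b \<rho> by (intro mult_right_mono) auto
      then show ?thesis by (simp add: power_divide power_sum prod_dividef)
    qed
    show "0 \<le> g \<alpha>" for \<alpha> using \<rho> by (simp add: g_def)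
  qed
  then have gs: "(g has_sum infsum g UNIV) UNIV" by (rule has_sum_infsum)
  from has_sum_finite_approximation[OF gs e] obtain A where
    A: "finite A" "dist (sum g A) (infsum g UNIV) \<le> e" by blast
  have gA: "(g has_sum (infsum g UNIV - sum g A)) (UNIV - A)"
    by (rule has_sum_Diff[OF gs has_sum_finite[OF A(1)]]) simp
  show ?thesis
  proof (intro exI conjI allI impI)
    show "finite A" by (rule A(1))
    fix \<xi> assume "\<forall>i. norm (\<xi> $ i - p $ i) \<le> h"
    then have \<xi>: "norm (\<xi> $ i - p $ i) \<le> h" for i by blast
    let ?f = "\<lambda>\<alpha>. b \<alpha> * (\<Prod>i\<in>UNIV. (\<xi> $ i - p $ i) ^ \<alpha> i)"
    have "\<xi> \<in> polydisc p \<rho>" using \<xi> \<rho> by (auto simp: polydisc_def intro: le_less_trans)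
    with sum have fs: "(?f has_sum H \<xi>) UNIV" by blast
    have fA: "(?f has_sum (H \<xi> - sum ?f A)) (UNIV - A)"
      by (rule has_sum_Diff[OF fs has_sum_finite[OF A(1)]]) simp
    have le: "norm (?f \<alpha>) \<le> g \<alpha>" for \<alpha>
    proof -
      have "(\<Prod>i\<in>UNIV. norm (\<xi> $ i - p $ i) ^ \<alpha> i) \<le> (\<Prod>i\<in>UNIV. h ^ \<alpha> i)"
        using \<xi> by (intro prod_mono) (auto intro: power_mono)
      then show ?thesis
        unfolding g_def norm_mult prod_norm[symmetric] norm_power power_sum by (intro mult_left_mono) auto
    qed
    have "norm (H \<xi> - sum ?f A) \<le> infsum g UNIV - sum g A"
    proof -
      have gsm: "g summable_on (UNIV - A)" using gA has_sum_imp_summable by blast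
      then have ns: "(\<lambda>\<alpha>. norm (?f \<alpha>)) summable_on (UNIV - A)"
        by (rule Infinite_Sum.abs_summable_on_comparison_test') (rule le)
      have "norm (H \<xi> - sum ?f A) \<le> infsum (\<lambda>\<alpha>. norm (?f \<alpha>)) (UNIV - A)"
        by (rule norm_has_sum_bound[OF has_sum_infsum[OF ns] fA])
      also have "\<dots> \<le> infsum g (UNIV - A)" by (rule infsum_mono[OF ns gsm le])
      also have "\<dots> = infsum g UNIV - sum g A" using gA by (rule infsumI)
      finally show ?thesis .
    qed
    also have "\<dots> \<le> e" using A(2) by (simp add: dist_real_def abs_if split: if_splits)
    finally show "norm (H \<xi> - sum ?f A) \<le> e" .
  qed
qed

section \<open>Coefficient families on words and their action by iterated derivatives\<close>

lemma finite_index_words: "finite (index_words n p)"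
proof -
  have "index_words n p = {w. set w \<subseteq> {..<n} \<and> length w = p}" by (auto simp: index_words_def)
  then show ?thesis using finite_lists_length_eq[of "{..<n}" p] by simp
qed

lemma index_words_0: "index_words n 0 = {[]}"
  by (auto simp: index_words_def)

text \<open>A bound on a chosen family of coefficients instead of the norm of the element it
  represents. \<open>C\<close> and \<open>a\<close> are both explicit, since under products the
  constants multiply and the radii add.\<close>

definition factorial_bound :: "nat \<Rightarrow> real \<Rightarrow> real \<Rightarrow> (nat list \<Rightarrow> real) \<Rightarrow> bool" where
  "factorial_bound n C a c \<longleftrightarrow> (\<forall>p. (\<Sum>w\<in>index_words n p. \<bar>c w\<bar>) * fact p \<le> C * a ^ p)"

lemma factorial_bound_nonneg: "factorial_bound n C a c \<Longrightarrow> C \<ge> 0"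
proof -
  assume "factorial_bound n C a c"
  then have "(\<Sum>w\<in>index_words n 0. \<bar>c w\<bar>) * fact 0 \<le> C * a ^ 0" unfolding factorial_bound_def by blast
  then show ?thesis by (simp add: index_words_0)
qed

text \<open>The action through the extended fields of a chart. Unlike \<open>act\<close> on the
  functions of \<open>S\<close>, it is used for functions that are holomorphic only near the base
  point, such as limits of partial sums.\<close>

definition local_act ::
  "nat \<Rightarrow> (nat \<Rightarrow> complex ^ 'n \<Rightarrow> complex ^ 'n) \<Rightarrow> (nat list \<Rightarrow> real) \<Rightarrow> nat \<Rightarrow>
    (complex ^ 'n \<Rightarrow> complex) \<Rightarrow> complex ^ 'n \<Rightarrow> complex" where
  "local_act n Y c p G \<xi> = (\<Sum>w\<in>index_words n p. complex_of_real (c w) * iter_deriv Y w G \<xi>)"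

text \<open>The factorial lost to the iterated derivatives is exactly the one gained from
  \<open>factorial_bound\<close>; only a geometric rate proportional to \<open>a\<close>
  remains.\<close>

lemma local_act_bound:
  assumes Y: "\<And>j. j < n \<Longrightarrow> holomorphic_map_on (ball p (s + h)) (Y j)"
    "\<And>j y. j < n \<Longrightarrow> y \<in> ball p (s + h) \<Longrightarrow> norm (Y j y) \<le> B"
    and G: "holomorphic_fun_on (ball p (s + h)) G" "\<And>y. y \<in> ball p (s + h) \<Longrightarrow> norm (G y) \<le> S0"
    and h: "h > 0" "B \<ge> 0" "S0 \<ge> 0" and c: "factorial_bound n C a c" and x: "x \<in> cball p s"
  shows "norm (local_act n Y c k G x) \<le> C * S0 * (a * (exp 1 * B / h)) ^ k"
proof -
  have "norm (local_act n Y c k G x) \<le> (\<Sum>w\<in>index_words n k. \<bar>c w\<bar> * (S0 * (exp 1 * B / h) ^ k * fact k))"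
    unfolding local_act_def
  proof (rule sum_norm_le)
    fix w assume w: "w \<in> index_words n k"
    then have lw: "length w = k" "set w \<subseteq> {..<n}" by (auto simp: index_words_def)
    have "norm (iter_deriv Y w G x) \<le> S0 * (exp 1 * B / h) ^ length w * fact (length w)"
      by (rule iter_deriv_bound[OF _ _ G h x]) (use Y lw in auto)
    then show "norm (complex_of_real (c w) * iter_deriv Y w G x) \<le> \<bar>c w\<bar> * (S0 * (exp 1 * B / h) ^ k * fact k)"
      using lw by (simp add: norm_mult mult_left_mono)
  qed
  also have "\<dots> = ((\<Sum>w\<in>index_words n k. \<bar>c w\<bar>) * fact k) * (S0 * (exp 1 * B / h) ^ k)"
    by (simp add: sum_distrib_right sum_distrib_left mult_ac)
  also have "\<dots> \<le> C * a ^ k * (S0 * (exp 1 * B / h) ^ k)"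
    using c h unfolding factorial_bound_def by (intro mult_right_mono) auto
  also have "\<dots> = C * S0 * (a * (exp 1 * B / h)) ^ k" unfolding power_mult_distrib by simp
  finally show ?thesis .
qed

lemma holomorphic_local_act:
  assumes "open U" "\<And>j. j < n \<Longrightarrow> holomorphic_map_on U (Y j)" "holomorphic_fun_on U G"
  shows "holomorphic_fun_on U (local_act n Y c p G)"
  unfolding local_act_def[abs_def]
  using assms by (intro holomorphic_fun_on_sum holomorphic_fun_on_mult holomorphic_fun_on_const holomorphic_iter_deriv)
    (auto simp: index_words_def)

lemma local_act_lincomb:
  assumes "open U" "\<And>j. j < n \<Longrightarrow> holomorphic_map_on U (Y j)"
    and G: "\<And>k. k \<in> I \<Longrightarrow> holomorphic_fun_on U (G k)" and "x \<in> U"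
  shows "local_act n Y c p (\<lambda>x. \<Sum>k\<in>I. b k * G k x) x = (\<Sum>k\<in>I. b k * local_act n Y c p (G k) x)"
proof -
  have "local_act n Y c p (\<lambda>x. \<Sum>k\<in>I. b k * G k x) x
      = (\<Sum>w\<in>index_words n p. \<Sum>k\<in>I. complex_of_real (c w) * (b k * iter_deriv Y w (G k) x))"
    unfolding local_act_def sum_distrib_left[symmetric]
    using assms by (intro sum.cong refl arg_cong2[of _ _ _ _ "(*)"] iter_deriv_lincomb[of U])
      (auto simp: index_words_def)
  also have "\<dots> = (\<Sum>k\<in>I. b k * local_act n Y c p (G k) x)"
    unfolding local_act_def sum_distrib_left by (subst sum.swap) (simp add: mult_ac)
  finally show ?thesis .
qed

lemma local_act_diff:
  assumes "open U" "\<And>j. j < n \<Longrightarrow> holomorphic_map_on U (Y j)"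
    and "holomorphic_fun_on U G" "holomorphic_fun_on U H" and "x \<in> U"
  shows "local_act n Y c p (\<lambda>x. G x - H x) x = local_act n Y c p G x - local_act n Y c p H x"
  using local_act_lincomb[of U n Y UNIV "\<lambda>b. if b then G else H" x c p "\<lambda>b. if b then 1 else -1"] assms
  by (simp add: UNIV_bool)

context analytic_vector_fields
begin

definition act :: "(nat list \<Rightarrow> real) \<Rightarrow> nat \<Rightarrow> (complex ^ 'N \<Rightarrow> complex) \<Rightarrow> complex ^ 'N \<Rightarrow> complex" where
  "act c p F \<xi> = (\<Sum>w\<in>index_words n p. complex_of_real (c w) * iter_field w F \<xi>)"

text \<open>The coproduct condition seen through the action on functions: applied to a product, the
  series behaves like an algebra homomorphism, degree by degree.\<close>

definition grouplike :: "(nat list \<Rightarrow> real) \<Rightarrow> bool" where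
  "grouplike c \<longleftrightarrow> c [] = 1 \<and>
    (\<forall>F\<in>holomorphic_functions S. \<forall>G\<in>holomorphic_functions S. \<forall>p. \<forall>\<xi>\<in>S.
      act c p (\<lambda>x. F x * G x) \<xi> = (\<Sum>i\<le>p. act c i F \<xi> * act c (p - i) G \<xi>))"

text \<open>A total definition. Only for admissible \<open>c\<close> are the series shown to
  converge, to real values that are the coordinates of a point of \<open>M\<close>.\<close>

definition flow :: "(nat list \<Rightarrow> real) \<Rightarrow> real ^ 'N \<Rightarrow> real ^ 'N" where
  "flow c m = (\<chi> i. Re (suminf (\<lambda>p. act c p (\<lambda>x. x $ i) (complexify m))))"

lemma act_eq_local_act:
  assumes "chart \<delta> B p r Y" "\<epsilon> \<le> \<delta>" "holomorphic_fun_on (ball p \<epsilon>) G"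
    and "\<And>x. x \<in> S \<inter> ball p \<epsilon> \<Longrightarrow> G x = F x" and "x \<in> S \<inter> ball p \<epsilon>"
  shows "act c k F x = local_act n Y c k G x"
  unfolding act_def local_act_def
  using iter_field_eq_iter_deriv[OF assms(1,2,3,4) _ assms(5)]
  by (intro sum.cong) (auto simp: index_words_def)

lemma act_holomorphic: "F \<in> holomorphic_functions S \<Longrightarrow> act c p F \<in> holomorphic_functions S"
  unfolding act_def[abs_def]
  by (intro holomorphic_functions_sum holomorphic_functions_mult holomorphic_functions_const
      iter_field_holomorphic) (auto simp: index_words_def)

lemma act_0: "c [] = 1 \<Longrightarrow> act c 0 F \<xi> = F \<xi>"
  by (simp add: act_def index_words_0 iter_field_simps)

end

section \<open>Decay of the terms and convergence near \<open>M\<close>\<close>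

locale charted_vector_fields = analytic_vector_fields S M n X
  for S :: "(complex ^ 'N) set" and M :: "(real ^ 'N) set"
    and n :: nat and X :: "nat \<Rightarrow> complex ^ 'N \<Rightarrow> complex ^ 'N" +
  fixes \<delta> B :: real
  assumes \<delta>_pos: "\<delta> > 0" and B_pos: "B > 0"
    and charts: "\<And>m. m \<in> M \<Longrightarrow> \<exists>r Y. chart \<delta> B (complexify m) r Y"
begin

text \<open>The polydisc of radius \<open>2 * h\<close> about \<open>m \<in> M\<close> lies in the ball of radius \<open>\<delta> / 2\<close>, and
  \<open>a0\<close> makes the terms of the series decay like \<open>4 ^ - p\<close>.\<close>

definition "h = \<delta> / (4 * real CARD('N))"
definition "a0 = h / (4 * exp 1 * B)"

lemma h_pos: "h > 0" and a0_pos: "a0 > 0" and h_le: "h \<le> \<delta> / 4"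
proof -
  have "real CARD('N) \<ge> 1" using zero_less_card_finite[where 'a='N] by linarith
  then show "h \<le> \<delta> / 4" using \<delta>_pos by (simp add: h_def field_simps)
  show "h > 0" using \<delta>_pos by (simp add: h_def)
  then show "a0 > 0" using B_pos by (simp add: a0_def)
qed

lemma a0_rate:
  assumes "0 \<le> a" "a \<le> a0" "h \<le> h'"
  shows "a * (exp 1 * B / h') \<le> 1 / 4" "0 \<le> a * (exp 1 * B / h')"
proof -
  have "a * (exp 1 * B / h') \<le> a0 * (exp 1 * B / h)"
    using assms B_pos h_pos by (intro mult_mono divide_left_mono) auto
  also have "\<dots> = 1 / 4" using h_pos B_pos by (simp add: a0_def)
  finally show "a * (exp 1 * B / h') \<le> 1 / 4" .
  show "0 \<le> a * (exp 1 * B / h')" using assms B_pos h_pos by simp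
qed

lemma chart_holomorphic_field:
  assumes "chart \<delta> B p r Y" "U \<subseteq> ball p \<delta>" "j < n"
  shows "holomorphic_map_on U (Y j)"
  using assms unfolding chart_def by (meson holomorphic_map_on_subset)

text \<open>The margin \<open>h'\<close> is left open because it is taken as
  \<open>\<delta> / 4\<close> for estimates on the ball of radius \<open>\<delta> / 2\<close>, and
  as \<open>h\<close> for estimates at the centre.\<close>

lemma local_act_decay:
  assumes ch: "chart \<delta> B p r Y" and G: "holomorphic_fun_on (ball p (s + h')) G"
    "\<And>y. y \<in> ball p (s + h') \<Longrightarrow> norm (G y) \<le> S0"
    and h': "h \<le> h'" "s + h' \<le> \<delta>" and c: "factorial_bound n C a c" "0 \<le> a" "a \<le> a0"
    and x: "x \<in> cball p s" and s: "s \<ge> 0"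
  shows "norm (local_act n Y c k G x) \<le> C * S0 * (1 / 4) ^ k"
proof -
  have h0: "h' > 0" using h' h_pos by simp
  have sub: "ball p (s + h') \<subseteq> ball p \<delta>" using h'(2) by (rule subset_ball)
  have "norm (G p) \<le> S0" using s h0 by (intro G) simp
  then have S0: "S0 \<ge> 0" using norm_ge_zero order_trans by blast
  have "norm (local_act n Y c k G x) \<le> C * S0 * (a * (exp 1 * B / h')) ^ k"
    using ch sub h0 B_pos S0
    by (intro local_act_bound[OF _ _ G _ _ _ c(1) x] chart_holomorphic_field[OF ch])
      (auto simp: chart_def)
  also have "\<dots> \<le> C * S0 * (1 / 4) ^ k"
    using a0_rate[OF c(2,3) h'(1)] S0 factorial_bound_nonneg[OF c(1)]
    by (intro mult_left_mono power_mono) auto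
  finally show ?thesis .
qed

text \<open>The extension may be unbounded on the full ball but is bounded on a compact smaller one.
  Three quarters of the radius leave \<open>\<delta> / 2\<close> for summing the series and
  \<open>\<delta> / 4\<close> as the margin for Cauchy's estimate.\<close>

lemma chart_extension_bounded:
  assumes "chart \<delta> B p r Y" "F \<in> holomorphic_functions S"
  obtains S0 where "S0 \<ge> 0" "\<And>x. x \<in> ball p (3 * \<delta> / 4) \<Longrightarrow> norm (F (r x)) \<le> S0"
proof -
  have "continuous_on (cball p (3 * \<delta> / 4)) (\<lambda>x. F (r x))"
    by (rule continuous_on_subset[OF holomorphic_fun_on_continuous[OF chart_extension[OF assms]]])
      (use \<delta>_pos in auto)
  then have "bounded ((\<lambda>x. F (r x)) ` cball p (3 * \<delta> / 4))"
    by (intro compact_imp_bounded compact_continuous_image) auto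
  then obtain S0 where S0: "S0 > 0" "\<forall>y\<in>(\<lambda>x. F (r x)) ` cball p (3 * \<delta> / 4). norm y \<le> S0"
    using bounded_pos by blast
  show ?thesis by (rule that[of S0]) (use S0 in auto)
qed

lemma chart_extension_subset:
  assumes "chart \<delta> B p r Y" "F \<in> holomorphic_functions S" "\<epsilon> \<le> \<delta>"
  shows "holomorphic_fun_on (ball p \<epsilon>) (\<lambda>x. F (r x))"
  by (rule holomorphic_fun_on_subset[OF chart_extension[OF assms(1,2)] subset_ball[OF assms(3)]])

lemma act_eq_local_act_extension:
  assumes "chart \<delta> B p r Y" "F \<in> holomorphic_functions S" "x \<in> S \<inter> ball p \<delta>"
  shows "act c k F x = local_act n Y c k (\<lambda>x. F (r x)) x"
  by (rule act_eq_local_act[OF assms(1) order_refl chart_extension[OF assms(1,2)] _ assms(3)])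
    (use assms(1) in \<open>auto simp: chart_def\<close>)

lemma act_decay:
  assumes ch: "chart \<delta> B p r Y" and F: "F \<in> holomorphic_functions S"
  obtains S0 where "S0 \<ge> 0" "\<And>C a c x k. factorial_bound n C a c \<Longrightarrow> 0 \<le> a \<Longrightarrow> a \<le> a0 \<Longrightarrow>
    x \<in> S \<inter> ball p (\<delta> / 2) \<Longrightarrow> norm (act c k F x) \<le> C * S0 * (1 / 4) ^ k"
proof -
  obtain S0 where S0: "S0 \<ge> 0" "\<And>x. x \<in> ball p (3 * \<delta> / 4) \<Longrightarrow> norm (F (r x)) \<le> S0"
    using chart_extension_bounded[OF ch F] by metis
  show ?thesis
  proof (rule that[OF S0(1)])
    fix C a c x k assume c: "factorial_bound n C a c" "0 \<le> a" "a \<le> a0" and x: "x \<in> S \<inter> ball p (\<delta> / 2)"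
    have eq: "\<delta> / 2 + \<delta> / 4 = 3 * \<delta> / 4" by simp
    have "norm (local_act n Y c k (\<lambda>x. F (r x)) x) \<le> C * S0 * (1 / 4) ^ k"
      by (rule local_act_decay[OF ch _ _ h_le _ c, where s = "\<delta> / 2"])
        (use x \<delta>_pos S0(2) in \<open>auto simp: eq intro!: chart_extension_subset[OF ch F]\<close>)
    moreover have "x \<in> S \<inter> ball p \<delta>" using x \<delta>_pos by auto
    ultimately show "norm (act c k F x) \<le> C * S0 * (1 / 4) ^ k"
      using act_eq_local_act_extension[OF ch F] by simp
  qed
qed

text \<open>The neighbourhood and \<open>S0\<close> depend on \<open>F\<close> only and serve all
  series of radius at most \<open>a0\<close> at once; this uniformity is exploited in
  \<open>iter_field_bound\<close>.\<close>

lemma act_decay_uniform: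
  assumes F: "F \<in> holomorphic_functions S"
  shows "\<exists>V S0. openin (top_of_set S) V \<and> complexify ` M \<subseteq> V \<and> S0 \<ge> 0 \<and>
    (\<forall>C a c x k. factorial_bound n C a c \<longrightarrow> 0 \<le> a \<longrightarrow> a \<le> a0 \<longrightarrow> x \<in> V \<longrightarrow>
      norm (act c k F x) \<le> C * S0 * (1 / 4) ^ k)"
proof -
  define good where "good m S0 \<longleftrightarrow> S0 \<ge> 0 \<and> (\<forall>C a c x k. factorial_bound n C a c \<longrightarrow> 0 \<le> a \<longrightarrow> a \<le> a0 \<longrightarrow>
    x \<in> S \<inter> ball (complexify m) (\<delta> / 2) \<longrightarrow> norm (act c k F x) \<le> C * S0 * (1 / 4) ^ k)" for m S0
  have "\<exists>S0. good m S0" if m: "m \<in> M" for m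
  proof -
    obtain r Y where ch: "chart \<delta> B (complexify m) r Y" using charts[OF m] by blast
    obtain S0 where "S0 \<ge> 0" "\<And>C a c x k. factorial_bound n C a c \<Longrightarrow> 0 \<le> a \<Longrightarrow> a \<le> a0 \<Longrightarrow>
        x \<in> S \<inter> ball (complexify m) (\<delta> / 2) \<Longrightarrow> norm (act c k F x) \<le> C * S0 * (1 / 4) ^ k"
      using act_decay[OF ch F] by metis
    then show ?thesis unfolding good_def by blast
  qed
  then obtain S0 where S0: "\<And>m. m \<in> M \<Longrightarrow> good m (S0 m)" by metis
  have "M \<subseteq> (\<Union>m\<in>M. ball m (\<delta> / 2))" using \<delta>_pos by force
  then obtain D where D: "D \<subseteq> M" "finite D" "M \<subseteq> (\<Union>m\<in>D. ball m (\<delta> / 2))"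
    using compactE_image[OF compact_M, of M "\<lambda>m. ball m (\<delta> / 2)"] by auto
  define V where "V = S \<inter> (\<Union>m\<in>D. ball (complexify m) (\<delta> / 2))"
  define T where "T = (\<Sum>m\<in>D. S0 m)"
  have S0D: "S0 m \<ge> 0" if "m \<in> D" for m using S0 D(1) that unfolding good_def by blast
  show ?thesis
  proof (intro exI conjI allI impI)
    show "openin (top_of_set S) V" unfolding V_def by (intro openin_open_Int open_UN) auto
    show "complexify ` M \<subseteq> V"
    proof
      fix y assume "y \<in> complexify ` M"
      then obtain m where m: "m \<in> M" "y = complexify m" by blast
      then obtain d where "d \<in> D" "m \<in> ball d (\<delta> / 2)" using D(3) by blast
      then show "y \<in> V" using M_S m by (auto simp: V_def dist_complexify)
    qed
    show "T \<ge> 0" unfolding T_def by (rule sum_nonneg) (rule S0D)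
    fix C a c x k assume c: "factorial_bound n C a c" "0 \<le> a" "a \<le> a0" and xV: "x \<in> V"
    obtain d where d: "d \<in> D" "x \<in> S \<inter> ball (complexify d) (\<delta> / 2)" using xV unfolding V_def by blast
    have "S0 d \<le> T" unfolding T_def by (rule member_le_sum[OF d(1) _ D(2)]) (use S0D in auto)
    then have "C * S0 d * (1 / 4) ^ k \<le> C * T * (1 / 4) ^ k"
      using factorial_bound_nonneg[OF c(1)] by (intro mult_right_mono mult_left_mono) auto
    moreover have "norm (act c k F x) \<le> C * S0 d * (1 / 4) ^ k"
      using S0 D(1) d c unfolding good_def by blast
    ultimately show "norm (act c k F x) \<le> C * T * (1 / 4) ^ k" by linarith
  qed
qed

theorem uniform_convergence:
  assumes c: "factorial_bound n C a c" "0 \<le> a" "a \<le> a0" and F: "F \<in> holomorphic_functions S"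
  shows "\<exists>V. openin (top_of_set S) V \<and> complexify ` M \<subseteq> V \<and>
    uniformly_convergent_on V (\<lambda>k \<xi>. \<Sum>p<k. act c p F \<xi>)"
proof -
  from act_decay_uniform[OF F] obtain V S0 where V: "openin (top_of_set S) V" "complexify ` M \<subseteq> V"
    and S0: "S0 \<ge> 0" "\<forall>C a c x k. factorial_bound n C a c \<longrightarrow> 0 \<le> a \<longrightarrow> a \<le> a0 \<longrightarrow> x \<in> V \<longrightarrow>
      norm (act c k F x) \<le> C * S0 * (1 / 4) ^ k"
    by (elim exE conjE)
  have "uniformly_convergent_on V (\<lambda>k \<xi>. \<Sum>p<k. act c p F \<xi>)"
  proof (rule Weierstrass_m_test')
    show "summable (\<lambda>k. C * S0 * (1 / 4 :: real) ^ k)" by (intro summable_mult summable_geometric) simp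
    show "norm (act c k F \<xi>) \<le> C * S0 * (1 / 4) ^ k" if "\<xi> \<in> V" for k \<xi>
      using S0(2) c that by blast
  qed
  with V show ?thesis by blast
qed

text \<open>The uniform decay is tested on the series whose single word \<open>w\<close> has
  coefficient \<open>a0 ^ length w / fact (length w)\<close>. It satisfies the factorial bound with
  constant 1 and radius \<open>a0\<close>.\<close>

lemma iter_field_bound:
  assumes F: "F \<in> holomorphic_functions S"
  obtains S0 where "S0 \<ge> 0" "\<And>w m. set w \<subseteq> {..<n} \<Longrightarrow> m \<in> M \<Longrightarrow>
    norm (iter_field w F (complexify m)) \<le> S0 * fact (length w) * (1 / (4 * a0)) ^ length w"
proof -
  from act_decay_uniform[OF F] obtain V S0 where V: "openin (top_of_set S) V" "complexify ` M \<subseteq> V"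
    and S0: "S0 \<ge> 0" "\<forall>C a c x k. factorial_bound n C a c \<longrightarrow> 0 \<le> a \<longrightarrow> a \<le> a0 \<longrightarrow> x \<in> V \<longrightarrow>
      norm (act c k F x) \<le> C * S0 * (1 / 4) ^ k"
    by (elim exE conjE)
  show ?thesis
  proof (rule that[OF S0(1)])
    fix w m assume w: "set w \<subseteq> {..<n}" and m: "m \<in> M"
    define c where "c v = (if v = w then a0 ^ length w / fact (length w) else 0)" for v
    have iw: "w \<in> index_words n p \<longleftrightarrow> p = length w" for p using w by (auto simp: index_words_def)
    have "(\<Sum>v\<in>index_words n p. \<bar>c v\<bar>) = (if p = length w then a0 ^ length w / fact (length w) else 0)" for p
    proof -
      have "(\<Sum>v\<in>index_words n p. \<bar>c v\<bar>) = (\<Sum>v\<in>index_words n p. if v = w then a0 ^ length w / fact (length w) else 0)"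
        using a0_pos by (intro sum.cong) (auto simp: c_def)
      then show ?thesis by (simp add: sum.delta finite_index_words iw)
    qed
    then have "factorial_bound n 1 a0 c" using a0_pos by (simp add: factorial_bound_def)
    then have "norm (act c (length w) F (complexify m)) \<le> 1 * S0 * (1 / 4) ^ length w"
      using a0_pos V(2) m by (intro S0(2)[rule_format]) auto
    moreover have "act c (length w) F (complexify m)
        = complex_of_real (a0 ^ length w / fact (length w)) * iter_field w F (complexify m)"
    proof -
      have "act c (length w) F (complexify m) = (\<Sum>v\<in>index_words n (length w).
          if v = w then complex_of_real (a0 ^ length w / fact (length w)) * iter_field w F (complexify m) else 0)"
        unfolding act_def by (intro sum.cong) (auto simp: c_def)
      then show ?thesis by (simp only: sum.delta[OF finite_index_words] iw) simp
    qed
    ultimately have "a0 ^ length w / fact (length w) * norm (iter_field w F (complexify m)) \<le> S0 * (1 / 4) ^ length w"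
      using a0_pos by (simp add: norm_mult norm_divide norm_power)
    then show "norm (iter_field w F (complexify m)) \<le> S0 * fact (length w) * (1 / (4 * a0)) ^ length w"
      using a0_pos by (simp add: power_divide power_mult_distrib field_simps)
  qed
qed

end

subsection \<open>Evaluation at a point\<close>

context analytic_vector_fields
begin

lemma act_lincomb:
  assumes F: "\<And>k. k \<in> I \<Longrightarrow> F k \<in> holomorphic_functions S" and \<xi>: "\<xi> \<in> S"
  shows "act c p (\<lambda>x. \<Sum>k\<in>I. b k * F k x) \<xi> = (\<Sum>k\<in>I. b k * act c p (F k) \<xi>)"
proof -
  have "act c p (\<lambda>x. \<Sum>k\<in>I. b k * F k x) \<xi>
      = (\<Sum>w\<in>index_words n p. \<Sum>k\<in>I. complex_of_real (c w) * (b k * iter_field w (F k) \<xi>))"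
    unfolding act_def sum_distrib_left[symmetric]
    by (intro sum.cong refl arg_cong2[of _ _ _ _ "(*)"] iter_field_lincomb F \<xi>)
      (auto simp: index_words_def)
  also have "\<dots> = (\<Sum>k\<in>I. b k * act c p (F k) \<xi>)"
    unfolding act_def sum_distrib_left by (subst sum.swap) (simp add: mult_ac)
  finally show ?thesis .
qed

end

context charted_vector_fields
begin

definition admissible :: "(nat list \<Rightarrow> real) \<Rightarrow> bool" where
  "admissible c \<longleftrightarrow> grouplike c \<and> (\<exists>C a. factorial_bound n C a c \<and> 0 \<le> a \<and> a \<le> a0)"

definition ev :: "(nat list \<Rightarrow> real) \<Rightarrow> real ^ 'N \<Rightarrow> (complex ^ 'N \<Rightarrow> complex) \<Rightarrow> complex" where
  "ev c m F = (suminf (\<lambda>k. act c k F (complexify m)))"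

lemma act_summable:
  assumes c: "factorial_bound n C a c" "0 \<le> a" "a \<le> a0" and F: "F \<in> holomorphic_functions S" and m: "m \<in> M"
  shows "summable (\<lambda>k. norm (act c k F (complexify m)))"
proof -
  obtain r Y where ch: "chart \<delta> B (complexify m) r Y" using charts[OF m] by blast
  obtain S0 where S0: "\<And>C a c x k. factorial_bound n C a c \<Longrightarrow> 0 \<le> a \<Longrightarrow> a \<le> a0 \<Longrightarrow>
    x \<in> S \<inter> ball (complexify m) (\<delta> / 2) \<Longrightarrow> norm (act c k F x) \<le> C * S0 * (1 / 4) ^ k"
    using act_decay[OF ch F] by metis
  show ?thesis
  proof (rule summable_comparison_test')
    show "summable (\<lambda>k. C * S0 * (1 / 4 :: real) ^ k)" by (intro summable_mult summable_geometric) simp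
    show "norm (norm (act c k F (complexify m))) \<le> C * S0 * (1 / 4) ^ k" if "k \<ge> 0" for k
      using S0[OF c, of "complexify m" k] M_S[OF m] \<delta>_pos by simp
  qed
qed

lemma admissible_summable:
  assumes "admissible c" "F \<in> holomorphic_functions S" "m \<in> M"
  shows "summable (\<lambda>k. norm (act c k F (complexify m)))"
  using assms act_summable unfolding admissible_def by metis

lemma ev_sums:
  assumes "admissible c" "F \<in> holomorphic_functions S" "m \<in> M"
  shows "(\<lambda>k. act c k F (complexify m)) sums ev c m F"
  unfolding ev_def by (rule summable_sums[OF summable_norm_cancel[OF admissible_summable[OF assms]]])

text \<open>\<open>grouplike\<close> says that the series for \<open>F * G\<close> is the Cauchy
  product of two absolutely convergent series.\<close>

lemma ev_mult:
  assumes c: "admissible c" and F: "F \<in> holomorphic_functions S" "G \<in> holomorphic_functions S" and m: "m \<in> M"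
  shows "ev c m (\<lambda>x. F x * G x) = ev c m F * ev c m G"
proof -
  have "act c k (\<lambda>x. F x * G x) (complexify m)
      = (\<Sum>i\<le>k. act c i F (complexify m) * act c (k - i) G (complexify m))" for k
    using c F M_S[OF m] unfolding admissible_def grouplike_def by blast
  then show ?thesis
    unfolding ev_def using Cauchy_product[OF admissible_summable[OF c F(1) m] admissible_summable[OF c F(2) m]]
    by simp
qed

lemma ev_const:
  assumes c: "admissible c" and m: "m \<in> M"
  shows "ev c m (\<lambda>_. b) = b"
proof -
  obtain r Y where ch: "chart \<delta> B (complexify m) r Y" using charts[OF m] by blast
  have "act c k (\<lambda>_. b) (complexify m) = local_act n Y c k (\<lambda>_. b) (complexify m)" for k
    by (rule act_eq_local_act[OF ch order_refl holomorphic_fun_on_const]) (use M_S[OF m] \<delta>_pos in auto)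
  moreover have "local_act n Y c k (\<lambda>_. b) (complexify m) = (if k = 0 then b else 0)" for k
  proof (cases "k = 0")
    case True
    then show ?thesis using c
      by (simp add: local_act_def index_words_0 iter_deriv_const admissible_def grouplike_def)
  next
    case False
    then have "w \<noteq> []" if "w \<in> index_words n k" for w using that by (auto simp: index_words_def)
    then show ?thesis using False by (simp add: local_act_def iter_deriv_const)
  qed
  ultimately have "(\<lambda>k. act c k (\<lambda>_. b) (complexify m)) = (\<lambda>k. if k = 0 then b else 0)" by simp
  then show ?thesis using sums_unique[OF sums_single[of 0 "\<lambda>_. b"]] unfolding ev_def by simp
qed

lemma ev_lincomb:
  assumes c: "admissible c" and F: "\<And>k. k \<in> I \<Longrightarrow> F k \<in> holomorphic_functions S" and m: "m \<in> M"
  shows "ev c m (\<lambda>x. \<Sum>k\<in>I. b k * F k x) = (\<Sum>k\<in>I. b k * ev c m (F k))"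
proof -
  have "(\<lambda>p. \<Sum>k\<in>I. b k * act c p (F k) (complexify m)) sums (\<Sum>k\<in>I. b k * ev c m (F k))"
    by (intro sums_sum sums_mult ev_sums c F m)
  then have "(\<lambda>p. act c p (\<lambda>x. \<Sum>k\<in>I. b k * F k x) (complexify m)) sums (\<Sum>k\<in>I. b k * ev c m (F k))"
    by (simp add: act_lincomb[OF F M_S[OF m]])
  from sums_unique[OF this] show ?thesis unfolding ev_def[of c m "\<lambda>x. \<Sum>k\<in>I. b k * F k x"] by simp
qed

lemma ev_power:
  assumes "admissible c" "F \<in> holomorphic_functions S" "m \<in> M"
  shows "(\<lambda>x. F x ^ k) \<in> holomorphic_functions S \<and> ev c m (\<lambda>x. F x ^ k) = ev c m F ^ k"
proof (induction k)
  case 0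
  then show ?case by (simp add: ev_const assms holomorphic_functions_const)
next
  case (Suc k)
  then show ?case using ev_mult[OF assms(1,2) _ assms(3)] holomorphic_functions_mult[OF assms(2)] by simp
qed

lemma ev_prod:
  assumes "admissible c" "\<And>i. i \<in> I \<Longrightarrow> F i \<in> holomorphic_functions S" "m \<in> M" "finite I"
  shows "(\<lambda>x. \<Prod>i\<in>I. F i x) \<in> holomorphic_functions S \<and> ev c m (\<lambda>x. \<Prod>i\<in>I. F i x) = (\<Prod>i\<in>I. ev c m (F i))"
  using assms(4,2)
proof (induction I rule: finite_induct)
  case empty
  then show ?case by (simp add: ev_const assms holomorphic_functions_const)
next
  case (insert i I)
  then show ?case using ev_mult[OF assms(1) _ _ assms(3), of "F i" "\<lambda>x. \<Prod>i\<in>I. F i x"]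
      holomorphic_functions_mult[of "F i" S "\<lambda>x. \<Prod>i\<in>I. F i x"] by simp
qed

definition ev_point :: "(nat list \<Rightarrow> real) \<Rightarrow> real ^ 'N \<Rightarrow> complex ^ 'N" where
  "ev_point c m = (\<chi> i. ev c m (\<lambda>x. x $ i))"

lemma ev_coordinate_shift:
  assumes c: "admissible c" and m: "m \<in> M"
  shows "(\<lambda>x. x $ i - b) \<in> holomorphic_functions S" "ev c m (\<lambda>x. x $ i - b) = ev_point c m $ i - b"
proof -
  show "(\<lambda>x. x $ i - b) \<in> holomorphic_functions S"
    by (intro holomorphic_functions_entire holomorphic_fun_intros)
  have "ev c m (\<lambda>x. \<Sum>k\<in>UNIV. (if k then 1 else - b) * (if k then (\<lambda>x. x $ i) else (\<lambda>_. 1)) x)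
      = (\<Sum>k\<in>UNIV. (if k then 1 else - b) * ev c m (if k then (\<lambda>x. x $ i) else (\<lambda>_. 1)))"
    by (rule ev_lincomb[OF c _ m]) (auto simp: holomorphic_functions_coord holomorphic_functions_const)
  then show "ev c m (\<lambda>x. x $ i - b) = ev_point c m $ i - b"
    by (simp add: UNIV_bool ev_const[OF c m] ev_point_def)
qed

text \<open>Only the supremum over the ball of radius \<open>h\<close> enters, and this is what
  later confines the point of evaluation. The geometric sum 4/3 is rounded up to 2.\<close>

lemma local_series_bound:
  assumes ch: "chart \<delta> B p r Y" and c: "factorial_bound n C a c" "0 \<le> a" "a \<le> a0"
    and G: "holomorphic_fun_on (ball p h) G" "\<And>y. y \<in> ball p h \<Longrightarrow> norm (G y) \<le> S0"
  shows "summable (\<lambda>k. local_act n Y c k G p)" "norm (suminf (\<lambda>k. local_act n Y c k G p)) \<le> 2 * C * S0"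
proof -
  have bd: "norm (local_act n Y c k G p) \<le> C * S0 * (1 / 4) ^ k" for k
    by (rule local_act_decay[OF ch _ _ order_refl _ c, where s = 0]) (use G h_le \<delta>_pos in auto)
  have sm: "summable (\<lambda>k. C * S0 * (1 / 4 :: real) ^ k)" by (intro summable_mult summable_geometric) simp
  have "summable (\<lambda>k. norm (local_act n Y c k G p))"
    by (rule summable_comparison_test'[OF sm, of 0]) (use bd in simp)
  then show "summable (\<lambda>k. local_act n Y c k G p)" by (rule summable_norm_cancel)
  have "norm (suminf (\<lambda>k. local_act n Y c k G p)) \<le> (suminf (\<lambda>k. C * S0 * (1 / 4 :: real) ^ k))"
    by (rule norm_suminf_le[OF bd sm])
  also have "\<dots> = C * S0 * (4 / 3)" by (subst suminf_mult) (simp_all add: suminf_geometric summable_geometric)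
  also have "\<dots> \<le> 2 * C * S0"
  proof -
    have "S0 \<ge> 0" using G(2)[of p] h_pos norm_ge_zero order_trans by (metis centre_in_ball)
    then have "0 \<le> C * S0" using factorial_bound_nonneg[OF c(1)] by simp
    then show ?thesis by linarith
  qed
  finally show "norm (suminf (\<lambda>k. local_act n Y c k G p)) \<le> 2 * C * S0" .
qed

text \<open>A character takes powers to powers, so the constant in its continuity estimate can be
  removed: it is bounded by the supremum over a small ball. Applied to a coordinate function, this
  confines the point of evaluation to that ball.\<close>

lemma ev_point_near:
  assumes c: "admissible c" and m: "m \<in> M"
  shows "norm (ev_point c m $ i - complexify m $ i) \<le> h"
proof (rule ccontr)
  let ?p = "complexify m" and ?G = "\<lambda>x. x $ i - complexify m $ i"
  assume "\<not> ?thesis"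
  then have gt: "norm (ev_point c m $ i - ?p $ i) / h > 1" using h_pos by simp
  obtain C a where ca: "factorial_bound n C a c" "0 \<le> a" "a \<le> a0" using c unfolding admissible_def by blast
  obtain r Y where ch: "chart \<delta> B ?p r Y" using charts[OF m] by blast
  have "(norm (ev_point c m $ i - ?p $ i) / h) ^ k \<le> 2 * C" for k
  proof -
    have hol: "holomorphic_fun_on (ball ?p h) (\<lambda>x. ?G x ^ k)" by (intro holomorphic_fun_intros)
    have "norm (?G y ^ k) \<le> h ^ k" if "y \<in> ball ?p h" for y
    proof -
      have "norm ((y - ?p) $ i) \<le> norm (y - ?p)" by (rule Finite_Cartesian_Product.norm_nth_le)
      then have "norm (?G y) \<le> h" using that by (simp add: dist_norm norm_minus_commute)
      then show ?thesis by (simp add: norm_power power_mono)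
    qed
    note lb = local_series_bound(2)[OF ch ca hol this]
    have "act c q (\<lambda>x. ?G x ^ k) ?p = local_act n Y c q (\<lambda>x. ?G x ^ k) ?p" for q
      by (rule act_eq_local_act[OF ch _ hol]) (use h_le \<delta>_pos h_pos M_S[OF m] in auto)
    then have "norm (ev c m (\<lambda>x. ?G x ^ k)) \<le> 2 * C * h ^ k" using lb by (simp add: ev_def)
    moreover have "ev c m (\<lambda>x. ?G x ^ k) = (ev_point c m $ i - ?p $ i) ^ k"
      using ev_power[OF c ev_coordinate_shift(1)[OF c m] m] ev_coordinate_shift(2)[OF c m] by simp
    ultimately show ?thesis using h_pos by (simp add: norm_power power_divide field_simps)
  qed
  moreover obtain k where "2 * C < (norm (ev_point c m $ i - ?p $ i) / h) ^ k"
    using real_arch_pow[OF gt] by blast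
  ultimately show False by (meson not_less)
qed

lemma polydisc_2h: "polydisc p (2 * h) \<subseteq> ball p (\<delta> / 2)" for p :: "complex ^ 'N"
  by (rule polydisc_subset_ball) (simp add: h_def)

lemma ev_point_polydisc: "admissible c \<Longrightarrow> m \<in> M \<Longrightarrow> ev_point c m \<in> polydisc (complexify m) (2 * h)"
  using ev_point_near h_pos unfolding polydisc_def by (smt (verit) mem_Collect_eq)

text \<open>By multiplicativity the character evaluates polynomials in the coordinates at
  \<open>ev_point c m\<close>. Partial sums of the power series approximate \<open>H\<close> within
  \<open>e\<close> on the closed polydisc of radius \<open>h\<close>, which contains both the ball
  of the continuity estimate and the point itself, so the two sides differ by at most
  \<open>(2 * C + 1) * e\<close>. Here \<open>H\<close> need only be holomorphic near
  \<open>m\<close>, as required for functions composed with a retraction and for sums of a second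
  series.\<close>

lemma local_evaluation:
  assumes c: "admissible c" and m: "m \<in> M" and ch: "chart \<delta> B (complexify m) r Y"
    and H: "holomorphic_fun_on (ball (complexify m) (\<delta> / 2)) H"
    "\<And>x. x \<in> ball (complexify m) (\<delta> / 2) \<Longrightarrow> norm (H x) \<le> S0"
  shows "(\<lambda>k. local_act n Y c k H (complexify m)) sums H (ev_point c m)"
proof -
  let ?p = "complexify m" and ?q = "ev_point c m"
  obtain C a where ca: "factorial_bound n C a c" "0 \<le> a" "a \<le> a0" using c unfolding admissible_def by blast
  have C: "C \<ge> 0" using factorial_bound_nonneg[OF ca(1)] .
  have sub: "ball ?p h \<subseteq> ball ?p (\<delta> / 2)" using h_le \<delta>_pos by (intro subset_ball) auto
  have Hh: "holomorphic_fun_on (ball ?p h) H" using H(1) sub by (rule holomorphic_fun_on_subset)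
  have Hbd: "norm (H y) \<le> S0" if "y \<in> ball ?p h" for y using H(2) sub that by blast
  let ?\<chi> = "\<lambda>G. suminf (\<lambda>k. local_act n Y c k G ?p)"
  have sums: "(\<lambda>k. local_act n Y c k H ?p) sums ?\<chi> H"
    by (rule summable_sums[OF local_series_bound(1)[OF ch ca Hh Hbd]])
  have near: "norm (?\<chi> H - H ?q) \<le> (2 * C + 1) * e" if e: "e > 0" for e
  proof -
    have "holomorphic_fun_on (polydisc ?p (2 * h)) H" using H(1) polydisc_2h by (rule holomorphic_fun_on_subset)
    moreover have "\<forall>x\<in>polydisc ?p (2 * h). norm (H x) \<le> S0" using H(2) polydisc_2h by blast
    moreover have "h < 2 * h" using h_pos by simp
    ultimately have "\<exists>A b. finite A \<and> (\<forall>\<xi>. (\<forall>i. norm (\<xi> $ i - ?p $ i) \<le> h) \<longrightarrow>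
        norm (H \<xi> - (\<Sum>\<alpha>\<in>A. b \<alpha> * (\<Prod>i\<in>UNIV. (\<xi> $ i - ?p $ i) ^ \<alpha> i))) \<le> e)"
      by (intro polynomial_approximation h_pos e)
    then obtain A b where A: "\<forall>\<xi>. (\<forall>i. norm (\<xi> $ i - ?p $ i) \<le> h) \<longrightarrow>
        norm (H \<xi> - (\<Sum>\<alpha>\<in>A. b \<alpha> * (\<Prod>i\<in>UNIV. (\<xi> $ i - ?p $ i) ^ \<alpha> i))) \<le> e"
      by (elim exE conjE)
    have approx: "norm (H \<xi> - (\<Sum>\<alpha>\<in>A. b \<alpha> * (\<Prod>i\<in>UNIV. (\<xi> $ i - ?p $ i) ^ \<alpha> i))) \<le> e"
      if "\<And>i. norm (\<xi> $ i - ?p $ i) \<le> h" for \<xi>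
      using A that by blast
    define P where "P x = (\<Sum>\<alpha>\<in>A. b \<alpha> * (\<Prod>i\<in>UNIV. (x $ i - ?p $ i) ^ \<alpha> i))" for x
    have Pent: "holomorphic_fun_on U P" for U unfolding P_def[abs_def] by (intro holomorphic_fun_intros)
    have mono: "(\<lambda>x. (\<Prod>i\<in>UNIV. (x $ i - ?p $ i) ^ \<alpha> i)) \<in> holomorphic_functions S
        \<and> ev c m (\<lambda>x. (\<Prod>i\<in>UNIV. (x $ i - ?p $ i) ^ \<alpha> i)) = (\<Prod>i\<in>UNIV. (?q $ i - ?p $ i) ^ \<alpha> i)" for \<alpha>
      using ev_prod[OF c _ m, of UNIV "\<lambda>i x. (x $ i - ?p $ i) ^ \<alpha> i"]
        ev_power[OF c ev_coordinate_shift(1)[OF c m] m] ev_coordinate_shift(2)[OF c m] by simp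
    have evP: "ev c m P = P ?q"
      unfolding P_def[abs_def] using ev_lincomb[OF c _ m, of A "\<lambda>\<alpha> x. \<Prod>i\<in>UNIV. (x $ i - ?p $ i) ^ \<alpha> i" b] mono
      by simp
    have "act c k P ?p = local_act n Y c k P ?p" for k
      by (rule act_eq_local_act[OF ch order_refl Pent]) (use M_S[OF m] \<delta>_pos in auto)
    then have "(\<lambda>k. local_act n Y c k P ?p) sums P ?q"
      using ev_sums[OF c holomorphic_functions_entire[OF Pent] m] evP by simp
    from sums_diff[OF sums this]
    have "(\<lambda>k. local_act n Y c k (\<lambda>x. H x - P x) ?p) sums (?\<chi> H - P ?q)"
    proof (subst local_act_diff[of "ball ?p h"])
      show "holomorphic_map_on (ball ?p h) (Y j)" if "j < n" for j
        by (rule chart_holomorphic_field[OF ch _ that]) (use h_le \<delta>_pos in auto)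
    qed (use Hh Pent h_pos in auto)
    then have "norm (?\<chi> H - P ?q) \<le> 2 * C * e"
    proof -
      assume s: "(\<lambda>k. local_act n Y c k (\<lambda>x. H x - P x) ?p) sums (?\<chi> H - P ?q)"
      have "norm (suminf (\<lambda>k. local_act n Y c k (\<lambda>x. H x - P x) ?p)) \<le> 2 * C * e"
      proof (rule local_series_bound(2)[OF ch ca])
        show "holomorphic_fun_on (ball ?p h) (\<lambda>x. H x - P x)" by (intro holomorphic_fun_on_diff Hh Pent)
        show "norm (H y - P y) \<le> e" if y: "y \<in> ball ?p h" for y
          unfolding P_def
        proof (rule approx)
          fix i
          have "norm ((y - ?p) $ i) \<le> norm (y - ?p)" by (rule Finite_Cartesian_Product.norm_nth_le)
          then show "norm (y $ i - ?p $ i) \<le> h" using y by (simp add: dist_norm norm_minus_commute)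
        qed
      qed
      then show ?thesis using sums_unique[OF s] by simp
    qed
    moreover have "norm (P ?q - H ?q) \<le> e"
      unfolding P_def norm_minus_commute[of _ "H ?q"] by (rule approx) (rule ev_point_near[OF c m])
    ultimately have "norm ((?\<chi> H - P ?q) + (P ?q - H ?q)) \<le> 2 * C * e + e" by (rule norm_triangle_mono)
    then show ?thesis by (simp add: algebra_simps)
  qed
  have "?\<chi> H = H ?q"
  proof (rule ccontr)
    assume "?\<chi> H \<noteq> H ?q"
    then have pos: "norm (?\<chi> H - H ?q) > 0" by simp
    define e where "e = norm (?\<chi> H - H ?q) / (2 * (2 * C + 1))"
    have "e > 0" using pos C by (simp add: e_def)
    from near[OF this] have "norm (?\<chi> H - H ?q) \<le> (2 * C + 1) * e" .
    moreover have "(2 * (2 * C + 1)) * e = norm (?\<chi> H - H ?q)"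
      unfolding e_def by (simp only: times_divide_eq_right, rule nonzero_mult_div_cancel_left) (use C in simp)
    ultimately show False using pos unfolding mult.assoc by linarith
  qed
  with sums show ?thesis by simp
qed

text \<open>So far the point \<open>ev_point c m\<close> is only known to lie near \<open>m\<close>
  in the ambient space. It is real because the fields preserve functions that are real on
  \<open>M\<close>; that it lies on \<open>S\<close> comes from evaluating functions composed with
  the retraction.\<close>

lemma flow_evaluation:
  assumes c: "admissible c" and m: "m \<in> M"
  shows complexify_flow: "complexify (flow c m) = ev_point c m"
    and flow_in_M: "flow c m \<in> M"
    and flow_eval: "F \<in> holomorphic_functions S \<Longrightarrow> ev c m F = F (complexify (flow c m))"
proof -
  let ?p = "complexify m" and ?q = "ev_point c m"
  have "ev c m (\<lambda>x. x $ i) \<in> \<real>" for i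
  proof -
    have "act c k (\<lambda>x. x $ i) ?p \<in> \<real>" for k
      unfolding act_def
      by (intro sum_in_Reals Reals_mult Reals_of_real iter_field_real holomorphic_functions_coord m)
        (auto simp: complexify_def index_words_def)
    then have "Im (act c k (\<lambda>x. x $ i) ?p) = 0" for k by (simp add: complex_is_Real_iff)
    moreover have "Im (ev c m (\<lambda>x. x $ i)) = (suminf (\<lambda>k. Im (act c k (\<lambda>x. x $ i) ?p)))"
      unfolding ev_def
      by (rule bounded_linear.suminf[OF bounded_linear_Im])
        (rule sums_summable[OF ev_sums[OF c holomorphic_functions_coord m]])
    ultimately show ?thesis by (simp add: complex_is_Real_iff)
  qed
  then have cr: "complexify (flow c m) $ i = ?q $ i" for i
    by (simp add: complexify_def flow_def ev_point_def ev_def)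
  then show cf: "complexify (flow c m) = ?q" by (simp add: vec_eq_iff)
  obtain r Y where ch: "chart \<delta> B ?p r Y" using charts[OF m] by blast
  have qb: "?q \<in> ball ?p (\<delta> / 2)" using ev_point_polydisc[OF c m] polydisc_2h by blast
  then have "?q \<in> ball ?p \<delta>" using \<delta>_pos by auto
  then have rq: "r ?q \<in> S" using ch unfolding chart_def by blast
  have evr: "ev c m F = F (r ?q)" if F: "F \<in> holomorphic_functions S" for F
  proof -
    obtain S0 where S0: "\<And>x. x \<in> ball ?p (3 * \<delta> / 4) \<Longrightarrow> norm (F (r x)) \<le> S0"
      using chart_extension_bounded[OF ch F] by metis
    have "(\<lambda>k. local_act n Y c k (\<lambda>x. F (r x)) ?p) sums F (r ?q)"
      by (rule local_evaluation[where ?S0.0 = S0, OF c m ch chart_extension_subset[OF ch F]])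
        (use S0 \<delta>_pos in auto)
    then have "(\<lambda>k. act c k F ?p) sums F (r ?q)"
      using act_eq_local_act_extension[OF ch F] M_S[OF m] \<delta>_pos by simp
    then show ?thesis unfolding ev_def by (rule sums_unique[symmetric])
  qed
  \<comment> \<open>The \<open>i\<close>-th coordinate of \<open>?q\<close> is the character of the
    coordinate function by definition, while \<open>evr\<close> gives that character as the
    coordinate of \<open>r ?q\<close>. Hence \<open>r\<close> fixes \<open>?q\<close>, and the image
    of \<open>r\<close> lies in \<open>S\<close>.\<close>
  have "?q $ i = r ?q $ i" for i
  proof -
    have "?q $ i = ev c m (\<lambda>x. x $ i)" by (simp add: ev_point_def)
    also have "\<dots> = r ?q $ i" by (rule evr[OF holomorphic_functions_coord])
    finally show ?thesis .
  qed
  then have "?q = r ?q" by (intro vec_eq_iff[THEN iffD2] allI)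
  then show "flow c m \<in> M" "F \<in> holomorphic_functions S \<Longrightarrow> ev c m F = F (complexify (flow c m))"
    using rq evr cf by (simp_all add: M_eq real_points_def)
qed

lemma flow_sums:
  assumes "admissible c" "m \<in> M" "F \<in> holomorphic_functions S"
  shows "(\<lambda>k. act c k F (complexify m)) sums F (complexify (flow c m))"
  using ev_sums[OF assms(1,3,2)] flow_eval[OF assms(1,2,3)] by simp

lemma local_series_holomorphic:
  assumes ch: "chart \<delta> B p r Y" and c: "factorial_bound n C a c" "0 \<le> a" "a \<le> a0"
    and G: "holomorphic_fun_on (ball p (3 * \<delta> / 4)) G" "\<And>y. y \<in> ball p (3 * \<delta> / 4) \<Longrightarrow> norm (G y) \<le> S0"
  shows "uniform_limit (ball p (\<delta> / 2)) (\<lambda>k x. \<Sum>i<k. local_act n Y c i G x) (\<lambda>x. suminf (\<lambda>k. local_act n Y c k G x)) sequentially"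
    and "holomorphic_fun_on (ball p (\<delta> / 2)) (\<lambda>x. suminf (\<lambda>k. local_act n Y c k G x))"
    and "x \<in> ball p (\<delta> / 2) \<Longrightarrow> (\<lambda>k. local_act n Y c k G x) sums (suminf (\<lambda>k. local_act n Y c k G x))"
    and "x \<in> ball p (\<delta> / 2) \<Longrightarrow> norm (suminf (\<lambda>k. local_act n Y c k G x)) \<le> 2 * C * S0"
    and "x \<in> ball p (\<delta> / 2) \<Longrightarrow> norm (local_act n Y c k G x) \<le> C * S0 * (1 / 4) ^ k"
proof -
  have eq: "\<delta> / 2 + \<delta> / 4 = 3 * \<delta> / 4" by simp
  have bd: "norm (local_act n Y c k G x) \<le> C * S0 * (1 / 4) ^ k" if "x \<in> ball p (\<delta> / 2)" for k x
    by (rule local_act_decay[OF ch _ _ h_le _ c, where s = "\<delta> / 2"])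
      (use that \<delta>_pos G in \<open>auto simp: eq\<close>)
  then show "x \<in> ball p (\<delta> / 2) \<Longrightarrow> norm (local_act n Y c k G x) \<le> C * S0 * (1 / 4) ^ k" by blast
  have sm: "summable (\<lambda>k. C * S0 * (1 / 4 :: real) ^ k)" by (intro summable_mult summable_geometric) simp
  show ul: "uniform_limit (ball p (\<delta> / 2)) (\<lambda>k x. \<Sum>i<k. local_act n Y c i G x) (\<lambda>x. suminf (\<lambda>k. local_act n Y c k G x)) sequentially"
    by (rule Weierstrass_m_test[OF bd sm])
  have hol: "holomorphic_fun_on (ball p (\<delta> / 2)) (local_act n Y c i G)" for i
    by (rule holomorphic_local_act[OF open_ball chart_holomorphic_field[OF ch]])
      (use \<delta>_pos in \<open>auto intro!: holomorphic_fun_on_subset[OF G(1)]\<close>)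
  show "holomorphic_fun_on (ball p (\<delta> / 2)) (\<lambda>x. suminf (\<lambda>k. local_act n Y c k G x))"
  proof (rule holomorphic_fun_on_uniform_limit)
    show "holomorphic_fun_on (ball p (\<delta> / 2)) (\<lambda>x. \<Sum>i<k. local_act n Y c i G x)" for k
      by (intro holomorphic_fun_on_sum hol)
    fix x assume x: "x \<in> ball p (\<delta> / 2)"
    obtain e where "e > 0" "ball x e \<subseteq> ball p (\<delta> / 2)" using openE[OF open_ball x] .
    then show "\<exists>d>0. ball x d \<subseteq> ball p (\<delta> / 2) \<and> uniform_limit (ball x d)
        (\<lambda>k x. \<Sum>i<k. local_act n Y c i G x) (\<lambda>x. suminf (\<lambda>k. local_act n Y c k G x)) sequentially"
      using uniform_limit_on_subset[OF ul] by blast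
  qed
  assume x: "x \<in> ball p (\<delta> / 2)"
  have "summable (\<lambda>k. local_act n Y c k G x)"
    by (rule summable_norm_cancel[OF summable_comparison_test'[OF sm, of 0]]) (use bd[OF x] in simp)
  then show "(\<lambda>k. local_act n Y c k G x) sums (suminf (\<lambda>k. local_act n Y c k G x))" by (rule summable_sums)
  have "norm (suminf (\<lambda>k. local_act n Y c k G x)) \<le> (suminf (\<lambda>k. C * S0 * (1 / 4 :: real) ^ k))"
    by (rule norm_suminf_le[OF bd[OF x] sm])
  also have "\<dots> = C * S0 * (4 / 3)" by (subst suminf_mult) (simp_all add: suminf_geometric summable_geometric)
  also have "\<dots> \<le> 2 * C * S0"
  proof -
    have "norm (G p) \<le> S0" using \<delta>_pos by (intro G) simp
    then have "S0 \<ge> 0" using norm_ge_zero order_trans by blast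
    then have "0 \<le> C * S0" using factorial_bound_nonneg[OF c(1)] by simp
    then show ?thesis by linarith
  qed
  finally show "norm (suminf (\<lambda>k. local_act n Y c k G x)) \<le> 2 * C * S0" .
qed

lemma coordinate_bounded: "y \<in> ball p \<epsilon> \<Longrightarrow> norm (y $ i) \<le> norm p + \<epsilon>" for y p :: "complex ^ 'N"
proof -
  assume "y \<in> ball p \<epsilon>"
  then have "norm (y - p) < \<epsilon>" by (simp add: dist_norm norm_minus_commute)
  then show ?thesis using Finite_Cartesian_Product.norm_nth_le[of y i] norm_triangle_sub[of y p] by linarith
qed

end

section \<open>Products of formal series\<close>

text \<open>The geometric majorant makes the family absolutely summable over the quadrant, so
  summation by rows and by antidiagonals gives the same value.\<close>

lemma double_series_diagonal:
  fixes t :: "nat \<Rightarrow> nat \<Rightarrow> complex"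
  assumes bd: "\<And>k q. norm (t k q) \<le> K * (1 / 2) ^ k * (1 / 2) ^ q"
    and inner: "\<And>k. (\<lambda>q. t k q) sums u k" and outer: "u sums U"
  shows "(\<lambda>p. \<Sum>i\<le>p. t i (p - i)) sums U"
proof -
  have "norm (t 0 0) \<le> K" using bd[of 0 0] by simp
  then have K: "K \<ge> 0" using norm_ge_zero order_trans by blast
  let ?g = "\<lambda>(k, q). K * (1 / 2 :: real) ^ k * (1 / 2) ^ q"
  have geo: "((\<lambda>q. (1 / 2 :: real) ^ q) has_sum 2) UNIV"
    using norm_summable_imp_has_sum[of "\<lambda>q. (1 / 2 :: real) ^ q" 2] geometric_sums[of "1 / 2 :: real"]
    by (simp add: summable_geometric)
  have "?g summable_on (UNIV \<times> UNIV)"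
  proof (rule summable_on_SigmaI)
    show "((\<lambda>q. ?g (k, q)) has_sum K * (1 / 2) ^ k * 2) UNIV" for k
      using has_sum_cmult_right[OF geo, of "K * (1 / 2) ^ k"] by simp
    show "(\<lambda>k. K * (1 / 2) ^ k * 2) summable_on UNIV"
      using summable_on_cmult_left[OF summable_on_cmult_right[OF has_sum_imp_summable[OF geo], of K], of 2] by simp
    show "0 \<le> ?g (k, q)" for k q using K by simp
  qed
  then have "(\<lambda>x. norm (case_prod t x)) summable_on (UNIV \<times> UNIV)"
    by (rule Infinite_Sum.abs_summable_on_comparison_test') (use bd in auto)
  then have summ: "case_prod t summable_on (UNIV \<times> UNIV)" by (rule Infinite_Sum.abs_summable_summable)
  define Z where "Z = infsum (case_prod t) (UNIV \<times> UNIV)"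
  have Z: "(case_prod t has_sum Z) (UNIV \<times> UNIV)" unfolding Z_def by (rule has_sum_infsum[OF summ])
  have inner': "((\<lambda>q. case_prod t (k, q)) has_sum u k) UNIV" for k
  proof -
    have "summable (\<lambda>q. norm (t k q))"
    proof (rule summable_comparison_test')
      show "summable (\<lambda>q. K * (1 / 2) ^ k * (1 / 2 :: real) ^ q)" by (intro summable_mult summable_geometric) simp
      show "norm (norm (t k q)) \<le> K * (1 / 2) ^ k * (1 / 2) ^ q" if "q \<ge> 0" for q using bd by simp
    qed
    from norm_summable_imp_has_sum[OF this inner] show ?thesis by simp
  qed
  have "(u has_sum Z) UNIV" by (rule has_sum_Sigma'[OF Z inner'])
  then have "u sums Z" by (rule has_sum_imp_sums)
  then have ZU: "Z = U" using outer sums_unique2 by blast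
  have bij: "bij_betw (\<lambda>(p, i). (i, p - i)) (Sigma UNIV (\<lambda>p::nat. {..p})) (UNIV \<times> UNIV)"
    by (rule bij_betwI[where g = "\<lambda>(k, q). (k + q, k)"]) auto
  have "((\<lambda>x. case_prod t ((\<lambda>(p, i). (i, p - i)) x)) has_sum U) (Sigma UNIV (\<lambda>p::nat. {..p}))"
    using has_sum_reindex_bij_betw[OF bij, of "case_prod t" U] Z ZU by blast
  then have "((\<lambda>p. \<Sum>i\<le>p. t i (p - i)) has_sum U) UNIV"
  proof (rule has_sum_Sigma')
    show "((\<lambda>i. case_prod t ((\<lambda>(p, i). (i, p - i)) (p, i))) has_sum (\<Sum>i\<le>p. t i (p - i))) {..p}" for p
      using has_sum_finite[of "{..p}" "\<lambda>i. t i (p - i)"] by simp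
  qed
  then show ?thesis by (rule has_sum_imp_sums)
qed

lemma sum_index_words_split:
  assumes "i \<le> p"
  shows "(\<Sum>w\<in>index_words n p. f (take i w) (drop i w)) =
    (\<Sum>u\<in>index_words n i. \<Sum>v\<in>index_words n (p - i). f u v)"
  unfolding sum.cartesian_product
proof (rule sum.reindex_bij_witness[of _ "\<lambda>(u, v). u @ v" "\<lambda>w. (take i w, drop i w)"])
  fix w assume "w \<in> index_words n p"
  then show "(take i w, drop i w) \<in> index_words n i \<times> index_words n (p - i)"
    using assms set_take_subset[of i w] set_drop_subset[of i w] by (auto simp: index_words_def)
qed (use assms in \<open>auto simp: index_words_def\<close>)

text \<open>The concatenation product of noncommutative formal series, read on coefficients: a word
  is cut in all possible ways into a prefix and a suffix.\<close>

definition conv :: "(nat list \<Rightarrow> real) \<Rightarrow> (nat list \<Rightarrow> real) \<Rightarrow> nat list \<Rightarrow> real" where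
  "conv c d w = (\<Sum>i\<le>length w. c (take i w) * d (drop i w))"

definition unit_series :: "nat list \<Rightarrow> real" where
  "unit_series w = (if w = [] then 1 else 0)"

definition convs :: "(nat list \<Rightarrow> real) list \<Rightarrow> nat list \<Rightarrow> real" where
  "convs cs = foldr conv cs unit_series"

definition dilate :: "real \<Rightarrow> (nat list \<Rightarrow> real) \<Rightarrow> nat list \<Rightarrow> real" where
  "dilate t c w = t ^ length w * c w"

lemma sum_conv:
  fixes g :: "nat list \<Rightarrow> 'b::real_algebra_1"
  shows "(\<Sum>w\<in>index_words n p. of_real (conv c d w) * g w) =
    (\<Sum>i\<le>p. \<Sum>u\<in>index_words n i. \<Sum>v\<in>index_words n (p - i). of_real (c u * d v) * g (u @ v))"
proof -
  have "(\<Sum>w\<in>index_words n p. of_real (conv c d w) * g w)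
      = (\<Sum>w\<in>index_words n p. \<Sum>i\<le>p. of_real (c (take i w) * d (drop i w)) * g (take i w @ drop i w))"
    by (intro sum.cong refl) (auto simp: conv_def index_words_def sum_distrib_right)
  also have "\<dots> = (\<Sum>i\<le>p. \<Sum>w\<in>index_words n p. of_real (c (take i w) * d (drop i w)) * g (take i w @ drop i w))"
    by (rule sum.swap)
  also have "\<dots> = (\<Sum>i\<le>p. \<Sum>u\<in>index_words n i. \<Sum>v\<in>index_words n (p - i). of_real (c u * d v) * g (u @ v))"
    by (intro sum.cong refl sum_index_words_split[where f = "\<lambda>u v. of_real (c u * d v) * g (u @ v)"]) auto
  finally show ?thesis .
qed

text \<open>With the factorial weights, summing over the cuts is the binomial theorem for
  \<open>(a + b) ^ p\<close>. The radii add, so repeated products eventually exceed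
  \<open>a0\<close>.\<close>

lemma factorial_bound_conv:
  assumes c: "factorial_bound n C a c" "0 \<le> a" and d: "factorial_bound n D b d" "0 \<le> b"
  shows "factorial_bound n (C * D) (a + b) (conv c d)"
  unfolding factorial_bound_def
proof
  fix p
  let ?W = "\<lambda>c i. \<Sum>w\<in>index_words n i. \<bar>c w\<bar>"
  have W: "?W c i \<le> C * a ^ i / fact i" "?W d i \<le> D * b ^ i / fact i" for i
    using c(1) d(1) unfolding factorial_bound_def by (simp_all add: field_simps)
  have "?W (conv c d) p \<le> (\<Sum>w\<in>index_words n p. \<Sum>i\<le>p. \<bar>c (take i w)\<bar> * \<bar>d (drop i w)\<bar>)"
  proof (rule sum_mono)
    fix w assume "w \<in> index_words n p"
    then have "length w = p" by (simp add: index_words_def)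
    then show "\<bar>conv c d w\<bar> \<le> (\<Sum>i\<le>p. \<bar>c (take i w)\<bar> * \<bar>d (drop i w)\<bar>)"
      unfolding conv_def using sum_abs[of "\<lambda>i. c (take i w) * d (drop i w)" "{..p}"] by (simp add: abs_mult)
  qed
  also have "\<dots> = (\<Sum>i\<le>p. \<Sum>w\<in>index_words n p. \<bar>c (take i w)\<bar> * \<bar>d (drop i w)\<bar>)" by (rule sum.swap)
  also have "\<dots> = (\<Sum>i\<le>p. ?W c i * ?W d (p - i))"
    by (intro sum.cong refl) (auto simp: sum_product
        intro!: sum_index_words_split[where f = "\<lambda>u v. \<bar>c u\<bar> * \<bar>d v\<bar>"])
  also have "\<dots> \<le> (\<Sum>i\<le>p. C * a ^ i / fact i * (D * b ^ (p - i) / fact (p - i)))"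
    using W c d factorial_bound_nonneg[OF c(1)] by (intro sum_mono mult_mono) (auto intro: sum_nonneg)
  finally have "?W (conv c d) p * fact p \<le> (\<Sum>i\<le>p. C * a ^ i / fact i * (D * b ^ (p - i) / fact (p - i))) * fact p"
    by (rule mult_right_mono) simp
  also have "\<dots> = (\<Sum>i\<le>p. C * D * (of_nat (p choose i) * a ^ i * b ^ (p - i)))"
    unfolding sum_distrib_right
    by (intro sum.cong refl) (simp add: binomial_fact field_simps)
  also have "\<dots> = C * D * (a + b) ^ p"
    by (simp add: binomial_ring sum_distrib_left)
  finally show "?W (conv c d) p * fact p \<le> C * D * (a + b) ^ p" .
qed

lemma factorial_bound_unit: "factorial_bound n 1 0 unit_series"
proof -
  have "(\<Sum>w\<in>index_words n p. \<bar>unit_series w\<bar>) * fact p \<le> 1 * 0 ^ p" for p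
  proof (cases "p = 0")
    case False
    then have "(\<Sum>w\<in>index_words n p. \<bar>unit_series w\<bar>) = 0"
      by (intro sum.neutral) (auto simp: unit_series_def index_words_def)
    then show ?thesis using False by simp
  qed (simp add: index_words_0 unit_series_def)
  then show ?thesis unfolding factorial_bound_def by blast
qed

lemma factorial_bound_dilate:
  assumes "factorial_bound n C a c" "0 \<le> t"
  shows "factorial_bound n C (t * a) (dilate t c)"
  unfolding factorial_bound_def
proof
  fix p
  have "(\<Sum>w\<in>index_words n p. \<bar>dilate t c w\<bar>) = t ^ p * (\<Sum>w\<in>index_words n p. \<bar>c w\<bar>)"
    unfolding sum_distrib_left using assms(2)
    by (intro sum.cong refl) (auto simp: dilate_def index_words_def abs_mult)
  moreover have "t ^ p * ((\<Sum>w\<in>index_words n p. \<bar>c w\<bar>) * fact p) \<le> t ^ p * (C * a ^ p)"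
    using assms unfolding factorial_bound_def by (intro mult_left_mono) auto
  ultimately show "(\<Sum>w\<in>index_words n p. \<bar>dilate t c w\<bar>) * fact p \<le> C * (t * a) ^ p"
    by (simp add: power_mult_distrib mult_ac)
qed

lemma dilate_unit: "dilate t unit_series = unit_series"
  by (simp add: fun_eq_iff dilate_def unit_series_def)

lemma dilate_conv: "dilate t (conv c d) = conv (dilate t c) (dilate t d)"
proof
  fix w
  have "t ^ length w * (c (take i w) * d (drop i w)) = dilate t c (take i w) * dilate t d (drop i w)"
    if "i \<le> length w" for i
    using that by (simp add: dilate_def min_def flip: power_add)
  then show "dilate t (conv c d) w = conv (dilate t c) (dilate t d) w"
    unfolding conv_def dilate_def[of t "conv c d"] sum_distrib_left by (intro sum.cong) auto
qed

lemma dilate_convs: "dilate t (convs cs) = convs (map (dilate t) cs)"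
  by (induction cs) (simp_all add: convs_def dilate_unit dilate_conv)

context analytic_vector_fields
begin

lemma act_conv:
  assumes F: "F \<in> holomorphic_functions S" and \<xi>: "\<xi> \<in> S"
  shows "act (conv c d) p F \<xi> = (\<Sum>i\<le>p. act c i (act d (p - i) F) \<xi>)"
proof -
  have 1: "act c i (act d q F) \<xi>
      = (\<Sum>u\<in>index_words n i. \<Sum>v\<in>index_words n q. complex_of_real (c u * d v) * iter_field (u @ v) F \<xi>)" for i q
  proof -
    have "iter_field u (act d q F) \<xi> = (\<Sum>v\<in>index_words n q. of_real (d v) * iter_field (u @ v) F \<xi>)"
      if u: "u \<in> index_words n i" for u
      unfolding act_def[abs_def] iter_field_append using u
      by (intro iter_field_lincomb iter_field_holomorphic F \<xi>) (auto simp: index_words_def)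
    then show ?thesis
      unfolding act_def[of c] by (simp add: sum_distrib_left mult_ac)
  qed
  show ?thesis unfolding 1 unfolding act_def by (rule sum_conv)
qed

lemma act_dilate: "act (dilate t c) p F \<xi> = of_real (t ^ p) * act c p F \<xi>"
  unfolding act_def sum_distrib_left
  by (intro sum.cong refl) (auto simp: dilate_def index_words_def mult_ac)

lemma grouplike_dilate:
  assumes "grouplike c"
  shows "grouplike (dilate t c)"
  unfolding grouplike_def
proof (intro conjI ballI allI)
  show "dilate t c [] = 1" using assms by (simp add: dilate_def grouplike_def)
  fix F G p \<xi>
  assume *: "F \<in> holomorphic_functions S" "G \<in> holomorphic_functions S" "\<xi> \<in> S"
  then have "act c p (\<lambda>x. F x * G x) \<xi> = (\<Sum>i\<le>p. act c i F \<xi> * act c (p - i) G \<xi>)"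
    using assms unfolding grouplike_def by blast
  then have "act (dilate t c) p (\<lambda>x. F x * G x) \<xi>
      = (\<Sum>i\<le>p. of_real (t ^ i * t ^ (p - i)) * (act c i F \<xi> * act c (p - i) G \<xi>))"
    by (simp add: act_dilate sum_distrib_left flip: power_add)
  then show "act (dilate t c) p (\<lambda>x. F x * G x) \<xi>
      = (\<Sum>i\<le>p. act (dilate t c) i F \<xi> * act (dilate t c) (p - i) G \<xi>)"
    by (simp add: act_dilate mult_ac)
qed

lemma act_unit: "act unit_series p F \<xi> = (if p = 0 then F \<xi> else 0)"
proof (cases "p = 0")
  case False
  then show ?thesis unfolding act_def
    by (auto simp: unit_series_def index_words_def intro!: sum.neutral)
qed (simp add: act_0 unit_series_def)

end

context charted_vector_fields
begin

lemma admissible_dilate: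
  assumes "admissible c" "0 \<le> t" "t \<le> 1"
  shows "admissible (dilate t c)"
proof -
  obtain C a where c: "factorial_bound n C a c" "0 \<le> a" "a \<le> a0" and g: "grouplike c"
    using assms(1) unfolding admissible_def by blast
  have "t * a \<le> 1 * a0" using c assms by (intro mult_mono) auto
  then show ?thesis unfolding admissible_def
    using grouplike_dilate[OF g] factorial_bound_dilate[OF c(1) assms(2)] c(2) assms(2)
    by (metis mult_1 mult_nonneg_nonneg)
qed

text \<open>The two actions are estimated together, as derivatives along concatenated words of
  length \<open>k + q\<close>, so that only one Cauchy margin is spent. The price is the factor
  \<open>k + q choose k\<close>, at most \<open>2 ^ (k + q)\<close>, which lowers the rate from 1/4
  to 1/2.\<close>

lemma iterated_local_act_bound:
  assumes ch: "chart \<delta> B p r Y" and c: "factorial_bound n C a c" "0 \<le> a" "a \<le> a0"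
    and d: "factorial_bound n D b d" "0 \<le> b" "b \<le> a0"
    and G: "holomorphic_fun_on (ball p h) G" "\<And>y. y \<in> ball p h \<Longrightarrow> norm (G y) \<le> S0"
  shows "norm (local_act n Y c k (local_act n Y d q G) p) \<le> C * D * S0 * (1 / 2) ^ k * (1 / 2) ^ q"
proof -
  let ?R = "exp 1 * B / h"
  have R: "?R \<ge> 0" using B_pos h_pos by simp
  have Yh: "holomorphic_map_on (ball p h) (Y j)" if "j < n" for j
    by (rule chart_holomorphic_field[OF ch _ that]) (use h_le \<delta>_pos in auto)
  have "norm (G p) \<le> S0" using h_pos by (intro G) simp
  then have S0: "S0 \<ge> 0" using norm_ge_zero order_trans by blast
  have eq: "local_act n Y c k (local_act n Y d q G) p
      = (\<Sum>u\<in>index_words n k. \<Sum>v\<in>index_words n q. of_real (c u * d v) * iter_deriv Y (u @ v) G p)"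
  proof -
    have "iter_deriv Y u (local_act n Y d q G) p = (\<Sum>v\<in>index_words n q. of_real (d v) * iter_deriv Y (u @ v) G p)"
      if u: "u \<in> index_words n k" for u
      unfolding local_act_def[abs_def] iter_deriv_append using u h_pos
      by (intro iter_deriv_lincomb[of "ball p h"] holomorphic_iter_deriv Yh G(1)) (auto simp: index_words_def)
    then show ?thesis unfolding local_act_def[of n Y c] by (simp add: sum_distrib_left mult_ac)
  qed
  let ?E = "S0 * ?R ^ (k + q) * fact (k + q)"
  have "norm (local_act n Y c k (local_act n Y d q G) p)
      \<le> (\<Sum>u\<in>index_words n k. \<Sum>v\<in>index_words n q. \<bar>c u\<bar> * \<bar>d v\<bar> * ?E)"
    unfolding eq
  proof (intro sum_norm_le)
    fix u v assume uv: "u \<in> index_words n k" "v \<in> index_words n q"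
    have "norm (iter_deriv Y (u @ v) G p) \<le> S0 * ?R ^ length (u @ v) * fact (length (u @ v))"
    proof (rule iter_deriv_bound[where s = 0])
      show "holomorphic_map_on (ball p (0 + h)) (Y j)" if "j \<in> set (u @ v)" for j
        using Yh[of j] that uv by (auto simp: index_words_def)
      show "norm (Y j y) \<le> B" if j: "j \<in> set (u @ v)" and y: "y \<in> ball p (0 + h)" for j y
      proof -
        have "y \<in> ball p \<delta>" using y h_le \<delta>_pos by auto
        moreover have "j < n" using j uv by (auto simp: index_words_def)
        ultimately show ?thesis using ch unfolding chart_def by blast
      qed
    qed (use G S0 B_pos h_pos in auto)
    then have "norm (iter_deriv Y (u @ v) G p) \<le> ?E" using uv by (simp add: index_words_def)
    then show "norm (complex_of_real (c u * d v) * iter_deriv Y (u @ v) G p) \<le> \<bar>c u\<bar> * \<bar>d v\<bar> * ?E"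
      by (simp add: norm_mult abs_mult mult_left_mono)
  qed
  also have "\<dots> = (\<Sum>u\<in>index_words n k. \<bar>c u\<bar>) * (\<Sum>v\<in>index_words n q. \<bar>d v\<bar>) * ?E"
    by (simp only: sum_product) (simp only: sum_distrib_right)
  also have "\<dots> \<le> (C * a ^ k / fact k) * (D * b ^ q / fact q) * ?E"
  proof (intro mult_right_mono mult_mono)
    show "(\<Sum>u\<in>index_words n k. \<bar>c u\<bar>) \<le> C * a ^ k / fact k" "(\<Sum>v\<in>index_words n q. \<bar>d v\<bar>) \<le> D * b ^ q / fact q"
      using c(1) d(1) unfolding factorial_bound_def by (simp_all add: field_simps)
  qed (use S0 R c(2) factorial_bound_nonneg[OF c(1)] in \<open>auto intro: sum_nonneg\<close>)
  also have "\<dots> = C * D * S0 * real (k + q choose k) * ((a * ?R) ^ k * (b * ?R) ^ q)"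
    unfolding binomial_fact[OF le_add1] power_mult_distrib power_add by simp
  also have "\<dots> \<le> C * D * S0 * 2 ^ (k + q) * ((1 / 4) ^ k * (1 / 4) ^ q)"
  proof (intro mult_mono mult_left_mono)
    have "k + q choose k \<le> 2 ^ (k + q)" by (rule binomial_le_pow2)
    then show "real (k + q choose k) \<le> 2 ^ (k + q)" by (metis of_nat_le_iff of_nat_numeral of_nat_power)
    show "(a * ?R) ^ k \<le> (1 / 4) ^ k" "(b * ?R) ^ q \<le> (1 / 4) ^ q"
      using a0_rate[OF c(2,3) order_refl] a0_rate[OF d(2,3) order_refl] by (auto intro: power_mono)
  qed (use S0 B_pos h_pos c(2) d(2) factorial_bound_nonneg[OF c(1)] factorial_bound_nonneg[OF d(1)] in
      \<open>auto intro!: mult_nonneg_nonneg zero_le_power divide_nonneg_pos\<close>)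
  also have "\<dots> = C * D * S0 * (1 / 2) ^ k * (1 / 2) ^ q"
  proof -
    have "(2::real) ^ k * (1 / 4) ^ k = (1 / 2) ^ k" for k by (simp flip: power_mult_distrib)
    from this[of k] this[of q] show ?thesis by (simp add: power_add mult_ac)
  qed
  finally show ?thesis .
qed

text \<open>The inner series sums to a function \<open>H\<close>, holomorphic near \<open>m\<close>,
  and \<open>local_evaluation\<close> sends \<open>H\<close> to its value at the moved point, which
  is \<open>f (flow c m)\<close>. The double series is then regrouped by total degree. The limit
  \<open>f\<close> is left abstract so that the lemma can be iterated over a list of
  factors.\<close>

lemma act_conv_sums:
  assumes c: "admissible c" and d: "factorial_bound n D b d" "0 \<le> b" "b \<le> a0"
    and F: "F \<in> holomorphic_functions S" and m: "m \<in> M"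
    and f: "\<And>m. m \<in> M \<Longrightarrow> (\<lambda>q. act d q F (complexify m)) sums f m"
  shows "(\<lambda>p. act (conv c d) p F (complexify m)) sums f (flow c m)"
proof -
  let ?p = "complexify m"
  obtain C a where ca: "factorial_bound n C a c" "0 \<le> a" "a \<le> a0" using c unfolding admissible_def by blast
  obtain r Y where ch: "chart \<delta> B ?p r Y" using charts[OF m] by blast
  obtain S0 where S0: "\<And>x. x \<in> ball ?p (3 * \<delta> / 4) \<Longrightarrow> norm (F (r x)) \<le> S0"
    using chart_extension_bounded[OF ch F] by metis
  define Hq where "Hq q = local_act n Y d q (\<lambda>x. F (r x))" for q
  define H where "H x = suminf (\<lambda>q. Hq q x)" for x
  have ext: "holomorphic_fun_on (ball ?p (3 * \<delta> / 4)) (\<lambda>x. F (r x))"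
    by (rule chart_extension_subset[OF ch F]) (use \<delta>_pos in simp)
  note loc = local_series_holomorphic[OF ch d ext S0, folded Hq_def, folded H_def]
  have sub: "ball ?p h \<subseteq> ball ?p (\<delta> / 2)" using h_le \<delta>_pos by (intro subset_ball) auto
  have Hqhol: "holomorphic_fun_on (ball ?p \<delta>) (Hq q)" for q
    unfolding Hq_def by (rule holomorphic_local_act[OF open_ball chart_holomorphic_field[OF ch order_refl] chart_extension[OF ch F]])
  have Hhol: "holomorphic_fun_on (ball ?p (\<delta> / 2)) H" using loc(2) by (simp add: H_def[abs_def])
  have Hqloc: "Hq q x = act d q F x" if "x \<in> S \<inter> ball ?p \<delta>" for q x
    unfolding Hq_def using act_eq_local_act_extension[OF ch F that] by simp
  have "H (ev_point c m) = f (flow c m)"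
  proof -
    have q: "complexify (flow c m) \<in> ball ?p (\<delta> / 2)"
      using ev_point_polydisc[OF c m] polydisc_2h unfolding complexify_flow[OF c m] by blast
    then have "Hq q (complexify (flow c m)) = act d q F (complexify (flow c m))" for q
      by (intro Hqloc) (use M_S[OF flow_in_M[OF c m]] \<delta>_pos in auto)
    then show ?thesis unfolding H_def complexify_flow[OF c m, symmetric]
      using sums_unique[OF f[OF flow_in_M[OF c m]]] by simp
  qed
  moreover have "(\<lambda>k. local_act n Y c k H ?p) sums H (ev_point c m)"
    by (rule local_evaluation[OF c m ch Hhol loc(4)])
  ultimately have outer: "(\<lambda>k. local_act n Y c k H ?p) sums f (flow c m)" by simp
  \<comment> \<open>The degree \<open>k\<close> part of the action is continuous for uniform
    convergence on the ball of radius \<open>h\<close>, with constant at most \<open>C\<close>; it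
    therefore commutes with the sum over \<open>q\<close>.\<close>
  have inner: "(\<lambda>q. local_act n Y c k (Hq q) ?p) sums local_act n Y c k H ?p" for k
    unfolding sums_def
  proof (rule LIMSEQ_I)
    fix e :: real assume e: "e > 0"
    have C: "C \<ge> 0" by (rule factorial_bound_nonneg[OF ca(1)])
    \<comment> \<open>The summand 1 covers \<open>C = 0\<close>.\<close>
    define e' where "e' = e / (C + 1)"
    have e': "e' > 0" "C * e' < e" using e C by (auto simp: e'_def field_simps)
    obtain Q where Q: "\<And>l x. l \<ge> Q \<Longrightarrow> x \<in> ball ?p (\<delta> / 2) \<Longrightarrow> dist (\<Sum>i<l. Hq i x) (H x) < e'"
      using uniform_limitD[OF loc(1) e'(1)] unfolding eventually_sequentially H_def by blast
    have Yh: "holomorphic_map_on (ball ?p h) (Y j)" if "j < n" for j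
      by (rule chart_holomorphic_field[OF ch _ that]) (use h_le \<delta>_pos in auto)
    have Hh: "holomorphic_fun_on (ball ?p h) H" using Hhol sub by (rule holomorphic_fun_on_subset)
    have Hqh: "holomorphic_fun_on (ball ?p h) (Hq q)" for q
      by (rule holomorphic_fun_on_subset[OF Hqhol]) (use h_le \<delta>_pos in auto)
    have hs: "holomorphic_fun_on (ball ?p h) (\<lambda>x. \<Sum>i<l. 1 * Hq i x)" for l
      by (intro holomorphic_fun_on_sum holomorphic_fun_on_mult holomorphic_fun_on_const Hqh)
    have "norm ((\<Sum>i<l. local_act n Y c k (Hq i) ?p) - local_act n Y c k H ?p) < e" if l: "l \<ge> Q" for l
    proof -
      have "(\<Sum>i<l. local_act n Y c k (Hq i) ?p) - local_act n Y c k H ?p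
          = local_act n Y c k (\<lambda>x. (\<Sum>i<l. 1 * Hq i x) - H x) ?p"
        using h_pos local_act_lincomb[of "ball ?p h" n Y "{..<l}" Hq ?p c k "\<lambda>_. 1"]
        by (subst local_act_diff[of "ball ?p h" n Y, OF open_ball Yh hs Hh]) (auto simp: Yh Hqh)
      moreover have "norm (local_act n Y c k (\<lambda>x. (\<Sum>i<l. 1 * Hq i x) - H x) ?p) \<le> C * e' * (1 / 4) ^ k"
      proof (rule local_act_decay[OF ch _ _ order_refl _ ca, where s = 0])
        show "holomorphic_fun_on (ball ?p (0 + h)) (\<lambda>x. (\<Sum>i<l. 1 * Hq i x) - H x)"
          using holomorphic_fun_on_diff[OF hs Hh] by simp
        show "norm ((\<Sum>i<l. 1 * Hq i y) - H y) \<le> e'" if "y \<in> ball ?p (0 + h)" for y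
          using Q[OF l, of y] that sub by (auto simp: dist_norm)
      qed (use h_le \<delta>_pos in auto)
      moreover have "C * e' * (1 / 4) ^ k \<le> C * e' * 1"
        using C e' by (intro mult_left_mono power_le_one) auto
      ultimately show ?thesis using e'(2) by simp
    qed
    then show "\<exists>no. \<forall>l\<ge>no. norm ((\<Sum>i<l. local_act n Y c k (Hq i) ?p) - local_act n Y c k H ?p) < e" by blast
  qed
  have "(\<lambda>p. \<Sum>i\<le>p. local_act n Y c i (Hq (p - i)) ?p) sums f (flow c m)"
  proof (rule double_series_diagonal[OF _ inner outer])
    show "norm (local_act n Y c k (Hq q) ?p) \<le> C * D * S0 * (1 / 2) ^ k * (1 / 2) ^ q" for k q
      unfolding Hq_def
    proof (rule iterated_local_act_bound[OF ch ca d])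
      show "holomorphic_fun_on (ball ?p h) (\<lambda>x. F (r x))"
        by (rule chart_extension_subset[OF ch F]) (use h_le \<delta>_pos in simp)
      show "norm (F (r y)) \<le> S0" if "y \<in> ball ?p h" for y
        using that h_le \<delta>_pos by (intro S0) auto
    qed
  qed
  moreover have "local_act n Y c i (Hq q) ?p = act c i (act d q F) ?p" for i q
    by (rule act_eq_local_act[OF ch order_refl Hqhol, symmetric]) (use Hqloc M_S[OF m] \<delta>_pos in auto)
  ultimately show ?thesis by (simp add: act_conv[OF F M_S[OF m]])
qed

lemma fold_flow_in_M: "(\<And>c. c \<in> set cs \<Longrightarrow> admissible c) \<Longrightarrow> m \<in> M \<Longrightarrow> fold flow cs m \<in> M"
  by (induction cs arbitrary: m) (auto simp: flow_in_M)

text \<open>Since radii add, one convergent series describes the whole composition as long as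
  \<open>length cs * a\<close> does not exceed \<open>a0\<close>. The first factor acts outermost on
  functions, hence its flow is applied first to points, which is the order of
  \<open>fold\<close>.\<close>

lemma act_convs_sums:
  assumes a: "0 \<le> a" and cs: "\<And>c. c \<in> set cs \<Longrightarrow> grouplike c \<and> (\<exists>C. factorial_bound n C a c)"
    and small: "real (length cs) * a \<le> a0"
    and F: "F \<in> holomorphic_functions S"
  shows "(\<exists>C. factorial_bound n C (real (length cs) * a) (convs cs)) \<and>
    (\<forall>m\<in>M. (\<lambda>p. act (convs cs) p F (complexify m)) sums F (complexify (fold flow cs m)))"
  using cs small
proof (induction cs)
  case Nil
  have "(\<lambda>p. if p = 0 then F (complexify m) else 0) sums F (complexify m)" for m
    using sums_single[of 0 "\<lambda>_. F (complexify m)"] by simp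
  then show ?case using factorial_bound_unit by (auto simp: convs_def act_unit)
next
  case (Cons c cs)
  have le: "real (length cs) * a + a \<le> a0" using Cons.prems(2) by (simp add: algebra_simps)
  have le1: "a \<le> a0" "real (length cs) * a \<le> a0"
    using le a mult_nonneg_nonneg[of "real (length cs)" a] by linarith+
  obtain D where D: "factorial_bound n D (real (length cs) * a) (convs cs)"
    and IH: "\<And>m. m \<in> M \<Longrightarrow> (\<lambda>p. act (convs cs) p F (complexify m)) sums F (complexify (fold flow cs m))"
    using Cons.IH Cons.prems(1) le1(2) by auto
  obtain C where C: "factorial_bound n C a c" and "grouplike c" using Cons.prems(1) by auto
  then have adm: "admissible c" using a le1 unfolding admissible_def by blast
  have eq: "convs (c # cs) = conv c (convs cs)" by (simp add: convs_def)
  have "factorial_bound n (C * D) (a + real (length cs) * a) (conv c (convs cs))"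
    by (rule factorial_bound_conv[OF C a D]) (use a in simp)
  moreover have "(\<lambda>p. act (conv c (convs cs)) p F (complexify m)) sums F (complexify (fold flow cs (flow c m)))"
    if "m \<in> M" for m
    using act_conv_sums[OF adm D _ le1(2) F that IH] a by simp
  ultimately show ?case unfolding eq by (auto simp: algebra_simps)
qed

end

section \<open>Analytic continuation along dilations\<close>

text \<open>Analyticity on the closed unit interval, end points included: holomorphic extensions to
  discs about its points, compared with \<open>f\<close> only inside the interval.\<close>

definition locally_analytic :: "(real \<Rightarrow> complex) \<Rightarrow> bool" where
  "locally_analytic f \<longleftrightarrow> (\<forall>t0\<in>{0..1}. \<exists>e>0. \<exists>g. g holomorphic_on ball (of_real t0) e \<and>
    (\<forall>t\<in>{0..1}. \<bar>t - t0\<bar> < e \<longrightarrow> g (of_real t) = f t))"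

lemma locally_analytic_const: "locally_analytic (\<lambda>_. c)"
  unfolding locally_analytic_def
  by (intro ballI exI[of _ 1] conjI exI[of _ "\<lambda>_. c"]) auto

lemma locally_analytic_diff:
  assumes "locally_analytic f" "locally_analytic g"
  shows "locally_analytic (\<lambda>t. f t - g t)"
  unfolding locally_analytic_def
proof
  fix t0 :: real assume t0: "t0 \<in> {0..1}"
  obtain e1 F where 1: "e1 > 0" "F holomorphic_on ball (of_real t0) e1"
    "\<And>t. t \<in> {0..1} \<Longrightarrow> \<bar>t - t0\<bar> < e1 \<Longrightarrow> F (of_real t) = f t"
    using assms(1) t0 unfolding locally_analytic_def by meson
  obtain e2 G where 2: "e2 > 0" "G holomorphic_on ball (of_real t0) e2"
    "\<And>t. t \<in> {0..1} \<Longrightarrow> \<bar>t - t0\<bar> < e2 \<Longrightarrow> G (of_real t) = g t"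
    using assms(2) t0 unfolding locally_analytic_def by meson
  have "(\<lambda>z. F z - G z) holomorphic_on ball (of_real t0) (min e1 e2)"
    by (intro holomorphic_intros holomorphic_on_subset[OF 1(2)] holomorphic_on_subset[OF 2(2)]) auto
  then show "\<exists>e>0. \<exists>H. H holomorphic_on ball (of_real t0) e \<and>
      (\<forall>t\<in>{0..1}. \<bar>t - t0\<bar> < e \<longrightarrow> H (of_real t) = f t - g t)"
    using 1 2 by (intro exI[of _ "min e1 e2"] conjI exI[of _ "\<lambda>z. F z - G z"]) auto
qed

text \<open>At the infimum \<open>t0\<close> of the points where \<open>f\<close> is nonzero, the
  local holomorphic extension vanishes on a real segment to the left of \<open>t0\<close>, hence on
  its whole disc by the identity theorem, contrary to the choice of \<open>t0\<close>.\<close>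

lemma locally_analytic_eq_zero:
  assumes f: "locally_analytic f" and \<eta>: "\<eta> > 0" "\<And>t. t \<in> {0..1} \<Longrightarrow> t < \<eta> \<Longrightarrow> f t = 0"
    and t: "t \<in> {0..1}"
  shows "f t = 0"
proof (rule ccontr)
  assume ft: "f t \<noteq> 0"
  define T where "T = {t \<in> {0..1}. f t \<noteq> 0}"
  have T: "t \<in> T" "bdd_below T" using ft t by (auto simp: T_def intro!: bdd_belowI[of _ 0])
  define t0 where "t0 = Inf T"
  have "\<eta> \<le> t0" unfolding t0_def
    by (rule cInf_greatest) (use T \<eta> in \<open>auto simp: T_def not_less[symmetric]\<close>)
  then have t0: "0 < t0" using \<eta>(1) by simp
  have "t0 \<le> 1" using cInf_lower[OF T] t by (simp add: t0_def)
  then have "t0 \<in> {0..1}" using t0 by simp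
  then obtain e g where e: "e > 0" "g holomorphic_on ball (of_real t0) e"
    "\<And>t. t \<in> {0..1} \<Longrightarrow> \<bar>t - t0\<bar> < e \<Longrightarrow> g (of_real t) = f t"
    using f unfolding locally_analytic_def by meson
  define U where "U = complex_of_real ` {s. max 0 (t0 - e) < s \<and> s < t0}"
  have gU: "g z = 0" if zU: "z \<in> U" for z
  proof -
    obtain s where s: "z = of_real s" "0 < s" "t0 - e < s" "s < t0" using zU by (auto simp: U_def)
    have "s \<notin> T" using cInf_lower[OF _ T(2), of s] s(4) by (auto simp: t0_def)
    then have "f s = 0" using s \<open>t0 \<le> 1\<close> by (simp add: T_def)
    then show ?thesis using e(3)[of s] s \<open>t0 \<le> 1\<close> by simp
  qed
  have lim: "complex_of_real t0 islimpt U"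
    unfolding islimpt_approachable
  proof (intro allI impI)
    fix d :: real assume d: "d > 0"
    define s where "s = t0 - min d (min e t0) / 2"
    have s: "max 0 (t0 - e) < s" "s < t0" "t0 - s < d" using d e(1) t0 by (auto simp: s_def min_def)
    show "\<exists>x'\<in>U. x' \<noteq> complex_of_real t0 \<and> dist x' (complex_of_real t0) < d"
      using s by (intro bexI[of _ "of_real s"]) (auto simp: U_def dist_real_def simp flip: of_real_diff)
  qed
  have "U \<subseteq> ball (of_real t0) e" by (auto simp: U_def dist_real_def)
  then have g0: "g w = 0" if "w \<in> ball (of_real t0) e" for w
    using analytic_continuation[OF e(2) open_ball connected_ball _ _ lim gU that] e(1) by simp
  obtain s where s: "s \<in> T" "s < t0 + e"
    using cInf_lessD[of T "t0 + e"] T e(1) unfolding t0_def by auto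
  have "t0 \<le> s" using cInf_lower[OF s(1) T(2)] by (simp add: t0_def)
  then have "g (of_real s) = f s" using s by (intro e(3)) (auto simp: T_def)
  moreover have "g (of_real s) = 0" using \<open>t0 \<le> s\<close> s by (intro g0) (simp add: dist_real_def)
  ultimately show False using s(1) by (simp add: T_def)
qed

context charted_vector_fields
begin

text \<open>Off the real axis the dilated action is no longer given by points of \<open>M\<close>; the series in the
  local chart supplies the holomorphic extension in the dilation parameter.\<close>

lemma locally_analytic_flow:
  assumes c: "admissible c" and \<gamma>M: "\<And>t. t \<in> {0..1} \<Longrightarrow> \<gamma> t \<in> M"
    and \<gamma>: "\<And>i. locally_analytic (\<lambda>t. of_real (\<gamma> t $ i))"
  shows "locally_analytic (\<lambda>t. of_real (flow (dilate t c) (\<gamma> t) $ i))"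
  unfolding locally_analytic_def
proof
  fix t0 :: real assume t0: "t0 \<in> {0..1}"
  let ?p = "complexify (\<gamma> t0)"
  obtain C a where ca: "factorial_bound n C a c" "0 \<le> a" "a \<le> a0" using c unfolding admissible_def by blast
  obtain r Y where ch: "chart \<delta> B ?p r Y" using charts[OF \<gamma>M[OF t0]] by blast
  have "\<exists>eg. fst eg > 0 \<and> snd eg holomorphic_on ball (of_real t0) (fst eg) \<and>
    (\<forall>t\<in>{0..1}. \<bar>t - t0\<bar> < fst eg \<longrightarrow> snd eg (of_real t) = of_real (\<gamma> t $ j))" for j
  proof -
    obtain e g where "e > 0" "g holomorphic_on ball (of_real t0) e"
      "\<forall>t\<in>{0..1}. \<bar>t - t0\<bar> < e \<longrightarrow> g (of_real t) = of_real (\<gamma> t $ j)"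
      using \<gamma>[of j] t0 unfolding locally_analytic_def by meson
    then show ?thesis by (intro exI[of _ "(e, g)"]) simp
  qed
  then obtain eg where eg: "\<And>j. fst (eg j) > 0"
    "\<And>j. snd (eg j) holomorphic_on ball (of_real t0) (fst (eg j))"
    "\<And>j t. t \<in> {0..1} \<Longrightarrow> \<bar>t - t0\<bar> < fst (eg j) \<Longrightarrow> snd (eg j) (of_real t) = of_real (\<gamma> t $ j)"
    by metis
  define e0 where "e0 = Min (range (\<lambda>j. fst (eg j)))"
  have e0: "e0 > 0" using eg(1) by (simp add: e0_def)
  have e0j: "e0 \<le> fst (eg j)" for j by (simp add: e0_def)
  define \<Gamma> where "\<Gamma> \<tau> = (\<chi> j. snd (eg j) \<tau>)" for \<tau>
  have \<Gamma>t: "\<Gamma> (of_real t) = complexify (\<gamma> t)" if "t \<in> {0..1}" "\<bar>t - t0\<bar> < e0" for t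
    using eg(3)[OF that(1)] e0j that(2) by (simp add: \<Gamma>_def complexify_def less_le_trans vec_eq_iff)
  have \<Gamma>hol: "(\<lambda>\<tau>. \<Gamma> \<tau> $ j) holomorphic_on ball (of_real t0) e0" for j
    using holomorphic_on_subset[OF eg(2) subset_ball[OF e0j]] by (simp add: \<Gamma>_def)
  have "isCont \<Gamma> (of_real t0)"
    unfolding continuous_at
  proof (rule vec_tendstoI)
    fix j
    have "isCont (\<lambda>\<tau>. \<Gamma> \<tau> $ j) (of_real t0)"
      using holomorphic_on_imp_continuous_on[OF \<Gamma>hol, of j] e0 by (simp add: continuous_on_eq_continuous_at)
    then show "((\<lambda>\<tau>. \<Gamma> \<tau> $ j) \<longlongrightarrow> \<Gamma> (of_real t0) $ j) (at (of_real t0))" by (simp add: continuous_at)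
  qed
  then obtain e1 where e1: "e1 > 0" "\<And>\<tau>. dist \<tau> (of_real t0) < e1 \<Longrightarrow> dist (\<Gamma> \<tau>) (\<Gamma> (of_real t0)) < \<delta> / 2"
    unfolding continuous_at_eps_delta using \<delta>_pos half_gt_zero by metis
  \<comment> \<open>The cap 1 gives \<open>norm \<tau> \<le> 2\<close> on the disc, so the factors
    \<open>\<tau> ^ k\<close> only turn the decay rate 1/4 into 1/2.\<close>
  define e where "e = min (min e0 e1) 1"
  have e: "e > 0" "e \<le> e0" "e \<le> e1" "e \<le> 1" using e0 e1 by (auto simp: e_def)
  have \<Gamma>ball: "\<Gamma> \<tau> \<in> ball ?p (\<delta> / 2)" if "\<tau> \<in> ball (of_real t0) e" for \<tau>
    using e1(2)[of \<tau>] that e \<Gamma>t[OF t0] e0 by (simp add: dist_commute)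
  let ?S0 = "norm ?p + 3 * \<delta> / 4"
  have loc: "norm (local_act n Y c k (\<lambda>x. x $ i) x) \<le> C * ?S0 * (1 / 4) ^ k" if "x \<in> ball ?p (\<delta> / 2)" for k x
    by (rule local_series_holomorphic(5)[OF ch ca holomorphic_fun_on_component coordinate_bounded that])
  define f where "f k \<tau> = \<tau> ^ k * local_act n Y c k (\<lambda>x. x $ i) (\<Gamma> \<tau>)" for k \<tau>
  have fhol: "f k holomorphic_on ball (of_real t0) e" for k
  proof -
    have hl: "holomorphic_fun_on (ball ?p (\<delta> / 2)) (local_act n Y c k (\<lambda>x. x $ i))"
      by (rule holomorphic_local_act[OF open_ball chart_holomorphic_field[OF ch] holomorphic_fun_on_component])
        (use \<delta>_pos in auto)
    have "(\<lambda>\<tau>. local_act n Y c k (\<lambda>x. x $ i) (\<Gamma> \<tau>)) holomorphic_on ball (of_real t0) e"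
      by (rule holomorphic_fun_on_compose_curve_on[OF hl open_ball \<Gamma>ball])
        (use e in \<open>auto intro: holomorphic_on_subset[OF \<Gamma>hol]\<close>)
    then show ?thesis unfolding f_def[abs_def] by (intro holomorphic_intros)
  qed
  have bd: "norm (f k \<tau>) \<le> C * ?S0 * (1 / 2) ^ k" if \<tau>: "\<tau> \<in> ball (of_real t0) e" for k \<tau>
  proof -
    have "norm \<tau> \<le> 2"
      using \<tau> e t0 norm_triangle_sub[of \<tau> "of_real t0"] by (simp add: dist_norm norm_minus_commute)
    then have "norm (f k \<tau>) \<le> 2 ^ k * (C * ?S0 * (1 / 4) ^ k)"
      unfolding f_def norm_mult norm_power
      using loc[OF \<Gamma>ball[OF \<tau>], of k] by (intro mult_mono power_mono) auto
    also have "\<dots> = C * ?S0 * (2 * (1 / 4)) ^ k" unfolding power_mult_distrib by simp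
    finally show ?thesis by simp
  qed
  have sm: "summable (\<lambda>k. C * ?S0 * (1 / 2 :: real) ^ k)" by (intro summable_mult summable_geometric) simp
  note ul = Weierstrass_m_test[OF bd sm]
  have "(\<lambda>\<tau>. suminf (\<lambda>k. f k \<tau>)) holomorphic_on ball (of_real t0) e"
  proof (rule holomorphic_uniform_sequence[OF open_ball])
    show "(\<lambda>\<tau>. \<Sum>i<l. f i \<tau>) holomorphic_on ball (of_real t0) e" for l
      by (intro holomorphic_on_sum fhol)
    fix x assume x: "x \<in> ball (complex_of_real t0) e"
    obtain d where d: "d > 0" "cball x d \<subseteq> ball (of_real t0) e"
      using bspec[OF open_ball[unfolded open_contains_cball] x] by blast
    then show "\<exists>d>0. cball x d \<subseteq> ball (of_real t0) e \<and>
        uniform_limit (cball x d) (\<lambda>l \<tau>. \<Sum>i<l. f i \<tau>) (\<lambda>\<tau>. suminf (\<lambda>k. f k \<tau>)) sequentially"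
      by (intro exI[of _ d] conjI uniform_limit_on_subset[OF ul])
  qed
  moreover have "suminf (\<lambda>k. f k (of_real t)) = of_real (flow (dilate t c) (\<gamma> t) $ i)"
    if t: "t \<in> {0..1}" "\<bar>t - t0\<bar> < e" for t
  proof -
    have tb: "complex_of_real t \<in> ball (of_real t0) e"
      using t(2) by (simp add: dist_real_def abs_minus_commute)
    have \<Gamma>t': "\<Gamma> (of_real t) = complexify (\<gamma> t)" using \<Gamma>t t e by simp
    have "complexify (\<gamma> t) \<in> ball ?p (\<delta> / 2)" using \<Gamma>ball[OF tb] \<Gamma>t' by simp
    then have "act c k (\<lambda>x. x $ i) (complexify (\<gamma> t)) = local_act n Y c k (\<lambda>x. x $ i) (complexify (\<gamma> t))" for k
      by (intro act_eq_local_act[OF ch order_refl holomorphic_fun_on_component])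
        (use M_S[OF \<gamma>M[OF t(1)]] \<delta>_pos in auto)
    then have "f k (of_real t) = act (dilate t c) k (\<lambda>x. x $ i) (complexify (\<gamma> t))" for k
      by (simp add: f_def \<Gamma>t' act_dilate)
    then have "suminf (\<lambda>k. f k (of_real t)) = ev_point (dilate t c) (\<gamma> t) $ i"
      by (simp add: ev_point_def ev_def)
    also have "\<dots> = complexify (flow (dilate t c) (\<gamma> t)) $ i"
      using complexify_flow[OF admissible_dilate[OF c] \<gamma>M[OF t(1)]] t(1) by simp
    finally show ?thesis by (simp add: complexify_def)
  qed
  ultimately show "\<exists>e>0. \<exists>g. g holomorphic_on ball (of_real t0) e \<and>
      (\<forall>t\<in>{0..1}. \<bar>t - t0\<bar> < e \<longrightarrow> g (of_real t) = of_real (flow (dilate t c) (\<gamma> t) $ i))"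
    using e(1) by (intro exI[of _ e] conjI exI[of _ "\<lambda>\<tau>. suminf (\<lambda>k. f k \<tau>)"]) auto
qed

text \<open>Reverse induction, because the last factor acts at a base point that the earlier dilated
  factors have already moved, analytically in \<open>t\<close>.\<close>

lemma locally_analytic_fold_flow:
  assumes "\<And>c. c \<in> set cs \<Longrightarrow> admissible c" "m \<in> M"
  shows "locally_analytic (\<lambda>t. of_real (fold flow (map (dilate t) cs) m $ i))"
  using assms(1)
proof (induction cs arbitrary: i rule: rev_induct)
  case Nil
  then show ?case by (simp add: locally_analytic_const)
next
  case (snoc c cs)
  have "locally_analytic (\<lambda>t. of_real (flow (dilate t c) (fold flow (map (dilate t) cs) m) $ i))"
  proof (rule locally_analytic_flow)
    show "fold flow (map (dilate t) cs) m \<in> M" if "t \<in> {0..1}" for t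
      using snoc.prems that by (intro fold_flow_in_M assms(2)) (auto intro!: admissible_dilate)
  qed (use snoc in auto)
  then show ?case by simp
qed

text \<open>Equality is assumed only for the action on coordinate functions at points of
  \<open>M\<close>, degree by degree. Dilation multiplies degree \<open>p\<close> by
  \<open>t ^ p\<close> on both sides, so the assumption persists for all \<open>t\<close>.\<close>

theorem fold_flow_unique:
  assumes a: "0 \<le> a" "a \<le> a0"
    and cs: "\<And>c. c \<in> set cs \<union> set ds \<Longrightarrow> grouplike c \<and> (\<exists>C. factorial_bound n C a c)"
    and eq: "\<And>i p m. m \<in> M \<Longrightarrow>
      act (convs cs) p (\<lambda>x. x $ i) (complexify m) = act (convs ds) p (\<lambda>x. x $ i) (complexify m)"
    and m: "m \<in> M"
  shows "fold flow cs m = fold flow ds m"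
proof -
  have adm: "admissible c" if "c \<in> set cs \<union> set ds" for c
    using cs[OF that] a unfolding admissible_def by blast
  \<comment> \<open>\<open>L\<close> bounds the lengths of both lists, so \<open>t < \<eta>\<close>
    puts the radius of either dilated product below \<open>a0\<close>. The summands 1 in
    \<open>L\<close> and in \<open>a + 1\<close> cover empty lists and \<open>a = 0\<close>.\<close>
  define L where "L = real (length cs + length ds) + 1"
  define \<eta> where "\<eta> = a0 / (L * (a + 1))"
  have L: "L > 0" by (simp add: L_def)
  have \<eta>: "\<eta> > 0" using a a0_pos L by (simp add: \<eta>_def)
  have small: "of_real (fold flow (map (dilate t) cs) m $ i) - complex_of_real (fold flow (map (dilate t) ds) m $ i) = 0"
    if t: "t \<in> {0..1}" "t < \<eta>" for t i
  proof -
    have "t * (L * (a + 1)) < a0"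
      using t(2) L a unfolding \<eta>_def by (subst (asm) pos_less_divide_eq) auto
    moreover have "t * (L * a) \<le> t * (L * (a + 1))" using t L by (intro mult_left_mono) auto
    ultimately have tL: "L * (t * a) \<le> a0" by (simp add: mult_ac)
    have sums: "(\<lambda>p. act (convs (map (dilate t) es)) p (\<lambda>x. x $ i) (complexify m))
        sums complexify (fold flow (map (dilate t) es) m) $ i"
      if es: "set es \<subseteq> set cs \<union> set ds" "real (length es) \<le> L" for es
    proof -
      have ex: "grouplike (dilate t c) \<and> (\<exists>C. factorial_bound n C (t * a) (dilate t c))" if "c \<in> set es" for c
      proof -
        obtain C where "grouplike c" "factorial_bound n C a c" using cs[of c] es(1) \<open>c \<in> set es\<close> by blast
        then show ?thesis using t grouplike_dilate factorial_bound_dilate[of n C a c t] by auto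
      qed
      have "real (length es) * (t * a) \<le> L * (t * a)" using es(2) t a by (intro mult_right_mono) auto
      with tL have "real (length (map (dilate t) es)) * (t * a) \<le> a0" by simp
      from act_convs_sums[OF _ _ this holomorphic_functions_coord[of i S]] show ?thesis
        using ex t a m by auto
    qed
    have "act (convs (map (dilate t) cs)) p (\<lambda>x. x $ i) (complexify m)
        = act (convs (map (dilate t) ds)) p (\<lambda>x. x $ i) (complexify m)" for p
      using eq[OF m, of p i] by (simp flip: dilate_convs add: act_dilate)
    then have "complexify (fold flow (map (dilate t) cs) m) $ i = complexify (fold flow (map (dilate t) ds) m) $ i"
      using sums_unique2[OF sums[of cs]] sums[of ds] by (simp add: L_def)
    then show ?thesis by (simp add: complexify_def)
  qed
  have "fold flow (map (dilate 1) cs) m $ i = fold flow (map (dilate 1) ds) m $ i" for i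
  proof -
    have "of_real (fold flow (map (dilate 1) cs) m $ i) - complex_of_real (fold flow (map (dilate 1) ds) m $ i) = 0"
      by (rule locally_analytic_eq_zero[OF locally_analytic_diff[OF
            locally_analytic_fold_flow locally_analytic_fold_flow] \<eta> small])
        (use adm m in auto)
    then show ?thesis by simp
  qed
  moreover have "dilate 1 = (\<lambda>c. c)" by (simp add: fun_eq_iff dilate_def)
  ultimately show ?thesis by (simp add: vec_eq_iff)
qed

end

section \<open>The universal enveloping algebra\<close>

definition free_extend :: "('g free_monoid \<Rightarrow> 'b::real_vector) \<Rightarrow> 'g free_algebra \<Rightarrow> 'b" where
  "free_extend f p = (\<Sum>w\<in>Poly_Mapping.keys p. Poly_Mapping.lookup p w *\<^sub>R f w)"

lemma free_extend_superset:
  assumes "finite A" "Poly_Mapping.keys p \<subseteq> A"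
  shows "free_extend f p = (\<Sum>w\<in>A. Poly_Mapping.lookup p w *\<^sub>R f w)"
  unfolding free_extend_def
  by (rule sum.mono_neutral_left) (use assms in \<open>auto simp: in_keys_iff\<close>)

lemma free_extend_0: "free_extend f 0 = 0"
  by (simp add: free_extend_def)

lemma free_extend_add: "free_extend f (p + q) = free_extend f p + free_extend f q"
proof -
  let ?A = "Poly_Mapping.keys p \<union> Poly_Mapping.keys q"
  have "free_extend f (p + q) = (\<Sum>w\<in>?A. Poly_Mapping.lookup (p + q) w *\<^sub>R f w)"
    by (rule free_extend_superset) (simp_all add: Poly_Mapping.keys_add)
  moreover have "free_extend f p = (\<Sum>w\<in>?A. Poly_Mapping.lookup p w *\<^sub>R f w)"
    "free_extend f q = (\<Sum>w\<in>?A. Poly_Mapping.lookup q w *\<^sub>R f w)"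
    by (rule free_extend_superset; simp)+
  ultimately show ?thesis by (simp add: lookup_add scaleR_add_left sum.distrib)
qed

lemma free_extend_scaleR: "free_extend f (c *\<^sub>R p) = c *\<^sub>R free_extend f p"
proof -
  have "Poly_Mapping.keys (c *\<^sub>R p) \<subseteq> Poly_Mapping.keys p"
    by (auto simp: in_keys_iff free_lookup_scaleR)
  then have "free_extend f (c *\<^sub>R p) = (\<Sum>w\<in>Poly_Mapping.keys p. Poly_Mapping.lookup (c *\<^sub>R p) w *\<^sub>R f w)"
    by (intro free_extend_superset) simp_all
  then show ?thesis by (simp add: free_extend_def free_lookup_scaleR scaleR_sum_right)
qed

lemma free_extend_diff: "free_extend f (p - q) = free_extend f p - free_extend f q"
proof -
  have "p - q = p + (-1) *\<^sub>R q" by simp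
  then show ?thesis by (simp only: free_extend_add free_extend_scaleR) simp
qed

lemma free_extend_single: "free_extend f (Poly_Mapping.single w c) = c *\<^sub>R f w"
  by (simp add: free_extend_def)

lemma free_extend_sum: "free_extend f (\<Sum>i\<in>I. p i) = (\<Sum>i\<in>I. free_extend f (p i))"
  by (induction I rule: infinite_finite_induct) (simp_all add: free_extend_0 free_extend_add)

lemma free_algebra_eq_sum:
  "p = (\<Sum>w\<in>Poly_Mapping.keys p. Poly_Mapping.single w (Poly_Mapping.lookup p w))" for p :: "'g free_algebra"
proof (rule poly_mapping_eqI)
  fix k
  show "Poly_Mapping.lookup p k
    = Poly_Mapping.lookup (\<Sum>w\<in>Poly_Mapping.keys p. Poly_Mapping.single w (Poly_Mapping.lookup p w)) k"
    unfolding lookup_sum lookup_single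
    by (cases "k \<in> Poly_Mapping.keys p") (auto simp: when_def sum.delta in_keys_iff)
qed

text \<open>The two-step form serves both the order-reversing antipode and the composition of
  differential operators.\<close>

lemma free_extend_mult: "free_extend f (p * q) = free_extend (\<lambda>u. free_extend (\<lambda>v. f (u + v)) q) p"
proof -
  have "p * q = (\<Sum>u\<in>Poly_Mapping.keys p. \<Sum>v\<in>Poly_Mapping.keys q.
      Poly_Mapping.single (u + v) (Poly_Mapping.lookup p u * Poly_Mapping.lookup q v))"
    by (subst free_algebra_eq_sum[of p], subst free_algebra_eq_sum[of q])
      (simp add: sum_product mult_single)
  then show ?thesis
    by (simp add: free_extend_sum free_extend_single free_extend_def[of _ p] free_extend_def[of _ q]
        scaleR_sum_right)
qed

lemma abs_uea_rep: "abs_uea (rep_uea u) = u"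
  by (rule Quotient_abs_rep[OF Quotient_uea])

lemma rep_abs_uea: "rep_uea (abs_uea p) - p \<in> uea_ideal"
  using Quotient_rep_abs[OF Quotient_uea, of p] by (simp add: uea_ideal.zero)

lemma uea_gen_add: "uea_gen (x + y) = uea_gen x + uea_gen y"
  by transfer (metis diff_diff_add uea_ideal.gen_add)

lemma uea_gen_scaleR: "uea_gen (c *\<^sub>R x) = c *\<^sub>R uea_gen x"
  by transfer (rule uea_ideal.gen_scaleR)

lemma uea_gen_bracket: "uea_gen (lie_bracket x y) = uea_gen x * uea_gen y - uea_gen y * uea_gen x"
proof -
  have "uea_gen x * uea_gen y - uea_gen y * uea_gen x = uea_gen (lie_bracket x y)"
    by transfer (rule uea_ideal.gen_bracket)
  then show ?thesis by simp
qed

lemma uea_gen_0: "uea_gen 0 = 0"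
  using uea_gen_scaleR[of 0 0] by simp

lemma uea_gen_uminus: "uea_gen (- x) = - uea_gen x"
  using uea_gen_scaleR[of "-1" x] by simp

lemma uea_gen_sum: "uea_gen (\<Sum>i\<in>I. f i) = (\<Sum>i\<in>I. uea_gen (f i))"
  by (induction I rule: infinite_finite_induct) (simp_all add: uea_gen_0 uea_gen_add)

subsection \<open>The antipode\<close>

text \<open>Reversal of words with a sign for every letter. On exponentials this gives the inverse,
  and it keeps the sum of the absolute values of the coefficients in each degree; small series
  therefore have equally small inverses.\<close>

definition antipode_word :: "'g::lie_algebra free_monoid \<Rightarrow> 'g uea" where
  "antipode_word w = prod_list (map (\<lambda>x. - uea_gen x) (rev (letters w)))"

lemma antipode_word_plus: "antipode_word (u + v) = antipode_word v * antipode_word u"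
  by (simp add: antipode_word_def plus_free_monoid_def)

lemma free_extend_antipode_mult:
  "free_extend antipode_word (p * q) = free_extend antipode_word q * free_extend antipode_word p"
  unfolding free_extend_mult antipode_word_plus
  by (simp add: free_extend_def sum_product scaleR_sum_right sum_distrib_left sum_distrib_right
      flip: scaleR_scaleR)

lemma free_extend_antipode_gen: "free_extend antipode_word (free_gen x) = - uea_gen x"
  by (simp add: free_gen_def free_extend_single antipode_word_def)

lemma antipode_ideal: "p \<in> uea_ideal \<Longrightarrow> free_extend antipode_word p = 0"
  by (induction rule: uea_ideal.induct)
    (simp_all add: free_extend_0 free_extend_add free_extend_diff free_extend_scaleR free_extend_antipode_mult
      free_extend_antipode_gen uea_gen_add uea_gen_scaleR uea_gen_bracket)

lift_definition antipode :: "'g::lie_algebra uea \<Rightarrow> 'g uea" is "free_extend antipode_word"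
  using antipode_ideal by (metis eq_iff_diff_eq_0 free_extend_diff)

lemma antipode_add: "antipode (u + v) = antipode u + antipode v"
  by transfer (simp add: free_extend_add)

lemma antipode_scaleR: "antipode (c *\<^sub>R u) = c *\<^sub>R antipode u"
  by transfer (simp add: free_extend_scaleR)

lemma antipode_mult: "antipode (u * v) = antipode v * antipode u"
  by transfer (simp add: free_extend_antipode_mult)

lemma antipode_gen: "antipode (uea_gen x) = - uea_gen x"
  by transfer (simp add: free_extend_antipode_gen)

lemma antipode_one: "antipode 1 = 1"
proof -
  have "free_extend antipode_word 1 = (1 :: 'a uea)"
    unfolding single_one[symmetric] free_extend_single
    by (simp add: antipode_word_def zero_free_monoid_def)
  then show ?thesis by transfer
qed

lemma antipode_0: "antipode 0 = 0"
  using antipode_scaleR[of 0 0] by simp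

lemma antipode_sum: "antipode (\<Sum>i\<in>I. f i) = (\<Sum>i\<in>I. antipode (f i))"
  by (induction I rule: infinite_finite_induct) (simp_all add: antipode_0 antipode_add)

lemma uea_word_simps:
  "uea_word \<omega> [] = 1" "uea_word \<omega> (j # w) = uea_gen (\<omega> j) * uea_word \<omega> w"
  "uea_word \<omega> (u @ v) = uea_word \<omega> u * uea_word \<omega> v"
  by (simp_all add: uea_word_def)

lemma antipode_uea_word: "antipode (uea_word \<omega> w) = (-1) ^ length w *\<^sub>R uea_word \<omega> (rev w)"
  by (induction w) (simp_all add: uea_word_simps antipode_one antipode_mult antipode_gen)

subsection \<open>Homogeneous elements as combinations of words\<close>

text \<open>Coefficients are indexed by \<open>A\<close> and not by its image, because different
  words may denote the same element.\<close>

lemma span_image_finite: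
  assumes "finite A" "z \<in> span (f ` A)"
  obtains c where "z = (\<Sum>a\<in>A. c a *\<^sub>R f a)"
proof -
  have "\<exists>c. z = (\<Sum>a\<in>A. c a *\<^sub>R f a)"
    using assms(2)
  proof (induction rule: span_induct_alt)
    case base
    then show ?case by (intro exI[of _ "\<lambda>_. 0"]) simp
  next
    case (step r x y)
    then obtain a c where a: "a \<in> A" "x = f a" and c: "y = (\<Sum>a\<in>A. c a *\<^sub>R f a)" by blast
    have "(\<Sum>b\<in>A. (c b + (if b = a then r else 0)) *\<^sub>R f b) = y + r *\<^sub>R f a"
      using a(1) assms(1) by (simp add: c scaleR_add_left sum.distrib if_distrib[of "\<lambda>t. t *\<^sub>R _"] sum.delta cong: if_cong)
    then show ?case using a(2) by (intro exI[of _ "\<lambda>b. c b + (if b = a then r else 0)"]) (simp add: add.commute)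
  qed
  with that show ?thesis by blast
qed

definition word_span :: "nat \<Rightarrow> (nat \<Rightarrow> 'g::lie_algebra) \<Rightarrow> nat \<Rightarrow> 'g uea set" where
  "word_span n \<omega> p = span (uea_word \<omega> ` index_words n p)"

lemma subspace_word_span: "subspace (word_span n \<omega> p)"
  by (simp add: word_span_def subspace_span)

lemma word_span_mult:
  assumes "a \<in> word_span n \<omega> i" "b \<in> word_span n \<omega> j"
  shows "a * b \<in> word_span n \<omega> (i + j)"
proof -
  obtain c where a: "a = (\<Sum>u\<in>index_words n i. c u *\<^sub>R uea_word \<omega> u)"
    using span_image_finite[OF finite_index_words assms(1)[unfolded word_span_def]] .
  obtain d where b: "b = (\<Sum>v\<in>index_words n j. d v *\<^sub>R uea_word \<omega> v)"
    using span_image_finite[OF finite_index_words assms(2)[unfolded word_span_def]] .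
  have "a * b = (\<Sum>u\<in>index_words n i. \<Sum>v\<in>index_words n j. (c u * d v) *\<^sub>R uea_word \<omega> (u @ v))"
    by (simp add: a b sum_product uea_word_simps mult.commute[of "d _"])
  also have "\<dots> \<in> word_span n \<omega> (i + j)"
    unfolding word_span_def
    by (intro span_sum span_scale span_base) (auto simp: index_words_def)
  finally show ?thesis .
qed

text \<open>The homogeneous elements that are combinations of words of the right length span a Lie
  subalgebra, since a bracket is a difference of products. It contains \<open>gr 1\<close>, hence is
  everything. Uniqueness of homogeneous components then returns from this span to the single degree
  \<open>k\<close>.\<close>

lemma words_of_homogeneous:
  fixes gr :: "nat \<Rightarrow> 'g::lie_algebra set"
  assumes gr: "graded_lie_algebra gr" and \<omega>: "indexed_basis n \<omega> (gr 1)" and x: "x \<in> gr k"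
  shows "uea_gen x \<in> word_span n \<omega> k"
proof -
  interpret graded_lie_algebra gr by (rule gr)
  let ?B = "\<lambda>k. {x \<in> gr k. uea_gen x \<in> word_span n \<omega> k}"
  let ?A = "span (\<Union>k. ?B k)"
  have sB: "subspace (?B k)" for k
    using subspace_gr[of k] subspace_word_span[of n \<omega> k]
    by (auto simp: subspace_def uea_gen_0 uea_gen_add uea_gen_scaleR)
  have bracket: "lie_bracket x y \<in> ?A" if "x \<in> ?A" "y \<in> ?A" for x y
    using that(1)
  proof (induction rule: span_induct_alt)
    case base
    have "lie_bracket 0 y = 0" using lie_bracket_scaleR_left[of 0 0 y] by simp
    then show ?case by (simp add: span_zero)
  next
    case (step c x z)
    have "lie_bracket x y \<in> ?A" using that(2)
    proof (induction rule: span_induct_alt)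
      case base
      have "lie_bracket x 0 = 0" using lie_bracket_scaleR_right[of x 0 0] by simp
      then show ?case by (simp add: span_zero)
    next
      case (step d y z)
      obtain i j where ij: "x \<in> ?B i" "y \<in> ?B j" using step(1) \<open>x \<in> (\<Union>k. ?B k)\<close> by blast
      then have "uea_gen x * uea_gen y \<in> word_span n \<omega> (i + j)" "uea_gen y * uea_gen x \<in> word_span n \<omega> (j + i)"
        by (auto intro: word_span_mult)
      then have "uea_gen (lie_bracket x y) \<in> word_span n \<omega> (i + j)"
        unfolding uea_gen_bracket using subspace_diff[OF subspace_word_span] by (metis add.commute)
      then have "lie_bracket x y \<in> ?B (i + j)" using ij lie_bracket_gr by blast
      then have "lie_bracket x y \<in> ?A" by (intro span_base) blast
      then show ?case unfolding lie_bracket_add_right lie_bracket_scaleR_right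
        using step(2) by (intro span_add span_scale) auto
    qed
    then show ?case unfolding lie_bracket_add_left lie_bracket_scaleR_left
      using step(2) by (intro span_add span_scale) auto
  qed
  have "gr 1 \<subseteq> ?B 1"
  proof
    fix x assume x: "x \<in> gr 1"
    then have "x \<in> span (\<omega> ` {..<n})" using \<omega> by (simp add: indexed_basis_def)
    then obtain c where c: "x = (\<Sum>j<n. c j *\<^sub>R \<omega> j)" by (rule span_image_finite[OF finite_lessThan])
    have "uea_gen (\<omega> j) \<in> word_span n \<omega> 1" if "j < n" for j
    proof -
      have "uea_word \<omega> [j] \<in> word_span n \<omega> 1" unfolding word_span_def
        by (intro span_base imageI) (simp add: index_words_def that)
      then show ?thesis by (simp add: uea_word_simps)
    qed
    then have "uea_gen x \<in> word_span n \<omega> 1" unfolding c uea_gen_sum uea_gen_scaleR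
      using subspace_word_span by (intro subspace_sum subspace_scale) auto
    with x show "x \<in> ?B 1" by blast
  qed
  then have "gr 1 \<subseteq> ?A" using span_superset[of "\<Union>k. ?B k"] by blast
  then have "?A = UNIV"
    using bracket by (intro gr_1_generates) (auto simp: lie_subalgebra_def)
  then have "x \<in> ?A" by simp
  then have "\<exists>N c. (\<forall>j. c j \<in> ?B j) \<and> (\<forall>j>N. c j = 0) \<and> x = (\<Sum>j\<le>N. c j)"
  proof (induction rule: span_induct_alt)
    case base
    have "0 \<in> ?B j" for j using sB subspace_0 by blast
    then show ?case by (intro exI[of _ 0] exI[of _ "\<lambda>_. 0"]) auto
  next
    case (step r x y)
    obtain i where i: "x \<in> ?B i" using step(1) by blast
    obtain N c where c: "\<And>j. c j \<in> ?B j" "\<And>j. j > N \<Longrightarrow> c j = 0" "y = (\<Sum>j\<le>N. c j)" using step(2) by blast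
    define c' where "c' j = c j + (if j = i then r *\<^sub>R x else 0)" for j
    have "c' j \<in> ?B j" for j
    proof (cases "j = i")
      case True
      have "c i + r *\<^sub>R x \<in> ?B i" by (rule subspace_add[OF sB c(1) subspace_scale[OF sB i]])
      then show ?thesis using True by (simp add: c'_def)
    qed (use c(1) in \<open>simp add: c'_def\<close>)
    moreover have "c' j = 0" if "j > max N i" for j using that c(2)[of j] by (simp add: c'_def)
    moreover have "(\<Sum>j\<le>max N i. c' j) = r *\<^sub>R x + y"
    proof -
      have "(\<Sum>j\<le>max N i. c j) = y" unfolding c(3)
        by (rule sum.mono_neutral_right) (use c(2) in auto)
      then show ?thesis by (simp add: c'_def sum.distrib sum.delta)
    qed
    ultimately show ?case by (intro exI[of _ "max N i"] exI[of _ c']) auto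
  qed
  then obtain N c where c: "\<And>j. c j \<in> ?B j" "\<And>j. j > N \<Longrightarrow> c j = 0" "x = (\<Sum>j\<le>N. c j)" by blast
  \<comment> \<open>Both \<open>c\<close> and the family concentrated in degree \<open>k\<close>
    decompose \<open>x\<close>, so they coincide and \<open>x\<close> is the component
    \<open>c k\<close>.\<close>
  let ?P = "\<lambda>c. (\<forall>k. c k \<in> gr k) \<and> finite {k. c k \<noteq> 0} \<and> x = (\<Sum>k | c k \<noteq> 0. c k)"
  have Pc: "?P c"
  proof (intro conjI allI)
    show "c k \<in> gr k" for k using c(1) by blast
    have sub: "{k. c k \<noteq> 0} \<subseteq> {..N}" using c(2) by (auto simp: not_less[symmetric])
    then show "finite {k. c k \<noteq> 0}" by (rule finite_subset) simp
    show "x = (\<Sum>k | c k \<noteq> 0. c k)" unfolding c(3)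
      by (rule sum.mono_neutral_right) (use sub in auto)
  qed
  have Pk: "?P (\<lambda>j. if j = k then x else 0)"
  proof (intro conjI allI)
    show "(if j = k then x else 0) \<in> gr j" for j using x subspace_0[OF subspace_gr] by simp
    have "{j. (if j = k then x else 0) \<noteq> 0} \<subseteq> {k}" by auto
    then show "finite {j. (if j = k then x else 0) \<noteq> 0}" by (rule finite_subset) simp
    have "{j. (if j = k then x else 0) \<noteq> 0} = (if x = 0 then {} else {k})" by auto
    then show "x = (\<Sum>j | (if j = k then x else 0) \<noteq> 0. (if j = k then x else 0))" by simp
  qed
  obtain c0 where "\<forall>c'. ?P c' \<longrightarrow> c' = c0" by (rule ex1E[OF gr_direct_sum[of x]])
  from this[THEN spec, THEN mp, OF Pc] this[THEN spec, THEN mp, OF Pk]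
  have "c = (\<lambda>j. if j = k then x else 0)" by (rule trans[OF _ sym])
  then have "c k = x" by simp
  then show ?thesis using c(1)[of k] by simp
qed

text \<open>Identifies the induced grading with the grading by word length. In particular every
  element of a graded piece has a representation by words, so the infimum in \<open>uea_norm\<close>
  runs over a nonempty set.\<close>

lemma uea_grade_words:
  assumes gr: "graded_lie_algebra gr" and \<omega>: "indexed_basis n \<omega> (gr 1)"
  shows "uea_grade gr p = word_span n \<omega> p"
proof
  have "prod_list (map uea_gen xs) \<in> word_span n \<omega> (sum_list ks)"
    if "list_all2 (\<lambda>x k. x \<in> gr k) xs ks" for xs ks
    using that
  proof (induction rule: list_all2_induct)
    case Nil
    have "uea_word \<omega> [] \<in> word_span n \<omega> 0" unfolding word_span_def
      by (intro span_base imageI) (simp add: index_words_def)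
    then show ?case by (simp add: uea_word_simps)
  next
    case (Cons x xs k ks)
    then show ?case using word_span_mult[OF words_of_homogeneous[OF gr \<omega>]] by simp
  qed
  then show "uea_grade gr p \<subseteq> word_span n \<omega> p"
    unfolding uea_grade_def by (intro span_minimal subspace_word_span) auto
  have \<omega>1: "\<omega> j \<in> gr 1" if "j < n" for j
    using \<omega> that span_base[of "\<omega> j" "\<omega> ` {..<n}"] by (auto simp: indexed_basis_def)
  show "word_span n \<omega> p \<subseteq> uea_grade gr p"
    unfolding word_span_def uea_grade_def
  proof (rule span_mono, rule image_subsetI)
    fix w assume w: "w \<in> index_words n p"
    have "list_all2 (\<lambda>x k. x \<in> gr k) (map \<omega> w) (replicate p 1)"
      using w \<omega>1 by (auto simp: list_all2_conv_all_nth index_words_def subset_iff)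
    moreover have "uea_word \<omega> w = prod_list (map uea_gen (map \<omega> w))" by (simp add: uea_word_def o_def)
    moreover have "sum_list (replicate p 1) = p" by (simp add: sum_list_replicate)
    ultimately show "uea_word \<omega> w \<in> {prod_list (map uea_gen xs) |xs ks.
        list_all2 (\<lambda>x k. x \<in> gr k) xs ks \<and> sum_list ks = p}" by blast
  qed
qed

definition represents :: "nat \<Rightarrow> (nat \<Rightarrow> 'g::lie_algebra) \<Rightarrow> (nat list \<Rightarrow> real) \<Rightarrow> 'g uea fps \<Rightarrow> bool" where
  "represents n \<omega> c z \<longleftrightarrow> (\<forall>p. fps_nth z p = (\<Sum>w\<in>index_words n p. c w *\<^sub>R uea_word \<omega> w))"

lemma uea_norm_approx:
  assumes "z \<in> word_span n \<omega> p" "e > 0"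
  obtains c where "z = (\<Sum>w\<in>index_words n p. c w *\<^sub>R uea_word \<omega> w)"
    "(\<Sum>w\<in>index_words n p. \<bar>c w\<bar>) < uea_norm n \<omega> p z + e"
proof -
  let ?X = "{(\<Sum>w\<in>index_words n p. \<bar>c w\<bar>) | c. z = (\<Sum>w\<in>index_words n p. c w *\<^sub>R uea_word \<omega> w)}"
  obtain c where "z = (\<Sum>w\<in>index_words n p. c w *\<^sub>R uea_word \<omega> w)"
    using span_image_finite[OF finite_index_words assms(1)[unfolded word_span_def]] .
  then have ne: "?X \<noteq> {}" by blast
  have "Inf ?X < uea_norm n \<omega> p z + e" using assms(2) by (simp add: uea_norm_def)
  from cInf_lessD[OF ne this] obtain t where t: "t \<in> ?X" "t < uea_norm n \<omega> p z + e" by (elim bexE)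
  from t(1) obtain d where "t = (\<Sum>w\<in>index_words n p. \<bar>d w\<bar>)"
    "z = (\<Sum>w\<in>index_words n p. d w *\<^sub>R uea_word \<omega> w)" by (elim CollectE exE conjE)
  with t(2) that show ?thesis by simp
qed

lemma uea_norm_le:
  assumes "z = (\<Sum>w\<in>index_words n p. c w *\<^sub>R uea_word \<omega> w)"
  shows "uea_norm n \<omega> p z \<le> (\<Sum>w\<in>index_words n p. \<bar>c w\<bar>)"
  unfolding uea_norm_def
  by (rule cInf_lower) (use assms in \<open>auto intro!: bdd_belowI[of _ 0] sum_nonneg\<close>)

text \<open>In degree \<open>p\<close> a representation is taken within
  \<open>a ^ p / fact p\<close> of the norm; this slack has the size of the bound itself and raises
  the constant by 1. Words of different lengths do not interfere, so the choices combine into one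
  family.\<close>

lemma U_fact_a_represents:
  assumes gr: "graded_lie_algebra gr" and \<omega>: "indexed_basis n \<omega> (gr 1)" and a: "a > 0"
    and z: "z \<in> U_fact_a gr n \<omega> a"
  obtains c C where "represents n \<omega> c z" "factorial_bound n C a c"
proof -
  obtain C where C: "\<And>p. uea_norm n \<omega> p (fps_nth z p) * fact p / a ^ p \<le> C"
    using z unfolding U_fact_a_def bdd_above_def by auto
  have "\<exists>c. fps_nth z p = (\<Sum>w\<in>index_words n p. c w *\<^sub>R uea_word \<omega> w) \<and>
    (\<Sum>w\<in>index_words n p. \<bar>c w\<bar>) < uea_norm n \<omega> p (fps_nth z p) + a ^ p / fact p" for p
  proof -
    have "fps_nth z p \<in> word_span n \<omega> p"
      using z uea_grade_words[OF gr \<omega>] unfolding U_fact_a_def uea_completion_def by blast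
    moreover have "a ^ p / fact p > 0" using a by simp
    ultimately show ?thesis using uea_norm_approx by metis
  qed
  then obtain c where c: "\<And>p. fps_nth z p = (\<Sum>w\<in>index_words n p. c p w *\<^sub>R uea_word \<omega> w)"
    "\<And>p. (\<Sum>w\<in>index_words n p. \<bar>c p w\<bar>) < uea_norm n \<omega> p (fps_nth z p) + a ^ p / fact p" by metis
  define d where "d w = c (length w) w" for w
  have d: "d w = c p w" if "w \<in> index_words n p" for w p using that by (simp add: d_def index_words_def)
  have "represents n \<omega> d z" using c(1) d by (simp add: represents_def)
  moreover have "factorial_bound n (C + 1) a d"
    unfolding factorial_bound_def
  proof
    fix p
    have "(\<Sum>w\<in>index_words n p. \<bar>d w\<bar>) * fact p \<le> (uea_norm n \<omega> p (fps_nth z p) + a ^ p / fact p) * fact p"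
      using c(2)[of p] d by (intro mult_right_mono) (auto intro: less_imp_le)
    also have "\<dots> = uea_norm n \<omega> p (fps_nth z p) * fact p + a ^ p" by (simp add: field_simps)
    also have "\<dots> \<le> C * a ^ p + a ^ p" using C[of p] a by (simp add: field_simps)
    finally show "(\<Sum>w\<in>index_words n p. \<bar>d w\<bar>) * fact p \<le> (C + 1) * a ^ p" by (simp add: algebra_simps)
  qed
  ultimately show ?thesis using that by blast
qed

lemma U_fact_a_I:
  assumes gr: "graded_lie_algebra gr" and \<omega>: "indexed_basis n \<omega> (gr 1)" and a: "a > 0"
    and c: "represents n \<omega> c z" "factorial_bound n C a c"
  shows "z \<in> U_fact_a gr n \<omega> a"
  unfolding U_fact_a_def
proof (intro CollectI conjI bdd_aboveI2)
  show "z \<in> uea_completion gr"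
    unfolding uea_completion_def uea_grade_words[OF gr \<omega>]
  proof (intro CollectI allI)
    fix p
    have "(\<Sum>w\<in>index_words n p. c w *\<^sub>R uea_word \<omega> w) \<in> word_span n \<omega> p"
      unfolding word_span_def by (intro span_sum span_scale span_base) simp
    then show "fps_nth z p \<in> word_span n \<omega> p" using c(1) by (simp add: represents_def)
  qed
  show "uea_norm n \<omega> p (fps_nth z p) * fact p / a ^ p \<le> C" for p
  proof -
    have "uea_norm n \<omega> p (fps_nth z p) * fact p \<le> (\<Sum>w\<in>index_words n p. \<bar>c w\<bar>) * fact p"
      using c(1) unfolding represents_def by (intro mult_right_mono uea_norm_le) auto
    also have "\<dots> \<le> C * a ^ p" using c(2) by (simp add: factorial_bound_def)
    finally show ?thesis using a by (simp add: field_simps)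
  qed
qed

subsection \<open>Exponential series\<close>

lemma fps_power_nth_less:
  fixes x :: "'a::ring_1 fps"
  assumes "fps_nth x 0 = 0" "p < k"
  shows "fps_nth (x ^ k) p = 0"
  using assms(2)
proof (induction k arbitrary: p)
  case (Suc k)
  have "fps_nth x i * fps_nth (x ^ k) (p - i) = 0" if "i \<le> p" for i
    using Suc that assms(1) by (cases "i = 0") auto
  then show ?case by (simp add: fps_mult_nth)
qed simp

text \<open>Term \<open>l\<close> starts in degree \<open>l\<close>, so in degree \<open>p\<close>
  both infinite sums may be cut off at \<open>p\<close>, and pairs of total index above
  \<open>p\<close> contribute nothing. This replaces convergence arguments for products of
  exponential series.\<close>

lemma triangle_product:
  fixes a b :: "nat \<Rightarrow> 'r::ring_1 fps"
  assumes low: "\<And>l q. q < l \<Longrightarrow> fps_nth (a l) q = 0" "\<And>l q. q < l \<Longrightarrow> fps_nth (b l) q = 0"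
    and A: "\<And>p. fps_nth A p = (\<Sum>l\<le>p. fps_nth (a l) p)" and B: "\<And>p. fps_nth B p = (\<Sum>l\<le>p. fps_nth (b l) p)"
  shows "fps_nth (A * B) p = (\<Sum>k\<le>p. \<Sum>l\<le>k. fps_nth (a l * b (k - l)) p)"
proof -
  have A': "fps_nth A i = (\<Sum>l\<le>p. fps_nth (a l) i)" and B': "fps_nth B i = (\<Sum>l\<le>p. fps_nth (b l) i)"
    if "i \<le> p" for i
    unfolding A B by (rule sum.mono_neutral_left; use that low in auto)+
  have zero: "fps_nth (a l * b k) p = 0" if "p < l + k" for l k
  proof -
    have "fps_nth (a l) i * fps_nth (b k) (p - i) = 0" if "i \<le> p" for i
      using low(1)[of i l] low(2)[of "p - i" k] \<open>p < l + k\<close> that by (cases "i < l") auto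
    then show ?thesis by (simp add: fps_mult_nth)
  qed
  have "fps_nth (A * B) p = (\<Sum>i\<le>p. (\<Sum>l\<le>p. fps_nth (a l) i) * (\<Sum>k\<le>p. fps_nth (b k) (p - i)))"
    unfolding fps_mult_nth atMost_atLeast0[symmetric] by (intro sum.cong refl) (simp add: A' B')
  also have "\<dots> = (\<Sum>i\<le>p. \<Sum>l\<le>p. \<Sum>k\<le>p. fps_nth (a l) i * fps_nth (b k) (p - i))"
    by (simp only: sum_product)
  also have "\<dots> = (\<Sum>l\<le>p. \<Sum>i\<le>p. \<Sum>k\<le>p. fps_nth (a l) i * fps_nth (b k) (p - i))"
    by (rule sum.swap)
  also have "\<dots> = (\<Sum>l\<le>p. \<Sum>k\<le>p. fps_nth (a l * b k) p)"
    unfolding fps_mult_nth atMost_atLeast0[symmetric] by (intro sum.cong refl sum.swap)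
  also have "\<dots> = (\<Sum>(l, k)\<in>{..p} \<times> {..p}. fps_nth (a l * b k) p)" by (simp add: sum.cartesian_product)
  also have "\<dots> = (\<Sum>(l, k)\<in>{(l, k). l + k \<le> p}. fps_nth (a l * b k) p)"
  proof (rule sum.mono_neutral_right)
    show "\<forall>x\<in>{..p} \<times> {..p} - {(l, k). l + k \<le> p}. (case x of (l, k) \<Rightarrow> fps_nth (a l * b k) p) = 0"
    proof
      fix x assume x: "x \<in> {..p} \<times> {..p} - {(l, k). l + k \<le> p}"
      obtain l k where lk: "x = (l, k)" by (cases x)
      then have "p < l + k" using x by simp
      then show "(case x of (l, k) \<Rightarrow> fps_nth (a l * b k) p) = 0" using lk zero by simp
    qed
  qed auto
  also have "\<dots> = (\<Sum>k\<le>p. \<Sum>l\<le>k. fps_nth (a l * b (k - l)) p)"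
    by (rule sum.triangle_reindex_eq)
  finally show ?thesis .
qed

lemma lie_completion_0: "graded_lie_algebra gr \<Longrightarrow> x \<in> lie_completion gr \<Longrightarrow> fps_nth x 0 = 0"
proof -
  assume "graded_lie_algebra gr" "x \<in> lie_completion gr"
  then have x0: "fps_nth x 0 \<in> uea_gen ` gr 0" and gr0: "gr 0 = {0}"
    unfolding lie_completion_def using graded_lie_algebra.gr_0 by blast+
  show ?thesis using x0 unfolding gr0 by (simp add: uea_gen_0)
qed

definition scaleR_fps :: "real \<Rightarrow> 'a::real_algebra_1 fps \<Rightarrow> 'a fps" where
  "scaleR_fps r z = Abs_fps (\<lambda>p. r *\<^sub>R fps_nth z p)"

lemma scaleR_fps_nth: "fps_nth (scaleR_fps r z) p = r *\<^sub>R fps_nth z p"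
  by (simp add: scaleR_fps_def)

lemma scaleR_fps_mult: "scaleR_fps r y * scaleR_fps s z = scaleR_fps (r * s) (y * z)"
  by (rule fps_ext) (simp add: fps_mult_nth scaleR_fps_nth scaleR_sum_right mult.commute[of s r])

text \<open>Powers of the single element \<open>x\<close> commute with each other although the
  algebra is noncommutative, so the terms with \<open>k\<close> factors add up to a multiple of
  \<open>(1 + (-1)) ^ k\<close>.\<close>

lemma series_exp_uminus:
  fixes x :: "'g::lie_algebra uea fps"
  assumes x: "fps_nth x 0 = 0"
  shows "series_exp x * series_exp (- x) = 1"
proof (rule fps_ext)
  fix p
  have x': "fps_nth (- x) 0 = 0" using x by simp
  define a where "a k = scaleR_fps (1 / fact k) (x ^ k)" for k
  define b where "b k = scaleR_fps (1 / fact k) ((- x) ^ k)" for k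
  have "fps_nth (series_exp x * series_exp (- x)) p = (\<Sum>k\<le>p. \<Sum>l\<le>k. fps_nth (a l * b (k - l)) p)"
    by (rule triangle_product)
      (simp_all add: a_def b_def scaleR_fps_nth fps_power_nth_less[OF x] fps_power_nth_less[OF x']
        series_exp_def divide_inverse)
  also have "\<dots> = (\<Sum>k\<le>p. (if k = 0 then fps_nth 1 p else 0))"
  proof (rule sum.cong[OF refl])
    fix k
    have ab: "fps_nth (a l * b (k - l)) p = ((-1) ^ (k - l) * real (k choose l) / fact k) *\<^sub>R fps_nth (x ^ k) p"
      if l: "l \<le> k" for l
    proof -
      have "(- x) ^ (k - l) = (if even (k - l) then x ^ (k - l) else - (x ^ (k - l)))"
        by (simp add: power_minus_even power_minus_odd)
      then have "x ^ l * (- x) ^ (k - l) = (if even (k - l) then x ^ k else - (x ^ k))"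
        using l by (simp flip: power_add)
      then have "fps_nth (x ^ l * (- x) ^ (k - l)) p = (-1) ^ (k - l) *\<^sub>R fps_nth (x ^ k) p" by simp
      then show ?thesis
        using l by (simp add: a_def b_def scaleR_fps_mult scaleR_fps_nth binomial_fact)
    qed
    have "(\<Sum>l\<le>k. fps_nth (a l * b (k - l)) p)
        = ((\<Sum>l\<le>k. (-1) ^ (k - l) * real (k choose l)) / fact k) *\<^sub>R fps_nth (x ^ k) p"
      by (simp add: ab scaleR_sum_left sum_divide_distrib)
    also have "(\<Sum>l\<le>k. (-1) ^ (k - l) * real (k choose l)) = (1 + (-1)) ^ k"
      unfolding binomial_ring by (intro sum.cong refl) simp
    finally show "(\<Sum>l\<le>k. fps_nth (a l * b (k - l)) p) = (if k = 0 then fps_nth 1 p else 0)"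
      by (cases "k = 0") simp_all
  qed
  also have "\<dots> = fps_nth 1 p" by (simp add: sum.delta)
  finally show "fps_nth (series_exp x * series_exp (- x)) p = fps_nth 1 p" .
qed

lemma lie_completion_uminus:
  assumes "graded_lie_algebra gr" "x \<in> lie_completion gr"
  shows "- x \<in> lie_completion gr"
  unfolding lie_completion_def
proof (intro CollectI allI)
  fix k
  interpret graded_lie_algebra gr by (rule assms(1))
  obtain y where "y \<in> gr k" "fps_nth x k = uea_gen y" using assms(2) by (auto simp: lie_completion_def)
  then show "fps_nth (- x) k \<in> uea_gen ` gr k"
    using subspace_neg[OF subspace_gr] uea_gen_uminus[of y] by (metis fps_neg_nth imageI)
qed

text \<open>Anti-multiplicativity reverses the factors, which leaves a power of a single element
  unchanged; only the sign of \<open>x\<close> survives.\<close>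

lemma antipode_exp:
  assumes "x \<in> lie_completion gr"
  shows "fps_nth (series_exp (- x)) p = antipode (fps_nth (series_exp x) p)"
proof -
  have x: "antipode (fps_nth x i) = fps_nth (- x) i" for i
  proof -
    obtain y where "fps_nth x i = uea_gen y" using assms by (auto simp: lie_completion_def)
    then show ?thesis by (simp add: antipode_gen)
  qed
  have pow: "antipode (fps_nth (x ^ k) p) = fps_nth ((- x) ^ k) p" for k p
  proof (induction k arbitrary: p)
    case 0
    then show ?case by (cases "p = 0") (simp_all add: antipode_one antipode_0)
  next
    case (Suc k)
    have "antipode (fps_nth (x ^ Suc k) p) = (\<Sum>i=0..p. fps_nth ((- x) ^ k) (p - i) * fps_nth (- x) i)"
      by (simp add: fps_mult_nth antipode_sum antipode_mult x Suc.IH)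
    also have "\<dots> = (\<Sum>i=0..p. fps_nth ((- x) ^ k) i * fps_nth (- x) (p - i))"
      by (rule sum.reindex_bij_witness[of _ "\<lambda>i. p - i" "\<lambda>i. p - i"]) auto
    also have "\<dots> = fps_nth ((- x) ^ Suc k) p" by (simp add: fps_mult_nth power_Suc2 sum_negf del: power_Suc)
    finally show ?case .
  qed
  show ?thesis by (simp add: series_exp_def antipode_sum antipode_scaleR pow)
qed

lemma represents_antipode:
  assumes c: "represents n \<omega> c z" and z: "\<And>p. fps_nth z' p = antipode (fps_nth z p)"
  shows "represents n \<omega> (\<lambda>w. (-1) ^ length w * c (rev w)) z'"
  unfolding represents_def
proof
  fix p
  have "fps_nth z' p = (\<Sum>w\<in>index_words n p. (c w * (-1) ^ length w) *\<^sub>R uea_word \<omega> (rev w))"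
    using c by (simp add: z represents_def antipode_sum antipode_scaleR antipode_uea_word)
  also have "\<dots> = (\<Sum>w\<in>index_words n p. ((-1) ^ length w * c (rev w)) *\<^sub>R uea_word \<omega> w)"
    by (rule sum.reindex_bij_witness[of _ rev rev]) (auto simp: index_words_def)
  finally show "fps_nth z' p = (\<Sum>w\<in>index_words n p. ((-1) ^ length w * c (rev w)) *\<^sub>R uea_word \<omega> w)" .
qed

lemma factorial_bound_antipode:
  assumes "factorial_bound n C a c"
  shows "factorial_bound n C a (\<lambda>w. (-1) ^ length w * c (rev w))"
proof -
  have "(\<Sum>w\<in>index_words n p. \<bar>(-1) ^ length w * c (rev w)\<bar>) = (\<Sum>w\<in>index_words n p. \<bar>c w\<bar>)" for p
    by (rule sum.reindex_bij_witness[of _ rev rev]) (auto simp: index_words_def abs_mult)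
  then show ?thesis using assms by (simp add: factorial_bound_def)
qed

section \<open>The action of the enveloping algebra\<close>

locale lie_action_on =
  fixes S :: "(complex ^ 'N) set" and X :: "'g::lie_algebra \<Rightarrow> complex ^ 'N \<Rightarrow> complex ^ 'N"
  assumes lie_action: "lie_action S X"
begin

lemma action_field: "holomorphic_vector_field S (X x)"
  using lie_action unfolding lie_action_def by blast

lemma action_tangent: "p \<in> S \<Longrightarrow> X x p \<in> tangent_space S p"
  using action_field unfolding holomorphic_vector_field_def by blast

definition vf_word :: "'g free_monoid \<Rightarrow> (complex ^ 'N \<Rightarrow> complex) \<Rightarrow> complex ^ 'N \<Rightarrow> complex" where
  "vf_word w = foldr (\<lambda>x. vf_apply S (X x)) (letters w)"

lemma vf_word_plus: "vf_word (u + v) F = vf_word u (vf_word v F)"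
  by (simp add: vf_word_def plus_free_monoid_def)

lemma vf_word_holomorphic: "F \<in> holomorphic_functions S \<Longrightarrow> vf_word w F \<in> holomorphic_functions S"
  unfolding vf_word_def by (rule foldr_vf_apply_holomorphic[OF _ action_field])

lemma vf_word_lincomb:
  assumes "\<And>k. k \<in> I \<Longrightarrow> F k \<in> holomorphic_functions S" "\<xi> \<in> S"
  shows "vf_word w (\<lambda>x. \<Sum>k\<in>I. b k * F k x) \<xi> = (\<Sum>k\<in>I. b k * vf_word w (F k) \<xi>)"
  unfolding vf_word_def by (rule foldr_vf_apply_lincomb[OF assms(1) action_field assms(2)])

definition free_act :: "'g free_algebra \<Rightarrow> (complex ^ 'N \<Rightarrow> complex) \<Rightarrow> complex ^ 'N \<Rightarrow> complex" where
  "free_act p F \<xi> = free_extend (\<lambda>w. vf_word w F \<xi>) p"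

lemma free_act_lincomb:
  assumes F: "\<And>k. k \<in> I \<Longrightarrow> F k \<in> holomorphic_functions S" and \<xi>: "\<xi> \<in> S"
  shows "free_act p (\<lambda>x. \<Sum>k\<in>I. b k * F k x) \<xi> = (\<Sum>k\<in>I. b k * free_act p (F k) \<xi>)"
proof -
  have "free_act p (\<lambda>x. \<Sum>k\<in>I. b k * F k x) \<xi>
      = (\<Sum>w\<in>Poly_Mapping.keys p. \<Sum>k\<in>I. Poly_Mapping.lookup p w *\<^sub>R (b k * vf_word w (F k) \<xi>))"
    by (simp add: free_act_def free_extend_def vf_word_lincomb[OF F \<xi>] scaleR_sum_right)
  also have "\<dots> = (\<Sum>k\<in>I. \<Sum>w\<in>Poly_Mapping.keys p. Poly_Mapping.lookup p w *\<^sub>R (b k * vf_word w (F k) \<xi>))"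
    by (rule sum.swap)
  finally show ?thesis by (simp add: free_act_def free_extend_def sum_distrib_left)
qed

lemma free_act_holomorphic: "F \<in> holomorphic_functions S \<Longrightarrow> free_act p F \<in> holomorphic_functions S"
  unfolding free_act_def[abs_def] free_extend_def
  by (intro holomorphic_functions_sum holomorphic_functions_scaleR vf_word_holomorphic)

lemma free_act_cong:
  assumes "F \<in> holomorphic_functions S" "\<And>x. x \<in> S \<Longrightarrow> F x = G x" "\<xi> \<in> S"
  shows "free_act p F \<xi> = free_act p G \<xi>"
  unfolding free_act_def free_extend_def vf_word_def
  by (intro sum.cong refl arg_cong2[of _ _ _ _ scaleR] foldr_vf_apply_cong action_field assms)

lemma free_act_mult:
  assumes F: "F \<in> holomorphic_functions S" and \<xi>: "\<xi> \<in> S"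
  shows "free_act (p * q) F \<xi> = free_act p (free_act q F) \<xi>"
proof -
  have "free_extend (\<lambda>v. vf_word (u + v) F \<xi>) q = vf_word u (free_act q F) \<xi>" for u
  proof -
    have "free_act q F = (\<lambda>x. \<Sum>v\<in>Poly_Mapping.keys q. of_real (Poly_Mapping.lookup q v) * vf_word v F x)"
      by (simp add: free_act_def[abs_def] free_extend_def scaleR_conv_of_real)
    then have "vf_word u (free_act q F) \<xi>
        = (\<Sum>v\<in>Poly_Mapping.keys q. of_real (Poly_Mapping.lookup q v) * vf_word u (vf_word v F) \<xi>)"
      using vf_word_lincomb[OF vf_word_holomorphic[OF F] \<xi>] by simp
    then show ?thesis by (simp add: free_extend_def vf_word_plus scaleR_conv_of_real)
  qed
  then show ?thesis by (simp add: free_act_def[of _ _ \<xi>] free_extend_mult)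
qed

lemma free_act_gen: "free_act (free_gen x) F \<xi> = vf_apply S (X x) F \<xi>"
  by (simp add: free_act_def free_gen_def free_extend_single vf_word_def)

lemma free_act_zero_fun:
  assumes "F \<in> holomorphic_functions S" "\<And>x. x \<in> S \<Longrightarrow> F x = 0" "\<xi> \<in> S"
  shows "free_act p F \<xi> = 0"
  using free_act_cong[OF assms(1), of "\<lambda>_. 0"] free_act_lincomb[of "{}" "\<lambda>_. F" \<xi> p "\<lambda>_. 0"] assms by simp

text \<open>The induction runs over all functions and all points at once: for a left multiple the
  inner operator must annihilate the function on all of \<open>S\<close>, and for a right multiple
  the hypothesis is applied to a transformed function. The bracket relation is the homomorphism
  property of the action.\<close>

lemma free_act_ideal:
  assumes "p \<in> uea_ideal" "F \<in> holomorphic_functions S" "\<xi> \<in> S"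
  shows "free_act p F \<xi> = 0"
  using assms
proof (induction arbitrary: F \<xi> rule: uea_ideal.induct)
  case zero
  then show ?case by (simp add: free_act_def free_extend_0)
next
  case (add p q)
  then show ?case by (simp add: free_act_def free_extend_add)
next
  case (mult_left p q)
  then show ?case
    using free_act_zero_fun[OF free_act_holomorphic[OF mult_left.prems(1), of p]] by (simp add: free_act_mult)
next
  case (mult_right p q)
  then show ?case using free_act_holomorphic[OF mult_right.prems(1)] by (simp add: free_act_mult)
next
  case (gen_add x y)
  have "X (x + y) \<xi> = X x \<xi> + X y \<xi>" using lie_action gen_add.prems(2) unfolding lie_action_def by blast
  from vf_apply_field_add[where X = "X x" and Y = "X y" and Z = "X (x + y)", OF gen_add.prems action_tangent action_tangent action_tangent this]
  show ?case using gen_add.prems(2)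
    by (simp add: free_act_def free_extend_diff) (simp add: free_act_gen flip: free_act_def)
next
  case (gen_scaleR c x)
  have "X (c *\<^sub>R x) \<xi> = c *\<^sub>R X x \<xi>" using lie_action gen_scaleR.prems(2) unfolding lie_action_def by blast
  from vf_apply_field_scaleR[where X = "X x" and Z = "X (c *\<^sub>R x)", OF gen_scaleR.prems action_tangent action_tangent this]
  show ?case using gen_scaleR.prems(2)
    by (simp add: free_act_def free_extend_diff free_extend_scaleR) (simp add: free_act_gen flip: free_act_def)
next
  case (gen_bracket x y)
  have eq: "free_act (free_gen x) G = vf_apply S (X x) G" for x G by (simp add: fun_eq_iff free_act_gen)
  have "free_act (free_gen x * free_gen y - free_gen y * free_gen x - free_gen (lie_bracket x y)) F \<xi>
    = free_act (free_gen x * free_gen y) F \<xi> - free_act (free_gen y * free_gen x) F \<xi>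
      - free_act (free_gen (lie_bracket x y)) F \<xi>"
    by (simp add: free_act_def free_extend_diff)
  also have "\<dots> = vf_apply S (X x) (vf_apply S (X y) F) \<xi> - vf_apply S (X y) (vf_apply S (X x) F) \<xi>
      - vf_apply S (X (lie_bracket x y)) F \<xi>"
    by (simp add: free_act_mult[OF gen_bracket] eq)
  also have "\<dots> = 0" using lie_action gen_bracket unfolding lie_action_def by auto
  finally show ?case .
qed

lemma uea_act_eq: "uea_act S X u F = free_act (rep_uea u) F"
  by (simp add: fun_eq_iff uea_act_def free_act_def free_extend_def vf_word_def)

lemma uea_act_abs:
  assumes "F \<in> holomorphic_functions S" "\<xi> \<in> S"
  shows "uea_act S X (abs_uea p) F \<xi> = free_act p F \<xi>"
  using free_act_ideal[OF rep_abs_uea assms, of p]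
  by (simp add: uea_act_eq free_act_def free_extend_diff)

lemma uea_act_holomorphic: "F \<in> holomorphic_functions S \<Longrightarrow> uea_act S X u F \<in> holomorphic_functions S"
  by (simp add: uea_act_eq free_act_holomorphic)

lemma uea_act_cong:
  "F \<in> holomorphic_functions S \<Longrightarrow> (\<And>x. x \<in> S \<Longrightarrow> F x = G x) \<Longrightarrow> \<xi> \<in> S \<Longrightarrow>
    uea_act S X u F \<xi> = uea_act S X u G \<xi>"
  by (simp add: uea_act_eq free_act_cong)

lemma uea_act_lincomb:
  "(\<And>k. k \<in> I \<Longrightarrow> F k \<in> holomorphic_functions S) \<Longrightarrow> \<xi> \<in> S \<Longrightarrow>
    uea_act S X u (\<lambda>x. \<Sum>k\<in>I. b k * F k x) \<xi> = (\<Sum>k\<in>I. b k * uea_act S X u (F k) \<xi>)"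
  unfolding uea_act_eq by (rule free_act_lincomb)

lemma uea_act_add_fun:
  assumes "F \<in> holomorphic_functions S" "G \<in> holomorphic_functions S" "\<xi> \<in> S"
  shows "uea_act S X u (\<lambda>x. F x + G x) \<xi> = uea_act S X u F \<xi> + uea_act S X u G \<xi>"
  using uea_act_lincomb[of UNIV "\<lambda>k. if k then F else G" \<xi> u "\<lambda>_. 1"] assms by (simp add: UNIV_bool add.commute)

context
  fixes F :: "complex ^ 'N \<Rightarrow> complex" and \<xi> :: "complex ^ 'N"
  assumes F: "F \<in> holomorphic_functions S" and \<xi>: "\<xi> \<in> S"
begin

lemma uea_act_add: "uea_act S X (u + v) F \<xi> = uea_act S X u F \<xi> + uea_act S X v F \<xi>"
proof -
  have "u + v = abs_uea (rep_uea u + rep_uea v)" by (metis abs_uea_rep plus_uea.abs_eq)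
  then show ?thesis by (simp add: uea_act_abs[OF F \<xi>]) (simp add: uea_act_eq free_act_def free_extend_add)
qed

lemma uea_act_scaleR: "uea_act S X (c *\<^sub>R u) F \<xi> = c *\<^sub>R uea_act S X u F \<xi>"
proof -
  have "c *\<^sub>R u = abs_uea (c *\<^sub>R rep_uea u)" by (metis abs_uea_rep scaleR_uea.abs_eq)
  then show ?thesis by (simp add: uea_act_abs[OF F \<xi>]) (simp add: uea_act_eq free_act_def free_extend_scaleR)
qed

lemma uea_act_zero: "uea_act S X 0 F \<xi> = 0"
  using uea_act_scaleR[of 0 0] by simp

lemma uea_act_sum: "uea_act S X (\<Sum>i\<in>I. u i) F \<xi> = (\<Sum>i\<in>I. uea_act S X (u i) F \<xi>)"
  by (induction I rule: infinite_finite_induct) (simp_all add: uea_act_zero uea_act_add)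

lemma uea_act_diff: "uea_act S X (u - v) F \<xi> = uea_act S X u F \<xi> - uea_act S X v F \<xi>"
  using uea_act_add[of u "(-1) *\<^sub>R v"] uea_act_scaleR[of "-1" v] by simp

lemma uea_act_mult: "uea_act S X (u * v) F \<xi> = uea_act S X u (uea_act S X v F) \<xi>"
proof -
  have "u * v = abs_uea (rep_uea u * rep_uea v)" by (metis abs_uea_rep times_uea.abs_eq)
  then show ?thesis by (simp add: uea_act_abs[OF F \<xi>]) (simp add: uea_act_eq free_act_mult[OF F \<xi>])
qed

lemma uea_act_one: "uea_act S X 1 F \<xi> = F \<xi>"
proof -
  have "uea_act S X 1 F \<xi> = free_act 1 F \<xi>"
    unfolding one_uea.abs_eq by (rule uea_act_abs[OF F \<xi>])
  also have "\<dots> = F \<xi>"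
    unfolding single_one[symmetric] free_act_def free_extend_single
    by (simp add: vf_word_def zero_free_monoid_def)
  finally show ?thesis .
qed

lemma uea_act_gen: "uea_act S X (uea_gen x) F \<xi> = vf_apply S (X x) F \<xi>"
proof -
  have "uea_gen x = abs_uea (free_gen x)" by (rule uea_gen.abs_eq)
  then show ?thesis by (simp add: uea_act_abs[OF F \<xi>] free_act_gen)
qed

end

subsection \<open>Exponentials act by algebra homomorphisms\<close>

definition act_series :: "complex ^ 'N \<Rightarrow> 'g uea fps \<Rightarrow> (complex ^ 'N \<Rightarrow> complex) \<Rightarrow> complex fps" where
  "act_series \<xi> u F = Abs_fps (\<lambda>p. uea_act S X (fps_nth u p) F \<xi>)"

lemma act_series_nth: "fps_nth (act_series \<xi> u F) p = uea_act S X (fps_nth u p) F \<xi>"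
  by (simp add: act_series_def)

lemma act_series_mult_right:
  assumes F: "F \<in> holomorphic_functions S" and \<xi>: "\<xi> \<in> S"
  shows "fps_nth (act_series \<xi> (u * x) F) p
    = (\<Sum>j\<le>p. fps_nth (act_series \<xi> u (uea_act S X (fps_nth x j) F)) (p - j))"
proof -
  have "fps_nth (act_series \<xi> (u * x) F) p
      = (\<Sum>i=0..p. uea_act S X (fps_nth u i) (uea_act S X (fps_nth x (p - i)) F) \<xi>)"
    by (simp add: act_series_nth fps_mult_nth uea_act_sum[OF F \<xi>] uea_act_mult[OF F \<xi>])
  also have "\<dots> = (\<Sum>j\<le>p. uea_act S X (fps_nth u (p - j)) (uea_act S X (fps_nth x j) F) \<xi>)"
    by (rule sum.reindex_bij_witness[of _ "\<lambda>j. p - j" "\<lambda>i. p - i"]) auto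
  finally show ?thesis by (simp add: act_series_nth)
qed

text \<open>\<open>A\<close> is the sum of the series \<open>C j\<close>, each shifted by
  \<open>j\<close> degrees, and multiplication by \<open>B\<close> commutes with shifts.\<close>

lemma fps_mult_shifted_sum:
  fixes A B :: "complex fps" and C :: "nat \<Rightarrow> complex fps"
  assumes "\<And>q. fps_nth A q = (\<Sum>j\<le>q. fps_nth (C j) (q - j))"
  shows "(\<Sum>j\<le>p. fps_nth (C j * B) (p - j)) = fps_nth (A * B) p"
proof -
  let ?g = "\<lambda>j i. fps_nth (C j) i * fps_nth B (p - (j + i))"
  have "fps_nth (A * B) p = (\<Sum>q\<le>p. \<Sum>j\<le>q. ?g j (q - j))"
    unfolding fps_mult_nth atMost_atLeast0[symmetric] assms by (simp add: sum_distrib_right)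
  also have "\<dots> = (\<Sum>(j, i)\<in>{(j, i). j + i \<le> p}. ?g j i)" by (rule sum.triangle_reindex_eq[symmetric])
  also have "{(j, i). j + i \<le> p} = Sigma {..p} (\<lambda>j. {..p - j})" by auto
  also have "(\<Sum>(j, i)\<in>Sigma {..p} (\<lambda>j. {..p - j}). ?g j i) = (\<Sum>j\<le>p. \<Sum>i\<le>p - j. ?g j i)"
    by (rule sum.Sigma[symmetric]) auto
  also have "\<dots> = (\<Sum>j\<le>p. fps_nth (C j * B) (p - j))"
    unfolding fps_mult_nth atMost_atLeast0[symmetric] by simp
  finally show ?thesis by simp
qed

lemma pascal_sum:
  fixes f :: "nat \<Rightarrow> nat \<Rightarrow> 'b::comm_ring_1"
  shows "(\<Sum>l\<le>k. of_nat (k choose l) * (f (Suc l) (k - l) + f l (Suc (k - l))))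
    = (\<Sum>l\<le>Suc k. of_nat (Suc k choose l) * f l (Suc k - l))"
proof -
  have "(\<Sum>l\<le>Suc k. of_nat (Suc k choose l) * f l (Suc k - l))
      = f 0 (Suc k) + (\<Sum>l\<le>k. of_nat (k choose l) * f (Suc l) (k - l))
        + (\<Sum>l\<le>k. of_nat (k choose Suc l) * f (Suc l) (k - l))"
    by (subst sum.atMost_Suc_shift) (simp add: algebra_simps sum.distrib)
  moreover have "f 0 (Suc k) + (\<Sum>l\<le>k. of_nat (k choose Suc l) * f (Suc l) (k - l))
      = (\<Sum>l\<le>Suc k. of_nat (k choose l) * f l (Suc k - l))"
    by (subst sum.atMost_Suc_shift) (simp add: binomial_eq_0)
  moreover have "\<dots> = (\<Sum>l\<le>k. of_nat (k choose l) * f l (Suc (k - l)))"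
    by (simp add: Suc_diff_le binomial_eq_0)
  ultimately show ?thesis by (simp add: algebra_simps sum.distrib)
qed

text \<open>The higher Leibniz formula. Every homogeneous component of \<open>x\<close> is a Lie
  element and acts as a derivation; since the components mix degrees, the formula is stated for
  generating series in the degree.\<close>

lemma act_series_power:
  assumes x: "x \<in> lie_completion gr" and F: "F \<in> holomorphic_functions S"
    and G: "G \<in> holomorphic_functions S" and \<xi>: "\<xi> \<in> S"
  shows "act_series \<xi> (x ^ k) (\<lambda>y. F y * G y)
    = (\<Sum>l\<le>k. of_nat (k choose l) * (act_series \<xi> (x ^ l) F * act_series \<xi> (x ^ (k - l)) G))"
  using F G
proof (induction k arbitrary: F G)
  case 0
  have "act_series \<xi> 1 F = fps_const (F \<xi>)" if "F \<in> holomorphic_functions S" for F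
    by (rule fps_ext) (simp add: act_series_nth uea_act_one[OF that \<xi>] uea_act_zero[OF that \<xi>])
  then show ?case using 0 holomorphic_functions_mult[OF 0] by (simp add: fps_const_mult)
next
  case (Suc k)
  define D where "D j F = uea_act S X (fps_nth x j) F" for j F
  have DA: "D j F \<in> holomorphic_functions S" if "F \<in> holomorphic_functions S" for j F
    unfolding D_def by (rule uea_act_holomorphic[OF that])
  have Leib: "D j (\<lambda>y. F y * G y) y = D j F y * G y + F y * D j G y" if y: "y \<in> S" for j y
  proof -
    obtain v where v: "fps_nth x j = uea_gen v" using x by (auto simp: lie_completion_def)
    show ?thesis unfolding D_def v
      by (simp add: uea_act_gen[OF _ y] Suc.prems holomorphic_functions_mult
          vf_apply_mult[where X = "X v", OF Suc.prems y action_tangent[OF y]])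
  qed
  note IH = Suc.IH
  \<comment> \<open>The last factor of the power is peeled off because it is the innermost operator:
    it meets the product of functions directly, where Leibniz applies, and the induction hypothesis
    handles the rest with changed functions.\<close>
  have snoc: "fps_nth (act_series \<xi> (x ^ Suc l) H) q = (\<Sum>j\<le>q. fps_nth (act_series \<xi> (x ^ l) (D j H)) (q - j))"
    if "H \<in> holomorphic_functions S" for H l q
    unfolding power_Suc2 D_def by (rule act_series_mult_right[OF that \<xi>])
  let ?\<Phi> = "\<lambda>l F. act_series \<xi> (x ^ l) F"
  show ?case
  proof (rule fps_ext)
    fix p
    have "fps_nth (?\<Phi> (Suc k) (\<lambda>y. F y * G y)) p
        = (\<Sum>j\<le>p. fps_nth (?\<Phi> k (\<lambda>y. D j F y * G y)) (p - j) + fps_nth (?\<Phi> k (\<lambda>y. F y * D j G y)) (p - j))"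
      unfolding snoc[OF holomorphic_functions_mult[OF Suc.prems]]
    proof (rule sum.cong[OF refl])
      fix j
      have 1: "(\<lambda>y. D j F y * G y) \<in> holomorphic_functions S" "(\<lambda>y. F y * D j G y) \<in> holomorphic_functions S"
        using DA Suc.prems by (auto intro: holomorphic_functions_mult)
      show "fps_nth (?\<Phi> k (D j (\<lambda>y. F y * G y))) (p - j)
        = fps_nth (?\<Phi> k (\<lambda>y. D j F y * G y)) (p - j) + fps_nth (?\<Phi> k (\<lambda>y. F y * D j G y)) (p - j)"
        unfolding act_series_nth uea_act_add_fun[OF 1 \<xi>, symmetric]
        by (rule uea_act_cong[OF DA[OF holomorphic_functions_mult[OF Suc.prems]] Leib \<xi>])
    qed
    also have "\<dots> = (\<Sum>j\<le>p. \<Sum>l\<le>k. of_nat (k choose l) *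
        (fps_nth (?\<Phi> l (D j F) * ?\<Phi> (k - l) G) (p - j) + fps_nth (?\<Phi> l F * ?\<Phi> (k - l) (D j G)) (p - j)))"
      by (intro sum.cong refl)
        (simp add: IH[OF DA Suc.prems(2)] IH[OF Suc.prems(1) DA] Suc.prems fps_sum_nth
          fps_of_nat[symmetric] distrib_left sum.distrib del: fps_of_nat)
    also have "\<dots> = (\<Sum>l\<le>k. of_nat (k choose l) *
        ((\<Sum>j\<le>p. fps_nth (?\<Phi> l (D j F) * ?\<Phi> (k - l) G) (p - j))
        + (\<Sum>j\<le>p. fps_nth (?\<Phi> (k - l) (D j G) * ?\<Phi> l F) (p - j))))"
      by (subst sum.swap) (simp add: sum_distrib_left distrib_left sum.distrib mult.commute[of "act_series \<xi> (x ^ _) F"])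
    also have "\<dots> = (\<Sum>l\<le>k. of_nat (k choose l) *
        (fps_nth (?\<Phi> (Suc l) F * ?\<Phi> (k - l) G) p + fps_nth (?\<Phi> l F * ?\<Phi> (Suc (k - l)) G) p))"
    proof (intro sum.cong refl arg_cong2[of _ _ _ _ "(*)"] arg_cong2[of _ _ _ _ "(+)"])
      fix l
      show "(\<Sum>j\<le>p. fps_nth (?\<Phi> l (D j F) * ?\<Phi> (k - l) G) (p - j)) = fps_nth (?\<Phi> (Suc l) F * ?\<Phi> (k - l) G) p"
        by (rule fps_mult_shifted_sum[OF snoc[OF Suc.prems(1)]])
      show "(\<Sum>j\<le>p. fps_nth (?\<Phi> (k - l) (D j G) * ?\<Phi> l F) (p - j)) = fps_nth (?\<Phi> l F * ?\<Phi> (Suc (k - l)) G) p"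
        using fps_mult_shifted_sum[OF snoc[OF Suc.prems(2)]] by (simp add: mult.commute)
    qed
    also have "\<dots> = (\<Sum>l\<le>Suc k. of_nat (Suc k choose l) * fps_nth (?\<Phi> l F * ?\<Phi> (Suc k - l) G) p)"
      by (rule pascal_sum[where f = "\<lambda>l m. fps_nth (?\<Phi> l F * ?\<Phi> m G) p"])
    also have "\<dots> = fps_nth (\<Sum>l\<le>Suc k. of_nat (Suc k choose l) * (?\<Phi> l F * ?\<Phi> (Suc k - l) G)) p"
      by (simp only: fps_sum_nth fps_of_nat[symmetric] fps_mult_left_const_nth)
    finally show "fps_nth (?\<Phi> (Suc k) (\<lambda>y. F y * G y)) p
      = fps_nth (\<Sum>l\<le>Suc k. of_nat (Suc k choose l) * (?\<Phi> l F * ?\<Phi> (Suc k - l) G)) p" .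
  qed
qed

text \<open>Division by \<open>fact k\<close> turns the binomial coefficients of
  \<open>act_series_power\<close> into the product of two exponential series.\<close>

lemma series_exp_multiplicative:
  assumes gr: "graded_lie_algebra gr" and x: "x \<in> lie_completion gr"
    and F: "F \<in> holomorphic_functions S" and G: "G \<in> holomorphic_functions S" and \<xi>: "\<xi> \<in> S"
  shows "uea_act S X (fps_nth (series_exp x) p) (\<lambda>y. F y * G y) \<xi>
    = (\<Sum>i\<le>p. uea_act S X (fps_nth (series_exp x) i) F \<xi> * uea_act S X (fps_nth (series_exp x) (p - i)) G \<xi>)"
proof -
  have low: "fps_nth (act_series \<xi> (x ^ l) H) q = 0" if "q < l" "H \<in> holomorphic_functions S" for l q H
    using fps_power_nth_less[OF lie_completion_0[OF gr x] that(1)]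
    by (simp add: act_series_nth uea_act_zero[OF that(2) \<xi>])
  define a where "a H l = scaleR_fps (1 / fact l) (act_series \<xi> (x ^ l) H)" for H l
  have exp: "fps_nth (act_series \<xi> (series_exp x) H) p = (\<Sum>l\<le>p. fps_nth (a H l) p)"
    if "H \<in> holomorphic_functions S" for H p
    by (simp add: act_series_nth series_exp_def a_def scaleR_fps_nth uea_act_sum[OF that \<xi>]
        uea_act_scaleR[OF that \<xi>] divide_inverse)
  have FG: "(\<lambda>y. F y * G y) \<in> holomorphic_functions S" by (rule holomorphic_functions_mult[OF F G])
  have "fps_nth (act_series \<xi> (series_exp x) F * act_series \<xi> (series_exp x) G) p
      = (\<Sum>k\<le>p. \<Sum>l\<le>k. fps_nth (a F l * a G (k - l)) p)"
    by (rule triangle_product) (simp_all add: exp F G, simp_all add: a_def scaleR_fps_nth low F G)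
  also have "\<dots> = (\<Sum>k\<le>p. fps_nth (a (\<lambda>y. F y * G y) k) p)"
  proof (rule sum.cong[OF refl])
    fix k
    have "fps_nth (a F l * a G (k - l)) p = (1 / fact k) *\<^sub>R (of_nat (k choose l) *
        fps_nth (act_series \<xi> (x ^ l) F * act_series \<xi> (x ^ (k - l)) G) p)" if "l \<le> k" for l
      using that by (simp add: a_def scaleR_fps_mult scaleR_fps_nth binomial_fact scaleR_conv_of_real)
    then have "(\<Sum>l\<le>k. fps_nth (a F l * a G (k - l)) p) = (1 / fact k) *\<^sub>R
      (\<Sum>l\<le>k. of_nat (k choose l) * fps_nth (act_series \<xi> (x ^ l) F * act_series \<xi> (x ^ (k - l)) G) p)"
      by (simp add: scaleR_sum_right)
    also have "(\<Sum>l\<le>k. of_nat (k choose l) * fps_nth (act_series \<xi> (x ^ l) F * act_series \<xi> (x ^ (k - l)) G) p)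
        = fps_nth (act_series \<xi> (x ^ k) (\<lambda>y. F y * G y)) p"
      unfolding act_series_power[OF x F G \<xi>] by (simp only: fps_sum_nth fps_of_nat[symmetric] fps_mult_left_const_nth)
    finally show "(\<Sum>l\<le>k. fps_nth (a F l * a G (k - l)) p) = fps_nth (a (\<lambda>y. F y * G y) k) p"
      by (simp add: a_def scaleR_fps_nth)
  qed
  also have "\<dots> = fps_nth (act_series \<xi> (series_exp x) (\<lambda>y. F y * G y)) p" by (simp add: exp[OF FG])
  finally show ?thesis by (simp add: fps_mult_nth act_series_nth atMost_atLeast0)
qed

end

section \<open>Iterated integrals\<close>

lemma conv_unit_right: "conv c unit_series = c"
proof
  fix w
  have "c (take i w) * unit_series (drop i w) = (if i = length w then c w else 0)" if "i \<le> length w" for i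
    using that by (auto simp: unit_series_def)
  then show "conv c unit_series w = c w" by (simp add: conv_def)
qed

lemma conv_unit_left: "conv unit_series c = c"
proof
  fix w
  have "unit_series (take i w) * c (drop i w) = (if i = 0 then c w else 0)" if "i \<le> length w" for i
    using that by (auto simp: unit_series_def)
  then show "conv unit_series c w = c w" by (simp add: conv_def)
qed

lemma conv_assoc: "conv (conv a b) c = conv a (conv b c)"
proof
  fix w :: "nat list"
  let ?g = "\<lambda>i j. a (take i w) * b (take j (drop i w)) * c (drop (i + j) w)"
  have "conv (conv a b) c w = (\<Sum>k\<le>length w. \<Sum>i\<le>k. ?g i (k - i))"
    unfolding conv_def sum_distrib_right
    by (intro sum.cong refl) (auto simp: min_def drop_take sum_distrib_right take_take)
  also have "\<dots> = (\<Sum>(i, j)\<in>{(i, j). i + j \<le> length w}. ?g i j)" by (rule sum.triangle_reindex_eq[symmetric])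
  also have "{(i, j). i + j \<le> length w} = Sigma {..length w} (\<lambda>i. {..length w - i})" by auto
  also have "(\<Sum>(i, j)\<in>Sigma {..length w} (\<lambda>i. {..length w - i}). ?g i j) = (\<Sum>i\<le>length w. \<Sum>j\<le>length w - i. ?g i j)"
    by (rule sum.Sigma[symmetric]) auto
  also have "\<dots> = conv a (conv b c) w"
    unfolding conv_def sum_distrib_left by (intro sum.cong refl) (simp_all add: mult.assoc add.commute)
  finally show "conv (conv a b) c w = conv a (conv b c) w" .
qed

lemma convs_snoc: "convs (cs @ [c]) = conv (convs cs) c"
  by (induction cs) (simp_all add: convs_def conv_unit_left conv_unit_right conv_assoc)

lemma sum_index_words_Suc:
  "(\<Sum>w\<in>index_words n (Suc p). f w) = (\<Sum>j<n. \<Sum>w\<in>index_words n p. f (j # w))"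
  unfolding sum.cartesian_product
  by (rule sum.reindex_bij_witness[of _ "\<lambda>(j, w). j # w" "\<lambda>w. (hd w, tl w)"])
    (auto simp: index_words_def length_Suc_conv)

lemma card_index_words: "card (index_words n p) = n ^ p"
proof -
  have "index_words n p = {w. set w \<subseteq> {..<n} \<and> length w = p}" by (auto simp: index_words_def)
  then show ?thesis using card_lists_length_eq[of "{..<n}" p] by simp
qed

text \<open>The integrals run over \<open>s \<le> r\<^sub>1 \<le> \<dots> \<le> r\<^sub>p \<le> t\<close> and are regarded as functions of the lower
  end: differentiating in \<open>s\<close> strips the first letter, the outermost vector field.\<close>

primrec iterated_integral :: "(nat \<Rightarrow> real \<Rightarrow> real) \<Rightarrow> real \<Rightarrow> nat list \<Rightarrow> real \<Rightarrow> real" where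
  "iterated_integral c t [] s = 1"
| "iterated_integral c t (j # w) s = integral {s..t} (\<lambda>r. c j r * iterated_integral c t w r)"

definition iterated_integral_deriv :: "(nat \<Rightarrow> real \<Rightarrow> real) \<Rightarrow> real \<Rightarrow> nat list \<Rightarrow> real \<Rightarrow> real" where
  "iterated_integral_deriv c t w s = (case w of [] \<Rightarrow> 0 | j # v \<Rightarrow> - (c j s * iterated_integral c t v s))"

lemma iterated_integral_end: "iterated_integral c t w t = (if w = [] then 1 else 0)"
  by (cases w) simp_all

lemma sum_iterated_integral_deriv:
  fixes g :: "nat list \<Rightarrow> complex"
  shows "(\<Sum>w\<in>index_words n p. of_real (iterated_integral_deriv c t w s) * g w) =
    (case p of 0 \<Rightarrow> 0 | Suc q \<Rightarrow> - (\<Sum>j<n. of_real (c j s) *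
      (\<Sum>w\<in>index_words n q. of_real (iterated_integral c t w s) * g (j # w))))"
  by (cases p) (simp_all add: index_words_0 sum_index_words_Suc iterated_integral_deriv_def
      sum_negf sum_distrib_left mult.assoc)

context
  fixes c :: "nat \<Rightarrow> real \<Rightarrow> real" and t :: real and n :: nat
  assumes cont: "\<And>j. j < n \<Longrightarrow> continuous_on {0..t} (c j)"
begin

lemma continuous_on_iterated_integral:
  assumes "set w \<subseteq> {..<n}"
  shows "continuous_on {0..t} (iterated_integral c t w)"
  using assms
proof (induction w)
  case (Cons j w)
  have "continuous_on {0..t} (\<lambda>r. c j r * iterated_integral c t w r)"
    using Cons by (intro continuous_on_mult cont) auto
  note integral_has_real_derivative'[OF this]
  then show ?case unfolding iterated_integral.simps by (rule DERIV_continuous_on)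
qed simp

lemma iterated_integral_has_derivative:
  assumes w: "set w \<subseteq> {..<n}" and s: "s \<in> {0..t}"
  shows "(iterated_integral c t w has_real_derivative iterated_integral_deriv c t w s) (at s within {0..t})"
proof (cases w)
  case Nil
  have "iterated_integral c t [] = (\<lambda>_. 1)" by (simp add: fun_eq_iff)
  then show ?thesis by (simp add: Nil iterated_integral_deriv_def)
next
  case (Cons j v)
  have "continuous_on {0..t} (\<lambda>r. c j r * iterated_integral c t v r)"
    using w Cons by (intro continuous_on_mult cont continuous_on_iterated_integral) auto
  from integral_has_real_derivative'[OF this s]
  have "(iterated_integral c t (j # v) has_real_derivative - (c j s * iterated_integral c t v s)) (at s within {0..t})"
    by (simp add: iterated_integral.simps(2)[abs_def])
  then show ?thesis by (simp add: Cons iterated_integral_deriv_def)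
qed

text \<open>\<open>(t - s) ^ p / fact p\<close> is the volume of the simplex of integration. In the
  induction step \<open>G\<close> is the primitive of the bound \<open>g\<close> that vanishes at
  \<open>t\<close>.\<close>

lemma iterated_integral_bound:
  assumes K: "\<And>j r. j < n \<Longrightarrow> r \<in> {0..t} \<Longrightarrow> \<bar>c j r\<bar> \<le> K" and w: "set w \<subseteq> {..<n}" and s: "s \<in> {0..t}"
  shows "\<bar>iterated_integral c t w s\<bar> \<le> (K * (t - s)) ^ length w / fact (length w)"
  using w s
proof (induction w arbitrary: s)
  case (Cons j w)
  have K0: "K \<ge> 0" using K[of j s] Cons.prems by force
  define g where "g r = K * ((K * (t - r)) ^ length w / fact (length w))" for r
  have "continuous_on {0..t} (\<lambda>r. c j r * iterated_integral c t w r)"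
    using Cons.prems by (intro continuous_on_mult cont continuous_on_iterated_integral) auto
  then have int: "(\<lambda>r. c j r * iterated_integral c t w r) integrable_on {s..t}"
    using Cons.prems by (intro integrable_continuous_interval) (auto elim: continuous_on_subset)
  define G where "G r = - ((K * (t - r)) ^ Suc (length w) / fact (Suc (length w)))" for r
  have "(G has_vector_derivative g r) (at r within {s..t})" for r
  proof -
    have "((\<lambda>r. K * (t - r)) has_real_derivative - K) (at r within {s..t})"
      by (auto intro!: derivative_eq_intros)
    then have "(G has_real_derivative - ((1 + real (length w)) * (- K * (K * (t - r)) ^ length w) / fact (Suc (length w))))
        (at r within {s..t})"
      unfolding G_def by (intro DERIV_minus DERIV_cdivide DERIV_power_Suc)
    moreover have "- ((1 + real (length w)) * (- K * (K * (t - r)) ^ length w) / fact (Suc (length w))) = g r"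
      unfolding g_def fact_Suc by (simp add: add.commute)
    ultimately have "(G has_real_derivative g r) (at r within {s..t})" by simp
    then show ?thesis by (simp add: has_real_derivative_iff_has_vector_derivative)
  qed
  then have "(g has_integral (G t - G s)) {s..t}"
    using Cons.prems by (intro fundamental_theorem_of_calculus) auto
  then have g: "g integrable_on {s..t}" "integral {s..t} g = (K * (t - s)) ^ Suc (length w) / fact (Suc (length w))"
    by (auto simp: G_def integral_unique has_integral_integrable)
  have "norm (integral {s..t} (\<lambda>r. c j r * iterated_integral c t w r)) \<le> integral {s..t} g"
  proof (rule Henstock_Kurzweil_Integration.integral_norm_bound_integral[OF int g(1)])
    fix r assume "r \<in> {s..t}"
    then show "norm (c j r * iterated_integral c t w r) \<le> g r"
      unfolding g_def real_norm_def abs_mult using Cons K0 by (intro mult_mono K Cons.IH) auto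
  qed
  then show ?case using g(2) by simp
qed simp

text \<open>The simplex volume supplies the factorial, and the \<open>n ^ p\<close> words of length
  \<open>p\<close> put the factor \<open>n\<close> into the radius. Short intervals thus give small
  radii, with constant 1.\<close>

lemma factorial_bound_iterated_integral:
  assumes K: "\<And>j r. j < n \<Longrightarrow> r \<in> {0..t} \<Longrightarrow> \<bar>c j r\<bar> \<le> K" and s: "s \<in> {0..t}"
  shows "factorial_bound n 1 (real n * (K * (t - s))) (\<lambda>w. iterated_integral c t w s)"
  unfolding factorial_bound_def
proof
  fix p
  have "(\<Sum>w\<in>index_words n p. \<bar>iterated_integral c t w s\<bar>) \<le> (\<Sum>w\<in>index_words n p. (K * (t - s)) ^ p / fact p)"
  proof (rule sum_mono)
    fix w assume "w \<in> index_words n p"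
    then have "set w \<subseteq> {..<n}" "length w = p" by (auto simp: index_words_def)
    then show "\<bar>iterated_integral c t w s\<bar> \<le> (K * (t - s)) ^ p / fact p"
      using iterated_integral_bound[OF K _ s, of w] by simp
  qed
  also have "\<dots> = real n ^ p * ((K * (t - s)) ^ p / fact p)" by (simp add: card_index_words)
  finally show "(\<Sum>w\<in>index_words n p. \<bar>iterated_integral c t w s\<bar>) * fact p \<le> 1 * (real n * (K * (t - s))) ^ p"
    by (simp add: power_mult_distrib[of "real n"] pos_le_divide_eq)
qed

text \<open>The functions \<open>g w\<close> may vary as well: the lemma is used with constant ones,
  with the action of the series \<open>E\<close>, and with values along a solution.\<close>

lemma iterated_integral_sum_has_derivative:
  fixes g g' :: "nat list \<Rightarrow> real \<Rightarrow> complex"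
  assumes s: "s \<in> {0..t}"
    and g: "\<And>w. w \<in> index_words n p \<Longrightarrow> (g w has_vector_derivative g' w s) (at s within {0..t})"
  shows "((\<lambda>r. \<Sum>w\<in>index_words n p. of_real (iterated_integral c t w r) * g w r) has_vector_derivative
    (\<Sum>w\<in>index_words n p. of_real (iterated_integral c t w s) * g' w s)
    + (\<Sum>w\<in>index_words n p. of_real (iterated_integral_deriv c t w s) * g w s)) (at s within {0..t})"
proof -
  have "((\<lambda>r. of_real (iterated_integral c t w r) * g w r) has_vector_derivative
      (of_real (iterated_integral c t w s) * g' w s + of_real (iterated_integral_deriv c t w s) * g w s))
      (at s within {0..t})" if w: "w \<in> index_words n p" for w
    using w by (intro has_vector_derivative_mult has_vector_derivative_of_real
        iterated_integral_has_derivative s g) (auto simp: index_words_def)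
  from has_vector_derivative_sum[OF this] show ?thesis by (simp add: sum.distrib)
qed

end

section \<open>Words of the enveloping algebra as words of vector fields\<close>

locale lie_fields = charted_vector_fields S M n "\<lambda>j. X (\<omega> j)" \<delta> B + lie_action_on S X
  for S :: "(complex ^ 'N) set" and M :: "(real ^ 'N) set" and n :: nat
    and X :: "'g::lie_algebra \<Rightarrow> complex ^ 'N \<Rightarrow> complex ^ 'N" and \<omega> :: "nat \<Rightarrow> 'g" and \<delta> B :: real
begin

lemma uea_act_word:
  assumes F: "F \<in> holomorphic_functions S" and w: "set w \<subseteq> {..<n}" and \<xi>: "\<xi> \<in> S"
  shows "uea_act S X (uea_word \<omega> w) F \<xi> = iter_field w F \<xi>"
  using w \<xi>
proof (induction w arbitrary: \<xi>)
  case Nil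
  then show ?case by (simp add: uea_word_simps iter_field_simps uea_act_one[OF F])
next
  case (Cons j w)
  have A: "uea_act S X (uea_word \<omega> w) F \<in> holomorphic_functions S" by (rule uea_act_holomorphic[OF F])
  have "vf_apply S (X (\<omega> j)) (uea_act S X (uea_word \<omega> w) F) \<xi> = vf_apply S (X (\<omega> j)) (iter_field w F) \<xi>"
    by (rule vf_apply_cong[where X = "X (\<omega> j)", OF A _ Cons.prems(2) action_tangent[OF Cons.prems(2)]])
      (use Cons in auto)
  then show ?case
    by (simp add: uea_word_simps iter_field_simps uea_act_mult[OF F Cons.prems(2)] uea_act_gen[OF A Cons.prems(2)])
qed

lemma uea_act_words:
  assumes F: "F \<in> holomorphic_functions S" and \<xi>: "\<xi> \<in> S"
    and u: "u = (\<Sum>w\<in>index_words n p. c w *\<^sub>R uea_word \<omega> w)"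
  shows "uea_act S X u F \<xi> = act c p F \<xi>"
  unfolding u uea_act_sum[OF F \<xi>] uea_act_scaleR[OF F \<xi>] act_def
  by (intro sum.cong refl) (simp add: uea_act_word[OF F _ \<xi>] index_words_def scaleR_conv_of_real)

lemma uea_act_represents:
  assumes "represents n \<omega> c z" "F \<in> holomorphic_functions S" "\<xi> \<in> S"
  shows "uea_act S X (fps_nth z p) F \<xi> = act c p F \<xi>"
  using assms unfolding represents_def by (intro uea_act_words) auto

lemma grouplike_series_exp:
  assumes gr: "graded_lie_algebra gr" and x: "x \<in> lie_completion gr" and c: "represents n \<omega> c (series_exp x)"
  shows "grouplike c"
  unfolding grouplike_def
proof (intro conjI ballI allI)
  have "c [] *\<^sub>R (1 :: 'g uea) = 1"
    using c[unfolded represents_def, THEN spec, of 0]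
    by (simp add: series_exp_def index_words_0 uea_word_simps)
  then have "(c [] - 1) *\<^sub>R (1 :: 'g uea) = 0" by (simp add: scaleR_left_diff_distrib)
  then show "c [] = 1" by simp
  fix F G p \<xi> assume *: "F \<in> holomorphic_functions S" "G \<in> holomorphic_functions S" "\<xi> \<in> S"
  from series_exp_multiplicative[OF gr x this, of p]
  show "act c p (\<lambda>x. F x * G x) \<xi> = (\<Sum>i\<le>p. act c i F \<xi> * act c (p - i) G \<xi>)"
    by (simp add: uea_act_represents[OF c] * holomorphic_functions_mult)
qed

lemma act_conv_represents:
  assumes c: "\<And>p F \<xi>. F \<in> holomorphic_functions S \<Longrightarrow> \<xi> \<in> S \<Longrightarrow> act c p F \<xi> = uea_act S X (fps_nth y p) F \<xi>"
    and d: "\<And>p F \<xi>. F \<in> holomorphic_functions S \<Longrightarrow> \<xi> \<in> S \<Longrightarrow> act d p F \<xi> = uea_act S X (fps_nth z p) F \<xi>"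
    and F: "F \<in> holomorphic_functions S" and \<xi>: "\<xi> \<in> S"
  shows "act (conv c d) p F \<xi> = uea_act S X (fps_nth (y * z) p) F \<xi>"
proof -
  have "act c i (act d q F) \<xi> = uea_act S X (fps_nth y i) (uea_act S X (fps_nth z q) F) \<xi>" for i q
    unfolding c[OF act_holomorphic[OF F] \<xi>]
    by (rule uea_act_cong[OF act_holomorphic[OF F] d[OF F] \<xi>])
  then show ?thesis
    by (simp add: act_conv[OF F \<xi>] fps_mult_nth uea_act_sum[OF F \<xi>] uea_act_mult[OF F \<xi>] atMost_atLeast0)
qed

lemma act_convs_represents:
  assumes "list_all2 (\<lambda>c z. represents n \<omega> c z) cs zs" "F \<in> holomorphic_functions S" "\<xi> \<in> S"
  shows "act (convs cs) p F \<xi> = uea_act S X (fps_nth (prod_list zs) p) F \<xi>"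
  using assms
proof (induction arbitrary: p F \<xi> rule: list_all2_induct)
  case Nil
  then show ?case
    by (cases "p = 0") (simp_all add: convs_def act_unit uea_act_one uea_act_zero)
next
  case (Cons c cs z zs)
  have "convs (c # cs) = conv c (convs cs)" by (simp add: convs_def)
  then show ?case
    using act_conv_represents[of c z "convs cs" "prod_list zs"] Cons uea_act_represents by simp
qed

subsection \<open>The flow of a time-dependent field\<close>

definition field_comb :: "(nat \<Rightarrow> real) \<Rightarrow> (complex ^ 'N \<Rightarrow> complex) \<Rightarrow> complex ^ 'N \<Rightarrow> complex" where
  "field_comb k F \<xi> = (\<Sum>j<n. of_real (k j) * vf_apply S (X (\<omega> j)) F \<xi>)"

lemma field_comb_cong:
  assumes "F \<in> holomorphic_functions S" "\<And>x. x \<in> S \<Longrightarrow> F x = G x" "\<xi> \<in> S"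
  shows "field_comb k F \<xi> = field_comb k G \<xi>"
  unfolding field_comb_def
proof (intro sum.cong refl arg_cong2[of _ _ _ _ "(*)"])
  fix j
  show "vf_apply S (X (\<omega> j)) F \<xi> = vf_apply S (X (\<omega> j)) G \<xi>"
    by (rule vf_apply_cong[where X = "X (\<omega> j)", OF assms action_tangent[OF assms(3)]])
qed

lemma field_comb_holomorphic: "F \<in> holomorphic_functions S \<Longrightarrow> field_comb k F \<in> holomorphic_functions S"
  unfolding field_comb_def[abs_def]
  by (intro holomorphic_functions_sum holomorphic_functions_mult holomorphic_functions_const
      vf_apply_holomorphic action_field)

lemma field_comb_sum_mult:
  assumes A: "\<And>i. i \<in> I \<Longrightarrow> A i \<in> holomorphic_functions S" and B: "\<And>i. i \<in> I \<Longrightarrow> B' i \<in> holomorphic_functions S"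
    and \<xi>: "\<xi> \<in> S"
  shows "field_comb k (\<lambda>x. \<Sum>i\<in>I. A i x * B' i x) \<xi>
    = (\<Sum>i\<in>I. field_comb k (A i) \<xi> * B' i \<xi> + A i \<xi> * field_comb k (B' i) \<xi>)"
proof -
  have "vf_apply S (X (\<omega> j)) (\<lambda>x. \<Sum>i\<in>I. A i x * B' i x) \<xi>
      = (\<Sum>i\<in>I. vf_apply S (X (\<omega> j)) (A i) \<xi> * B' i \<xi> + A i \<xi> * vf_apply S (X (\<omega> j)) (B' i) \<xi>)" for j
  proof -
    have "vf_apply S (X (\<omega> j)) (\<lambda>x. \<Sum>i\<in>I. A i x * B' i x) \<xi> = (\<Sum>i\<in>I. vf_apply S (X (\<omega> j)) (\<lambda>x. A i x * B' i x) \<xi>)"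
      by (rule vf_apply_sum[where X = "X (\<omega> j)", OF _ \<xi> action_tangent[OF \<xi>]])
        (intro holomorphic_functions_mult A B)
    also have "\<dots> = (\<Sum>i\<in>I. vf_apply S (X (\<omega> j)) (A i) \<xi> * B' i \<xi> + A i \<xi> * vf_apply S (X (\<omega> j)) (B' i) \<xi>)"
      by (intro sum.cong refl vf_apply_mult[where X = "X (\<omega> j)"] A B \<xi> action_tangent[OF \<xi>])
    finally show ?thesis .
  qed
  then have "field_comb k (\<lambda>x. \<Sum>i\<in>I. A i x * B' i x) \<xi> = (\<Sum>j<n. \<Sum>i\<in>I. of_real (k j) *
      (vf_apply S (X (\<omega> j)) (A i) \<xi> * B' i \<xi> + A i \<xi> * vf_apply S (X (\<omega> j)) (B' i) \<xi>))"
    by (simp add: field_comb_def sum_distrib_left)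
  also have "\<dots> = (\<Sum>i\<in>I. \<Sum>j<n. of_real (k j) *
      (vf_apply S (X (\<omega> j)) (A i) \<xi> * B' i \<xi> + A i \<xi> * vf_apply S (X (\<omega> j)) (B' i) \<xi>))"
    by (rule sum.swap)
  finally show ?thesis
    by (simp add: field_comb_def sum_distrib_left sum_distrib_right distrib_left sum.distrib mult_ac)
qed

lemma field_comb_act:
  assumes F: "F \<in> holomorphic_functions S" and \<xi>: "\<xi> \<in> S"
  shows "field_comb k (act c p F) \<xi>
    = (\<Sum>j<n. of_real (k j) * (\<Sum>w\<in>index_words n p. of_real (c w) * iter_field (j # w) F \<xi>))"
proof -
  have "vf_apply S (X (\<omega> j)) (act c p F) \<xi> = (\<Sum>w\<in>index_words n p. of_real (c w) * iter_field (j # w) F \<xi>)"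
    if j: "j < n" for j
  proof -
    have "iter_field [j] (\<lambda>x. \<Sum>w\<in>index_words n p. of_real (c w) * iter_field w F x) \<xi>
        = (\<Sum>w\<in>index_words n p. of_real (c w) * iter_field [j] (iter_field w F) \<xi>)"
      by (rule iter_field_lincomb[OF iter_field_holomorphic[OF F] _ \<xi>]) (use j in \<open>auto simp: index_words_def\<close>)
    then show ?thesis by (simp add: iter_field_simps act_def[abs_def])
  qed
  then show ?thesis by (simp add: field_comb_def)
qed

end

locale lie_path = lie_fields S M n X \<omega> \<delta> B
  for S :: "(complex ^ 'N) set" and M :: "(real ^ 'N) set" and n :: nat
    and X :: "'g::lie_algebra \<Rightarrow> complex ^ 'N \<Rightarrow> complex ^ 'N" and \<omega> :: "nat \<Rightarrow> 'g" and \<delta> B :: real +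
  fixes c :: "nat \<Rightarrow> real \<Rightarrow> real" and T :: real
  assumes c_cont: "\<And>j. j < n \<Longrightarrow> continuous_on {0..T} (c j)"
begin

text \<open>The coefficients of the path-ordered exponential (Chen series) of the path from time
  \<open>s\<close> to time \<open>t\<close>.\<close>

abbreviation holonomy :: "real \<Rightarrow> real \<Rightarrow> nat list \<Rightarrow> real" where
  "holonomy t s \<equiv> (\<lambda>w. iterated_integral c t w s)"

lemma c_cont_t: "t \<le> T \<Longrightarrow> j < n \<Longrightarrow> continuous_on {0..t} (c j)"
  by (rule continuous_on_subset[OF c_cont]) auto

lemma act_holonomy_derivative:
  assumes F: "F \<in> holomorphic_functions S" and \<xi>: "\<xi> \<in> S" and t: "t \<le> T" and s: "s \<in> {0..t}"
  shows "((\<lambda>r. act (holonomy t r) p F \<xi>) has_vector_derivative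
    (case p of 0 \<Rightarrow> 0 | Suc q \<Rightarrow> - field_comb (\<lambda>j. c j s) (act (holonomy t s) q F) \<xi>)) (at s within {0..t})"
proof -
  have "((\<lambda>r. \<Sum>w\<in>index_words n p. of_real (iterated_integral c t w r) * iter_field w F \<xi>) has_vector_derivative
      (\<Sum>w\<in>index_words n p. of_real (iterated_integral c t w s) * 0)
      + (\<Sum>w\<in>index_words n p. of_real (iterated_integral_deriv c t w s) * iter_field w F \<xi>)) (at s within {0..t})"
    by (rule iterated_integral_sum_has_derivative[OF c_cont_t[OF t] s, where g' = "\<lambda>_ _. 0"])
      (auto intro: has_vector_derivative_const)
  moreover have "(\<lambda>r. act (holonomy t r) p F \<xi>)
      = (\<lambda>r. \<Sum>w\<in>index_words n p. of_real (iterated_integral c t w r) * iter_field w F \<xi>)"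
    by (simp add: act_def fun_eq_iff)
  ultimately show ?thesis
    unfolding sum_iterated_integral_deriv by (cases p) (simp_all add: field_comb_act[OF F \<xi>])
qed

lemma act_holonomy_end: "act (holonomy t t) p F \<xi> = (if p = 0 then F \<xi> else 0)"
proof -
  have "holonomy t t = unit_series" by (simp add: fun_eq_iff iterated_integral_end unit_series_def)
  then show ?thesis by (simp add: act_unit)
qed

text \<open>No logarithm is exhibited. By induction on the degree, both sides of the product rule
  have the same derivative in \<open>s\<close>, because \<open>field_comb\<close> is a derivation
  and lowers the degree by one, and they agree at \<open>s = t\<close>, where the holonomy is the
  unit series.\<close>

lemma grouplike_holonomy:
  assumes t: "t \<le> T" and s: "s \<in> {0..t}"
  shows "grouplike (holonomy t s)"
proof -
  have "act (holonomy t s) p (\<lambda>x. F x * G x) \<xi> = (\<Sum>i\<le>p. act (holonomy t s) i F \<xi> * act (holonomy t s) (p - i) G \<xi>)"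
    if F: "F \<in> holomorphic_functions S" and G: "G \<in> holomorphic_functions S" and "\<xi> \<in> S" "s \<in> {0..t}" for p F G \<xi> s
    using that(3,4)
  proof (induction p arbitrary: \<xi> s)
    case 0
    then show ?case by (simp add: act_0)
  next
    case (Suc p)
    note FG = holomorphic_functions_mult[OF F G]
    have \<xi>: "\<xi> \<in> S" by (rule Suc.prems(1))
    define A where "A i r = act (holonomy t r) i F \<xi>" for i r
    define A' where "A' i r = act (holonomy t r) i G \<xi>" for i r
    let ?L = "\<lambda>r. field_comb (\<lambda>j. c j r)"
    define D where "D i r = (case i of 0 \<Rightarrow> 0 | Suc q \<Rightarrow> - ?L r (act (holonomy t r) q F) \<xi>)" for i r
    define D' where "D' i r = (case i of 0 \<Rightarrow> 0 | Suc q \<Rightarrow> - ?L r (act (holonomy t r) q G) \<xi>)" for i r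
    define d where "d r = act (holonomy t r) (Suc p) (\<lambda>x. F x * G x) \<xi> - (\<Sum>i\<le>Suc p. A i r * A' (Suc p - i) r)" for r
    have "(d has_vector_derivative 0) (at r within {0..t})" if r: "r \<in> {0..t}" for r
    proof -
      have "(d has_vector_derivative - ?L r (act (holonomy t r) p (\<lambda>x. F x * G x)) \<xi>
          - (\<Sum>i\<le>Suc p. A i r * D' (Suc p - i) r + D i r * A' (Suc p - i) r)) (at r within {0..t})"
        unfolding d_def[abs_def] A_def A'_def D_def D'_def
        by (intro has_vector_derivative_diff has_vector_derivative_sum has_vector_derivative_mult
            act_holonomy_derivative F G \<xi> t r)
          (use act_holonomy_derivative[OF FG \<xi> t r, of "Suc p"] in simp)
      moreover have "?L r (act (holonomy t r) p (\<lambda>x. F x * G x)) \<xi>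
          = (\<Sum>i\<le>p. ?L r (act (holonomy t r) i F) \<xi> * A' (p - i) r + A i r * ?L r (act (holonomy t r) (p - i) G) \<xi>)"
      proof -
        have "?L r (act (holonomy t r) p (\<lambda>x. F x * G x)) \<xi>
            = ?L r (\<lambda>x. \<Sum>i\<le>p. act (holonomy t r) i F x * act (holonomy t r) (p - i) G x) \<xi>"
          by (rule field_comb_cong[OF act_holomorphic[OF FG] Suc.IH[OF _ r] \<xi>])
        also have "\<dots> = (\<Sum>i\<le>p. ?L r (act (holonomy t r) i F) \<xi> * A' (p - i) r + A i r * ?L r (act (holonomy t r) (p - i) G) \<xi>)"
          unfolding A_def A'_def
          by (rule field_comb_sum_mult[OF act_holomorphic[OF F] act_holomorphic[OF G] \<xi>])
        finally show ?thesis .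
      qed
      moreover have "(\<Sum>i\<le>Suc p. D i r * A' (Suc p - i) r) = - (\<Sum>i\<le>p. ?L r (act (holonomy t r) i F) \<xi> * A' (p - i) r)"
        by (subst sum.atMost_Suc_shift) (simp add: D_def sum_negf)
      moreover have "(\<Sum>i\<le>Suc p. A i r * D' (Suc p - i) r) = - (\<Sum>i\<le>p. A i r * ?L r (act (holonomy t r) (p - i) G) \<xi>)"
        by (simp add: D'_def sum_negf Suc_diff_le)
      ultimately show ?thesis by (simp add: sum.distrib)
    qed
    then obtain z where "\<And>r. r \<in> {0..t} \<Longrightarrow> d r = z"
      using has_vector_derivative_zero_constant[of "{0..t}" d] by auto
    moreover have "d t = 0"
    proof -
      have "(\<Sum>i\<le>Suc p. A i t * A' (Suc p - i) t) = 0"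
      proof (rule sum.neutral, rule ballI)
        show "A i t * A' (Suc p - i) t = 0" for i
          by (cases "i = 0") (simp_all add: A_def A'_def act_holonomy_end)
      qed
      then show ?thesis unfolding d_def by (simp add: act_holonomy_end del: sum.atMost_Suc)
    qed
    ultimately have "d s = 0" using Suc.prems(2) by (metis atLeastAtMost_iff order_refl order_trans)
    then show ?case by (simp add: d_def A_def A'_def)
  qed
  then show ?thesis using s unfolding grouplike_def by auto
qed

text \<open>The product of the series of \<open>E\<close> up to \<open>s\<close> with the holonomy from \<open>s\<close> to \<open>t\<close> does not depend
  on \<open>s\<close>: the two derivatives cancel.\<close>

lemma holonomy_split:
  assumes gr: "graded_lie_algebra gr" and \<omega>: "indexed_basis n \<omega> (gr 1)"
    and \<mu>: "\<And>r. r \<in> {0..T} \<Longrightarrow> \<mu> r = (\<Sum>j<n. c j r *\<^sub>R \<omega> j)"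
    and E: "\<And>r. r \<in> {0..T} \<Longrightarrow> E r \<in> uea_completion gr"
      "\<And>r. r \<in> {0..T} \<Longrightarrow>
        has_series_derivative n \<omega> E (E r * (fps_const (uea_gen (\<mu> r)) * fps_X)) r {0..T}"
    and F: "F \<in> holomorphic_functions S" and \<xi>: "\<xi> \<in> S" and t: "t \<in> {0..T}" and s: "s \<in> {0..t}"
  shows "uea_act S X (fps_nth (E t) p) F \<xi>
    = (\<Sum>i\<le>p. uea_act S X (fps_nth (E s) i) (act (holonomy t s) (p - i) F) \<xi>)"
proof -
  have tT: "t \<le> T" using t by simp
  let ?L = "\<lambda>r. field_comb (\<lambda>j. c j r)"
  have coef: "fps_nth (E r * (fps_const (uea_gen (\<mu> r)) * fps_X)) i
      = (case i of 0 \<Rightarrow> 0 | Suc k \<Rightarrow> fps_nth (E r) k * uea_gen (\<mu> r))" for r i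
    by (cases i) (simp_all add: mult.assoc[symmetric])
  have words: "fps_nth (E r) i \<in> word_span n \<omega> i" if "r \<in> {0..T}" for r i
    using E(1)[OF that] uea_grade_words[OF gr \<omega>] unfolding uea_completion_def by blast
  have gen\<mu>: "uea_gen (\<mu> r) \<in> word_span n \<omega> 1" if "r \<in> {0..T}" for r
  proof -
    have "uea_word \<omega> [j] \<in> word_span n \<omega> 1" if "j < n" for j
      unfolding word_span_def by (intro span_base imageI) (simp add: index_words_def that)
    then show ?thesis unfolding \<mu>[OF that] uea_gen_sum uea_gen_scaleR
      by (intro subspace_sum subspace_scale subspace_word_span) (simp_all add: uea_word_simps)
  qed
  \<comment> \<open>Membership in the graded pieces is recorded because \<open>uea_norm\<close>
    controls an element only through its representations by words of that length.\<close>
  have coef_words: "fps_nth (E r * (fps_const (uea_gen (\<mu> r)) * fps_X)) i \<in> word_span n \<omega> i" if "r \<in> {0..T}" for r i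
    unfolding coef using word_span_mult[OF words[OF that] gen\<mu>[OF that]] subspace_0[OF subspace_word_span]
    by (cases i) auto
  \<comment> \<open>Transfers convergence in \<open>uea_norm\<close> to the action at
    \<open>\<xi>\<close>. The infimum is approached with slack \<open>e / ?W\<close>, so the case of
    vanishing weight is separate; there the action itself vanishes.\<close>
  have norm_bd: "norm (uea_act S X u H \<xi>) \<le> uea_norm n \<omega> i u * (\<Sum>w\<in>index_words n i. norm (iter_field w H \<xi>))"
    if u: "u \<in> word_span n \<omega> i" and H: "H \<in> holomorphic_functions S" for u H i
  proof (cases "(\<Sum>w\<in>index_words n i. norm (iter_field w H \<xi>)) = 0")
    case W0: True
    obtain k where k: "u = (\<Sum>w\<in>index_words n i. k w *\<^sub>R uea_word \<omega> w)"
      using span_image_finite[OF finite_index_words u[unfolded word_span_def]] .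
    have "iter_field w H \<xi> = 0" if "w \<in> index_words n i" for w
      using W0 that by (subst (asm) sum_nonneg_eq_0_iff) (auto simp: finite_index_words)
    then show ?thesis using uea_act_words[OF H \<xi> k] W0 by (simp add: act_def)
  next
    case False
    let ?W = "\<Sum>w\<in>index_words n i. norm (iter_field w H \<xi>)"
    have W: "?W > 0" using False sum_nonneg[of "index_words n i" "\<lambda>w. norm (iter_field w H \<xi>)"] by simp
    show ?thesis
    proof (rule field_le_epsilon)
      fix e :: real assume "e > 0"
      then have "e / ?W > 0" using W by simp
      then obtain k where k: "u = (\<Sum>w\<in>index_words n i. k w *\<^sub>R uea_word \<omega> w)"
        "(\<Sum>w\<in>index_words n i. \<bar>k w\<bar>) < uea_norm n \<omega> i u + e / ?W"
        using uea_norm_approx[OF u] by blast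
      have "norm (uea_act S X u H \<xi>) \<le> (\<Sum>w\<in>index_words n i. \<bar>k w\<bar> * ?W)"
        unfolding uea_act_words[OF H \<xi> k(1)] act_def
      proof (rule sum_norm_le)
        fix w assume w: "w \<in> index_words n i"
        have "norm (iter_field w H \<xi>) \<le> ?W" by (rule member_le_sum[OF w]) (simp_all add: finite_index_words)
        then show "norm (complex_of_real (k w) * iter_field w H \<xi>) \<le> \<bar>k w\<bar> * ?W"
          by (simp add: norm_mult mult_left_mono)
      qed
      also have "\<dots> = (\<Sum>w\<in>index_words n i. \<bar>k w\<bar>) * ?W" by (simp add: sum_distrib_right)
      also have "\<dots> \<le> (uea_norm n \<omega> i u + e / ?W) * ?W" using k(2) W by (intro mult_right_mono) auto
      also have "\<dots> = uea_norm n \<omega> i u * ?W + e" using W by (simp add: distrib_right)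
      finally show "norm (uea_act S X u H \<xi>) \<le> uea_norm n \<omega> i u * ?W + e" .
    qed
  qed
  \<comment> \<open>The equation for \<open>E\<close> read off on functions. Multiplication by
    \<open>\<mu> r\<close> raises the degree by one, hence the index shift and the zero in degree
    0.\<close>
  have E_deriv: "((\<lambda>r. uea_act S X (fps_nth (E r) i) H \<xi>) has_vector_derivative
      (case i of 0 \<Rightarrow> 0 | Suc k \<Rightarrow> uea_act S X (fps_nth (E r) k) (?L r H) \<xi>)) (at r within {0..t})"
    if H: "H \<in> holomorphic_functions S" and r: "r \<in> {0..t}" for H r i
  proof -
    have rT: "r \<in> {0..T}" using r tT by auto
    let ?v = "fps_nth (E r * (fps_const (uea_gen (\<mu> r)) * fps_X)) i"
    let ?W = "\<Sum>w\<in>index_words n i. norm (iter_field w H \<xi>)"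
    let ?q = "\<lambda>y. (fps_nth (E y) i - fps_nth (E r) i) /\<^sub>R (y - r) - ?v"
    have lim: "((\<lambda>y. uea_norm n \<omega> i (?q y) * ?W) \<longlongrightarrow> 0) (at r within {0..T})"
      using E(2)[OF rT] unfolding has_series_derivative_def by (intro tendsto_mult_left_zero) blast
    have "((\<lambda>y. ((uea_act S X (fps_nth (E y) i) H \<xi> - uea_act S X (fps_nth (E r) i) H \<xi>)
        - (y - r) *\<^sub>R uea_act S X ?v H \<xi>) /\<^sub>R norm (y - r)) \<longlongrightarrow> 0) (at r within {0..T})"
    proof (rule Lim_null_comparison[OF _ lim], unfold eventually_at, intro exI[of _ 1] conjI ballI impI)
      fix y assume y: "y \<in> {0..T}" "y \<noteq> r \<and> dist y r < 1"
      have q: "?q y \<in> word_span n \<omega> i"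
        by (intro subspace_diff subspace_scale subspace_word_span words coef_words y(1) rT)
      have "uea_act S X (?q y) H \<xi>
          = (uea_act S X (fps_nth (E y) i) H \<xi> - uea_act S X (fps_nth (E r) i) H \<xi>) /\<^sub>R (y - r) - uea_act S X ?v H \<xi>"
        by (simp add: uea_act_diff[OF H \<xi>] uea_act_scaleR[OF H \<xi>])
      also have "\<dots> = ((uea_act S X (fps_nth (E y) i) H \<xi> - uea_act S X (fps_nth (E r) i) H \<xi>)
          - (y - r) *\<^sub>R uea_act S X ?v H \<xi>) /\<^sub>R (y - r)"
        using y by (simp add: scaleR_diff_right)
      finally have "norm (((uea_act S X (fps_nth (E y) i) H \<xi> - uea_act S X (fps_nth (E r) i) H \<xi>)
          - (y - r) *\<^sub>R uea_act S X ?v H \<xi>) /\<^sub>R norm (y - r)) = norm (uea_act S X (?q y) H \<xi>)"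
        by simp
      also have "\<dots> \<le> uea_norm n \<omega> i (?q y) * ?W" by (rule norm_bd[OF q H])
      finally show "norm (((uea_act S X (fps_nth (E y) i) H \<xi> - uea_act S X (fps_nth (E r) i) H \<xi>)
          - (y - r) *\<^sub>R uea_act S X ?v H \<xi>) /\<^sub>R norm (y - r)) \<le> uea_norm n \<omega> i (?q y) * ?W" .
    qed simp
    then have "((\<lambda>y. uea_act S X (fps_nth (E y) i) H \<xi>) has_vector_derivative uea_act S X ?v H \<xi>) (at r within {0..T})"
      unfolding has_vector_derivative_def has_derivative_at_within by (simp add: bounded_linear_scaleR_left)
    then have "((\<lambda>y. uea_act S X (fps_nth (E y) i) H \<xi>) has_vector_derivative uea_act S X ?v H \<xi>) (at r within {0..t})"
      by (rule has_vector_derivative_within_subset) (use tT in auto)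
    moreover have "uea_act S X ?v H \<xi> = (case i of 0 \<Rightarrow> 0 | Suc k \<Rightarrow> uea_act S X (fps_nth (E r) k) (?L r H) \<xi>)"
    proof (cases i)
      case 0
      then show ?thesis by (simp add: coef uea_act_zero[OF H \<xi>])
    next
      case (Suc k)
      have "uea_act S X (uea_gen (\<mu> r)) H x = ?L r H x" if x: "x \<in> S" for x
        unfolding \<mu>[OF rT] uea_gen_sum uea_gen_scaleR uea_act_sum[OF H x] uea_act_scaleR[OF H x]
          uea_act_gen[OF H x] field_comb_def by (simp add: scaleR_conv_of_real)
      then show ?thesis
        using uea_act_cong[OF uea_act_holomorphic[OF H] _ \<xi>, of "uea_gen (\<mu> r)" "?L r H"]
        by (simp add: Suc coef uea_act_mult[OF H \<xi>])
    qed
    ultimately show ?thesis by simp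
  qed
  \<comment> \<open>\<open>Z r i q\<close> arises twice: with a plus sign from differentiating
    \<open>E\<close> in degree \<open>Suc i\<close>, and with a minus sign from differentiating the
    holonomy in degree \<open>Suc q\<close>. In the sum over a fixed total degree the two
    contributions cancel.\<close>
  define Z where "Z r i q = uea_act S X (fps_nth (E r) i) (?L r (act (holonomy t r) q F)) \<xi>" for r i q
  have act_expand: "uea_act S X u (act k q F) \<xi> = (\<Sum>w\<in>index_words n q. of_real (k w) * uea_act S X u (iter_field w F) \<xi>)"
    for u k q
    unfolding act_def[abs_def] by (rule uea_act_lincomb[OF iter_field_holomorphic[OF F] \<xi>]) (auto simp: index_words_def)
  have Q_deriv: "((\<lambda>r. uea_act S X (fps_nth (E r) i) (act (holonomy t r) q F) \<xi>) has_vector_derivative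
      (case i of 0 \<Rightarrow> 0 | Suc k \<Rightarrow> Z r k q) - (case q of 0 \<Rightarrow> 0 | Suc k \<Rightarrow> Z r i k)) (at r within {0..t})"
    if r: "r \<in> {0..t}" for r i q
  proof -
    let ?g = "\<lambda>w r. uea_act S X (fps_nth (E r) i) (iter_field w F) \<xi>"
    let ?g' = "\<lambda>w r. (case i of 0 \<Rightarrow> 0 | Suc k \<Rightarrow> uea_act S X (fps_nth (E r) k) (?L r (iter_field w F)) \<xi>)"
    have wF: "iter_field w F \<in> holomorphic_functions S" if "w \<in> index_words n q" for w q
      by (rule iter_field_holomorphic[OF F]) (use that in \<open>auto simp: index_words_def\<close>)
    have "((\<lambda>r. \<Sum>w\<in>index_words n q. of_real (iterated_integral c t w r) * ?g w r) has_vector_derivative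
      (\<Sum>w\<in>index_words n q. of_real (iterated_integral c t w r) * ?g' w r)
      + (\<Sum>w\<in>index_words n q. of_real (iterated_integral_deriv c t w r) * ?g w r)) (at r within {0..t})"
      by (rule iterated_integral_sum_has_derivative[OF c_cont_t[OF tT] r]) (assumption | rule E_deriv[OF wF r])+
    moreover have "(\<Sum>w\<in>index_words n q. of_real (iterated_integral c t w r) * ?g' w r)
        = (case i of 0 \<Rightarrow> 0 | Suc k \<Rightarrow> Z r k q)"
    proof (cases i)
      case (Suc k)
      have "?L r (act (holonomy t r) q F) x
          = (\<Sum>w\<in>index_words n q. of_real (iterated_integral c t w r) * ?L r (iter_field w F) x)" if x: "x \<in> S" for x
        unfolding field_comb_act[OF F x] unfolding field_comb_def sum_distrib_left
        by (subst sum.swap) (simp add: iter_field_simps mult_ac)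
      then have "Z r k q = uea_act S X (fps_nth (E r) k)
          (\<lambda>x. \<Sum>w\<in>index_words n q. of_real (iterated_integral c t w r) * ?L r (iter_field w F) x) \<xi>"
        unfolding Z_def by (intro uea_act_cong[OF field_comb_holomorphic[OF act_holomorphic[OF F]] _ \<xi>])
      also have "\<dots> = (\<Sum>w\<in>index_words n q. of_real (iterated_integral c t w r) *
          uea_act S X (fps_nth (E r) k) (?L r (iter_field w F)) \<xi>)"
        by (rule uea_act_lincomb[OF field_comb_holomorphic[OF wF] \<xi>])
      finally show ?thesis by (simp add: Suc)
    qed simp
    moreover have "(\<Sum>w\<in>index_words n q. of_real (iterated_integral_deriv c t w r) * ?g w r)
        = - (case q of 0 \<Rightarrow> 0 | Suc k \<Rightarrow> Z r i k)"
    proof (cases q)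
      case (Suc k)
      have jF: "iter_field (j # w) F \<in> holomorphic_functions S" if "w \<in> index_words n k" "j < n" for w j
        by (rule iter_field_holomorphic[OF F]) (use that in \<open>auto simp: index_words_def\<close>)
      have "Z r i k = uea_act S X (fps_nth (E r) i)
          (\<lambda>x. \<Sum>j<n. of_real (c j r) * (\<Sum>w\<in>index_words n k. of_real (iterated_integral c t w r) * iter_field (j # w) F x)) \<xi>"
        unfolding Z_def
        by (rule uea_act_cong[OF field_comb_holomorphic[OF act_holomorphic[OF F]] field_comb_act[OF F] \<xi>])
      also have "\<dots> = (\<Sum>j<n. of_real (c j r) * uea_act S X (fps_nth (E r) i)
          (\<lambda>x. \<Sum>w\<in>index_words n k. of_real (iterated_integral c t w r) * iter_field (j # w) F x) \<xi>)"
        by (rule uea_act_lincomb[OF _ \<xi>])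
          (intro holomorphic_functions_sum holomorphic_functions_mult holomorphic_functions_const jF, auto)
      also have "\<dots> = (\<Sum>j<n. of_real (c j r) * (\<Sum>w\<in>index_words n k. of_real (iterated_integral c t w r) *
          uea_act S X (fps_nth (E r) i) (iter_field (j # w) F) \<xi>))"
        by (intro sum.cong refl arg_cong2[of _ _ _ _ "(*)"] uea_act_lincomb[OF jF \<xi>]) auto
      finally show ?thesis unfolding sum_iterated_integral_deriv by (simp add: Suc)
    qed (simp add: sum_iterated_integral_deriv)
    ultimately show ?thesis by (simp add: act_expand)
  qed
  define f where "f r = (\<Sum>i\<le>p. uea_act S X (fps_nth (E r) i) (act (holonomy t r) (p - i) F) \<xi>)" for r
  have "(f has_vector_derivative 0) (at r within {0..t})" if r: "r \<in> {0..t}" for r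
  proof -
    have "(f has_vector_derivative (\<Sum>i\<le>p. (case i of 0 \<Rightarrow> 0 | Suc k \<Rightarrow> Z r k (p - i))
        - (case p - i of 0 \<Rightarrow> 0 | Suc k \<Rightarrow> Z r i k))) (at r within {0..t})"
      unfolding f_def[abs_def] by (intro has_vector_derivative_sum Q_deriv r)
    moreover have "(\<Sum>i\<le>p. (case i of 0 \<Rightarrow> 0 | Suc k \<Rightarrow> Z r k (p - i)) - (case p - i of 0 \<Rightarrow> 0 | Suc k \<Rightarrow> Z r i k)) = 0"
    proof (cases p)
      case (Suc m)
      have "(\<Sum>i\<le>Suc m. case i of 0 \<Rightarrow> 0 | Suc k \<Rightarrow> Z r k (Suc m - i)) = (\<Sum>i\<le>m. Z r i (m - i))"
        by (subst sum.atMost_Suc_shift) simp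
      moreover have "(\<Sum>i\<le>Suc m. case Suc m - i of 0 \<Rightarrow> 0 | Suc k \<Rightarrow> Z r i k) = (\<Sum>i\<le>m. Z r i (m - i))"
        by (simp add: Suc_diff_le)
      ultimately show ?thesis unfolding Suc sum_subtractf by (simp del: sum.atMost_Suc)
    qed simp
    ultimately show ?thesis by simp
  qed
  then obtain z where z: "\<And>r. r \<in> {0..t} \<Longrightarrow> f r = z"
    using has_vector_derivative_zero_constant[of "{0..t}" f] by auto
  have "f t = uea_act S X (fps_nth (E t) p) F \<xi>"
  proof -
    have "uea_act S X (fps_nth (E t) i) (act (holonomy t t) (p - i) F) \<xi>
        = (if i = p then uea_act S X (fps_nth (E t) p) F \<xi> else 0)" if "i \<le> p" for i
    proof (cases "i = p")
      case True
      have "uea_act S X u (act (holonomy t t) 0 F) \<xi> = uea_act S X u F \<xi>" for u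
        by (rule uea_act_cong[OF act_holomorphic[OF F] _ \<xi>]) (simp add: act_holonomy_end)
      then show ?thesis using True by simp
    next
      case False
      then have "act (holonomy t t) (p - i) F = (\<lambda>_. 0)" using that by (simp add: fun_eq_iff act_holonomy_end)
      then show ?thesis using False uea_act_lincomb[of "{}" "\<lambda>_. F" \<xi> _ "\<lambda>_. 0"] \<xi> by simp
    qed
    then show ?thesis by (simp add: f_def sum.delta)
  qed
  moreover have "f t = f s" using z[of t] z[OF s] s by auto
  ultimately show ?thesis by (simp add: f_def)
qed

end

section \<open>Differential equations on the real points\<close>

text \<open>Makes real parts of holomorphic functions available as test functions in the
  differential equation, which is stated for smooth real functions on \<open>M\<close>.\<close>

lemma smooth_real_part:
  assumes F: "F \<in> holomorphic_functions S" and M: "M = real_points S"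
  shows "extends_locally smooth_on M (\<lambda>x. Re (F (complexify x)))"
  unfolding extends_locally_def
proof
  fix m assume "m \<in> M"
  then have "complexify m \<in> S" by (simp add: M real_points_def)
  then obtain U G where U: "open U" "complexify m \<in> U" "holomorphic_fun_on U G" "\<And>x. x \<in> S \<inter> U \<Longrightarrow> G x = F x"
    using holomorphic_functionsE[OF F] by metis
  have op: "open (complexify -` U)" by (rule open_vimage[OF U(1) continuous_on_complexify])
  show "\<exists>V g. open V \<and> m \<in> V \<and> smooth_on V g \<and> (\<forall>x\<in>M \<inter> V. g x = Re (F (complexify x)))"
    by (intro exI[of _ "complexify -` U"] exI[of _ "\<lambda>x. Re (G (complexify x))"] conjI op
        smooth_on_Re_holomorphic[OF U(1,3) op]) (use U M in \<open>auto simp: real_points_def\<close>)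
qed

context lie_path
begin

text \<open>The equation is applied to the real parts of \<open>F\<close> and of
  \<open>- \<i> * F\<close>, which give the real and the imaginary part of the claim.\<close>

lemma solution_derivative:
  assumes R: "\<And>F. extends_locally smooth_on M F \<Longrightarrow> ((\<lambda>s. F (R s)) has_real_derivative
      vf_apply M (real_restriction V) F (R t)) (at t within {0..T})"
    and V: "\<And>\<xi>. \<xi> \<in> S \<Longrightarrow> V \<xi> = (\<Sum>j<n. c j t *\<^sub>R X (\<omega> j) \<xi>)"
    and F: "F \<in> holomorphic_functions S" and m: "R t \<in> M"
  shows "((\<lambda>s. F (complexify (R s))) has_vector_derivative
    field_comb (\<lambda>j. c j t) F (complexify (R t))) (at t within {0..T})"
proof -
  have *: "((\<lambda>s. Re (G (complexify (R s)))) has_real_derivative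
      Re (field_comb (\<lambda>j. c j t) G (complexify (R t)))) (at t within {0..T})"
    if G: "G \<in> holomorphic_functions S" for G
    using R[OF smooth_real_part[OF G M_eq]]
    unfolding vf_apply_real_restriction[where V = V and k = "\<lambda>j. c j t", OF G m V[OF M_S[OF m]]] field_comb_def .
  have "field_comb (\<lambda>j. c j t) (\<lambda>x. - \<i> * F x) (complexify (R t)) = - \<i> * field_comb (\<lambda>j. c j t) F (complexify (R t))"
    unfolding field_comb_def sum_distrib_left
    by (intro sum.cong refl)
      (simp add: vf_apply_cmult[where X = "X (\<omega> _)", OF F M_S[OF m] action_tangent[OF M_S[OF m]], of _ "- \<i>", simplified])
  then show ?thesis
    using *[OF F] *[OF holomorphic_functions_mult[OF holomorphic_functions_const F], of "- \<i>"]
    unfolding has_vector_derivative_complex_iff by simp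
qed

text \<open>Moving along \<open>R\<close> adds \<open>field_comb\<close> of every term, while moving
  the lower end of the holonomy subtracts that of the term one degree below. The sum telescopes, and
  only the term of degree \<open>P\<close> survives.\<close>

lemma taylor_derivative:
  assumes t: "t \<in> {0..T}" and s: "s \<in> {0..t}" and F: "F \<in> holomorphic_functions S"
    and R: "\<And>F. F \<in> holomorphic_functions S \<Longrightarrow> ((\<lambda>s. F (complexify (R s))) has_vector_derivative
      field_comb (\<lambda>j. c j s) F (complexify (R s))) (at s within {0..T})" and m: "R s \<in> M"
  shows "((\<lambda>r. \<Sum>p\<le>P. act (holonomy t r) p F (complexify (R r))) has_vector_derivative
    field_comb (\<lambda>j. c j s) (act (holonomy t s) P F) (complexify (R s))) (at s within {0..t})"
proof -
  let ?L = "field_comb (\<lambda>j. c j s)" and ?x = "complexify (R s)"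
  have x: "?x \<in> S" by (rule M_S[OF m])
  have tT: "t \<le> T" using t by simp
  have wF: "iter_field w F \<in> holomorphic_functions S" if "w \<in> index_words n p" for w p
    by (rule iter_field_holomorphic[OF F]) (use that in \<open>auto simp: index_words_def\<close>)
  have "((\<lambda>r. act (holonomy t r) p F (complexify (R r))) has_vector_derivative
      (?L (act (holonomy t s) p F) ?x - (case p of 0 \<Rightarrow> 0 | Suc q \<Rightarrow> ?L (act (holonomy t s) q F) ?x)))
      (at s within {0..t})" for p
  proof -
    have "((\<lambda>r. \<Sum>w\<in>index_words n p. of_real (iterated_integral c t w r) * iter_field w F (complexify (R r)))
      has_vector_derivative
      (\<Sum>w\<in>index_words n p. of_real (iterated_integral c t w s) * ?L (iter_field w F) ?x)
      + (\<Sum>w\<in>index_words n p. of_real (iterated_integral_deriv c t w s) * iter_field w F ?x)) (at s within {0..t})"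
    proof (rule iterated_integral_sum_has_derivative[OF c_cont_t[OF tT] s,
          where g = "\<lambda>w r. iter_field w F (complexify (R r))" and g' = "\<lambda>w r. ?L (iter_field w F) ?x"])
      fix w assume "w \<in> index_words n p"
      from has_vector_derivative_within_subset[OF R[OF wF[OF this]]]
      show "((\<lambda>r. iter_field w F (complexify (R r))) has_vector_derivative ?L (iter_field w F) ?x) (at s within {0..t})"
        using tT by auto
    qed
    moreover have "(\<Sum>w\<in>index_words n p. of_real (iterated_integral c t w s) * ?L (iter_field w F) ?x)
        = ?L (act (holonomy t s) p F) ?x"
      unfolding field_comb_act[OF F x] unfolding field_comb_def sum_distrib_left
      by (subst sum.swap) (simp add: iter_field_simps mult_ac)
    moreover have "(\<Sum>w\<in>index_words n p. of_real (iterated_integral_deriv c t w s) * iter_field w F ?x)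
        = - (case p of 0 \<Rightarrow> 0 | Suc q \<Rightarrow> ?L (act (holonomy t s) q F) ?x)"
      unfolding sum_iterated_integral_deriv by (cases p) (simp_all add: field_comb_act[OF F x])
    ultimately show ?thesis by (simp add: act_def)
  qed
  from has_vector_derivative_sum[OF this]
  have "((\<lambda>r. \<Sum>p\<le>P. act (holonomy t r) p F (complexify (R r))) has_vector_derivative
    (\<Sum>p\<le>P. ?L (act (holonomy t s) p F) ?x - (case p of 0 \<Rightarrow> 0 | Suc q \<Rightarrow> ?L (act (holonomy t s) q F) ?x)))
    (at s within {0..t})" .
  moreover have "(\<Sum>p\<le>P. ?L (act (holonomy t s) p F) ?x - (case p of 0 \<Rightarrow> 0 | Suc q \<Rightarrow> ?L (act (holonomy t s) q F) ?x))
      = ?L (act (holonomy t s) P F) ?x"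
    by (induction P) simp_all
  ultimately show ?thesis by simp
qed

text \<open>The remainder has one more derivative than integrals: \<open>fact (Suc P)\<close>
  against \<open>fact P\<close> leaves \<open>Suc P\<close>, and \<open>a0 ^ P\<close> against
  \<open>(1 / (4 * a0)) ^ Suc P\<close> leaves \<open>(1 / 4) ^ P / (4 * a0)\<close>.\<close>

lemma taylor_remainder_bound:
  assumes K: "\<And>j r. j < n \<Longrightarrow> r \<in> {0..T} \<Longrightarrow> \<bar>c j r\<bar> \<le> K" "0 \<le> K"
    and t: "t \<in> {0..T}" and s: "s \<in> {0..t}" and small: "real n * (K * (t - s)) \<le> a0"
    and S0: "0 \<le> S0" "\<And>w m. set w \<subseteq> {..<n} \<Longrightarrow> m \<in> M \<Longrightarrow>
      norm (iter_field w F (complexify m)) \<le> S0 * fact (length w) * (1 / (4 * a0)) ^ length w"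
    and F: "F \<in> holomorphic_functions S" and m: "m \<in> M"
  shows "norm (field_comb (\<lambda>j. c j s) (act (holonomy t s) P F) (complexify m))
    \<le> real n * K * S0 / (4 * a0) * (real (Suc P) * (1 / 4) ^ P)"
proof -
  let ?B = "S0 * fact (Suc P) * (1 / (4 * a0)) ^ Suc P"
  have B: "0 \<le> ?B" using S0(1) a0_pos by simp
  have K_t: "\<bar>c j r\<bar> \<le> K" if "j < n" "r \<in> {0..t}" for j r using K(1) t that by auto
  have cont: "continuous_on {0..t} (c j)" if "j < n" for j using c_cont_t t that by auto
  have fb: "(\<Sum>w\<in>index_words n P. \<bar>iterated_integral c t w s\<bar>) * fact P \<le> a0 ^ P"
  proof -
    have "(\<Sum>w\<in>index_words n P. \<bar>iterated_integral c t w s\<bar>) * fact P \<le> (real n * (K * (t - s))) ^ P"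
      using factorial_bound_iterated_integral[OF cont K_t s] by (simp add: factorial_bound_def)
    also have "\<dots> \<le> a0 ^ P" using small K(2) s by (intro power_mono) auto
    finally show ?thesis .
  qed
  have "norm (field_comb (\<lambda>j. c j s) (act (holonomy t s) P F) (complexify m))
      \<le> (\<Sum>j<n. K * ((\<Sum>w\<in>index_words n P. \<bar>iterated_integral c t w s\<bar>) * ?B))"
    unfolding field_comb_act[OF F M_S[OF m]]
  proof (rule sum_norm_le)
    fix j assume j: "j \<in> {..<n}"
    have "norm (\<Sum>w\<in>index_words n P. of_real (iterated_integral c t w s) * iter_field (j # w) F (complexify m))
        \<le> (\<Sum>w\<in>index_words n P. \<bar>iterated_integral c t w s\<bar> * ?B)"
    proof (rule sum_norm_le)
      fix w assume "w \<in> index_words n P"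
      then have "norm (iter_field (j # w) F (complexify m)) \<le> ?B"
        using S0(2)[OF _ m, of "j # w"] j by (auto simp: index_words_def)
      then show "norm (of_real (iterated_integral c t w s) * iter_field (j # w) F (complexify m))
          \<le> \<bar>iterated_integral c t w s\<bar> * ?B"
        unfolding norm_mult norm_of_real by (intro mult_left_mono) auto
    qed
    then show "norm (of_real (c j s) * (\<Sum>w\<in>index_words n P. of_real (iterated_integral c t w s)
        * iter_field (j # w) F (complexify m))) \<le> K * ((\<Sum>w\<in>index_words n P. \<bar>iterated_integral c t w s\<bar>) * ?B)"
      unfolding norm_mult norm_of_real sum_distrib_right using K_t[of j s] s j K(2)
      by (intro mult_mono) auto
  qed
  also have "\<dots> = real n * K * (S0 * real (Suc P) * (1 / (4 * a0)) ^ Suc P)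
      * ((\<Sum>w\<in>index_words n P. \<bar>iterated_integral c t w s\<bar>) * fact P)"
    by (simp add: fact_Suc)
  also have "\<dots> \<le> real n * K * (S0 * real (Suc P) * (1 / (4 * a0)) ^ Suc P) * a0 ^ P"
    using K(2) S0(1) a0_pos by (intro mult_left_mono fb) auto
  also have "\<dots> = real n * K * S0 / (4 * a0) * (real (Suc P) * (1 / 4) ^ P)"
    using a0_pos by (simp add: power_divide power_mult_distrib field_simps)
  finally show ?thesis .
qed

text \<open>At \<open>s = t\<close> the Taylor sum is \<open>F\<close> at \<open>R t\<close>; at
  \<open>s = s0\<close> it is a partial sum of the series that evaluates \<open>F\<close> at the
  flow of the holonomy. Integrating the derivative bounds their difference by a quantity tending to
  zero, so no uniqueness theorem for ordinary differential equations is invoked. Coordinate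
  functions then separate the points.\<close>

lemma flow_step:
  assumes K: "\<And>j r. j < n \<Longrightarrow> r \<in> {0..T} \<Longrightarrow> \<bar>c j r\<bar> \<le> K" "0 \<le> K"
    and t: "t \<in> {0..T}" and s0: "s0 \<in> {0..t}" and small: "real n * (K * (t - s0)) \<le> a0"
    and R: "\<And>F s. F \<in> holomorphic_functions S \<Longrightarrow> s \<in> {0..T} \<Longrightarrow> ((\<lambda>s. F (complexify (R s))) has_vector_derivative
      field_comb (\<lambda>j. c j s) F (complexify (R s))) (at s within {0..T})"
    and RM: "\<And>s. s \<in> {0..T} \<Longrightarrow> R s \<in> M"
  shows "R t = flow (holonomy t s0) (R s0)"
proof -
  have tT: "t \<le> T" "s0 \<in> {0..T}" using t s0 by auto
  have adm: "admissible (holonomy t s0)"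
  proof -
    have "factorial_bound n 1 (real n * (K * (t - s0))) (holonomy t s0)"
      by (rule factorial_bound_iterated_integral[OF c_cont_t[OF tT(1)] K(1) s0]) (use tT in auto)
    moreover have "0 \<le> real n * (K * (t - s0))" using K(2) s0 by simp
    ultimately show ?thesis
      unfolding admissible_def using grouplike_holonomy[OF tT(1) s0] small by blast
  qed
  have "F (complexify (R t)) = F (complexify (flow (holonomy t s0) (R s0)))" if F: "F \<in> holomorphic_functions S" for F
  proof -
    obtain S0 where S0: "0 \<le> S0" "\<And>w m. set w \<subseteq> {..<n} \<Longrightarrow> m \<in> M \<Longrightarrow>
      norm (iter_field w F (complexify m)) \<le> S0 * fact (length w) * (1 / (4 * a0)) ^ length w"
      using iter_field_bound[OF F] by blast
    define V where "V P s = (\<Sum>p\<le>P. act (holonomy t s) p F (complexify (R s)))" for P s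
    define b where "b P = real n * K * S0 / (4 * a0) * (real (Suc P) * (1 / 4) ^ P)" for P
    have bound: "norm (V P t - V P s0) \<le> b P * (t - s0)" for P
    proof -
      have "(V P has_vector_derivative field_comb (\<lambda>j. c j s) (act (holonomy t s) P F) (complexify (R s)))
          (at s within {s0..t})" if "s \<in> {s0..t}" for s
        unfolding V_def[abs_def]
        by (rule has_vector_derivative_within_subset[OF taylor_derivative[OF t _ F R RM]]) (use that s0 tT in auto)
      then have int: "((\<lambda>s. field_comb (\<lambda>j. c j s) (act (holonomy t s) P F) (complexify (R s)))
          has_integral V P t - V P s0) {s0..t}"
        using s0 by (intro fundamental_theorem_of_calculus) auto
      have "norm (V P t - V P s0) \<le> b P * measure lborel {s0..t}"
      proof (rule has_integral_bound_real[OF _ finite.emptyI int])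
        show "0 \<le> b P" using K(2) S0(1) a0_pos by (simp add: b_def)
        fix s assume s: "s \<in> {s0..t} - {}"
        have "real n * (K * (t - s)) \<le> real n * (K * (t - s0))" using s K(2) by (intro mult_left_mono) auto
        then show "norm (field_comb (\<lambda>j. c j s) (act (holonomy t s) P F) (complexify (R s))) \<le> b P"
          unfolding b_def using s s0 tT small
          by (intro taylor_remainder_bound[OF K t _ _ S0 F RM]) auto
      qed
      then show ?thesis using s0 by simp
    qed
    have lim_b: "(\<lambda>P. b P * (t - s0)) \<longlonglongrightarrow> 0"
    proof -
      have "(\<lambda>P. real (Suc P) * (1 / 4 :: real) ^ P) \<longlonglongrightarrow> 0" by real_asymp
      from tendsto_mult_left[OF this, of "real n * K * S0 / (4 * a0)"]
      have "b \<longlonglongrightarrow> 0" by (simp add: b_def[abs_def])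
      then show ?thesis by (rule tendsto_mult_left_zero)
    qed
    have lim: "(\<lambda>P. V P t - V P s0) \<longlonglongrightarrow> 0"
      by (rule Lim_null_comparison[OF always_eventually lim_b]) (use bound in blast)
    have "V P t = F (complexify (R t))" for P
    proof -
      have "V P t = (\<Sum>p\<le>P. if p = 0 then F (complexify (R t)) else 0)" by (simp add: V_def act_holonomy_end)
      then show ?thesis by (simp add: sum.delta)
    qed
    then have V_t: "(\<lambda>P. V P t) \<longlonglongrightarrow> F (complexify (R t))" by simp
    have "(\<lambda>P. V P s0) \<longlonglongrightarrow> F (complexify (flow (holonomy t s0) (R s0)))"
      using flow_sums[OF adm RM[OF tT(2)] F] unfolding V_def sums_def_le .
    from LIMSEQ_unique[OF tendsto_diff[OF V_t this] lim] show ?thesis by simp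
  qed
  from this[OF holomorphic_functions_coord] show ?thesis
    by (simp add: vec_eq_iff complexify_def)
qed

theorem trivial_holonomy:
  assumes gr: "graded_lie_algebra gr" and \<omega>: "indexed_basis n \<omega> (gr 1)" and T: "0 \<le> T"
    and \<mu>: "\<And>r. r \<in> {0..T} \<Longrightarrow> \<mu> r = (\<Sum>j<n. c j r *\<^sub>R \<omega> j)"
    and E: "\<And>r. r \<in> {0..T} \<Longrightarrow> E r \<in> uea_completion gr"
      "\<And>r. r \<in> {0..T} \<Longrightarrow>
        has_series_derivative n \<omega> E (E r * (fps_const (uea_gen (\<mu> r)) * fps_X)) r {0..T}"
      "E 0 = 1" "E T = 1"
    and R: "\<And>F s. F \<in> holomorphic_functions S \<Longrightarrow> s \<in> {0..T} \<Longrightarrow> ((\<lambda>s. F (complexify (R s))) has_vector_derivative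
      field_comb (\<lambda>j. c j s) F (complexify (R s))) (at s within {0..T})"
    and RM: "\<And>s. s \<in> {0..T} \<Longrightarrow> R s \<in> M"
  shows "R T = R 0"
proof -
  have "\<exists>K. \<forall>j\<in>{..<n}. \<forall>r\<in>{0..T}. \<bar>c j r\<bar> \<le> K"
  proof -
    have "\<forall>j\<in>{..<n}. \<exists>k. \<forall>r\<in>{0..T}. \<bar>c j r\<bar> \<le> k"
      using compact_imp_bounded[OF compact_continuous_image[OF c_cont compact_Icc]]
      by (auto simp: bounded_iff)
    then obtain k where k: "\<And>j r. j < n \<Longrightarrow> r \<in> {0..T} \<Longrightarrow> \<bar>c j r\<bar> \<le> k j" by (metis lessThan_iff)
    have "\<bar>c j r\<bar> \<le> (\<Sum>i<n. \<bar>k i\<bar>)" if "j < n" "r \<in> {0..T}" for j r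
    proof -
      have "\<bar>c j r\<bar> \<le> \<bar>k j\<bar>" using k[OF that] by simp
      also have "\<dots> \<le> (\<Sum>i<n. \<bar>k i\<bar>)" by (rule member_le_sum) (use that in auto)
      finally show ?thesis .
    qed
    then show ?thesis by blast
  qed
  then obtain K' where K': "\<And>j r. j < n \<Longrightarrow> r \<in> {0..T} \<Longrightarrow> \<bar>c j r\<bar> \<le> K'" by blast
  \<comment> \<open>For \<open>n = 0\<close> the bound \<open>K'\<close> is unconstrained and could
    be negative.\<close>
  define K where "K = max K' 0"
  have K: "\<And>j r. j < n \<Longrightarrow> r \<in> {0..T} \<Longrightarrow> \<bar>c j r\<bar> \<le> K" "0 \<le> K"
    using K' by (auto simp: K_def intro: max.coboundedI1)
  \<comment> \<open>With \<open>N\<close> equal subintervals the holonomy over each has radius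
    \<open>real n * (K * (T / real N))\<close>, which is then below \<open>a0\<close>. The strict
    inequality also makes \<open>N\<close> positive.\<close>
  obtain N :: nat where N: "real n * K * T / a0 < real N" using reals_Archimedean2 by blast
  have "0 \<le> real n * K * T / a0" using K(2) T a0_pos by simp
  with N have N0: "real N > 0" by linarith
  define a where "a = real n * (K * (T / real N))"
  have a: "0 \<le> a" "a \<le> a0"
  proof -
    show "0 \<le> a" using K(2) T by (simp add: a_def)
    have "real n * K * T < real N * a0" using N a0_pos by (simp add: pos_divide_less_eq)
    then show "a \<le> a0" using N0 by (simp add: a_def field_simps)
  qed
  define s where "s l = T / real N * real l" for l
  have s_mem: "s l \<in> {0..T}" if "l \<le> N" for l
  proof -
    have "T * real l \<le> T * real N" using that T by (intro mult_left_mono) auto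
    then show ?thesis using N0 T by (simp add: s_def field_simps)
  qed
  have s_mono: "s l \<in> {0..s (Suc l)}" for l using T by (simp add: s_def divide_right_mono mult_left_mono)
  have s_step: "s (Suc l) - s l = T / real N" for l by (simp add: s_def algebra_simps add_divide_distrib)
  have sN: "s N = T" and s0: "s 0 = 0" using N0 by (simp_all add: s_def)
  define cs where "cs L = map (\<lambda>l. holonomy (s (Suc l)) (s l)) [0..<L]" for L
  have flows: "fold flow (cs L) (R 0) = R (s L)" if "L \<le> N" for L
    using that
  proof (induction L)
    case (Suc L)
    have "R (s (Suc L)) = flow (holonomy (s (Suc L)) (s L)) (R (s L))"
      using a(2) by (intro flow_step[OF K s_mem[OF Suc.prems] s_mono _ R RM]) (simp_all add: s_step a_def)
    with Suc show ?case by (simp add: cs_def)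
  qed (simp add: cs_def s0)
  \<comment> \<open>The product of the holonomies is identified with \<open>E (s L)\<close> only
    through the action on functions, which is all that \<open>fold_flow_unique\<close> asks for.
    Thus no equation between coefficients on words is claimed.\<close>
  have acts: "act (convs (cs L)) p F \<xi> = uea_act S X (fps_nth (E (s L)) p) F \<xi>"
    if "L \<le> N" "F \<in> holomorphic_functions S" "\<xi> \<in> S" for L p F \<xi>
    using that
  proof (induction L arbitrary: p F \<xi>)
    case 0
    then show ?case
      by (cases "p = 0") (simp_all add: cs_def convs_def s0 E(3) act_unit uea_act_one uea_act_zero)
  next
    case (Suc L)
    have "cs (Suc L) = cs L @ [holonomy (s (Suc L)) (s L)]" by (simp add: cs_def)
    then have "act (convs (cs (Suc L))) p F \<xi>
        = (\<Sum>i\<le>p. act (convs (cs L)) i (act (holonomy (s (Suc L)) (s L)) (p - i) F) \<xi>)"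
      by (simp add: convs_snoc act_conv[OF Suc.prems(2,3)])
    also have "\<dots> = (\<Sum>i\<le>p. uea_act S X (fps_nth (E (s L)) i) (act (holonomy (s (Suc L)) (s L)) (p - i) F) \<xi>)"
      using Suc.prems by (intro sum.cong refl Suc.IH act_holomorphic) auto
    also have "\<dots> = uea_act S X (fps_nth (E (s (Suc L))) p) F \<xi>"
      by (rule holonomy_split[OF gr \<omega> \<mu> E(1,2) Suc.prems(2,3) s_mem[OF Suc.prems(1)] s_mono, symmetric])
    finally show ?case .
  qed
  \<comment> \<open>The total product acts like \<open>E T = 1\<close>, so it is compared with the
    empty product, whose flow is the identity.\<close>
  have "fold flow (cs N) (R 0) = fold flow [] (R 0)"
  proof (rule fold_flow_unique[OF a])
    fix c' assume "c' \<in> set (cs N) \<union> set []"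
    then obtain l where l: "l < N" "c' = holonomy (s (Suc l)) (s l)" by (auto simp: cs_def)
    have le: "s (Suc l) \<le> T" using s_mem[of "Suc l"] l(1) by simp
    have "factorial_bound n 1 (real n * (K * (s (Suc l) - s l))) c'"
      unfolding l(2) by (rule factorial_bound_iterated_integral[OF c_cont_t[OF le] K(1) s_mono]) (use le in auto)
    then show "grouplike c' \<and> (\<exists>C. factorial_bound n C a c')"
      unfolding s_step a_def using grouplike_holonomy[OF le s_mono] l(2) by blast
  next
    fix i p m assume "m \<in> M"
    then show "act (convs (cs N)) p (\<lambda>x. x $ i) (complexify m) = act (convs []) p (\<lambda>x. x $ i) (complexify m)"
      using acts[OF order_refl holomorphic_functions_coord M_S, of m p i]
      by (cases "p = 0") (simp_all add: sN E(4) convs_def act_unit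
          uea_act_one[OF holomorphic_functions_coord M_S] uea_act_zero[OF holomorphic_functions_coord M_S])
  qed (use RM[of 0] T in auto)
  then show ?thesis using flows[OF order_refl] by (simp add: sN)
qed

end

section \<open>Analytic diffeomorphisms\<close>

text \<open>Local holomorphic extensions compose directly, whereas composing real power series would
  require rearrangements. Real analyticity is deduced from them once, in
  \<open>extends_holomorphically_analytic\<close>.\<close>

definition extends_holomorphically :: "(real ^ 'n) set \<Rightarrow> (real ^ 'n \<Rightarrow> real ^ 'n) \<Rightarrow> bool" where
  "extends_holomorphically M f \<longleftrightarrow> (\<forall>m\<in>M. \<exists>W G. open W \<and> complexify m \<in> W \<and> holomorphic_map_on W G \<and>
    (\<forall>x\<in>M. complexify x \<in> W \<longrightarrow> G (complexify x) = complexify (f x)))"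

lemma extends_holomorphically_cong:
  "extends_holomorphically M f \<Longrightarrow> (\<And>m. m \<in> M \<Longrightarrow> f m = g m) \<Longrightarrow> extends_holomorphically M g"
  unfolding extends_holomorphically_def by metis

lemma extends_holomorphically_id: "extends_holomorphically M (\<lambda>x. x)"
  unfolding extends_holomorphically_def holomorphic_map_on_def
  by (intro ballI exI[of _ UNIV] exI[of _ "\<lambda>x. x"]) (auto intro: holomorphic_fun_on_component)

lemma extends_holomorphically_compose:
  assumes f: "extends_holomorphically M f" "\<And>m. m \<in> M \<Longrightarrow> f m \<in> M" and g: "extends_holomorphically M g"
  shows "extends_holomorphically M (\<lambda>x. g (f x))"
  unfolding extends_holomorphically_def
proof
  fix m assume m: "m \<in> M"
  from bspec[OF f(1)[unfolded extends_holomorphically_def] m]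
  obtain W G where W: "open W" "complexify m \<in> W" "holomorphic_map_on W G"
    "\<forall>x\<in>M. complexify x \<in> W \<longrightarrow> G (complexify x) = complexify (f x)"
    by (elim exE conjE)
  from bspec[OF g[unfolded extends_holomorphically_def] f(2)[OF m]]
  obtain V H where V: "open V" "complexify (f m) \<in> V" "holomorphic_map_on V H"
    "\<forall>x\<in>M. complexify x \<in> V \<longrightarrow> H (complexify x) = complexify (g x)"
    by (elim exE conjE)
  let ?W = "W \<inter> G -` V"
  have "continuous_on W G"
  proof (rule continuous_at_imp_continuous_on, rule ballI)
    fix x assume "x \<in> W"
    from holomorphic_map_on_has_derivative[OF W(3) this] obtain D where "(G has_derivative D) (at x)" .
    then show "isCont G x" by (rule has_derivative_continuous)
  qed
  then have op: "open ?W" by (rule continuous_open_preimage[OF _ W(1) V(1)])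
  have "holomorphic_map_on ?W G" using W(3) unfolding holomorphic_map_on_def
    by (intro allI) (rule holomorphic_fun_on_subset[of W], auto)
  then have hol: "holomorphic_map_on ?W (\<lambda>x. H (G x))" by (rule holomorphic_map_on_compose[OF _ V(3)]) auto
  show "\<exists>W F. open W \<and> complexify m \<in> W \<and> holomorphic_map_on W F \<and>
      (\<forall>x\<in>M. complexify x \<in> W \<longrightarrow> F (complexify x) = complexify (g (f x)))"
    by (intro exI[of _ ?W] exI[of _ "\<lambda>x. H (G x)"] conjI op hol) (use W V m f(2) in auto)
qed

lemma extends_holomorphically_analytic:
  assumes "extends_holomorphically M f"
  shows "extends_locally real_analytic_map_on M f"
  unfolding extends_locally_def
proof
  fix m assume "m \<in> M"
  from bspec[OF assms[unfolded extends_holomorphically_def] this]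
  obtain W G where W: "open W" "complexify m \<in> W" "holomorphic_map_on W G"
    "\<forall>x\<in>M. complexify x \<in> W \<longrightarrow> G (complexify x) = complexify (f x)"
    by (elim exE conjE)
  have "real_analytic_map_on (complexify -` W) (\<lambda>x. \<chi> i. Re (G (complexify x) $ i))"
    using W(3) unfolding real_analytic_map_on_def holomorphic_map_on_def
    by (auto intro: real_analytic_Re_holomorphic[OF W(1)])
  moreover have "(\<chi> i. Re (G (complexify x) $ i)) = f x" if "x \<in> M \<inter> complexify -` W" for x
    using W(4) that by (simp add: vec_eq_iff complexify_def)
  ultimately show "\<exists>U g. open U \<and> m \<in> U \<and> real_analytic_map_on U g \<and> (\<forall>x\<in>M \<inter> U. g x = f x)"
    using open_vimage[OF W(1) continuous_on_complexify] W(2) by blast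
qed

lemma analytic_diffeoI:
  assumes f: "extends_holomorphically M f" "\<And>m. m \<in> M \<Longrightarrow> f m \<in> M"
    and g: "extends_holomorphically M g" "\<And>m. m \<in> M \<Longrightarrow> g m \<in> M"
    and inv: "\<And>m. m \<in> M \<Longrightarrow> g (f m) = m" "\<And>m. m \<in> M \<Longrightarrow> f (g m) = m"
  shows "analytic_diffeo M f"
proof -
  have bij: "bij_betw f M M" by (rule bij_betwI[where g = g]) (use f g inv in auto)
  have "inv_into M f m = g m" if m: "m \<in> M" for m
    using inv_into_f_f[OF bij_betw_imp_inj_on[OF bij] g(2)[OF m]] inv(2)[OF m] by simp
  then have "extends_holomorphically M (inv_into M f)"
    using extends_holomorphically_cong[OF g(1)] by simp
  then show ?thesis
    unfolding analytic_diffeo_def using bij f(1) extends_holomorphically_analytic by blast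
qed

context charted_vector_fields
begin

lemma flow_extends:
  assumes c: "admissible c"
  shows "extends_holomorphically M (flow c)"
  unfolding extends_holomorphically_def
proof
  fix m assume m: "m \<in> M"
  let ?p = "complexify m"
  obtain C a where ca: "factorial_bound n C a c" "0 \<le> a" "a \<le> a0" using c unfolding admissible_def by blast
  obtain r Y where ch: "chart \<delta> B ?p r Y" using charts[OF m] by blast
  let ?G = "\<lambda>x. \<chi> i. suminf (\<lambda>k. local_act n Y c k (\<lambda>x. x $ i) x)"
  have hol: "holomorphic_map_on (ball ?p (\<delta> / 2)) ?G"
    unfolding holomorphic_map_on_def
    by (intro allI, subst vec_lambda_beta)
      (rule local_series_holomorphic(2)[OF ch ca holomorphic_fun_on_component coordinate_bounded])
  show "\<exists>W G. open W \<and> ?p \<in> W \<and> holomorphic_map_on W G \<and>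
      (\<forall>x\<in>M. complexify x \<in> W \<longrightarrow> G (complexify x) = complexify (flow c x))"
  proof (intro exI conjI ballI impI)
    show "open (ball ?p (\<delta> / 2))" "?p \<in> ball ?p (\<delta> / 2)" using \<delta>_pos by auto
    show "holomorphic_map_on (ball ?p (\<delta> / 2)) ?G" by (rule hol)
    fix x assume x: "x \<in> M" "complexify x \<in> ball ?p (\<delta> / 2)"
    have "act c k (\<lambda>x. x $ i) (complexify x) = local_act n Y c k (\<lambda>x. x $ i) (complexify x)" for k i
      by (rule act_eq_local_act[OF ch order_refl holomorphic_fun_on_component])
        (use x M_S \<delta>_pos in \<open>auto simp: dist_complexify\<close>)
    then show "?G (complexify x) = complexify (flow c x)"
      using sums_unique[OF flow_sums[OF c x(1) holomorphic_functions_coord]] by (simp add: vec_eq_iff)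
  qed
qed

lemma fold_flow_extends:
  "(\<And>c. c \<in> set cs \<Longrightarrow> admissible c) \<Longrightarrow> extends_holomorphically M (fold flow cs)"
proof (induction cs)
  case (Cons c cs)
  then have c: "admissible c" and cs: "extends_holomorphically M (fold flow cs)" by auto
  have "extends_holomorphically M (\<lambda>x. fold flow cs (flow c x))"
    by (rule extends_holomorphically_compose[OF flow_extends[OF c] flow_in_M[OF c] cs])
  then show ?case by (simp add: o_def)
qed (simp add: extends_holomorphically_id id_def)

end

section \<open>The group generated by small group-like series\<close>

locale lie_group_action = lie_fields S M n X \<omega> \<delta> B
  for S :: "(complex ^ 'N) set" and M :: "(real ^ 'N) set" and n :: nat
    and X :: "'g::lie_algebra \<Rightarrow> complex ^ 'N \<Rightarrow> complex ^ 'N" and \<omega> :: "nat \<Rightarrow> 'g" and \<delta> B :: real +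
  fixes gr :: "nat \<Rightarrow> 'g set" and a :: real
  assumes graded: "graded_lie_algebra gr" and basis: "indexed_basis n \<omega> (gr 1)"
    and a_pos: "0 < a" and a_le: "a \<le> a0"
begin

abbreviation generators :: "'g uea fps set" where
  "generators \<equiv> G_bar gr \<inter> U_fact_a gr n \<omega> a"

text \<open>Any two choices have the same flow on \<open>M\<close> by
  \<open>fold_flow_unique\<close>, because both act as \<open>z\<close> does.\<close>

definition rep :: "'g uea fps \<Rightarrow> nat list \<Rightarrow> real" where
  "rep z = (SOME c. represents n \<omega> c z \<and> grouplike c \<and> (\<exists>C. factorial_bound n C a c))"

lemma rep:
  assumes "z \<in> generators"
  shows "represents n \<omega> (rep z) z" "grouplike (rep z) \<and> (\<exists>C. factorial_bound n C a (rep z))" "admissible (rep z)"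
proof -
  obtain x where x: "x \<in> lie_completion gr" "z = series_exp x" using assms by (auto simp: G_bar_def)
  obtain c C where c: "represents n \<omega> c z" "factorial_bound n C a c"
    using U_fact_a_represents[OF graded basis a_pos] assms by blast
  have "grouplike c" by (rule grouplike_series_exp[OF graded x(1)]) (use c x in simp)
  with c have "\<exists>c. represents n \<omega> c z \<and> grouplike c \<and> (\<exists>C. factorial_bound n C a c)" by blast
  from someI_ex[OF this]
  have r: "represents n \<omega> (rep z) z \<and> grouplike (rep z) \<and> (\<exists>C. factorial_bound n C a (rep z))"
    unfolding rep_def .
  then show "represents n \<omega> (rep z) z" "grouplike (rep z) \<and> (\<exists>C. factorial_bound n C a (rep z))" by simp_all
  with a_le less_imp_le[OF a_pos] show "admissible (rep z)" unfolding admissible_def by blast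
qed

definition Q :: "'g uea fps \<Rightarrow> real ^ 'N \<Rightarrow> real ^ 'N" where
  "Q z = restrict (flow (rep z)) M"

lemma fold_Q:
  "set zs \<subseteq> generators \<Longrightarrow> m \<in> M \<Longrightarrow> fold Q zs m = fold flow (map rep zs) m"
  by (induction zs arbitrary: m) (auto simp: Q_def flow_in_M rep(3))

lemma fold_Q_in_M: "set zs \<subseteq> generators \<Longrightarrow> m \<in> M \<Longrightarrow> fold Q zs m \<in> M"
  using fold_flow_in_M[of "map rep zs" m] rep(3) by (auto simp: fold_Q)

lemma fold_Q_extends: "set zs \<subseteq> generators \<Longrightarrow> extends_holomorphically M (fold Q zs)"
proof (rule extends_holomorphically_cong[OF fold_flow_extends[of "map rep zs"]])
  assume zs: "set zs \<subseteq> generators"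
  show "admissible c" if "c \<in> set (map rep zs)" for c using that rep(3)[OF subsetD[OF zs]] by auto
  show "fold flow (map rep zs) m = fold Q zs m" if "m \<in> M" for m by (rule fold_Q[OF zs that, symmetric])
qed

text \<open>The representing families may differ as coefficients; what agrees is the action of their
  products, which by \<open>act_convs_represents\<close> depends only on the product of the
  series.\<close>

lemma fold_Q_unique:
  assumes zs: "set zs \<subseteq> generators" and ws: "set ws \<subseteq> generators"
    and eq: "prod_list zs = prod_list ws" and m: "m \<in> M"
  shows "fold Q zs m = fold Q ws m"
  unfolding fold_Q[OF zs m] fold_Q[OF ws m]
proof (rule fold_flow_unique[OF less_imp_le[OF a_pos] a_le _ _ m])
  show "grouplike c \<and> (\<exists>C. factorial_bound n C a c)" if "c \<in> set (map rep zs) \<union> set (map rep ws)" for c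
    using that rep(2)[OF subsetD[OF zs]] rep(2)[OF subsetD[OF ws]] by auto
  have rel: "list_all2 (\<lambda>c z. represents n \<omega> c z) (map rep vs) vs" if "set vs \<subseteq> generators" for vs
    using that rep(1) by (induction vs) auto
  show "act (convs (map rep zs)) p (\<lambda>x. x $ i) (complexify m') = act (convs (map rep ws)) p (\<lambda>x. x $ i) (complexify m')"
    if "m' \<in> M" for i p m'
    unfolding act_convs_represents[OF rel[OF zs] holomorphic_functions_coord M_S[OF that]]
      act_convs_represents[OF rel[OF ws] holomorphic_functions_coord M_S[OF that]] eq ..
qed

text \<open>The inverse of \<open>series_exp x\<close> is \<open>series_exp (- x)\<close>, the image
  under the antipode, which is represented by reversed and signed coefficients with the same
  constant and radius. Hence the generating set is closed under inverses for each fixed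
  \<open>a\<close>.\<close>

lemma generators_inverse:
  assumes "z \<in> generators"
  obtains z' where "z' \<in> generators" "z * z' = 1" "z' * z = 1"
proof -
  obtain x where x: "x \<in> lie_completion gr" "z = series_exp x" using assms by (auto simp: G_bar_def)
  obtain c C where c: "represents n \<omega> c z" "factorial_bound n C a c"
    using U_fact_a_represents[OF graded basis a_pos] assms by blast
  note x' = lie_completion_uminus[OF graded x(1)]
  show ?thesis
  proof (rule that[of "series_exp (- x)"])
    have "represents n \<omega> (\<lambda>w. (-1) ^ length w * c (rev w)) (series_exp (- x))"
      by (rule represents_antipode[OF c(1)[unfolded x(2)] antipode_exp[OF x(1)]])
    from U_fact_a_I[OF graded basis a_pos this factorial_bound_antipode[OF c(2)]]
    show "series_exp (- x) \<in> generators" using x' by (simp add: G_bar_def)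
    show "z * series_exp (- x) = 1"
      unfolding x(2) by (rule series_exp_uminus[OF lie_completion_0[OF graded x(1)]])
    show "series_exp (- x) * z = 1"
      unfolding x(2) using series_exp_uminus[OF lie_completion_0[OF graded x']] by simp
  qed
qed

lemma generator_words_inverse:
  "set zs \<subseteq> generators \<Longrightarrow> \<exists>ws. set ws \<subseteq> generators \<and> prod_list (zs @ ws) = 1 \<and> prod_list (ws @ zs) = 1"
proof (induction zs)
  case (Cons z zs)
  then obtain ws where ws: "set ws \<subseteq> generators" "prod_list zs * prod_list ws = 1" "prod_list ws * prod_list zs = 1"
    by auto
  obtain z' where z': "z' \<in> generators" "z * z' = 1" "z' * z = 1"
    using generators_inverse[of z] Cons.prems by auto
  have "prod_list zs * (prod_list ws * z') = z'" "z' * (z * prod_list zs) = prod_list zs"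
    using ws(2) z'(3) by (simp_all flip: mult.assoc)
  then show ?case using ws z' by (intro exI[of _ "ws @ [z']"]) (simp add: mult.assoc)
qed (auto intro!: exI[of _ "[]"])

text \<open>The inverse map is again a composition of flows, for a word \<open>ws\<close> with the
  inverse product: both concatenations have product 1 and therefore act as the empty list by
  \<open>fold_Q_unique\<close>.\<close>

lemma fold_Q_diffeo:
  assumes zs: "set zs \<subseteq> generators"
  shows "restrict (fold Q zs) M \<in> carrier (analytic_diffeo_group M)"
proof -
  obtain ws where ws: "set ws \<subseteq> generators" "prod_list (zs @ ws) = 1" "prod_list (ws @ zs) = 1"
    using generator_words_inverse[OF zs] by blast
  have "fold Q (zs @ ws) m = m" "fold Q (ws @ zs) m = m" if "m \<in> M" for m
    using fold_Q_unique[of "zs @ ws" "[]" m] fold_Q_unique[of "ws @ zs" "[]" m] zs ws that by auto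
  then have "analytic_diffeo M (restrict (fold Q zs) M)"
    using zs ws(1) extends_holomorphically_cong[OF fold_Q_extends[OF zs], of "restrict (fold Q zs) M"]
    by (intro analytic_diffeoI[where g = "fold Q ws"]) (auto simp: fold_Q_in_M fold_Q_extends)
  then show ?thesis by (simp add: analytic_diffeo_group_def)
qed

lemma Q_diffeo: "z \<in> generators \<Longrightarrow> Q z \<in> carrier (analytic_diffeo_group M)"
  using fold_Q_diffeo[of "[z]"] by (simp add: Q_def)

lemma series_act_Q:
  assumes z: "z \<in> generators" and F: "F \<in> holomorphic_functions S" and m: "m \<in> M"
  shows "series_act S X z F (complexify m) = F (complexify (Q z m))"
  using sums_unique[OF flow_sums[OF rep(3)[OF z] m F]] m
  by (simp add: series_act_def uea_act_represents[OF rep(1)[OF z] F M_S[OF m]] Q_def)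

text \<open>Inverses of generators are generators, so plain products exhaust the generated subgroup.
  The inverse in \<open>G_fact\<close> is determined directly from its definition as the unique
  two-sided inverse.\<close>

lemma carrier_G_fact_a_words:
  assumes "z \<in> carrier (G_fact_a gr n \<omega> a)"
  shows "\<exists>zs. set zs \<subseteq> generators \<and> z = prod_list zs"
proof -
  let ?G = "G_fact gr n \<omega>"
  have sub: "generators \<subseteq> carrier ?G" using a_pos by (auto simp: G_fact_def U_fact_def)
  have "z \<in> generate ?G (carrier ?G \<inter> generators)"
    using assms by (simp add: G_fact_a_def carrier_subgroup_generated)
  then show ?thesis
  proof (induction rule: generate.induct)
    case one
    show ?case by (intro exI[of _ "[]"]) (simp add: G_fact_def)
  next
    case (incl h)
    then show ?case by (intro exI[of _ "[h]"]) auto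
  next
    case (inv h)
    then obtain h' where h': "h' \<in> generators" "h * h' = 1" "h' * h = 1" using generators_inverse by blast
    have "inv\<^bsub>?G\<^esub> h = h'"
      unfolding m_inv_def
    proof (rule the_equality)
      show "h' \<in> carrier ?G \<and> h \<otimes>\<^bsub>?G\<^esub> h' = \<one>\<^bsub>?G\<^esub> \<and> h' \<otimes>\<^bsub>?G\<^esub> h = \<one>\<^bsub>?G\<^esub>"
        using h' sub by (auto simp: G_fact_def)
      fix y assume "y \<in> carrier ?G \<and> h \<otimes>\<^bsub>?G\<^esub> y = \<one>\<^bsub>?G\<^esub> \<and> y \<otimes>\<^bsub>?G\<^esub> h = \<one>\<^bsub>?G\<^esub>"
      then have "y * h = 1" by (simp add: G_fact_def)
      then have "y * (h * h') = h'" by (simp flip: mult.assoc)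
      then show "y = h'" using h'(2) by simp
    qed
    then show ?case using h'(1) by (intro exI[of _ "[h']"]) simp
  next
    case (eng h1 h2)
    then obtain zs ws where "set zs \<subseteq> generators" "h1 = prod_list zs" "set ws \<subseteq> generators" "h2 = prod_list ws"
      by blast
    then show ?case by (intro exI[of _ "zs @ ws"]) (simp add: G_fact_def)
  qed
qed

definition QQ :: "'g uea fps \<Rightarrow> real ^ 'N \<Rightarrow> real ^ 'N" where
  "QQ z = restrict (fold Q (SOME zs. set zs \<subseteq> generators \<and> z = prod_list zs)) M"

lemma QQ_eq: "set zs \<subseteq> generators \<Longrightarrow> z = prod_list zs \<Longrightarrow> QQ z = restrict (fold Q zs) M"
proof -
  assume zs: "set zs \<subseteq> generators" "z = prod_list zs"
  define ws where "ws = (SOME ws. set ws \<subseteq> generators \<and> z = prod_list ws)"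
  have "\<exists>ws. set ws \<subseteq> generators \<and> z = prod_list ws" using zs by blast
  from someI_ex[OF this] have "set ws \<subseteq> generators \<and> z = prod_list ws" unfolding ws_def .
  then have "restrict (fold Q ws) M = restrict (fold Q zs) M"
    using zs by (intro restrict_ext fold_Q_unique) auto
  then show ?thesis unfolding QQ_def ws_def .
qed

lemma QQ_hom: "QQ \<in> hom (G_fact_a gr n \<omega> a) (analytic_diffeo_group M)"
proof (rule homI)
  fix z w assume "z \<in> carrier (G_fact_a gr n \<omega> a)" "w \<in> carrier (G_fact_a gr n \<omega> a)"
  then obtain zs ws where zs: "set zs \<subseteq> generators" "z = prod_list zs" and ws: "set ws \<subseteq> generators" "w = prod_list ws"
    using carrier_G_fact_a_words by metis
  show "QQ z \<in> carrier (analytic_diffeo_group M)" unfolding QQ_eq[OF zs] by (rule fold_Q_diffeo[OF zs(1)])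
  have "QQ (z * w) = restrict (fold Q (zs @ ws)) M" by (rule QQ_eq) (use zs ws in auto)
  also have "\<dots> = compose M (QQ w) (QQ z)"
    unfolding QQ_eq[OF zs] QQ_eq[OF ws] compose_def
    by (rule restrict_ext) (simp add: fold_Q_in_M[OF zs(1)])
  finally show "QQ (z \<otimes>\<^bsub>G_fact_a gr n \<omega> a\<^esub> w) = QQ z \<otimes>\<^bsub>analytic_diffeo_group M\<^esub> QQ w"
    by (simp add: G_fact_a_def G_fact_def analytic_diffeo_group_def)
qed

end

lemma (in lie_fields) series_uniform_convergence:
  assumes gr: "graded_lie_algebra gr" and \<omega>: "indexed_basis n \<omega> (gr 1)" and a: "0 < a" "a \<le> a0"
    and z: "z \<in> U_fact_a gr n \<omega> a" and F: "F \<in> holomorphic_functions S"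
  shows "\<exists>V. openin (top_of_set S) V \<and> complexify ` M \<subseteq> V \<and>
    uniformly_convergent_on V (\<lambda>k \<xi>. \<Sum>p<k. uea_act S X (fps_nth z p) F \<xi>)"
proof -
  obtain c C where c: "represents n \<omega> c z" "factorial_bound n C a c"
    using U_fact_a_represents[OF gr \<omega> a(1) z] .
  obtain V where V: "openin (top_of_set S) V" "complexify ` M \<subseteq> V"
    "uniformly_convergent_on V (\<lambda>k \<xi>. \<Sum>p<k. act c p F \<xi>)"
    using uniform_convergence[OF c(2) less_imp_le[OF a(1)] a(2) F] by blast
  have "V \<subseteq> S" using openin_imp_subset[OF V(1)] .
  then have eq: "(\<Sum>p<k. act c p F \<xi>) = (\<Sum>p<k. uea_act S X (fps_nth z p) F \<xi>)" if "\<xi> \<in> V" for k \<xi>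
    using that uea_act_represents[OF c(1) F] by (intro sum.cong refl) auto
  obtain l where l: "uniform_limit V (\<lambda>k \<xi>. \<Sum>p<k. act c p F \<xi>) l sequentially"
    using V(3) unfolding uniformly_convergent_on_def by (elim exE)
  have "uniform_limit V (\<lambda>k \<xi>. \<Sum>p<k. uea_act S X (fps_nth z p) F \<xi>) l sequentially"
    by (rule iffD1[OF uniform_limit_cong' l]) (simp_all add: eq)
  then have "uniformly_convergent_on V (\<lambda>k \<xi>. \<Sum>p<k. uea_act S X (fps_nth z p) F \<xi>)"
    unfolding uniformly_convergent_on_def by (intro exI[of _ l])
  with V(1,2) show ?thesis by (intro exI[of _ V] conjI)
qed

lemma (in lie_action_on) action_sum:
  assumes \<xi>: "\<xi> \<in> S"
  shows "X (\<Sum>j\<in>J. c j *\<^sub>R x j) \<xi> = (\<Sum>j\<in>J. c j *\<^sub>R X (x j) \<xi>)"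
proof -
  have add: "X (u + v) \<xi> = X u \<xi> + X v \<xi>" and scale: "X (r *\<^sub>R u) \<xi> = r *\<^sub>R X u \<xi>" for u v r
    using lie_action \<xi> unfolding lie_action_def by blast+
  have "X 0 \<xi> = 0" using scale[of 0 0] by simp
  then show ?thesis by (induction J rule: infinite_finite_induct) (simp_all add: add scale)
qed

theorem theorem6p1:
  fixes \<M> :: "(complex ^ 'N) set" and M :: "(real ^ 'N) set"
    and gr :: "nat \<Rightarrow> 'g::lie_algebra set" and n :: nat and \<omega> :: "nat \<Rightarrow> 'g"
    and X :: "'g \<Rightarrow> complex ^ 'N \<Rightarrow> complex ^ 'N"
  assumes "closed \<M>" and "complex_submanifold \<M>"
    and "\<And>\<xi>. \<xi> \<in> \<M> \<Longrightarrow> (\<chi> i. cnj (\<xi> $ i)) \<in> \<M>"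
    and "M = real_points \<M>"
    and "smooth_submanifold M" and "compact M"
    and "graded_lie_algebra gr" and "indexed_basis n \<omega> (gr 1)"
    and "lie_action \<M> X"
    and "\<And>j. j < n \<Longrightarrow> real_on M (X (\<omega> j))"
  shows "\<exists>a0>0. \<forall>a. 0 < a \<and> a \<le> a0 \<longrightarrow>
    (\<forall>z\<in>U_fact_a gr n \<omega> a. \<forall>F\<in>holomorphic_functions \<M>.
      \<exists>V. openin (top_of_set \<M>) V \<and> complexify ` M \<subseteq> V \<and>
        uniformly_convergent_on V (\<lambda>k \<xi>. \<Sum>p<k. uea_act \<M> X (fps_nth z p) F \<xi>))
    \<and> (\<exists>Q.
      (\<forall>z\<in>G_bar gr \<inter> U_fact_a gr n \<omega> a.
        Q z \<in> carrier (analytic_diffeo_group M) \<and>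
        (\<forall>F\<in>holomorphic_functions \<M>. \<forall>m\<in>M.
          series_act \<M> X z F (complexify m) = F (complexify (Q z m))))
      \<and> (\<exists>QQ\<in>hom (G_fact_a gr n \<omega> a) (analytic_diffeo_group M).
          \<forall>z\<in>carrier (G_fact_a gr n \<omega> a).
            (\<exists>zs. set zs \<subseteq> G_bar gr \<inter> U_fact_a gr n \<omega> a \<and> z = prod_list zs) \<and>
            (\<forall>zs. set zs \<subseteq> G_bar gr \<inter> U_fact_a gr n \<omega> a \<and> z = prod_list zs \<longrightarrow>
              QQ z = restrict (fold Q zs) M)))
    \<and> (\<forall>T \<mu> E R.
      0 \<le> T \<and> C1_curve n \<omega> {0..T} \<mu> \<and>
      (\<forall>t\<in>{0..T}. E t \<in> uea_completion gr \<and>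
        has_series_derivative n \<omega> E (E t * (fps_const (uea_gen (\<mu> t)) * fps_X)) t {0..T}) \<and>
      E 0 = 1 \<and> E T = 1 \<and>
      (\<forall>t\<in>{0..T}. smooth_diffeo M (R t)) \<and> (\<forall>m\<in>M. R 0 m = m) \<and>
      (\<forall>F :: real ^ 'N \<Rightarrow> real. extends_locally smooth_on M F \<longrightarrow>
        (\<forall>t\<in>{0..T}. \<forall>m\<in>M. ((\<lambda>s. F (R s m)) has_real_derivative
          vf_apply M (real_restriction (X (\<mu> t))) F (R t m)) (at t within {0..T})))
      \<longrightarrow> (\<forall>m\<in>M. R T m = m))"
proof -
  note submanifold = assms(2) and M = assms(4) and compact = assms(6) and graded = assms(7) and basis = assms(8)
    and action = assms(9) and real = assms(10)
  have "analytic_vector_fields \<M> M n (\<lambda>j. X (\<omega> j))"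
    using submanifold M compact action real by (unfold_locales) (auto simp: lie_action_def)
  then interpret vf: analytic_vector_fields \<M> M n "\<lambda>j. X (\<omega> j)" .
  from vf.uniform_charts obtain \<delta> B where "\<delta> > 0" "B > 0" "\<forall>m\<in>M. \<exists>r Y. vf.chart \<delta> B (complexify m) r Y"
    by (elim exE conjE)
  then interpret lie_fields \<M> M n X \<omega> \<delta> B
    using action by unfold_locales auto
  show ?thesis
  \<comment> \<open>The witness depends on the chart radius, the bound on the extended fields and
    the dimension alone, so it is fixed before \<open>a\<close>, the series and the
    functions.\<close>
  proof (intro exI[of _ a0] conjI allI impI a0_pos)
    fix a :: real assume "0 < a \<and> a \<le> a0"
    then interpret lie_group_action \<M> M n X \<omega> \<delta> B gr a
      by (intro lie_group_action.intro lie_group_action_axioms.intro lie_fields_axioms graded basis) simp_all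
    show "\<forall>z\<in>U_fact_a gr n \<omega> a. \<forall>F\<in>holomorphic_functions \<M>.
        \<exists>V. openin (top_of_set \<M>) V \<and> complexify ` M \<subseteq> V \<and>
          uniformly_convergent_on V (\<lambda>k \<xi>. \<Sum>p<k. uea_act \<M> X (fps_nth z p) F \<xi>)"
      by (intro ballI series_uniform_convergence[OF graded basis a_pos a_le])
    show "\<exists>Q.
        (\<forall>z\<in>G_bar gr \<inter> U_fact_a gr n \<omega> a.
          Q z \<in> carrier (analytic_diffeo_group M) \<and>
          (\<forall>F\<in>holomorphic_functions \<M>. \<forall>m\<in>M.
            series_act \<M> X z F (complexify m) = F (complexify (Q z m))))
        \<and> (\<exists>QQ\<in>hom (G_fact_a gr n \<omega> a) (analytic_diffeo_group M).
            \<forall>z\<in>carrier (G_fact_a gr n \<omega> a).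
              (\<exists>zs. set zs \<subseteq> G_bar gr \<inter> U_fact_a gr n \<omega> a \<and> z = prod_list zs) \<and>
              (\<forall>zs. set zs \<subseteq> G_bar gr \<inter> U_fact_a gr n \<omega> a \<and> z = prod_list zs \<longrightarrow>
                QQ z = restrict (fold Q zs) M))"
    proof (rule exI[of _ Q], intro conjI)
      show "\<forall>z\<in>G_bar gr \<inter> U_fact_a gr n \<omega> a.
          Q z \<in> carrier (analytic_diffeo_group M) \<and>
          (\<forall>F\<in>holomorphic_functions \<M>. \<forall>m\<in>M. series_act \<M> X z F (complexify m) = F (complexify (Q z m)))"
        by (intro ballI conjI Q_diffeo series_act_Q)
      show "\<exists>QQ\<in>hom (G_fact_a gr n \<omega> a) (analytic_diffeo_group M).
          \<forall>z\<in>carrier (G_fact_a gr n \<omega> a).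
            (\<exists>zs. set zs \<subseteq> G_bar gr \<inter> U_fact_a gr n \<omega> a \<and> z = prod_list zs) \<and>
            (\<forall>zs. set zs \<subseteq> G_bar gr \<inter> U_fact_a gr n \<omega> a \<and> z = prod_list zs \<longrightarrow>
              QQ z = restrict (fold Q zs) M)"
      proof (rule bexI[OF _ QQ_hom], intro ballI conjI allI impI)
        fix z assume "z \<in> carrier (G_fact_a gr n \<omega> a)"
        then show "\<exists>zs. set zs \<subseteq> generators \<and> z = prod_list zs" by (rule carrier_G_fact_a_words)
        fix zs assume "set zs \<subseteq> generators \<and> z = prod_list zs"
        then show "QQ z = restrict (fold Q zs) M" by (elim conjE) (rule QQ_eq)
      qed
    qed
  next
    fix T :: real and \<mu> E R
    assume *: "0 \<le> T \<and> C1_curve n \<omega> {0..T} \<mu> \<and>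
      (\<forall>t\<in>{0..T}. E t \<in> uea_completion gr \<and>
        has_series_derivative n \<omega> E (E t * (fps_const (uea_gen (\<mu> t)) * fps_X)) t {0..T}) \<and>
      E 0 = 1 \<and> E T = 1 \<and>
      (\<forall>t\<in>{0..T}. smooth_diffeo M (R t)) \<and> (\<forall>m\<in>M. R 0 m = m) \<and>
      (\<forall>F :: real ^ 'N \<Rightarrow> real. extends_locally smooth_on M F \<longrightarrow>
        (\<forall>t\<in>{0..T}. \<forall>m\<in>M. ((\<lambda>s. F (R s m)) has_real_derivative
          vf_apply M (real_restriction (X (\<mu> t))) F (R t m)) (at t within {0..T})))"
    then have T: "0 \<le> T" and E: "\<And>t. t \<in> {0..T} \<Longrightarrow> E t \<in> uea_completion gr"
      "\<And>t. t \<in> {0..T} \<Longrightarrow>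
        has_series_derivative n \<omega> E (E t * (fps_const (uea_gen (\<mu> t)) * fps_X)) t {0..T}" "E 0 = 1" "E T = 1"
      and R0: "\<And>m. m \<in> M \<Longrightarrow> R 0 m = m" and diffeo: "\<And>t. t \<in> {0..T} \<Longrightarrow> smooth_diffeo M (R t)"
      and R: "\<And>F t m. extends_locally smooth_on M F \<Longrightarrow> t \<in> {0..T} \<Longrightarrow> m \<in> M \<Longrightarrow>
        ((\<lambda>s. F (R s m)) has_real_derivative vf_apply M (real_restriction (X (\<mu> t))) F (R t m)) (at t within {0..T})"
      by simp_all
    from * obtain c c' where c: "\<forall>t\<in>{0..T}. \<mu> t = (\<Sum>j<n. c j t *\<^sub>R \<omega> j)"
      "\<forall>j<n. (\<forall>t\<in>{0..T}. (c j has_real_derivative c' j t) (at t within {0..T})) \<and> continuous_on {0..T} (c' j)"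
      unfolding C1_curve_def by (elim conjE exE)
    interpret lie_path \<M> M n X \<omega> \<delta> B c T
    proof unfold_locales
      show "continuous_on {0..T} (c j)" if "j < n" for j
        by (rule DERIV_continuous_on[of _ _ "c' j"]) (use c(2) that in blast)
    qed
    show "\<forall>m\<in>M. R T m = m"
    proof
      fix m assume m: "m \<in> M"
      have RM: "R t m \<in> M" if "t \<in> {0..T}" for t
        using diffeo[OF that] m unfolding smooth_diffeo_def bij_betw_def by blast
      have "R T m = R 0 m"
      proof (rule trivial_holonomy[OF graded basis T _ E _ RM])
        show "\<mu> r = (\<Sum>j<n. c j r *\<^sub>R \<omega> j)" if "r \<in> {0..T}" for r using c(1) that by blast
        show "((\<lambda>s. F (complexify (R s m))) has_vector_derivative
            field_comb (\<lambda>j. c j s) F (complexify (R s m))) (at s within {0..T})"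
          if F: "F \<in> holomorphic_functions \<M>" and s: "s \<in> {0..T}" for F s
        proof (rule solution_derivative[OF R[OF _ s m] _ F RM[OF s]])
          fix \<xi> assume "\<xi> \<in> \<M>"
          then show "X (\<mu> s) \<xi> = (\<Sum>j<n. c j s *\<^sub>R X (\<omega> j) \<xi>)"
            using c(1) s by (simp add: action_sum)
        qed
      qed
      then show "R T m = m" using R0[OF m] by simp
    qed
  qed
qed

end
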